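(* Let $S_0$ be $\mathbb P^2$ or a Hirzebruch surface $\mathbb F_\delta$, let $\mathcal F$ be the extension to $S_0$ of a polynomial foliation on $\mathbb C^2$, with $\mathcal B_{\mathcal F}\ne\emptyset$, and let $\Sigma$ be a restricted set of independent algebraic solutions of $\mathcal F$. Let $T_\alpha$ ($\alpha\in\mathbb R^\ell$) be the associated family of $\mathbb R$-divisors on $Z_{\mathcal F}$ and $\alpha_{\mathcal F}^\Sigma$ the associated distinguished vector. (a) If $T^2_{\alpha_{\mathcal F}^\Sigma}<0$, then $\mathcal F$ is not algebraically integrable. (b) If $T^2_{\alpha_{\mathcal F}^\Sigma}=0$ and $\mathcal F$ is algebraically integrable, then the $\mathbb Q$-divisor $T_{\mathcal F}$ satisfies $T_{\mathcal F}=T_{\alpha_{\mathcal F}^\Sigma}$, and $\alpha_{\mathcal F}^\Sigma\in(\mathbb Q_{>0})^\ell$.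
   Context: **Foliations.** All surfaces are complex. A foliation $\mathcal F$ on a smooth surface $S$ is given by an open cover $\{U_i\}$ and regular $1$-forms $\omega_i$ on $U_i$ with isolated zeros, $\omega_i=f_{ij}\omega_j$ on $U_i\cap U_j$ with $f_{ij}$ nowhere vanishing (equivalently by vector fields $v_i$ with isolated zeros, $v_i=g_{ij}v_j$; the line bundle with cocycle $(g_{ij})$ is the canonical sheaf $\mathcal K_{\mathcal F}$). A curve with local equations $f_i=0$ is $\mathcal F$-invariant if $\omega_i\wedge df_i=f_i\eta_i$ with $\eta_i$ a regular $2$-form. An integral curve is a reduced irreducible curve. $\nu_p(\mathcal F)$ is the vanishing order at $p$ of a local vector field defining $\mathcal F$. If $m=\nu_p(\mathcal F)\ge1$ and $a_m\,dx+b_m\,dy$ is the lowest homogeneous jet at $p$ of a local defining $1$-form, then $p$ is a simple singularity if $m=1$ and the matrix $\begin{pmatrix}\partial b_1/\partial x&\partial b_1/\partial y\\-\partial a_1/\partial x&-\partial a_1/\partial y\end{pmatrix}$ has eigenvalues $\lambda_1,\lambda_2$ with either $\lambda_1\lambda_2\ne0$ and $\lambda_1/\lambda_2\notin\mathbb Q_{>0}$, or $\lambda_1\lambda_2=0$ and $\lambda_1^2+\lambda_2^2\neq0$; otherwise $p$ is ordinary. $p$ is terminal dicritical if $xa_m+yb_m=0$. **Surfaces.** $S_0$ is either $\mathbb P^2$ with coordinates $(X:Y:Z)$, where $\mathbb C^2$ is identified with $\{Z\neq0\}$ and $L$ denotes a line; or $\mathbb F_\delta$ ($\delta\ge0$),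 the quotient of $(\mathbb C^2\setminus0)\times(\mathbb C^2\setminus 0)$ (coordinates $(X_0,X_1;Y_0,Y_1)$) by $(\lambda,\mu)\cdot(X_0,X_1;Y_0,Y_1)=(\lambda X_0,\lambda X_1;\mu Y_0,\lambda^{-\delta}\mu Y_1)$, where $\mathbb C^2$ is identified with $\{X_0Y_0\ne0\}$ via $x=X_1/X_0$, $y=X_0^\delta Y_1/Y_0$; $F$ is a fiber of the ruling $(X_0,X_1;Y_0,Y_1)\mapsto(X_0,X_1)$ and $M$ a section with $M^2=\delta$ ($F^2=0$, $F\cdot M=1$). A polynomial foliation $\mathcal F^{\mathbb C^2}$ on $\mathbb C^2$ is one defined by $A\,dx+B\,dy$ with $A,B$ coprime polynomials; its extension to $S_0$ is the foliation on $S_0$ (with isolated singularities) restricting to it. Write $\mathcal K_{\mathcal F}=\mathcal O_{\mathbb P^2}(r-1)$ or $\mathcal K_{\mathcal F}=\mathcal O_{\mathbb F_\delta}(d_1F+d_2M)$. **Dicritical configuration.** Let $\mathcal S_{\mathcal F}$ be the set of centers of a minimal sequence of point blowups after which the strict transform of $\mathcal F$ has no ordinary singularity. $\mathcal B_{\mathcal F}\subseteq\mathcal S_{\mathcal F}$ is the set of $p\in \mathcal S_{\mathcal F}$ such that some $q\in\mathcal S_{\mathcal F}$ infinitely near $p$ ($q\ge p$, possibly $q=p$) is a terminal dicritical singularity of the strict transform of $\mathcal F$ on the surface $q$ belongs to. Write $\mathcal B_{\mathcal F}=\{p_1,\dots,p_n\}$; blowing up its points gives $\pi_{\mathcal F}:Z_{\mathcal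 F}\to S_0$. $E_i$ is the exceptional divisor of the blowup at $p_i$; $^*$ and $\widetilde{\ }$ denote total and strict transforms on $Z_{\mathcal F}$. Let $p_{k_1},\dots,p_{k_d}$ be the points of $\mathcal B_{\mathcal F}$ that are terminal dicritical; $E_i$ is dicritical if $i\in\{k_1,\dots,k_d\}$, non-dicritical otherwise. $p_r\to p_i$ means $p_r$ lies on $E_i$ or on one of its strict transforms. $\widetilde{\mathcal F}$ is the strict transform of $\mathcal F$ on $Z_{\mathcal F}$. Throughout $\mathcal B_{\mathcal F}\ne\emptyset$. **First integrals, $D_{\mathcal F}$ and $T_{\mathcal F}$.** A rational first integral of $\mathcal F$ is a non-constant rational function of $S_0$ with indeterminacy set contained in $\mathcal S_{\mathcal F}\cap S_0$ whose level curves contain the leaves of $\mathcal F$; $\mathcal F$ is algebraically integrable if one exists. Then there is a primitive one $R$: all others are $u\circ R$ with $u\in\mathbb C(t)\setminus\mathbb C$. Writing $R=P/Q$ with $P,Q$ coprime (bi)homogeneous, $\mathcal P_{\mathcal F}$ is the pencil of curves $\alpha P+\beta Q=0$; $\pi_{\mathcal F}$ eliminates its base points, so $R$ induces a morphism $\varphi:Z_{\mathcal F}\to\mathbb P^1$. The characteristic divisor is $D_{\mathcal F}:=bL^*-\sum m_iE_i^*$ (resp. $aF^*+bM^*-\sum m_iE_i^*$) such that $\varphi$ is the morphism induced by $|D_{\mathcal F}|$; general curves of $\mathcal P_{\mathcal F}$ lie in $|bL|$ (resp. $|aF+bM|$), their strict transforms have multiplicity $m_i$ at $p_i$ and are linearly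 equivalent on $Z_{\mathcal F}$ to $D_{\mathcal F}$. As $\mathcal B_{\mathcal F}\neq\emptyset$, $b\ne0$, and $T_{\mathcal F}:=\frac1bD_{\mathcal F}$. **Independent solutions.** $NS(Z_{\mathcal F})=\mathrm{Pic}(Z_{\mathcal F})\otimes\mathbb R$, with basis $[L^*],[E_1^*],\dots,[E_n^*]$ (resp. $[F^*],[M^*],[E_1^*],\dots,[E_n^*]$). Let $\epsilon_{p_i}(\mathcal F)$ be $1$ if $p_i$ is terminal dicritical and $0$ otherwise, $\nu_{p_i}(\mathcal F)$ the multiplicity at $p_i$ of the strict transform of $\mathcal F$ on the surface containing $p_i$, $K_{Z_{\mathcal F}}=-3L^*+\sum E_i^*$ (resp. $(\delta-2)F^*-2M^*+\sum E_i^*$) and $K_{\widetilde{\mathcal F}}=(r-1)L^*-\sum(\nu_{p_i}(\mathcal F)+\epsilon_{p_i}(\mathcal F)-1)E_i^*$ (resp. $d_1F^*+d_2M^*-\sum(\nu_{p_i}(\mathcal F)+\epsilon_{p_i}(\mathcal F)-1)E_i^*$). For a finite set $\Sigma$ of integral curves on $S_0$, $V(\Sigma):=\{[\widetilde C]\mid C\in\Sigma\}\cup\{[K_{\widetilde{\mathcal F}}-K_{Z_{\mathcal F}}]\}\cup\{[\widetilde E_i]\mid E_i\text{ non-dicritical}\}$. A set of independent algebraic solutions of length $\sigma$ is a set $\Sigma=\{C_1,\dots,C_\sigma\}$ (possibly empty) of $\mathcal F$-invariant integral curves on $S_0$ such that the elements of $V(\Sigma)$ are linearly independent; it is always assumed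 that $\sigma\le d-1$ (resp. $\sigma\le d$). It is restricted if $[L^*]$ (resp. $[F^*]$) is not in the linear span of $V(\Sigma)$. **The divisors $T_\alpha$.** Put $\ell:=d-\sigma-1$ (resp. $d-\sigma$). For $1\le j\le d$ let $\lambda_{ij}=0$ if $p_{k_j}\not\ge p_i$, $\lambda_{k_jj}=1$, and $\lambda_{ij}=\sum_{p_s\to p_i}\lambda_{sj}$ for the other $p_i$ with $p_{k_j}\ge p_i$. Put $h_0=1$, $h_j=0$ if $S_0=\mathbb P^2$, and $h_0=-\frac{d_1-\delta+2}{d_2+2}-\delta$, $h_j=\frac{\sum_i(\nu_{p_i}(\mathcal F)+\epsilon_{p_i}(\mathcal F))\lambda_{ij}}{d_2+2}$ if $S_0=\mathbb F_\delta$ ($1\le j\le d$; $d_2+2>0$). For $\alpha\in\mathbb R^d$ let $\mathbf v(\alpha)=[L^*]-\sum_i(\sum_j\lambda_{ij}\alpha_j)[E_i^*]$ (resp. $(h_0+\sum_jh_j\alpha_j)[F^*]+[M^*]-\sum_i(\sum_j\lambda_{ij}\alpha_j)[E_i^*]$). For restricted $\Sigma$, the solutions $\alpha\in\mathbb R^d$ of the linear system $\mathbf v(\alpha)\cdot[\widetilde C_i]=0$ ($1\le i\le\sigma$), together with $\mathbf v(\alpha)\cdot[K_{\widetilde{\mathcal F}}-K_{Z_{\mathcal F}}]=0$ when $S_0=\mathbb P^2$, form, after possibly reordering the $p_{k_j}$, the set given by $\alpha_s=\mu_{0,s}+\sum_{k=1}^\ell\mu_{k,s}\alpha_k$ ($\ell+1\le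 s\le d$) with $\alpha_1,\dots,\alpha_\ell\in\mathbb R$ free and $\mu_{k,s}\in\mathbb Q$. Put $\Lambda_{i0}=\sum_{s=\ell+1}^d\lambda_{is}\mu_{0,s}$, $\Lambda_{ik}=\lambda_{ik}+\sum_{s=\ell+1}^d\lambda_{is}\mu_{k,s}$, $H_0=h_0+\sum_{s=\ell+1}^dh_s\mu_{0,s}$, $H_k=h_k+\sum_{s=\ell+1}^dh_s\mu_{k,s}$ ($1\le k\le\ell$), and for $\alpha\in\mathbb R^\ell$: $T_\alpha:=L^*-\sum_i(\Lambda_{i0}+\sum_{k}\Lambda_{ik}\alpha_k)E_i^*$ (resp. $T_\alpha:=(H_0+\sum_kH_k\alpha_k)F^*+M^*-\sum_i(\Lambda_{i0}+\sum_k\Lambda_{ik}\alpha_k)E_i^*$). **The vector $\alpha_{\mathcal F}^\Sigma$.** It is the unique solution $\alpha\in\mathbb R^\ell$ (a rational vector) of the linear system $\sum_{k=1}^\ell(\sum_{i=1}^n\Lambda_{ij}\Lambda_{ik})\alpha_k=H_j-\sum_{i=1}^n\Lambda_{i0}\Lambda_{ij}$, $1\le j\le\ell$. *)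

theory Defs
  imports
    "HOL-Complex_Analysis.Complex_Analysis"
    "HOL-Computational_Algebra.Computational_Algebra"
    "HOL-Library.Poly_Mapping"
    "HOL-Library.Function_Algebras"
begin

text \<open>Bivariate polynomials in local coordinates \<open>x, y\<close>: the outer variable is \<open>y\<close>, the inner
  one is \<open>x\<close>, so the coefficient of \<open>x\<^sup>i y\<^sup>j\<close> in \<open>f\<close> is \<open>coeff (coeff f j) i\<close>.\<close>

type_synonym bipoly = "complex poly poly"

definition bconst :: "complex \<Rightarrow> bipoly" where
  "bconst c = [:[:c:]:]"

definition bX :: bipoly where "bX = [:[:0, 1:]:]"

definition bY :: bipoly where "bY = [:0, 1:]"

definition ev :: "bipoly \<Rightarrow> complex \<times> complex \<Rightarrow> complex" where
  "ev f z = poly (poly f [:snd z:]) (fst z)"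

definition dx :: "bipoly \<Rightarrow> bipoly" where "dx f = map_poly pderiv f"

definition dy :: "bipoly \<Rightarrow> bipoly" where "dy f = pderiv f"

definition bsubst :: "bipoly \<Rightarrow> bipoly \<Rightarrow> bipoly \<Rightarrow> bipoly" where
  "bsubst f g h = (\<Sum>j\<le>degree f. \<Sum>i\<le>degree (coeff f j). bconst (coeff (coeff f j) i) * g ^ i * h ^ j)"

definition hpart :: "nat \<Rightarrow> bipoly \<Rightarrow> bipoly" where
  "hpart n f = (\<Sum>i\<le>n. monom (monom (coeff (coeff f (n - i)) i) i) (n - i))"

definition mult0 :: "bipoly \<Rightarrow> nat" where
  "mult0 f = (LEAST n. hpart n f \<noteq> 0)"

text \<open>A pair \<open>(a, b)\<close> is the 1-form \<open>a dx + b dy\<close>; the corresponding vector field is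
  \<open>b \<partial>\<^sub>x - a \<partial>\<^sub>y\<close>.\<close>

type_synonym form = "bipoly \<times> bipoly"

definition form_ev :: "form \<Rightarrow> complex \<times> complex \<Rightarrow> complex \<times> complex \<Rightarrow> complex" where
  "form_ev w z t = ev (fst w) z * fst t + ev (snd w) z * snd t"

definition vfield :: "form \<Rightarrow> complex \<times> complex \<Rightarrow> complex \<times> complex" where
  "vfield w z = (ev (snd w) z, - ev (fst w) z)"

definition pullback :: "form \<Rightarrow> bipoly \<Rightarrow> bipoly \<Rightarrow> form" where
  "pullback w g h =
     (bsubst (fst w) g h * dx g + bsubst (snd w) g h * dx h,
      bsubst (fst w) g h * dy g + bsubst (snd w) g h * dy h)"

text \<open>The surfaces. A point is given by homogeneous coordinates: \<open>[X, Y, Z]\<close> for the plane,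
  \<open>[X0, X1, Y0, Y1]\<close> for a Hirzebruch surface. The standard affine charts (all isomorphic to
  the affine plane) are numbered so that chart 0 is the distinguished copy of the affine plane:
  \<open>Z \<noteq> 0\<close>, \<open>X \<noteq> 0\<close>, \<open>Y \<noteq> 0\<close>, respectively
  \<open>X0 Y0 \<noteq> 0\<close>, \<open>X1 Y0 \<noteq> 0\<close>, \<open>X0 Y1 \<noteq> 0\<close>, \<open>X1 Y1 \<noteq> 0\<close>.\<close>

datatype surface = P2 | Hirz nat

definition charts :: "surface \<Rightarrow> nat set" where
  "charts S = (case S of P2 \<Rightarrow> {..<3} | Hirz \<delta> \<Rightarrow> {..<4})"

definition hc :: "surface \<Rightarrow> nat \<Rightarrow> 'a \<Rightarrow> 'a \<Rightarrow> ('a::{zero,one}) list" where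
  "hc S c u v = (case S of
      P2 \<Rightarrow> (if c = 0 then [u, v, 1] else if c = 1 then [1, u, v] else [u, 1, v])
    | Hirz \<delta> \<Rightarrow> (if c = 0 then [1, u, 1, v] else if c = 1 then [u, 1, 1, v]
                else if c = 2 then [1, u, v, 1] else [u, 1, v, 1]))"

definition chart_dom :: "surface \<Rightarrow> nat \<Rightarrow> complex list \<Rightarrow> bool" where
  "chart_dom S c X = (case S of
      P2 \<Rightarrow> (if c = 0 then X!2 \<noteq> 0 else if c = 1 then X!0 \<noteq> 0 else X!1 \<noteq> 0)
    | Hirz \<delta> \<Rightarrow> (if c = 0 then X!0 \<noteq> 0 \<and> X!2 \<noteq> 0 else if c = 1 then X!1 \<noteq> 0 \<and> X!2 \<noteq> 0
                else if c = 2 then X!0 \<noteq> 0 \<and> X!3 \<noteq> 0 else X!1 \<noteq> 0 \<and> X!3 \<noteq> 0))"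

definition chart_coords :: "surface \<Rightarrow> nat \<Rightarrow> complex list \<Rightarrow> complex \<times> complex" where
  "chart_coords S c X = (case S of
      P2 \<Rightarrow> (if c = 0 then (X!0 / X!2, X!1 / X!2)
            else if c = 1 then (X!1 / X!0, X!2 / X!0)
            else (X!0 / X!1, X!2 / X!1))
    | Hirz \<delta> \<Rightarrow> (if c = 0 then (X!1 / X!0, X!0 ^ \<delta> * X!3 / X!2)
                else if c = 1 then (X!0 / X!1, X!1 ^ \<delta> * X!3 / X!2)
                else if c = 2 then (X!1 / X!0, X!2 / (X!0 ^ \<delta> * X!3))
                else (X!0 / X!1, X!2 / (X!1 ^ \<delta> * X!3))))"

definition overlap :: "surface \<Rightarrow> nat \<Rightarrow> nat \<Rightarrow> (complex \<times> complex) set" where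
  "overlap S c c' = {z. chart_dom S c' (hc S c (fst z) (snd z))}"

definition transition :: "surface \<Rightarrow> nat \<Rightarrow> nat \<Rightarrow> complex \<times> complex \<Rightarrow> complex \<times> complex" where
  "transition S c c' z = chart_coords S c' (hc S c (fst z) (snd z))"

text \<open>The torus acting on homogeneous coordinates; for the plane only \<open>m\<close> acts. A degree is a pair
  \<open>(a, b)\<close>: it stands for \<open>a F + b M\<close> on a Hirzebruch surface, and for \<open>b L\<close>
  (with \<open>a = 0\<close>) on the plane.\<close>

definition act :: "surface \<Rightarrow> complex \<Rightarrow> complex \<Rightarrow> complex list \<Rightarrow> complex list" where
  "act S l m X = (case S of
      P2 \<Rightarrow> [m * X!0, m * X!1, m * X!2]
    | Hirz \<delta> \<Rightarrow> [l * X!0, l * X!1, m * X!2, (l powi (- int \<delta>)) * m * X!3])"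

type_synonym deg = "int \<times> int"

text \<open>Foliations on the surface: a regular 1-form with isolated zeros on each chart (on the affine
  plane, isolated zeros means coprime coefficients), which agree on overlaps up to the nowhere
  vanishing regular function \<open>p / q\<close>.\<close>

definition foliation_on :: "surface \<Rightarrow> (nat \<Rightarrow> form) \<Rightarrow> bool" where
  "foliation_on S W \<longleftrightarrow>
     (\<forall>c\<in>charts S. coprime (fst (W c)) (snd (W c))) \<and>
     (\<forall>c\<in>charts S. \<forall>c'\<in>charts S. \<exists>p q. \<forall>z\<in>overlap S c c'.
        ev p z \<noteq> 0 \<and> ev q z \<noteq> 0 \<and>
        (\<forall>t. ev q z * form_ev (W c) z t =
             ev p z * form_ev (W c') (transition S c c' z)
                        (frechet_derivative (transition S c c') (at z) t)))"

text \<open>The canonical sheaf, with cocycle \<open>g\<close> given by \<open>v\<^sub>c = g\<^sub>c\<^sub>c\<^sub>' v\<^sub>c\<^sub>'\<close>, is isomorphic to the line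
  bundle of degree \<open>(a, b)\<close>: a section \<open>s\<close> of the latter is a function on homogeneous coordinates with
  \<open>s (act l m X) = l\<^sup>a m\<^sup>b s X\<close>, whence its cocycle \<open>1 / (l\<^sup>a m\<^sup>b)\<close>; the \<open>k c\<close> form the coboundary
  (the units on a chart are the nonzero constants).\<close>

definition canonical_degree :: "surface \<Rightarrow> (nat \<Rightarrow> form) \<Rightarrow> deg \<Rightarrow> bool" where
  "canonical_degree S W d \<longleftrightarrow>
     (S = P2 \<longrightarrow> fst d = 0) \<and>
     (\<exists>k :: nat \<Rightarrow> complex. (\<forall>c\<in>charts S. k c \<noteq> 0) \<and>
        (\<forall>c\<in>charts S. \<forall>c'\<in>charts S. \<forall>z\<in>overlap S c c'. \<forall>l m.
           l \<noteq> 0 \<longrightarrow> m \<noteq> 0 \<longrightarrow>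
           (let z' = transition S c c' z;
                g = k c / k c' * inverse (l powi fst d * m powi snd d)
            in hc S c' (fst z') (snd z') = act S l m (hc S c (fst z) (snd z)) \<longrightarrow>
               frechet_derivative (transition S c c') (at z) (vfield (W c) z) =
                 (g * fst (vfield (W c') z'), g * snd (vfield (W c') z')))))"

definition extends_to :: "surface \<Rightarrow> bipoly \<Rightarrow> bipoly \<Rightarrow> (nat \<Rightarrow> form) \<Rightarrow> bool" where
  "extends_to S A B W \<longleftrightarrow> foliation_on S W \<and> W 0 = (A, B)"

text \<open>Polynomials in the homogeneous coordinates (the variable with index \<open>i\<close> is the \<open>i\<close>-th
  coordinate), and homogeneity of a given degree.\<close>

type_synonym mpoly = "(nat \<Rightarrow>\<^sub>0 nat) \<Rightarrow>\<^sub>0 complex"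

definition cst :: "complex \<Rightarrow> mpoly" where "cst c = Poly_Mapping.single 0 c"

definition meval :: "(complex \<Rightarrow> 'a) \<Rightarrow> 'a list \<Rightarrow> mpoly \<Rightarrow> 'a::comm_semiring_1" where
  "meval C X f =
     (\<Sum>m\<in>Poly_Mapping.keys f. C (Poly_Mapping.lookup f m) *
        (\<Prod>i\<in>Poly_Mapping.keys m. (X ! i) ^ Poly_Mapping.lookup m i))"

definition weight :: "surface \<Rightarrow> (nat \<Rightarrow>\<^sub>0 nat) \<Rightarrow> deg" where
  "weight S m = (let e = (\<lambda>i. int (Poly_Mapping.lookup m i)) in case S of
      P2 \<Rightarrow> (0, e 0 + e 1 + e 2)
    | Hirz \<delta> \<Rightarrow> (e 0 + e 1 - int \<delta> * e 3, e 2 + e 3))"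

definition homogeneous :: "surface \<Rightarrow> deg \<Rightarrow> mpoly \<Rightarrow> bool" where
  "homogeneous S d f \<longleftrightarrow>
     (\<forall>m\<in>Poly_Mapping.keys f.
        Poly_Mapping.keys m \<subseteq> (case S of P2 \<Rightarrow> {..<3} | Hirz \<delta> \<Rightarrow> {..<4}) \<and> weight S m = d)"

definition hdeg :: "surface \<Rightarrow> mpoly \<Rightarrow> deg" where
  "hdeg S f = (THE d. homogeneous S d f)"

definition dehom :: "surface \<Rightarrow> mpoly \<Rightarrow> nat \<Rightarrow> bipoly" where
  "dehom S f c = meval bconst (hc S c bX bY) f"

text \<open>An integral curve is given by an irreducible (bi)homogeneous equation.\<close>

definition integral_curve :: "surface \<Rightarrow> mpoly \<Rightarrow> bool" where
  "integral_curve S f \<longleftrightarrow> irreducible f \<and> (\<exists>d. homogeneous S d f)"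

definition invariant_curve :: "surface \<Rightarrow> (nat \<Rightarrow> form) \<Rightarrow> mpoly \<Rightarrow> bool" where
  "invariant_curve S W f \<longleftrightarrow>
     (\<forall>c\<in>charts S. dehom S f c dvd fst (W c) * dy (dehom S f c) - snd (W c) * dx (dehom S f c))"

text \<open>Infinitely near points. \<open>Proper c u v\<close> is the point with coordinates \<open>(u, v)\<close> in chart \<open>c\<close>;
  \<open>Near p d\<close> is the point of the exceptional divisor of the blowup at \<open>p\<close> lying in the direction \<open>d\<close>.
  If \<open>(x, y)\<close> are the local coordinates centered at \<open>p\<close>, then those centered at \<open>Near p d\<close> satisfy
  \<open>x = x', y = x' (y' + t)\<close> for \<open>d = Some t\<close> and \<open>x = x' y', y = y'\<close> for \<open>d = None\<close>.\<close>

datatype ipt = Proper nat complex complex | Near ipt "complex option"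

fun bl_x :: "complex option \<Rightarrow> bipoly" where
  "bl_x (Some t) = bX"
| "bl_x None = bX * bY"

fun bl_y :: "complex option \<Rightarrow> bipoly" where
  "bl_y (Some t) = bX * (bY + bconst t)"
| "bl_y None = bY"

fun exc_eq :: "complex option \<Rightarrow> bipoly" where
  "exc_eq (Some t) = bX"
| "exc_eq None = bY"

text \<open>To have each point of the surface only once, \<open>c\<close> is the first chart containing it.\<close>

fun on_surface :: "surface \<Rightarrow> ipt \<Rightarrow> bool" where
  "on_surface S (Proper c u v) \<longleftrightarrow> c \<in> charts S \<and> (\<forall>c'<c. (u, v) \<notin> overlap S c c')"
| "on_surface S (Near p d) \<longleftrightarrow> on_surface S p"

text \<open>\<open>inf_near p q\<close>: the point \<open>q\<close> is infinitely near (or equal) to \<open>p\<close>.\<close>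

fun inf_near :: "ipt \<Rightarrow> ipt \<Rightarrow> bool" where
  "inf_near p (Proper c u v) \<longleftrightarrow> p = Proper c u v"
| "inf_near p (Near q d) \<longleftrightarrow> p = Near q d \<or> inf_near p q"

definition strict_curve :: "complex option \<Rightarrow> bipoly \<Rightarrow> bipoly" where
  "strict_curve d f =
     (let g = bsubst f (bl_x d) (bl_y d) in g div exc_eq d ^ (GREATEST k. exc_eq d ^ k dvd g))"

definition strict_form :: "complex option \<Rightarrow> form \<Rightarrow> form" where
  "strict_form d w =
     (let (a, b) = pullback w (bl_x d) (bl_y d);
          k = (GREATEST k. exc_eq d ^ k dvd a \<and> exc_eq d ^ k dvd b)
      in (a div exc_eq d ^ k, b div exc_eq d ^ k))"

text \<open>Strict transforms at \<open>p\<close>, in the coordinates centered at \<open>p\<close>, of the foliation and of a curve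
  on the surface.\<close>

fun local_form :: "(nat \<Rightarrow> form) \<Rightarrow> ipt \<Rightarrow> form" where
  "local_form W (Proper c u v) = pullback (W c) (bX + bconst u) (bY + bconst v)"
| "local_form W (Near p d) = strict_form d (local_form W p)"

fun local_curve :: "surface \<Rightarrow> mpoly \<Rightarrow> ipt \<Rightarrow> bipoly" where
  "local_curve S f (Proper c u v) = bsubst (dehom S f c) (bX + bconst u) (bY + bconst v)"
| "local_curve S f (Near p d) = strict_curve d (local_curve S f p)"

text \<open>The same for the exceptional divisor of the blowup at \<open>p\<close> (the equation is \<open>1\<close> at points which
  are not infinitely near to \<open>p\<close>, and at \<open>p\<close> itself).\<close>

fun local_exc :: "ipt \<Rightarrow> ipt \<Rightarrow> bipoly" where
  "local_exc p (Proper c u v) = 1"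
| "local_exc p (Near q d) = (if q = p then exc_eq d else strict_curve d (local_exc p q))"

definition curve_mult :: "surface \<Rightarrow> mpoly \<Rightarrow> ipt \<Rightarrow> nat" where
  "curve_mult S f p = mult0 (local_curve S f p)"

text \<open>\<open>proximate q p\<close> is \<open>q \<rightarrow> p\<close>.\<close>

definition proximate :: "ipt \<Rightarrow> ipt \<Rightarrow> bool" where
  "proximate q p \<longleftrightarrow> q \<noteq> p \<and> inf_near p q \<and> ev (local_exc p q) (0, 0) = 0"

definition nu_form :: "form \<Rightarrow> nat" where
  "nu_form w = (LEAST n. hpart n (fst w) \<noteq> 0 \<or> hpart n (snd w) \<noteq> 0)"

definition linear_matrix :: "form \<Rightarrow> complex^2^2" where
  "linear_matrix w =
     (let a = hpart 1 (fst w); b = hpart 1 (snd w); o' = (0, 0)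
      in vector [vector [ev (dx b) o', ev (dy b) o'],
                 vector [- ev (dx a) o', - ev (dy a) o']])"

text \<open>\<open>l1, l2\<close> are the eigenvalues of \<open>J\<close>, counted with multiplicity.\<close>

definition eigenvalues2 :: "complex^2^2 \<Rightarrow> complex \<Rightarrow> complex \<Rightarrow> bool" where
  "eigenvalues2 J l1 l2 \<longleftrightarrow> (\<forall>t. det (mat t - J) = (t - l1) * (t - l2))"

definition simple_sing :: "form \<Rightarrow> bool" where
  "simple_sing w \<longleftrightarrow> nu_form w = 1 \<and>
     (\<exists>l1 l2. eigenvalues2 (linear_matrix w) l1 l2 \<and>
        (l1 * l2 \<noteq> 0 \<and> l1 / l2 \<notin> of_rat ` {r. 0 < r} \<or>
         l1 * l2 = 0 \<and> l1\<^sup>2 + l2\<^sup>2 \<noteq> 0))"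

definition ordinary_sing :: "form \<Rightarrow> bool" where
  "ordinary_sing w \<longleftrightarrow> nu_form w \<ge> 1 \<and> \<not> simple_sing w"

definition terminal_dicritical :: "form \<Rightarrow> bool" where
  "terminal_dicritical w \<longleftrightarrow> nu_form w \<ge> 1 \<and>
     (let m = nu_form w in bX * hpart m (fst w) + bY * hpart m (snd w) = 0)"

text \<open>The sets of centers of finite sequences of point blowups are the \<open>configuration\<close>s \<open>K\<close>. Every point
  of the surface obtained by blowing up \<open>K\<close> is, up to the identification of a point with its unique
  preimage under blowups centered elsewhere, a \<open>p\<close> with \<open>blown_up_point S K p\<close>.\<close>

definition configuration :: "surface \<Rightarrow> ipt set \<Rightarrow> bool" where
  "configuration S K \<longleftrightarrow> finite K \<and> (\<forall>p\<in>K. on_surface S p) \<and> (\<forall>p d. Near p d \<in> K \<longrightarrow> p \<in> K)"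

definition blown_up_point :: "surface \<Rightarrow> ipt set \<Rightarrow> ipt \<Rightarrow> bool" where
  "blown_up_point S K p \<longleftrightarrow> on_surface S p \<and> p \<notin> K \<and> (\<forall>q. inf_near q p \<and> q \<noteq> p \<longrightarrow> q \<in> K)"

definition reduces :: "surface \<Rightarrow> (nat \<Rightarrow> form) \<Rightarrow> ipt set \<Rightarrow> bool" where
  "reduces S W K \<longleftrightarrow> configuration S K \<and>
     (\<forall>p. blown_up_point S K p \<longrightarrow> \<not> ordinary_sing (local_form W p))"

definition minimal_reduction :: "surface \<Rightarrow> (nat \<Rightarrow> form) \<Rightarrow> ipt set \<Rightarrow> bool" where
  "minimal_reduction S W K \<longleftrightarrow> reduces S W K \<and> (\<forall>K'. reduces S W K' \<and> K' \<subseteq> K \<longrightarrow> K' = K)"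

definition term_dic_at :: "(nat \<Rightarrow> form) \<Rightarrow> ipt \<Rightarrow> bool" where
  "term_dic_at W p \<longleftrightarrow> terminal_dicritical (local_form W p)"

definition dicritical_config :: "(nat \<Rightarrow> form) \<Rightarrow> ipt set \<Rightarrow> ipt set" where
  "dicritical_config W SF = {p\<in>SF. \<exists>q\<in>SF. inf_near p q \<and> term_dic_at W q}"

definition dic_points :: "(nat \<Rightarrow> form) \<Rightarrow> ipt set \<Rightarrow> ipt set" where
  "dic_points W BF = {p\<in>BF. term_dic_at W p}"

definition nu :: "(nat \<Rightarrow> form) \<Rightarrow> ipt \<Rightarrow> nat" where
  "nu W p = nu_form (local_form W p)"

definition eps :: "(nat \<Rightarrow> form) \<Rightarrow> ipt \<Rightarrow> nat" where
  "eps W p = (if term_dic_at W p then 1 else 0)"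

text \<open>The Neron-Severi space of the blowup at \<open>BF\<close>: a class is its coordinate function with respect to
  the basis \<open>[L\<^sup>*]\<close> (resp. \<open>[F\<^sup>*], [M\<^sup>*]\<close>), \<open>[E\<^sub>p\<^sup>*]\<close> (the coordinates at the other
  generators are \<open>0\<close>). Functions are made a real vector space with the pointwise operations.\<close>

datatype gen = GL | GF | GM | GE ipt

type_synonym cls = "gen \<Rightarrow> real"

instantiation "fun" :: (type, real_vector) real_vector
begin

definition scaleR_fun :: "real \<Rightarrow> ('a \<Rightarrow> 'b) \<Rightarrow> 'a \<Rightarrow> 'b" where
  "scaleR_fun r f = (\<lambda>x. r *\<^sub>R f x)"

instance
  by standard (simp_all add: scaleR_fun_def fun_eq_iff scaleR_add_right scaleR_add_left)

end

text \<open>\<open>divisor S BF a b e\<close> is \<open>b L\<^sup>* - \<Sum>\<^sub>p e\<^sub>p E\<^sub>p\<^sup>*\<close> (where \<open>a\<close> is irrelevant), resp.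
  \<open>a F\<^sup>* + b M\<^sup>* - \<Sum>\<^sub>p e\<^sub>p E\<^sub>p\<^sup>*\<close>.\<close>

definition divisor :: "surface \<Rightarrow> ipt set \<Rightarrow> real \<Rightarrow> real \<Rightarrow> (ipt \<Rightarrow> real) \<Rightarrow> cls" where
  "divisor S BF a b e g = (case g of
      GL \<Rightarrow> (if S = P2 then b else 0)
    | GF \<Rightarrow> (if S = P2 then 0 else a)
    | GM \<Rightarrow> (if S = P2 then 0 else b)
    | GE p \<Rightarrow> (if p \<in> BF then - e p else 0))"

definition inter :: "surface \<Rightarrow> ipt set \<Rightarrow> cls \<Rightarrow> cls \<Rightarrow> real" where
  "inter S BF D D' =
     (case S of
        P2 \<Rightarrow> D GL * D' GL
      | Hirz \<delta> \<Rightarrow> D GF * D' GM + D GM * D' GF + real \<delta> * (D GM * D' GM))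
     - (\<Sum>p\<in>BF. D (GE p) * D' (GE p))"

definition strict_cls :: "surface \<Rightarrow> ipt set \<Rightarrow> mpoly \<Rightarrow> cls" where
  "strict_cls S BF f =
     divisor S BF (of_int (fst (hdeg S f))) (of_int (snd (hdeg S f))) (\<lambda>p. real (curve_mult S f p))"

definition strict_exc_cls :: "surface \<Rightarrow> ipt set \<Rightarrow> ipt \<Rightarrow> cls" where
  "strict_exc_cls S BF q =
     divisor S BF 0 0 (\<lambda>p. if p = q then -1 else real (mult0 (local_exc q p)))"

definition K_Z :: "surface \<Rightarrow> ipt set \<Rightarrow> cls" where
  "K_Z S BF = (case S of
      P2 \<Rightarrow> divisor S BF 0 (-3) (\<lambda>p. -1)
    | Hirz \<delta> \<Rightarrow> divisor S BF (real \<delta> - 2) (-2) (\<lambda>p. -1))"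

definition K_fol :: "surface \<Rightarrow> (nat \<Rightarrow> form) \<Rightarrow> deg \<Rightarrow> ipt set \<Rightarrow> cls" where
  "K_fol S W d BF =
     divisor S BF (of_int (fst d)) (of_int (snd d)) (\<lambda>p. real (nu W p) + real (eps W p) - 1)"

text \<open>Rational first integrals. Leaves are the classes of the equivalence relation on nonsingular
  points generated by: two points lie on a common holomorphic disc, contained in a chart and
  tangent to the foliation. Points are pairs (chart, coordinates).\<close>

definition nonsing :: "surface \<Rightarrow> (nat \<Rightarrow> form) \<Rightarrow> nat \<times> complex \<times> complex \<Rightarrow> bool" where
  "nonsing S W p \<longleftrightarrow> (case p of (c, z) \<Rightarrow>
     c \<in> charts S \<and> \<not> (ev (fst (W c)) z = 0 \<and> ev (snd (W c)) z = 0))"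

inductive same_leaf ::
  "surface \<Rightarrow> (nat \<Rightarrow> form) \<Rightarrow> nat \<times> complex \<times> complex \<Rightarrow> nat \<times> complex \<times> complex \<Rightarrow> bool"
  for S W where
  disc: "\<lbrakk>g holomorphic_on ball 0 1; h holomorphic_on ball 0 1;
          \<And>s. s \<in> ball 0 1 \<Longrightarrow> nonsing S W (c, g s, h s);
          \<And>s. s \<in> ball 0 1 \<Longrightarrow> form_ev (W c) (g s, h s) (deriv g s, deriv h s) = 0;
          s1 \<in> ball 0 1; s2 \<in> ball 0 1\<rbrakk>
         \<Longrightarrow> same_leaf S W (c, g s1, h s1) (c, g s2, h s2)"
| chart: "\<lbrakk>nonsing S W (c, z); c' \<in> charts S; z \<in> overlap S c c'\<rbrakk>
         \<Longrightarrow> same_leaf S W (c, z) (c', transition S c c' z)"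
| trans: "\<lbrakk>same_leaf S W p q; same_leaf S W q r\<rbrakk> \<Longrightarrow> same_leaf S W p r"

definition leaf :: "surface \<Rightarrow> (nat \<Rightarrow> form) \<Rightarrow> nat \<times> complex \<times> complex \<Rightarrow> (nat \<times> complex \<times> complex) set"
  where "leaf S W p = {q. same_leaf S W p q}"

definition vanishing :: "surface \<Rightarrow> mpoly \<Rightarrow> (nat \<times> complex \<times> complex) set" where
  "vanishing S f = {(c, u, v). c \<in> charts S \<and> meval id (hc S c u v) f = 0}"

text \<open>\<open>P / Q\<close> is a rational first integral.\<close>

definition first_integral ::
  "surface \<Rightarrow> (nat \<Rightarrow> form) \<Rightarrow> ipt set \<Rightarrow> mpoly \<Rightarrow> mpoly \<Rightarrow> bool" where
  "first_integral S W SF P Q \<longleftrightarrow>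
     P \<noteq> 0 \<and> Q \<noteq> 0 \<and> (\<exists>d. homogeneous S d P \<and> homogeneous S d Q) \<and>
     (\<forall>D. D dvd P \<longrightarrow> D dvd Q \<longrightarrow> D dvd 1) \<and>
     (\<nexists>k. P = cst k * Q) \<and>
     (\<forall>c u v. on_surface S (Proper c u v) \<and> (c, u, v) \<in> vanishing S P \<inter> vanishing S Q
        \<longrightarrow> Proper c u v \<in> SF) \<and>
     (\<forall>p. nonsing S W p \<longrightarrow>
        (\<exists>\<alpha> \<beta>. (\<alpha>, \<beta>) \<noteq> (0, 0) \<and> leaf S W p \<subseteq> vanishing S (cst \<alpha> * P + cst \<beta> * Q)))"

definition alg_integrable :: "surface \<Rightarrow> (nat \<Rightarrow> form) \<Rightarrow> ipt set \<Rightarrow> bool" where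
  "alg_integrable S W SF \<longleftrightarrow> (\<exists>P Q. first_integral S W SF P Q)"

text \<open>\<open>homz g n P Q\<close> is \<open>Q\<^sup>n g(P / Q)\<close>; so the last equation below is \<open>P' / Q' = (g / h)(P / Q)\<close>.\<close>

definition homz :: "complex poly \<Rightarrow> nat \<Rightarrow> mpoly \<Rightarrow> mpoly \<Rightarrow> mpoly" where
  "homz g n P Q = (\<Sum>i\<le>n. cst (coeff g i) * P ^ i * Q ^ (n - i))"

definition primitive_first_integral ::
  "surface \<Rightarrow> (nat \<Rightarrow> form) \<Rightarrow> ipt set \<Rightarrow> mpoly \<Rightarrow> mpoly \<Rightarrow> bool" where
  "primitive_first_integral S W SF P Q \<longleftrightarrow> first_integral S W SF P Q \<and>
     (\<forall>P' Q'. first_integral S W SF P' Q' \<longrightarrow>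
        (\<exists>g h :: complex poly. coprime g h \<and> max (degree g) (degree h) > 0 \<and>
           (let n = max (degree g) (degree h) in P' * homz h n P Q = Q' * homz g n P Q)))"

text \<open>The multiplicity at \<open>p\<close> of the strict transform of a general member of the pencil of \<open>P, Q\<close>.\<close>

definition general_mult :: "surface \<Rightarrow> mpoly \<Rightarrow> mpoly \<Rightarrow> ipt \<Rightarrow> nat" where
  "general_mult S P Q p = (THE m. finite {k. curve_mult S (P + cst k * Q) p \<noteq> m})"

definition D_F :: "surface \<Rightarrow> ipt set \<Rightarrow> mpoly \<Rightarrow> mpoly \<Rightarrow> cls" where
  "D_F S BF P Q =
     divisor S BF (of_int (fst (hdeg S P))) (of_int (snd (hdeg S P))) (\<lambda>p. real (general_mult S P Q p))"

definition T_F :: "surface \<Rightarrow> ipt set \<Rightarrow> mpoly \<Rightarrow> mpoly \<Rightarrow> cls" where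
  "T_F S BF P Q = (1 / of_int (snd (hdeg S P))) *\<^sub>R D_F S BF P Q"

definition V_set :: "surface \<Rightarrow> (nat \<Rightarrow> form) \<Rightarrow> deg \<Rightarrow> ipt set \<Rightarrow> mpoly set \<Rightarrow> cls set" where
  "V_set S W d BF \<Sigma> =
     strict_cls S BF ` \<Sigma> \<union> {K_fol S W d BF - K_Z S BF} \<union>
     strict_exc_cls S BF ` (BF - dic_points W BF)"

text \<open>The cardinality condition says that the listed classes are pairwise distinct, i.e. linear
  independence is that of the family; in particular, \<open>\<Sigma>\<close> has only one equation for each curve.\<close>

definition independent_solutions ::
  "surface \<Rightarrow> (nat \<Rightarrow> form) \<Rightarrow> deg \<Rightarrow> ipt set \<Rightarrow> mpoly set \<Rightarrow> bool" where
  "independent_solutions S W d BF \<Sigma> \<longleftrightarrow>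
     finite \<Sigma> \<and> (\<forall>f\<in>\<Sigma>. integral_curve S f \<and> invariant_curve S W f) \<and>
     independent (V_set S W d BF \<Sigma>) \<and>
     card (V_set S W d BF \<Sigma>) = card \<Sigma> + 1 + card (BF - dic_points W BF) \<and>
     (if S = P2 then card \<Sigma> + 1 \<le> card (dic_points W BF) else card \<Sigma> \<le> card (dic_points W BF))"

definition restricted :: "surface \<Rightarrow> (nat \<Rightarrow> form) \<Rightarrow> deg \<Rightarrow> ipt set \<Rightarrow> mpoly set \<Rightarrow> bool" where
  "restricted S W d BF \<Sigma> \<longleftrightarrow>
     (if S = P2 then divisor S BF 0 1 (\<lambda>p. 0) \<notin> span (V_set S W d BF \<Sigma>)
      else divisor S BF 1 0 (\<lambda>p. 0) \<notin> span (V_set S W d BF \<Sigma>))"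

definition ell :: "surface \<Rightarrow> (nat \<Rightarrow> form) \<Rightarrow> ipt set \<Rightarrow> mpoly set \<Rightarrow> nat" where
  "ell S W BF \<Sigma> =
     (if S = P2 then card (dic_points W BF) - card \<Sigma> - 1 else card (dic_points W BF) - card \<Sigma>)"

text \<open>\<open>lam BF q p\<close> is the coefficient \<open>\<lambda>\<close> of the point \<open>p\<close> with respect to the dicritical point \<open>q\<close>.\<close>

lemma inf_near_size: "inf_near p q \<Longrightarrow> size p \<le> size q \<and> (p \<noteq> q \<longrightarrow> size p < size q)"
  by (induction q) auto

function lam :: "ipt set \<Rightarrow> ipt \<Rightarrow> ipt \<Rightarrow> real" where
  "lam BF q p =
     (if \<not> inf_near p q then 0
      else if p = q then 1
      else (\<Sum>s\<in>{s\<in>BF. proximate s p}. lam BF q s))"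
  by pat_completeness auto
termination
proof (relation "Wellfounded.measure (\<lambda>(BF, q, p). if inf_near p q then Suc (size q - size p) else 0)")
  fix BF q p s
  assume "\<not> \<not> inf_near p q" "p \<noteq> q" "s \<in> {s \<in> BF. proximate s p}"
  then show "((BF, q, s), BF, q, p) \<in>
      Wellfounded.measure (\<lambda>(BF, q, p). if inf_near p q then Suc (size q - size p) else 0)"
    using inf_near_size[of p q] inf_near_size[of p s] inf_near_size[of s q]
    by (auto simp: proximate_def)
qed simp

declare lam.simps [simp del]

text \<open>In the following, \<open>ks 1, ..., ks d\<close> are the dicritical points.
  \<open>hco \<dots> j\<close> is \<open>h\<^sub>j\<close>, including \<open>j = 0\<close>.\<close>

definition hco :: "surface \<Rightarrow> (nat \<Rightarrow> form) \<Rightarrow> deg \<Rightarrow> ipt set \<Rightarrow> (nat \<Rightarrow> ipt) \<Rightarrow> nat \<Rightarrow> real" where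
  "hco S W kd BF ks j = (case S of
      P2 \<Rightarrow> (if j = 0 then 1 else 0)
    | Hirz \<delta> \<Rightarrow>
        (if j = 0 then - (of_int (fst kd) - real \<delta> + 2) / (of_int (snd kd) + 2) - real \<delta>
         else (\<Sum>p\<in>BF. (real (nu W p) + real (eps W p)) * lam BF (ks j) p) / (of_int (snd kd) + 2)))"

definition v_vec ::
  "surface \<Rightarrow> (nat \<Rightarrow> form) \<Rightarrow> deg \<Rightarrow> ipt set \<Rightarrow> (nat \<Rightarrow> ipt) \<Rightarrow> (nat \<Rightarrow> real) \<Rightarrow> cls" where
  "v_vec S W kd BF ks \<alpha> =
     (let d = card (dic_points W BF) in
      divisor S BF (hco S W kd BF ks 0 + (\<Sum>j=1..d. hco S W kd BF ks j * \<alpha> j)) 1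
        (\<lambda>p. \<Sum>j=1..d. lam BF (ks j) p * \<alpha> j))"

definition v_system ::
  "surface \<Rightarrow> (nat \<Rightarrow> form) \<Rightarrow> deg \<Rightarrow> ipt set \<Rightarrow> mpoly set \<Rightarrow> (nat \<Rightarrow> ipt) \<Rightarrow> (nat \<Rightarrow> real) \<Rightarrow> bool" where
  "v_system S W kd BF \<Sigma> ks \<alpha> \<longleftrightarrow>
     (\<forall>f\<in>\<Sigma>. inter S BF (v_vec S W kd BF ks \<alpha>) (strict_cls S BF f) = 0) \<and>
     (S = P2 \<longrightarrow> inter S BF (v_vec S W kd BF ks \<alpha>) (K_fol S W kd BF - K_Z S BF) = 0)"

text \<open>\<open>\<mu>\<close> describes the solutions of the system, with free parameters \<open>\<alpha> 1, ..., \<alpha> \<ell>\<close>.\<close>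

definition solution_param ::
  "surface \<Rightarrow> (nat \<Rightarrow> form) \<Rightarrow> deg \<Rightarrow> ipt set \<Rightarrow> mpoly set \<Rightarrow> (nat \<Rightarrow> ipt) \<Rightarrow> (nat \<Rightarrow> nat \<Rightarrow> real) \<Rightarrow> bool"
  where
  "solution_param S W kd BF \<Sigma> ks \<mu> \<longleftrightarrow>
     (let d = card (dic_points W BF); l = ell S W BF \<Sigma> in
      (\<forall>k\<in>{0..l}. \<forall>s\<in>{l+1..d}. \<mu> k s \<in> \<rat>) \<and>
      (\<forall>\<alpha> :: nat \<Rightarrow> real. v_system S W kd BF \<Sigma> ks \<alpha> \<longleftrightarrow>
         (\<forall>s\<in>{l+1..d}. \<alpha> s = \<mu> 0 s + (\<Sum>k=1..l. \<mu> k s * \<alpha> k))))"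

definition Lam ::
  "surface \<Rightarrow> (nat \<Rightarrow> form) \<Rightarrow> ipt set \<Rightarrow> mpoly set \<Rightarrow> (nat \<Rightarrow> ipt) \<Rightarrow> (nat \<Rightarrow> nat \<Rightarrow> real) \<Rightarrow> ipt \<Rightarrow> nat \<Rightarrow> real"
  where
  "Lam S W BF \<Sigma> ks \<mu> p k =
     (if k = 0 then 0 else lam BF (ks k) p) +
     (\<Sum>s=ell S W BF \<Sigma> + 1..card (dic_points W BF). lam BF (ks s) p * \<mu> k s)"

definition Hco ::
  "surface \<Rightarrow> (nat \<Rightarrow> form) \<Rightarrow> deg \<Rightarrow> ipt set \<Rightarrow> mpoly set \<Rightarrow> (nat \<Rightarrow> ipt) \<Rightarrow> (nat \<Rightarrow> nat \<Rightarrow> real) \<Rightarrow> nat \<Rightarrow> real"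
  where
  "Hco S W kd BF \<Sigma> ks \<mu> k =
     hco S W kd BF ks k +
     (\<Sum>s=ell S W BF \<Sigma> + 1..card (dic_points W BF). hco S W kd BF ks s * \<mu> k s)"

definition T_div ::
  "surface \<Rightarrow> (nat \<Rightarrow> form) \<Rightarrow> deg \<Rightarrow> ipt set \<Rightarrow> mpoly set \<Rightarrow> (nat \<Rightarrow> ipt) \<Rightarrow> (nat \<Rightarrow> nat \<Rightarrow> real) \<Rightarrow>
   (nat \<Rightarrow> real) \<Rightarrow> cls" where
  "T_div S W kd BF \<Sigma> ks \<mu> \<alpha> =
     (let l = ell S W BF \<Sigma> in
      divisor S BF (Hco S W kd BF \<Sigma> ks \<mu> 0 + (\<Sum>k=1..l. Hco S W kd BF \<Sigma> ks \<mu> k * \<alpha> k)) 1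
        (\<lambda>p. Lam S W BF \<Sigma> ks \<mu> p 0 + (\<Sum>k=1..l. Lam S W BF \<Sigma> ks \<mu> p k * \<alpha> k)))"

text \<open>The linear system defining the distinguished vector.\<close>

definition alpha_system ::
  "surface \<Rightarrow> (nat \<Rightarrow> form) \<Rightarrow> deg \<Rightarrow> ipt set \<Rightarrow> mpoly set \<Rightarrow> (nat \<Rightarrow> ipt) \<Rightarrow> (nat \<Rightarrow> nat \<Rightarrow> real) \<Rightarrow>
   (nat \<Rightarrow> real) \<Rightarrow> bool" where
  "alpha_system S W kd BF \<Sigma> ks \<mu> \<alpha> \<longleftrightarrow>
     (let l = ell S W BF \<Sigma>; \<Lambda> = Lam S W BF \<Sigma> ks \<mu> in
      \<forall>j\<in>{1..l}.
        (\<Sum>k=1..l. (\<Sum>p\<in>BF. \<Lambda> p j * \<Lambda> p k) * \<alpha> k) =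
        Hco S W kd BF \<Sigma> ks \<mu> j - (\<Sum>p\<in>BF. \<Lambda> p 0 * \<Lambda> p j))"

end

theory Submission
  imports Defs "HOL-Computational_Algebra.Field_as_Ring"
begin

text \<open>Let \<open>P / Q\<close> be a rational first integral of degree \<open>d\<close>, with general member of multiplicity \<open>m\<^sub>p\<close>
  at \<open>p\<close>. On the blown-up surface the general member is disjoint from another general member, from the
  invariant curves, from the divisorial part of the zeros of \<open>Q dP - P dQ\<close> and from the non-dicritical
  exceptional curves, since all of these lie in other members, while it meets the dicritical ones
  outside the configuration. By Bezout's theorem on \<open>S\<^sub>0\<close> and Noether's formula this means
  \<open>D\<^sup>2 = 0\<close>, \<open>D \<cdot> C = 0\<close>, \<open>D \<cdot> (K\<^sub>F - K\<^sub>Z) = 0\<close>, and \<open>m\<^sub>p = \<Sum>\<^bsub>q \<rightarrow> p\<^esub> m\<^sub>q\<close> for non-dicritical \<open>p\<close>,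
  with \<open>>\<close> for dicritical \<open>p\<close>. The proximity relations express \<open>T\<^sub>F\<close> as \<open>v(\<alpha>)\<close> with
  \<open>\<alpha>\<^sub>j = (m\<^sub>p - \<Sum>\<^bsub>q \<rightarrow> p\<^esub> m\<^sub>q) / b > 0\<close> for \<open>p = p\<^bsub>k\<^sub>j\<^esub>\<close>, and the remaining equations show \<open>T\<^sub>F = T\<^sub>\<alpha>\<close>.
  The distinguished vector is the critical point of the concave quadratic function \<open>\<alpha> \<mapsto> T\<^sub>\<alpha>\<^sup>2\<close>, so its
  value there is at least \<open>T\<^sub>F\<^sup>2 = 0\<close>, with equality only if the vector is the parameter of \<open>T\<^sub>F\<close>.\<close>

section \<open>Polynomials on the affine plane: identities by evaluation, derivatives, finiteness of
  common zeros\<close>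

section \<open>Bivariate polynomials\<close>

text \<open>Noether's formula is taken as the definition of the local intersection number
  \<open>NN\<close>, so its behaviour under blowups is built in and the difficulty moves to
  invariance under adding to \<open>g\<close> a multiple of \<open>f\<close>
  (\<open>NN_cong\<close>). With that, Bezout's theorem becomes pseudo-division of polynomials in
  \<open>y\<close>. That curves lie in members of the pencil is algebra for the exceptional ones;
  for invariant curves and for the zeros of \<open>Q dP - P dQ\<close> it needs integration:
  \<open>P / Q\<close> is shown to be constant along a holomorphic disc inside the curve. The
  predicate \<open>Mem\<close> records the finitely many parameters involved, so one member with
  another parameter is general at all points of the configuration at once. That no base point
  escapes the configuration rests on two facts: blowing up a point that is not ordinary creates no
  ordinary point, and above every base point there is a dicritical one, because the intersection
  number of the two generators drops at each base point that is blown up.\<close>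

lemma ev_simps [simp]:
  "ev 0 z = 0" "ev 1 z = 1" "ev (f + g) z = ev f z + ev g z" "ev (f - g) z = ev f z - ev g z"
  "ev (- f) z = - ev f z" "ev (f * g) z = ev f z * ev g z" "ev (f ^ n) z = ev f z ^ n"
  "ev (bconst c) z = c" "ev bX z = fst z" "ev bY z = snd z"
  by (simp_all add: ev_def bconst_def bX_def bY_def)

lemma ev_sum: "ev (sum f A) z = (\<Sum>i\<in>A. ev (f i) z)"
  by (induction A rule: infinite_finite_induct) auto

lemma ev_prod: "ev (prod f A) z = (\<Prod>i\<in>A. ev (f i) z)"
  by (induction A rule: infinite_finite_induct) auto

lemma ev_pCons: "ev (pCons a p) (x, y) = poly a x + y * ev p (x, y)"
  by (simp add: ev_def)

lemma ev_const [simp]: "ev [:p:] z = poly p (fst z)"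
  by (simp add: ev_def)

lemma ev_altdef: "ev f (x, y) = (\<Sum>j\<le>degree f. poly (coeff f j) x * y ^ j)"
  by (simp add: ev_def poly_altdef[of f] poly_sum)

lemma ev_altdef2:
  "ev f (x, y) = (\<Sum>j\<le>degree f. \<Sum>i\<le>degree (coeff f j). coeff (coeff f j) i * x ^ i * y ^ j)"
  unfolding ev_altdef by (intro sum.cong refl) (simp add: poly_altdef sum_distrib_right)

lemma ev_monom [simp]: "ev (monom (monom c i) j) z = c * fst z ^ i * snd z ^ j"
  by (simp add: ev_def poly_monom)

lemma ev_bsubst [simp]: "ev (bsubst f g h) z = ev f (ev g z, ev h z)"
  by (simp add: bsubst_def ev_sum ev_altdef2)

text \<open>Over each \<open>x\<close> in \<open>X\<close> the polynomial in \<open>y\<close> has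
  infinitely many roots, so its coefficient at \<open>degree f\<close> vanishes; the leading
  coefficient of \<open>f\<close> then has infinitely many roots itself.\<close>

lemma ev_zero_ext:
  assumes X: "infinite X" and Y: "\<And>x. x \<in> X \<Longrightarrow> infinite {y. ev f (x, y) = 0}"
  shows "f = 0"
proof (rule ccontr)
  assume "f \<noteq> 0"
  have "coeff (lead_coeff f) i = 0" for i
  proof -
    have "poly (lead_coeff f) x = 0" if "x \<in> X" for x
    proof -
      define q where "q = map_poly (\<lambda>p. poly p x) f"
      have "poly q y = ev f (x, y)" for y
        unfolding q_def ev_def by (induction f) (auto simp: map_poly_pCons)
      then have "q = 0" using Y[OF that] poly_roots_finite[of q] by auto
      then have "coeff q (degree f) = 0" by simp
      then show ?thesis by (simp add: q_def coeff_map_poly)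
    qed
    then have "X \<subseteq> {x. poly (lead_coeff f) x = 0}" by auto
    then have "lead_coeff f = 0"
      using poly_roots_finite[of "lead_coeff f"] X finite_subset by blast
    then show ?thesis by simp
  qed
  then have "lead_coeff f = 0" by (simp add: poly_eq_iff)
  then show False using \<open>f \<noteq> 0\<close> by simp
qed

lemma infinite_complex_Compl: "finite X \<Longrightarrow> infinite (- X :: complex set)"
  using infinite_UNIV_char_0 by (metis Compl_eq_Diff_UNIV finite_Diff2)

text \<open>Chart changes are explicit only where both coordinates are nonzero; this makes a check
  there sufficient for an identity of local equations.\<close>

lemma ev_ext_torus:
  assumes "\<And>x y. x \<noteq> 0 \<Longrightarrow> y \<noteq> 0 \<Longrightarrow> ev f (x, y) = ev g (x, y)"
  shows "f = g"
proof -
  have inf: "infinite (- {0 :: complex})" by (rule infinite_complex_Compl) simp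
  have "f - g = 0"
  proof (rule ev_zero_ext[OF inf])
    fix x :: complex assume "x \<in> - {0}"
    then have "- {0} \<subseteq> {y. ev (f - g) (x, y) = 0}" using assms by auto
    then show "infinite {y. ev (f - g) (x, y) = 0}" using inf finite_subset by blast
  qed
  then show ?thesis by simp
qed

lemma ev_ext: "(\<And>x y. ev f (x, y) = ev g (x, y)) \<Longrightarrow> f = g"
  by (rule ev_ext_torus) auto

lemma bsubst_add: "bsubst (f + f') g h = bsubst f g h + bsubst f' g h"
  and bsubst_diff: "bsubst (f - f') g h = bsubst f g h - bsubst f' g h"
  and bsubst_mult: "bsubst (f * f') g h = bsubst f g h * bsubst f' g h"
  and bsubst_uminus: "bsubst (- f) g h = - bsubst f g h"
  and bsubst_0 [simp]: "bsubst 0 g h = 0"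
  and bsubst_1 [simp]: "bsubst 1 g h = 1"
  and bsubst_bconst [simp]: "bsubst (bconst c) g h = bconst c"
  and bsubst_bX [simp]: "bsubst bX g h = g"
  and bsubst_bY [simp]: "bsubst bY g h = h"
  and bsubst_power: "bsubst (f ^ n) g h = bsubst f g h ^ n"
  by (rule ev_ext; simp)+

lemmas bsubst_simps = bsubst_add bsubst_diff bsubst_mult bsubst_uminus bsubst_power

lemma bX_ne_0 [simp]: "bX \<noteq> 0" and bY_ne_0 [simp]: "bY \<noteq> 0"
  by (simp_all add: bX_def bY_def)

lemma bconst_0 [simp]: "bconst 0 = 0" and bconst_1 [simp]: "bconst 1 = 1"
  by (simp_all add: bconst_def one_pCons)

lemma bconst_eq_0_iff [simp]: "bconst c = 0 \<longleftrightarrow> c = 0"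
  by (simp add: bconst_def)

lemma bconst_dvd_1: "c \<noteq> 0 \<Longrightarrow> bconst c dvd 1"
  by (simp add: bconst_def is_unit_const_poly_iff dvd_field_iff)

lemma bipoly_is_unit_iff: "(f :: bipoly) dvd 1 \<longleftrightarrow> (\<exists>c. c \<noteq> 0 \<and> f = bconst c)"
  by (auto simp: bconst_def is_unit_poly_iff dvd_field_iff)

subsection \<open>Partial derivatives\<close>

lemma dx_pCons: "dx (pCons a p) = pCons (pderiv a) (dx p)"
  by (simp add: dx_def map_poly_pCons)

lemma dy_pCons: "dy (pCons a p) = p + pCons 0 (dy p)"
  by (simp add: dy_def pderiv_pCons)

lemma dx_0 [simp]: "dx 0 = 0" and dy_0 [simp]: "dy 0 = 0"
  by (simp_all add: dx_def dy_def)

lemma DERIV_ev: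
  assumes "(g has_field_derivative g') (at s)" "(h has_field_derivative h') (at s)"
  shows "((\<lambda>s. ev f (g s, h s)) has_field_derivative
           (ev (dx f) (g s, h s) * g' + ev (dy f) (g s, h s) * h')) (at s)"
proof (induction f)
  case 0
  then show ?case by simp
next
  case (pCons a p)
  have "((\<lambda>s. poly a (g s) + h s * ev p (g s, h s)) has_field_derivative
      (poly (pderiv a) (g s) * g' +
       (h' * ev p (g s, h s) + (ev (dx p) (g s, h s) * g' + ev (dy p) (g s, h s) * h') * h s))) (at s)"
    by (intro DERIV_add DERIV_mult assms pCons.IH DERIV_chain2[OF poly_DERIV])
  then show ?case
    by (simp add: ev_pCons dx_pCons dy_pCons algebra_simps)
qed

lemma DERIV_ev_fst: "((\<lambda>x. ev f (x, y)) has_field_derivative ev (dx f) (x, y)) (at x)"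
  using DERIV_ev[of "\<lambda>x. x" 1 x "\<lambda>x. y" 0 f] by simp

lemma DERIV_ev_snd: "((\<lambda>y. ev f (x, y)) has_field_derivative ev (dy f) (x, y)) (at y)"
  using DERIV_ev[of "\<lambda>y. x" 0 y "\<lambda>y. y" 1 f] by simp

lemma ev_dx_unique: "((\<lambda>x. ev f (x, y)) has_field_derivative D) (at x) \<Longrightarrow> ev (dx f) (x, y) = D"
  by (rule DERIV_unique[OF DERIV_ev_fst])

lemma ev_dy_unique: "((\<lambda>y. ev f (x, y)) has_field_derivative D) (at y) \<Longrightarrow> ev (dy f) (x, y) = D"
  by (rule DERIV_unique[OF DERIV_ev_snd])

text \<open>Evaluation is injective and the analytic derivative is unique, so the algebraic rules
  are read off from the differentiation rules for complex functions.\<close>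

lemma dx_add: "dx (f + g) = dx f + dx g" and dx_diff: "dx (f - g) = dx f - dx g"
  and dx_uminus: "dx (- f) = - dx f"
  and dx_mult: "dx (f * g) = dx f * g + f * dx g"
  by (rule ev_ext, rule ev_dx_unique, (auto intro!: derivative_eq_intros DERIV_ev_fst)[])+

lemma dy_add: "dy (f + g) = dy f + dy g" and dy_diff: "dy (f - g) = dy f - dy g"
  and dy_uminus: "dy (- f) = - dy f"
  and dy_mult: "dy (f * g) = dy f * g + f * dy g"
  by (rule ev_ext, rule ev_dy_unique, (auto intro!: derivative_eq_intros DERIV_ev_snd)[])+

lemma dx_basic [simp]: "dx bX = 1" "dx bY = 0" "dx (bconst c) = 0" "dx 1 = 0"
  by (rule ev_ext, rule ev_dx_unique, (auto intro!: derivative_eq_intros)[])+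

lemma dy_basic [simp]: "dy bX = 0" "dy bY = 1" "dy (bconst c) = 0" "dy 1 = 0"
  by (rule ev_ext, rule ev_dy_unique, (auto intro!: derivative_eq_intros)[])+

lemma dx_power: "dx (f ^ n) = of_nat n * f ^ (n - 1) * dx f"
  by (induction n) (auto simp: dx_mult algebra_simps power_eq_if)

lemma dy_power: "dy (f ^ n) = of_nat n * f ^ (n - 1) * dy f"
  by (induction n) (auto simp: dy_mult algebra_simps power_eq_if)

lemma dx_bsubst: "dx (bsubst f g h) = bsubst (dx f) g h * dx g + bsubst (dy f) g h * dx h"
  by (rule ev_ext, rule ev_dx_unique)
    (auto intro!: derivative_eq_intros DERIV_ev DERIV_ev_fst)

lemma dy_bsubst: "dy (bsubst f g h) = bsubst (dx f) g h * dy g + bsubst (dy f) g h * dy h"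
  by (rule ev_ext, rule ev_dy_unique)
    (auto intro!: derivative_eq_intros DERIV_ev DERIV_ev_snd)

lemmas d_simps = dx_add dx_diff dx_uminus dx_mult dy_add dy_diff dy_uminus dy_mult

lemma bconst_of_nat: "bconst (of_nat n) = of_nat n"
  by (simp add: bconst_def of_nat_poly)

subsection \<open>Restriction to the coordinate axes\<close>

text \<open>The letter names the equation of the axis: \<open>rX\<close> restricts to
  \<open>x = 0\<close> and leaves a polynomial in \<open>y\<close>, \<open>rY\<close> restricts to
  \<open>y = 0\<close>.\<close>

definition rX :: "bipoly \<Rightarrow> complex poly" where "rX f = map_poly (\<lambda>p. poly p 0) f"

definition rY :: "bipoly \<Rightarrow> complex poly" where "rY f = poly f 0"

lemma poly_ext: "(\<And>x :: complex. poly p x = poly q x) \<Longrightarrow> p = q"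
  by (metis poly_eq_poly_eq_iff ext)

lemma poly_rX [simp]: "poly (rX f) y = ev f (0, y)"
  unfolding rX_def ev_def by (induction f) (auto simp: map_poly_pCons)

lemma poly_rY [simp]: "poly (rY f) x = ev f (x, 0)"
  by (simp add: rY_def ev_def)

lemma rX_hom [simp]: "rX (f + g) = rX f + rX g" "rX (f - g) = rX f - rX g"
  "rX (f * g) = rX f * rX g" "rX 0 = 0" "rX (f ^ n) = rX f ^ n" "rX (bconst c) = [:c:]"
  "rX 1 = 1" "rX (- f) = - rX f"
  by (rule poly_ext; simp)+

lemma rY_hom [simp]: "rY (f + g) = rY f + rY g" "rY (f - g) = rY f - rY g"
  "rY (f * g) = rY f * rY g" "rY 0 = 0" "rY (f ^ n) = rY f ^ n" "rY (bconst c) = [:c:]"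
  "rY 1 = 1" "rY (- f) = - rY f"
  by (rule poly_ext; simp)+

lemma rX_basic [simp]: "rX bX = 0" "rX bY = [:0, 1:]"
  by (rule poly_ext; simp)+

lemma rY_basic [simp]: "rY bY = 0" "rY bX = [:0, 1:]"
  by (rule poly_ext; simp)+

lemma rX_dy: "rX (dy f) = pderiv (rX f)"
  by (rule poly_ext) (use DERIV_unique[OF DERIV_ev_snd poly_DERIV[of "rX f", simplified]] in simp)

lemma bX_dvd_iff: "bX dvd f \<longleftrightarrow> rX f = 0"
proof
  assume "rX f = 0"
  then have "\<And>j. poly (coeff f j) 0 = 0" by (simp add: rX_def poly_eq_iff coeff_map_poly)
  then have "\<And>j. [:0, 1:] dvd coeff f j" by (simp add: poly_eq_0_iff_dvd)
  then show "bX dvd f" unfolding bX_def by (simp add: const_poly_dvd_iff)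
qed (auto elim!: dvdE)

lemma bY_dvd_iff: "bY dvd f \<longleftrightarrow> rY f = 0"
  unfolding bY_def rY_def using poly_eq_0_iff_dvd[of f 0] by simp

lemma prime_bX: "prime_elem bX"
  by (rule prime_elemI) (auto simp: bX_dvd_iff)

lemma prime_bY: "prime_elem bY"
  by (rule prime_elemI) (auto simp: bY_dvd_iff)

subsection \<open>Common zeros\<close>

text \<open>Without \<open>y\<close> the zero set contains a vertical line; otherwise the
  fundamental theorem of algebra gives a zero over every \<open>x\<close> outside the roots of the
  leading coefficient.\<close>

lemma nonunit_infinite_zeros:
  assumes "f \<noteq> 0" "\<not> (f :: bipoly) dvd 1"
  shows "infinite {z. ev f z = 0}"
proof (cases "degree f = 0")
  case True
  then obtain p where p: "f = [:p:]" by (auto elim: degree_eq_zeroE)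
  have "degree p \<noteq> 0"
  proof
    assume "degree p = 0"
    then obtain c where "p = [:c:]" by (auto elim: degree_eq_zeroE)
    then show False using assms p by (auto simp: bipoly_is_unit_iff bconst_def)
  qed
  then obtain x where "poly p x = 0"
    using fundamental_theorem_of_algebra[of p] constant_degree[of p] by auto
  then have "range (\<lambda>y. (x, y)) \<subseteq> {z. ev f z = 0}" using p by auto
  moreover have "infinite (range (\<lambda>y :: complex. (x, y)))"
    using finite_imageD[of "Pair x" "UNIV :: complex set"]
    by (auto simp: inj_on_def infinite_UNIV_char_0)
  ultimately show ?thesis using finite_subset by blast
next
  case False
  let ?X = "- {x. poly (lead_coeff f) x = 0}"
  have inf: "infinite ?X"
    using assms(1) by (intro infinite_complex_Compl poly_roots_finite) simp
  have "\<exists>y. ev f (x, y) = 0" if "x \<in> ?X" for x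
  proof -
    define q where "q = map_poly (\<lambda>p. poly p x) f"
    have q: "poly q y = ev f (x, y)" for y
      unfolding q_def ev_def by (induction f) (auto simp: map_poly_pCons)
    have "coeff q (degree f) \<noteq> 0" using that by (simp add: q_def coeff_map_poly)
    then have "degree q \<noteq> 0" using False le_degree[of q "degree f"] by linarith
    then show ?thesis
      using fundamental_theorem_of_algebra[of q] constant_degree[of q] q by auto
  qed
  then have "?X \<subseteq> fst ` {z. ev f z = 0}" by force
  then show ?thesis using inf finite_surj by blast
qed

text \<open>Euclid's algorithm over the rational functions in \<open>x\<close>, with pseudo-division
  so that everything stays polynomial: an element of least \<open>y\<close>-degree in the ideal of
  \<open>\<phi>\<close> and \<open>f\<close> must be free of \<open>y\<close>.\<close>

lemma prime_combination:
  assumes phi: "prime_elem (\<phi> :: bipoly)" and deg: "degree \<phi> > 0" and ndvd: "\<not> \<phi> dvd f"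
  shows "\<exists>U V r. r \<noteq> 0 \<and> U * \<phi> + V * f = [:r:]"
proof -
  define I where "I = {h. h \<noteq> 0 \<and> (\<exists>U V. h = U * \<phi> + V * f)}"
  have "\<phi> \<in> I" unfolding I_def using phi
    by (intro CollectI conjI exI[of _ 1] exI[of _ 0]) auto
  then obtain h where h: "h \<in> I" "\<And>h'. h' \<in> I \<Longrightarrow> degree h \<le> degree h'"
    using ex_has_least_nat[of "\<lambda>h. h \<in> I" \<phi> degree] by auto
  from h(1) obtain U V where hUV: "h = U * \<phi> + V * f" and h0: "h \<noteq> 0" by (auto simp: I_def)
  \<comment> \<open>Minimality of \<open>degree h\<close> kills the pseudo-remainder, at the cost of
    a factor \<open>c\<close> that is a polynomial in \<open>x\<close>.\<close>
  have div: "\<exists>c. c \<noteq> 0 \<and> h dvd smult c g" if g: "\<exists>U V. g = U * \<phi> + V * f" for g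
  proof -
    obtain q r where qr: "pseudo_divmod g h = (q, r)" by (cases "pseudo_divmod g h")
    let ?c = "coeff h (degree h) ^ (Suc (degree g) - degree h)"
    have eq: "smult ?c g = h * q + r" and r: "r = 0 \<or> degree r < degree h"
      using pseudo_divmod[OF h0 qr] by auto
    from g obtain U' V' where g': "g = U' * \<phi> + V' * f" by blast
    have "r = (smult ?c U' - U * q) * \<phi> + (smult ?c V' - V * q) * f"
      using eq hUV g' by (simp add: algebra_simps smult_add_right)
    then have "\<exists>U V. r = U * \<phi> + V * f" by blast
    then have "r = 0" using r h(2)[of r] unfolding I_def by force
    then show ?thesis using eq h0 by (intro exI[of _ ?c]) auto
  qed
  have "degree h = 0"
  proof (rule ccontr)
    assume dh: "degree h \<noteq> 0"
    have "\<exists>U V. \<phi> = U * \<phi> + V * f" by (rule exI[of _ 1], rule exI[of _ 0]) simp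
    then obtain c q where c: "c \<noteq> 0" "smult c \<phi> = h * q" using div by (blast elim: dvdE)
    have "\<phi> dvd h * q" using c(2) by (metis dvd_smult dvd_refl)
    \<comment> \<open>If \<open>\<phi>\<close> divides \<open>h\<close>, it divides a multiple of
      \<open>f\<close> by a polynomial in \<open>x\<close>, which primality excludes; if it divides
      \<open>q\<close>, then \<open>h\<close> divides a polynomial in \<open>x\<close>, which its
      degree excludes.\<close>
    then consider "\<phi> dvd h" | "\<phi> dvd q" using phi by (auto simp: prime_elem_dvd_mult_iff)
    then show False
    proof cases
      case 1
      have "\<exists>U V. f = U * \<phi> + V * f" by (rule exI[of _ 0], rule exI[of _ 1]) simp
      then obtain c' where c': "c' \<noteq> 0" "h dvd smult c' f" using div by blast
      then have "\<phi> dvd [:c':] * f" using 1 by (auto intro: dvd_trans)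
      then have "\<phi> dvd [:c':]" using prime_elem_dvd_multD[OF phi] ndvd by blast
      then show False using c'(1) deg dvd_imp_degree_le[of \<phi> "[:c':]"] by auto
    next
      case 2
      then obtain q' where "q = \<phi> * q'" by (blast elim: dvdE)
      then have "([:c:] - h * q') * \<phi> = 0" using c(2) by (simp add: algebra_simps)
      then have "[:c:] = h * q'" using phi by (simp only: mult_eq_0_iff) auto
      moreover from this have "q' \<noteq> 0" using c(1) by auto
      ultimately have "degree [:c:] = degree h + degree q'" using h0 degree_mult_eq[of h q'] by metis
      then show False using dh by simp
    qed
  qed
  then obtain r where "h = [:r:]" by (auto elim: degree_eq_zeroE)
  then show ?thesis using hUV h0 by (intro exI[of _ U] exI[of _ V] exI[of _ r]) auto
qed

text \<open>A prime free of \<open>y\<close> is linear in \<open>x\<close> up to a unit, and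
  \<open>f\<close> does not vanish identically on that line. Otherwise a combination of
  \<open>\<phi>\<close> and \<open>f\<close> is a nonzero polynomial in \<open>x\<close>: it leaves
  finitely many \<open>x\<close>, and \<open>\<phi>\<close> contains no vertical line.\<close>

lemma prime_finite_common_zeros:
  assumes phi: "prime_elem (\<phi> :: bipoly)" and ndvd: "\<not> \<phi> dvd f"
  shows "finite {z. ev \<phi> z = 0 \<and> ev f z = 0}"
proof (cases "degree \<phi> = 0")
  case True
  then obtain p where p: "\<phi> = [:p:]" by (auto elim: degree_eq_zeroE)
  have pp: "prime_elem p" using phi p by (simp add: prime_elem_const_poly_iff)
  have fin: "finite {y. ev f (x, y) = 0}" if x: "poly p x = 0" for x
  proof -
    obtain q where q: "p = [:- x, 1:] * q" using x unfolding poly_eq_0_iff_dvd by (rule dvdE)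
    then have "q dvd 1"
      using pp irreducibleD[OF prime_elem_imp_irreducible[OF pp] q] by (auto simp: is_unit_poly_iff)
    then have pd: "p dvd [:- x, 1:]" unfolding q by (simp only: mult_unit_dvd_iff dvd_refl)
    define g where "g = map_poly (\<lambda>p. poly p x) f"
    have g: "poly g y = ev f (x, y)" for y
      unfolding g_def ev_def by (induction f) (auto simp: map_poly_pCons)
    have "g \<noteq> 0"
    proof
      assume "g = 0"
      then have "\<And>j. poly (coeff f j) x = 0" by (simp add: g_def poly_eq_iff coeff_map_poly)
      then have "\<And>j. p dvd coeff f j" using pd by (metis dvd_trans poly_eq_0_iff_dvd)
      then show False using ndvd p by (simp add: const_poly_dvd_iff)
    qed
    then show ?thesis using poly_roots_finite[of g] g by simp
  qed
  have "{z. ev \<phi> z = 0 \<and> ev f z = 0} \<subseteq> (SIGMA x:{x. poly p x = 0}. {y. ev f (x, y) = 0})"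
    using p by auto
  moreover have "finite \<dots>" using fin pp by (intro finite_SigmaI poly_roots_finite) auto
  ultimately show ?thesis using finite_subset by blast
next
  case False
  from prime_combination[OF phi _ ndvd] False obtain U V r
    where r: "r \<noteq> 0" "U * \<phi> + V * f = [:r:]" by auto
  have fin: "finite {y. ev \<phi> (x, y) = 0}" for x
  proof -
    define g where "g = map_poly (\<lambda>p. poly p x) \<phi>"
    have g: "poly g y = ev \<phi> (x, y)" for y
      unfolding g_def ev_def by (induction \<phi>) (auto simp: map_poly_pCons)
    have "g \<noteq> 0"
    proof
      assume "g = 0"
      then have "\<And>j. poly (coeff \<phi> j) x = 0" by (simp add: g_def poly_eq_iff coeff_map_poly)
      then have "[:[:- x, 1:]:] dvd \<phi>" by (simp add: const_poly_dvd_iff poly_eq_0_iff_dvd)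
      then obtain k where k: "\<phi> = [:[:- x, 1:]:] * k" by (blast elim: dvdE)
      have "\<not> [:[:- x, 1:]:] dvd (1 :: bipoly)" by (simp add: is_unit_const_poly_iff is_unit_poly_iff)
      then have "k dvd 1" using irreducibleD[OF prime_elem_imp_irreducible[OF phi] k] by auto
      then have "degree k = 0" by (auto simp: is_unit_poly_iff)
      then have "degree \<phi> = 0" using degree_mult_le[of "[:[:- x, 1:]:]" k] k by simp
      then show False using False by simp
    qed
    then show ?thesis using poly_roots_finite[of g] g by simp
  qed
  have "{z. ev \<phi> z = 0 \<and> ev f z = 0} \<subseteq> (SIGMA x:{x. poly r x = 0}. {y. ev \<phi> (x, y) = 0})"
  proof
    fix z assume *: "z \<in> {z. ev \<phi> z = 0 \<and> ev f z = 0}"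
    then have "ev [:r:] z = 0" by (simp flip: r(2))
    then show "z \<in> (SIGMA x:{x. poly r x = 0}. {y. ev \<phi> (x, y) = 0})" using * by (cases z) simp
  qed
  moreover have "finite \<dots>" using fin r by (intro finite_SigmaI poly_roots_finite) auto
  ultimately show ?thesis using finite_subset by blast
qed

lemma prime_infinite_zeros: "prime_elem (\<phi> :: bipoly) \<Longrightarrow> infinite {z. ev \<phi> z = 0}"
  by (rule nonunit_infinite_zeros) auto

text \<open>The Nullstellensatz in the form used below: infinitely many points of an irreducible
  curve detect divisibility.\<close>

lemma prime_dvd_of_infinite:
  assumes "prime_elem (\<phi> :: bipoly)" "infinite Z" "\<And>z. z \<in> Z \<Longrightarrow> ev \<phi> z = 0 \<and> ev f z = 0"
  shows "\<phi> dvd f"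
  using prime_finite_common_zeros[OF assms(1), of f] assms(2,3)
    finite_subset[of Z "{z. ev \<phi> z = 0 \<and> ev f z = 0}"] by blast

lemma coprime_prime_iff:
  "coprime (f :: bipoly) g \<longleftrightarrow> \<not> (f = 0 \<and> g = 0) \<and> (\<nexists>\<phi>. prime_elem \<phi> \<and> \<phi> dvd f \<and> \<phi> dvd g)"
proof
  assume "coprime f g"
  then show "\<not> (f = 0 \<and> g = 0) \<and> (\<nexists>\<phi>. prime_elem \<phi> \<and> \<phi> dvd f \<and> \<phi> dvd g)"
    by (auto simp: prime_elem_def coprime_common_divisor)
next
  assume *: "\<not> (f = 0 \<and> g = 0) \<and> (\<nexists>\<phi>. prime_elem \<phi> \<and> \<phi> dvd f \<and> \<phi> dvd g)"
  show "coprime f g"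
  proof (rule coprimeI, rule ccontr)
    fix c assume c: "c dvd f" "c dvd g" "\<not> c dvd 1"
    then have "c \<noteq> 0" using * by auto
    then obtain \<phi> where "prime_elem \<phi>" "\<phi> dvd c"
      using c(3) prime_divisor_exists[of c] by (auto simp: prime_def)
    then show False using c * by (meson dvd_trans)
  qed
qed

text \<open>A common prime factor contributes its infinite zero set; conversely, each prime factor
  of \<open>f\<close> adds only finitely many common zeros.\<close>

lemma coprime_iff_finite_zeros:
  assumes "f \<noteq> 0"
  shows "coprime (f :: bipoly) g \<longleftrightarrow> finite {z. ev f z = 0 \<and> ev g z = 0}"
proof
  assume "finite {z. ev f z = 0 \<and> ev g z = 0}"
  then have "\<nexists>\<phi>. prime_elem \<phi> \<and> \<phi> dvd f \<and> \<phi> dvd g"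
  proof (intro notI, elim exE conjE)
    fix \<phi> assume fin: "finite {z. ev f z = 0 \<and> ev g z = 0}" and "prime_elem \<phi>" "\<phi> dvd f" "\<phi> dvd g"
    then have "{z. ev \<phi> z = 0} \<subseteq> {z. ev f z = 0 \<and> ev g z = 0}" by (auto elim!: dvdE)
    then show False using fin prime_infinite_zeros[OF \<open>prime_elem \<phi>\<close>] finite_subset by blast
  qed
  then show "coprime f g" using assms by (auto simp: coprime_prime_iff)
next
  assume cop: "coprime f g"
  have "finite {z. ev h z = 0 \<and> ev g z = 0}" if "h dvd f" "h \<noteq> 0" for h
    using that
  proof (induction h rule: prime_divisors_induct)
    case zero
    then show ?case by simp
  next
    case (unit u)
    then show ?case by (auto simp: bipoly_is_unit_iff)
  next
    case (factor p x)
    then have "p dvd f" by (auto intro: dvd_mult_left)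
    then have "\<not> p dvd g" using cop factor(1) by (auto simp: prime_def coprime_prime_iff)
    then have "finite {z. ev p z = 0 \<and> ev g z = 0}"
      using factor(1) by (intro prime_finite_common_zeros) (auto simp: prime_def)
    moreover have "finite {z. ev x z = 0 \<and> ev g z = 0}" using factor by (auto intro: dvd_mult_right)
    ultimately show ?case
      by (rule rev_finite_subset[OF finite_UnI]) auto
  qed
  from this[OF dvd_refl assms] show "finite {z. ev f z = 0 \<and> ev g z = 0}" .
qed

section \<open>Orders at the origin, strict transforms and the tangent cone\<close>

section \<open>Multiplicities and blowups\<close>

definition cf :: "bipoly \<Rightarrow> nat \<Rightarrow> nat \<Rightarrow> complex" where "cf f i j = coeff (coeff f j) i"

text \<open>The order at the origin as a predicate: unlike \<open>mult0\<close> it is meaningful for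
  the zero polynomial, and it is stable under linear combinations.\<close>

definition oge :: "nat \<Rightarrow> bipoly \<Rightarrow> bool" where "oge n f \<longleftrightarrow> (\<forall>i j. i + j < n \<longrightarrow> cf f i j = 0)"

definition pb :: "complex option \<Rightarrow> bipoly \<Rightarrow> bipoly" where "pb d f = bsubst f (bl_x d) (bl_y d)"

definition sw :: "bipoly \<Rightarrow> bipoly" where "sw f = bsubst f bY bX"

lemma cf_ext: "(\<And>i j. cf f i j = cf g i j) \<Longrightarrow> f = g"
  by (simp add: cf_def poly_eq_iff)

lemma cf_simps [simp]: "cf 0 i j = 0" "cf (f + g) i j = cf f i j + cf g i j"
  "cf (f - g) i j = cf f i j - cf g i j" "cf (- f) i j = - cf f i j"
  "cf (bconst c * f) i j = c * cf f i j"
  by (simp_all add: cf_def bconst_def)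

lemma cf_sum: "cf (sum f A) i j = (\<Sum>k\<in>A. cf (f k) i j)"
  by (induction A rule: infinite_finite_induct) auto

lemma cf_monom: "cf (monom (monom c a) b) i j = (if i = a \<and> j = b then c else 0)"
  by (simp add: cf_def)

lemma cf_00: "cf f 0 0 = ev f (0, 0)"
  by (simp add: cf_def ev_def poly_0_coeff_0)

lemma cf_10: "cf f 1 0 = ev (dx f) (0, 0)"
  by (simp add: cf_def ev_def poly_0_coeff_0 dx_def coeff_map_poly coeff_pderiv)

lemma cf_01: "cf f 0 1 = ev (dy f) (0, 0)"
  by (simp add: cf_def ev_def poly_0_coeff_0 dy_def coeff_pderiv)

lemma cf_hpart: "cf (hpart n f) i j = (if i + j = n then cf f i j else 0)"
proof -
  have "cf (hpart n f) i j = (\<Sum>k\<le>n. if i = k \<and> j = n - k then cf f k (n - k) else 0)"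
    unfolding hpart_def cf_sum by (intro sum.cong refl) (simp add: cf_monom cf_def)
  also have "\<dots> = (\<Sum>k\<in>{..n}. if k = i then (if j = n - i then cf f i (n - i) else 0) else 0)"
    by (intro sum.cong) auto
  also have "\<dots> = (if i + j = n then cf f i j else 0)"
    by (subst sum.delta) auto
  finally show ?thesis .
qed

lemma hpart_eq_0_iff: "hpart n f = 0 \<longleftrightarrow> (\<forall>i j. i + j = n \<longrightarrow> cf f i j = 0)"
proof
  assume "\<forall>i j. i + j = n \<longrightarrow> cf f i j = 0"
  then show "hpart n f = 0" by (intro cf_ext) (simp add: cf_hpart)
next
  assume "hpart n f = 0"
  then have "cf (hpart n f) i j = 0" for i j by simp
  then show "\<forall>i j. i + j = n \<longrightarrow> cf f i j = 0" unfolding cf_hpart by metis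
qed

lemma oge_hpart: "oge n f \<longleftrightarrow> (\<forall>k<n. hpart k f = 0)"
  by (auto simp: oge_def hpart_eq_0_iff)

lemma oge_0 [simp]: "oge n 0" and oge_zero [simp]: "oge 0 f"
  by (simp_all add: oge_def)

lemma hpart_nonzero: assumes "f \<noteq> 0" shows "\<exists>n. hpart n f \<noteq> 0"
proof (rule ccontr)
  assume "\<nexists>n. hpart n f \<noteq> 0"
  then have "f = 0" by (intro cf_ext) (auto simp: hpart_eq_0_iff)
  then show False using assms by simp
qed

lemma oge_mult0: assumes "f \<noteq> 0" shows "oge n f \<longleftrightarrow> n \<le> mult0 f"
proof -
  have "hpart (mult0 f) f \<noteq> 0"
    unfolding mult0_def using hpart_nonzero[OF assms] by (rule LeastI_ex)
  moreover have "k < mult0 f \<Longrightarrow> hpart k f = 0" for k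
    unfolding mult0_def using not_less_Least by blast
  ultimately show ?thesis unfolding oge_hpart by (meson less_le_trans not_le)
qed

lemma mult0_eq_0_iff: "f \<noteq> 0 \<Longrightarrow> mult0 f = 0 \<longleftrightarrow> ev f (0, 0) \<noteq> 0"
  using oge_mult0[of f 1] by (auto simp: oge_def cf_00)

lemma monom_expansion:
  "f = (\<Sum>j\<le>degree f. \<Sum>i\<le>degree (coeff f j). monom (monom (cf f i j) i) j)"
  by (rule ev_ext) (simp add: ev_sum ev_altdef2[of f] cf_def)

lemma sum_cf_pick:
  "(\<Sum>j\<le>degree f. \<Sum>i\<le>degree (coeff f j). if i = a \<and> j = b then cf f i j else 0) = cf f a b"
proof -
  have "cf f a b = cf (\<Sum>j\<le>degree f. \<Sum>i\<le>degree (coeff f j). monom (monom (cf f i j) i) j) a b"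
    using monom_expansion[of f] by simp
  also have "\<dots> = (\<Sum>j\<le>degree f. \<Sum>i\<le>degree (coeff f j). if i = a \<and> j = b then cf f i j else 0)"
    unfolding cf_sum cf_monom by (intro sum.cong refl) auto
  finally show ?thesis by simp
qed

lemma cf_sw: "cf (sw f) a b = cf f b a"
proof -
  have "sw f = (\<Sum>j\<le>degree f. \<Sum>i\<le>degree (coeff f j). monom (monom (cf f i j) j) i)"
    by (rule ev_ext) (simp add: ev_sum ev_altdef2[of f] sw_def cf_def algebra_simps)
  then have "cf (sw f) a b =
      (\<Sum>j\<le>degree f. \<Sum>i\<le>degree (coeff f j). if i = b \<and> j = a then cf f i j else 0)"
    unfolding cf_sum cf_monom by (simp add: cf_sum cf_monom conj_commute eq_commute)
  then show ?thesis by (simp add: sum_cf_pick)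
qed

lemma sw_simps [simp]: "ev (sw f) (x, y) = ev f (y, x)" "sw (sw f) = f" "sw (f * g) = sw f * sw g"
  "sw (f ^ n) = sw f ^ n" "sw bX = bY" "sw bY = bX" "sw (f + g) = sw f + sw g"
  by (simp add: sw_def, (rule ev_ext; simp add: sw_def)+)

lemma oge_sw [simp]: "oge n (sw f) = oge n f"
  unfolding oge_def cf_sw by (metis add.commute)

lemma cf_pb0: "cf (pb (Some 0) f) a b = (if b \<le> a then cf f (a - b) b else 0)"
proof -
  have "pb (Some 0) f =
      (\<Sum>j\<le>degree f. \<Sum>i\<le>degree (coeff f j). monom (monom (cf f i j) (i + j)) j)"
    by (rule ev_ext)
      (simp add: ev_sum ev_altdef2[of f] pb_def cf_def power_mult_distrib power_add mult_ac)
  then have "cf (pb (Some 0) f) a b =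
      (\<Sum>j\<le>degree f. \<Sum>i\<le>degree (coeff f j). if a = i + j \<and> b = j then cf f i j else 0)"
    by (simp add: cf_sum cf_monom)
  also have "\<dots> = (if b \<le> a then (\<Sum>j\<le>degree f. \<Sum>i\<le>degree (coeff f j).
      if i = a - b \<and> j = b then cf f i j else 0) else 0)"
    by (auto intro!: sum.cong sum.neutral)
  also have "\<dots> = (if b \<le> a then cf f (a - b) b else 0)"
    by (simp only: sum_cf_pick)
  finally show ?thesis .
qed

lemma pb_simps [simp]: "pb d 0 = 0" "pb d 1 = 1" "pb d (f + g) = pb d f + pb d g"
  "pb d (f - g) = pb d f - pb d g" "pb d (f * g) = pb d f * pb d g" "pb d (f ^ n) = pb d f ^ n"
  "pb d (bconst c) = bconst c" "pb d (- f) = - pb d f"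
  by (simp_all add: pb_def bsubst_simps)

lemma ev_pb: "ev (pb (Some t) f) (x, y) = ev f (x, x * (y + t))" "ev (pb None f) (x, y) = ev f (x * y, y)"
  by (simp_all add: pb_def)

lemma ev_pb_origin [simp]: "ev (pb d f) (0, 0) = ev f (0, 0)"
  by (cases d) (simp_all add: ev_pb)

lemma pb_Some: "pb (Some t) f = bsubst (pb (Some 0) f) bX (bY + bconst t)"
  by (rule ev_ext) (simp add: ev_pb)

lemma pb_None: "pb None f = sw (pb (Some 0) (sw f))"
  by (rule ev_ext) (simp add: ev_pb mult.commute)

lemma bX_power_dvd_iff: "bX ^ n dvd f \<longleftrightarrow> (\<forall>i<n. \<forall>j. cf f i j = 0)"
proof -
  have "bX ^ n = [:monom 1 n:]" by (rule ev_ext) (simp add: poly_monom)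
  then show ?thesis by (auto simp: const_poly_dvd_iff monom_1_dvd_iff' cf_def)
qed

text \<open>In the direction \<open>Some 0\<close> the monomial with exponents (i, j) goes to the
  one with (i + j, j), so nothing cancels and the power of \<open>bX\<close> is the least
  \<open>i + j\<close>. Another finite direction differs by a translation of \<open>y\<close>, and
  \<open>None\<close> by an exchange of the coordinates.\<close>

lemma exc_power_dvd_pb: "exc_eq d ^ n dvd pb d f \<longleftrightarrow> oge n f"
proof -
  have 0: "bX ^ n dvd pb (Some 0) f \<longleftrightarrow> oge n f" for f
  proof -
    have "bX ^ n dvd pb (Some 0) f \<longleftrightarrow> (\<forall>i<n. \<forall>j\<le>i. cf f (i - j) j = 0)"
      unfolding bX_power_dvd_iff cf_pb0 by auto
    also have "\<dots> \<longleftrightarrow> oge n f" unfolding oge_def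
    proof (intro iffI allI impI)
      fix i j assume *: "\<forall>i<n. \<forall>j\<le>i. cf f (i - j) j = 0" "i + j < n"
      then show "cf f i j = 0" using *(1)[rule_format, of "i + j" j] by simp
    next
      fix i j assume *: "\<forall>i j. i + j < n \<longrightarrow> cf f i j = 0" "i < n" "j \<le> i"
      then show "cf f (i - j) j = 0" by simp
    qed
    finally show ?thesis .
  qed
  show ?thesis
  proof (cases d)
    case None
    have "bY ^ n dvd pb None f \<longleftrightarrow> bX ^ n dvd pb (Some 0) (sw f)"
    proof
      assume "bY ^ n dvd pb None f"
      then obtain q where "pb None f = bY ^ n * q" by (blast elim: dvdE)
      then have "sw (pb None f) = bX ^ n * sw q" by simp
      then show "bX ^ n dvd pb (Some 0) (sw f)" by (simp add: pb_None)
    next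
      assume "bX ^ n dvd pb (Some 0) (sw f)"
      then obtain q where "pb (Some 0) (sw f) = bX ^ n * q" by (blast elim: dvdE)
      then show "bY ^ n dvd pb None f" by (simp add: pb_None)
    qed
    then show ?thesis using None 0[of "sw f"] by simp
  next
    case (Some t)
    have "bX ^ n dvd pb (Some t) f \<longleftrightarrow> bX ^ n dvd pb (Some 0) f"
    proof
      assume "bX ^ n dvd pb (Some t) f"
      then obtain q where q: "pb (Some t) f = bX ^ n * q" by (blast elim: dvdE)
      have "pb (Some 0) f = bsubst (pb (Some t) f) bX (bY - bconst t)"
        by (rule ev_ext) (simp add: ev_pb)
      also have "\<dots> = bX ^ n * bsubst q bX (bY - bconst t)"
        by (simp add: q bsubst_simps)
      finally show "bX ^ n dvd pb (Some 0) f" by simp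
    next
      assume "bX ^ n dvd pb (Some 0) f"
      then obtain q where "pb (Some 0) f = bX ^ n * q" by (blast elim: dvdE)
      then show "bX ^ n dvd pb (Some t) f" by (simp add: pb_Some[of t] bsubst_simps)
    qed
    then show ?thesis using Some 0 by simp
  qed
qed

lemma prime_exc: "prime_elem (exc_eq d)"
  by (cases d) (simp_all add: prime_bX prime_bY)

lemma exc_ne_0 [simp]: "exc_eq d \<noteq> 0"
  by (cases d) simp_all

lemma ev_exc_origin [simp]: "ev (exc_eq d) (0, 0) = 0"
  by (cases d) simp_all

lemma pb_eq_0_iff [simp]: "pb d f = 0 \<longleftrightarrow> f = 0"
proof
  assume 0: "pb d f = 0"
  show "f = 0"
  proof (rule ev_ext_torus)
    fix x y :: complex assume xy: "x \<noteq> 0" "y \<noteq> 0"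
    show "ev f (x, y) = ev 0 (x, y)"
    proof (cases d)
      case None
      then show ?thesis using arg_cong[OF 0, of "\<lambda>f. ev f (x / y, y)"] xy by (simp add: ev_pb)
    next
      case (Some t)
      then show ?thesis using arg_cong[OF 0, of "\<lambda>f. ev f (x, y / x - t)"] xy by (simp add: ev_pb)
    qed
  qed
qed simp

lemma prime_power_dvd_cancel:
  fixes p :: "'a :: idom"
  assumes "prime_elem p" "\<not> p dvd b" "p ^ n dvd a * b"
  shows "p ^ n dvd a"
  using assms(3)
proof (induction n arbitrary: a)
  case (Suc n)
  then have "p dvd a * b" by (metis dvd_mult_left power_Suc)
  then have "p dvd a" using assms(1,2) by (auto simp: prime_elem_dvd_mult_iff)
  then obtain a' where a': "a = p * a'" by (blast elim: dvdE)
  have "p * p ^ n dvd p * (a' * b)" using Suc.prems a' by (simp add: mult_ac)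
  moreover have "p \<noteq> 0" using assms(1) by auto
  ultimately have "p ^ n dvd a' * b" by (simp only: dvd_mult_cancel_left) simp
  then have "p ^ n dvd a'" by (rule Suc.IH)
  then show ?case by (simp add: a')
qed simp

lemma strict_curve:
  assumes "f \<noteq> 0"
  shows pb_eq_strict: "pb d f = exc_eq d ^ mult0 f * strict_curve d f"
    and exc_not_dvd_strict: "\<not> exc_eq d dvd strict_curve d f"
    and strict_ne_0: "strict_curve d f \<noteq> 0"
proof -
  have "(GREATEST k. exc_eq d ^ k dvd pb d f) = mult0 f"
    by (rule Greatest_equality) (simp_all add: exc_power_dvd_pb oge_mult0[OF assms])
  then have s: "strict_curve d f = pb d f div exc_eq d ^ mult0 f"
    by (simp add: strict_curve_def pb_def Let_def)
  have dvd: "exc_eq d ^ mult0 f dvd pb d f"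
    by (simp add: exc_power_dvd_pb oge_mult0[OF assms])
  then show eq: "pb d f = exc_eq d ^ mult0 f * strict_curve d f" by (simp add: s)
  show "\<not> exc_eq d dvd strict_curve d f"
  proof
    assume "exc_eq d dvd strict_curve d f"
    then have "exc_eq d ^ Suc (mult0 f) dvd pb d f"
      by (subst eq) (simp add: mult_dvd_mono mult.commute)
    then show False by (simp only: exc_power_dvd_pb oge_mult0[OF assms])
  qed
  then show "strict_curve d f \<noteq> 0" by auto
qed

text \<open>Strict transforms are computed through this characterization: exhibiting a factorization
  avoids the \<open>GREATEST\<close> and the division in the definition.\<close>

lemma strict_unique:
  assumes "f \<noteq> 0" "pb d f = exc_eq d ^ k * g" "\<not> exc_eq d dvd g"
  shows "mult0 f = k" "strict_curve d f = g"
proof -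
  note s = strict_curve[OF assms(1), of d]
  have "k \<le> mult0 f" using assms(2) by (simp flip: oge_mult0[OF assms(1)] exc_power_dvd_pb[of d])
  moreover have "mult0 f \<le> k"
  proof (rule ccontr)
    assume "\<not> mult0 f \<le> k"
    then have "exc_eq d ^ Suc k dvd pb d f" by (simp only: exc_power_dvd_pb oge_mult0[OF assms(1)])
    then have "exc_eq d * exc_eq d ^ k dvd g * exc_eq d ^ k" by (simp add: assms(2) mult.commute)
    then show False using assms(3) by (simp add: dvd_mult_cancel_right)
  qed
  ultimately show k: "mult0 f = k" by simp
  show "strict_curve d f = g" using s(1) assms(2) k by simp
qed

lemma
  assumes "f \<noteq> 0" "g \<noteq> 0"
  shows mult0_mult: "mult0 (f * g) = mult0 f + mult0 g"
    and strict_mult: "strict_curve d (f * g) = strict_curve d f * strict_curve d g"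
proof -
  have *: "pb d (f * g) = exc_eq d ^ (mult0 f + mult0 g) * (strict_curve d f * strict_curve d g)"
    "\<not> exc_eq d dvd strict_curve d f * strict_curve d g" for d
    using strict_curve[OF assms(1), of d] strict_curve[OF assms(2), of d] prime_exc[of d]
    by (simp_all add: power_add prime_elem_dvd_mult_iff)
  show "mult0 (f * g) = mult0 f + mult0 g" "strict_curve d (f * g) = strict_curve d f * strict_curve d g"
    using strict_unique[OF _ *] assms by auto
qed

lemma strict_unit: assumes "ev f (0, 0) \<noteq> 0" shows "ev (strict_curve d f) (0, 0) \<noteq> 0"
proof -
  have f: "f \<noteq> 0" using assms by auto
  then have "mult0 f = 0" using assms by (simp add: mult0_eq_0_iff)
  then have "strict_curve d f = pb d f" using pb_eq_strict[OF f, of d] by simp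
  then show ?thesis using assms by simp
qed

lemma strict_Some:
  assumes "f \<noteq> 0"
  shows "strict_curve (Some t) f = bsubst (strict_curve (Some 0) f) bX (bY + bconst t)"
proof -
  have "bX ^ mult0 f * strict_curve (Some t) f =
      bX ^ mult0 f * bsubst (strict_curve (Some 0) f) bX (bY + bconst t)"
    using strict_curve(1)[OF assms, of "Some t"] strict_curve(1)[OF assms, of "Some 0"] pb_Some[of t f]
    by (simp add: bsubst_simps)
  then show ?thesis by simp
qed

text \<open>The restriction of the strict transform to the exceptional curve: in homogeneous terms,
  the lowest homogeneous part of \<open>f\<close>.\<close>

definition lead :: "bipoly \<Rightarrow> complex poly" where "lead f = rX (strict_curve (Some 0) f)"

lemma lead_ne_0: "f \<noteq> 0 \<Longrightarrow> lead f \<noteq> 0"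
  unfolding lead_def using exc_not_dvd_strict[of f "Some 0"] by (simp add: bX_dvd_iff)

lemma poly_rX_strict_Some:
  "f \<noteq> 0 \<Longrightarrow> poly (rX (strict_curve (Some t) f)) y = poly (lead f) (y + t)"
  by (simp add: strict_Some[of f t] lead_def)

lemma poly_cofinite_ext:
  assumes "finite (F :: complex set)" "\<And>x. x \<notin> F \<Longrightarrow> poly p x = poly q x"
  shows "p = q"
proof (rule ccontr)
  assume "p \<noteq> q"
  then have "finite {x. poly (p - q) x = 0}" by (intro poly_roots_finite) simp
  moreover have "- F \<subseteq> {x. poly (p - q) x = 0}" using assms(2) by auto
  ultimately show False using infinite_complex_Compl[OF assms(1)] finite_subset by blast
qed

text \<open>In the overlap of the two charts of the blowup the exceptional equations have quotient
  \<open>x\<close>, so the two strict transforms differ by its \<open>mult0 f\<close>-th power; the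
  same point of the exceptional curve has coordinates \<open>x\<close> and
  \<open>1 / x\<close>.\<close>

lemma poly_rY_strict_None:
  assumes "f \<noteq> 0" "x \<noteq> 0"
  shows "poly (rY (strict_curve None f)) x = x ^ mult0 f * poly (lead f) (1 / x)"
proof -
  let ?p = "poly (strict_curve None f)" and ?m = "mult0 f"
  define p where "p = map_poly (\<lambda>p. poly p x) (strict_curve None f)"
  define q where "q = [:x ^ ?m:] * pcompose (map_poly (\<lambda>p. poly p (1 / x)) (sw (strict_curve (Some 0) f))) [:0, x:]"
  have evp: "poly (map_poly (\<lambda>p. poly p a) g) b = ev g (a, b)" for a b g
    unfolding ev_def by (induction g) (auto simp: map_poly_pCons)
  have pv: "poly p y = ev (strict_curve None f) (x, y)" for y by (simp add: p_def evp)
  have qv: "poly q y = x ^ ?m * ev (strict_curve (Some 0) f) (x * y, 1 / x)" for y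
    by (simp add: q_def poly_pcompose evp mult.commute)
  \<comment> \<open>For fixed \<open>x\<close> both are polynomials in \<open>y\<close> that agree
    for nonzero \<open>y\<close>; the wanted value is the one at \<open>y = 0\<close>, on the
    exceptional curve.\<close>
  have "p = q"
  proof (rule poly_cofinite_ext[of "{0}"])
    fix y :: complex assume "y \<notin> {0}"
    then have y: "y \<noteq> 0" by simp
    have "y ^ ?m * poly p y = ev (pb None f) (x, y)"
      using strict_curve(1)[OF assms(1), of None] by (simp add: pv)
    also have "\<dots> = ev (pb (Some 0) f) (x * y, 1 / x)" using assms(2) by (simp add: ev_pb)
    also have "\<dots> = (x * y) ^ ?m * ev (strict_curve (Some 0) f) (x * y, 1 / x)"
      using strict_curve(1)[OF assms(1), of "Some 0"] by simp
    finally show "poly p y = poly q y" using y by (simp add: qv power_mult_distrib)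
  qed simp
  then have "poly p 0 = poly q 0" by simp
  then show ?thesis unfolding pv qv by (simp add: lead_def)
qed

text \<open>\<open>p\<close> and \<open>q\<close> are the affine equations of a section of degree
  \<open>n\<close> on the projective line: its zeros are the \<open>degree q\<close> roots of
  \<open>q\<close> and the zero of \<open>p\<close> at the point \<open>0\<close>, which the other
  chart misses. Since \<open>n\<close> may be negative, the degree bound also serves as a vanishing
  criterion.\<close>

lemma poly_reversal:
  assumes "q \<noteq> 0" and eq: "\<And>s. s \<noteq> 0 \<Longrightarrow> poly p s = s powi n * poly q (1 / s)"
  shows "(p :: complex poly) \<noteq> 0" "int (degree q) \<le> n" "int (order 0 p) = n - int (degree q)"
proof -
  let ?r = "reflect_poly q"
  have r: "poly ?r s = s ^ degree q * poly q (1 / s)" if "s \<noteq> 0" for s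
    using poly_reflect_poly_nz[OF that, of q] by (simp add: field_simps)
  have r0: "poly ?r 0 \<noteq> 0" using assms(1) by simp
  have eq': "poly p s = s powi (n - int (degree q)) * poly ?r s" if "s \<noteq> 0" for s
    using eq[OF that] r[OF that] that by (simp add: power_int_diff)
  show le: "int (degree q) \<le> n"
  proof (rule ccontr)
    assume "\<not> int (degree q) \<le> n"
    then obtain k where k: "int (degree q) - n = int k" "k > 0"
      by (metis diff_gt_0_iff_gt not_le of_nat_0_less_iff zero_less_imp_eq_int)
    have "monom 1 k * p = ?r"
    proof (rule poly_cofinite_ext[of "{0}"])
      fix s :: complex assume "s \<notin> {0}"
      moreover have "n - int (degree q) = - int k" using k by simp
      ultimately show "poly (monom 1 k * p) s = poly ?r s"
        using eq'[of s] by (simp add: poly_monom power_int_minus)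
    qed simp
    then have "poly ?r 0 = 0" using k(2) by (metis poly_monom poly_mult power_0_left mult_zero_left mult_zero_right neq0_conv)
    then show False using r0 by simp
  qed
  define k where "k = nat (n - int (degree q))"
  have p: "p = [:- 0, 1:] ^ k * ?r"
  proof (rule poly_cofinite_ext[of "{0}"])
    fix s :: complex assume "s \<notin> {0}"
    moreover have "n - int (degree q) = int k" using le by (simp add: k_def)
    ultimately show "poly p s = poly ([:- 0, 1:] ^ k * ?r) s"
      using eq'[of s] by simp
  qed simp
  show p0: "p \<noteq> 0" unfolding p using assms(1) by simp
  have "order 0 p = order 0 ([:- 0, 1 :: complex:] ^ k) + order 0 ?r"
    using p p0 by (metis order_mult)
  also have "order 0 ?r = 0" using r0 by (rule order_0I)
  finally show "int (order 0 p) = n - int (degree q)"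
    using le by (simp only: order_power_n_n k_def)
qed

lemma sum_order: assumes "(p :: complex poly) \<noteq> 0" shows "(\<Sum>x\<in>{x. poly p x = 0}. order x p) = degree p"
proof -
  have "degree p = degree (smult (lead_coeff p) (\<Prod>z | poly p z = 0. [:- z, 1:] ^ order z p))"
    by (simp only: complex_poly_decompose)
  also have "\<dots> = (\<Sum>z | poly p z = 0. order z p)"
    using assms by (simp add: degree_prod_eq_sum_degree degree_linear_power)
  finally show ?thesis by simp
qed

lemma order_shift:
  assumes "p \<noteq> 0" "\<And>y. poly q y = poly p (y + t)"
  shows "order 0 q = order (t :: complex) p" "q \<noteq> 0"
proof -
  from order_decomp[OF assms(1), of t] obtain r where
    r: "p = [:- t, 1:] ^ order t p * r" "\<not> [:- t, 1:] dvd r" by blast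
  have q: "q = [:- 0, 1:] ^ order t p * pcompose r [:t, 1:]"
  proof (rule poly_ext)
    fix y
    have "poly q y = poly ([:- t, 1:] ^ order t p * r) (y + t)" using assms(2) r(1) by simp
    then show "poly q y = poly ([:- 0, 1:] ^ order t p * pcompose r [:t, 1:]) y"
      by (simp add: poly_pcompose add.commute)
  qed
  have r0: "poly (pcompose r [:t, 1:]) 0 \<noteq> 0" using r(2) by (simp add: poly_pcompose poly_eq_0_iff_dvd)
  then show q0: "q \<noteq> 0" unfolding q by auto
  have "order 0 q = order 0 ([:- 0, 1 :: complex:] ^ order t p) + order 0 (pcompose r [:t, 1:])"
    using q q0 by (metis order_mult)
  then show "order 0 q = order t p" using order_0I[OF r0] by (simp only: order_power_n_n)
qed

text \<open>The tangent directions, as the points where the strict transform meets the exceptional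
  curve; by \<open>strict_unit\<close> there are none if \<open>f\<close> does not vanish at the
  origin.\<close>

definition dirs :: "bipoly \<Rightarrow> complex option set" where
  "dirs f = {d. ev (strict_curve d f) (0, 0) = 0}"

lemma dirs_subset:
  assumes "f \<noteq> 0" shows "dirs f \<subseteq> insert None (Some ` {t. poly (lead f) t = 0})"
proof
  fix d assume d: "d \<in> dirs f"
  show "d \<in> insert None (Some ` {t. poly (lead f) t = 0})"
  proof (cases d)
    case (Some t)
    then show ?thesis
      using d poly_rX_strict_Some[OF assms, of t 0] by (auto simp: dirs_def)
  qed simp
qed

lemma finite_dirs: "f \<noteq> 0 \<Longrightarrow> finite (dirs f)"
  by (rule finite_subset[OF dirs_subset]) (simp_all add: poly_roots_finite lead_ne_0)

section \<open>Local intersection numbers by Noether's formula and their invariance\<close>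

section \<open>Noether intersection numbers\<close>

text \<open>The intersection number at the origin is defined by Noether's formula, as a sum over the common
  infinitely near points, which are given by lists of directions.\<close>

primrec st :: "complex option list \<Rightarrow> bipoly \<Rightarrow> bipoly" where
  "st [] f = f"
| "st (d # ds) f = st ds (strict_curve d f)"

definition supp :: "bipoly \<Rightarrow> bipoly \<Rightarrow> complex option list set" where
  "supp f g = {ds. ev (st ds f) (0, 0) = 0 \<and> ev (st ds g) (0, 0) = 0}"

text \<open>Expresses that there is no common component through the origin. A sum over an infinite
  set is \<open>0\<close>, so \<open>NN\<close> has its meaning only under this condition.\<close>

definition fin :: "bipoly \<Rightarrow> bipoly \<Rightarrow> bool" where "fin f g \<longleftrightarrow> finite (supp f g)"

definition NN :: "bipoly \<Rightarrow> bipoly \<Rightarrow> nat" where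
  "NN f g = (\<Sum>ds\<in>supp f g. mult0 (st ds f) * mult0 (st ds g))"

lemma st_ne_0: "f \<noteq> 0 \<Longrightarrow> st ds f \<noteq> 0"
  by (induction ds arbitrary: f) (simp_all add: strict_ne_0)

lemma st_mult: "f \<noteq> 0 \<Longrightarrow> g \<noteq> 0 \<Longrightarrow> st ds (f * g) = st ds f * st ds g"
  by (induction ds arbitrary: f g) (simp_all add: strict_ne_0 strict_mult)

lemma st_unit: "ev f (0, 0) \<noteq> 0 \<Longrightarrow> ev (st ds f) (0, 0) \<noteq> 0"
  by (induction ds arbitrary: f) (simp_all add: strict_unit)

lemma supp_sym: "supp f g = supp g f"
  by (auto simp: supp_def)

lemma fin_sym: "fin f g = fin g f"
  by (simp add: fin_def supp_sym)

lemma NN_sym: "NN f g = NN g f"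
  by (simp add: NN_def supp_sym mult.commute)

lemma supp_unit:
  assumes "ev f (0, 0) \<noteq> 0 \<or> ev g (0, 0) \<noteq> 0"
  shows "supp f g = {}" "fin f g" "NN f g = 0"
proof -
  show "supp f g = {}" using assms by (auto simp: supp_def dest: st_unit)
  then show "fin f g" "NN f g = 0" by (simp_all add: fin_def NN_def)
qed

lemma supp_rec:
  assumes "ev f (0, 0) = 0" "ev g (0, 0) = 0" "dirs f \<inter> dirs g \<subseteq> D"
  shows "supp f g = insert [] (\<Union>d\<in>D. (#) d ` supp (strict_curve d f) (strict_curve d g))"
proof (rule set_eqI)
  fix ds
  show "ds \<in> supp f g \<longleftrightarrow> ds \<in> insert [] (\<Union>d\<in>D. (#) d ` supp (strict_curve d f) (strict_curve d g))"
  proof (cases ds)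
    case Nil
    then show ?thesis using assms by (simp add: supp_def)
  next
    case (Cons d ds')
    have "d \<in> D" if "ds' \<in> supp (strict_curve d f) (strict_curve d g)"
      using that assms(3) supp_unit(1)[of "strict_curve d f" "strict_curve d g"]
      by (auto simp: dirs_def)
    then show ?thesis using Cons by (auto simp: supp_def)
  qed
qed

lemma fin_rec:
  assumes "f \<noteq> 0" "g \<noteq> 0"
  shows "fin f g \<longleftrightarrow> (\<forall>d. fin (strict_curve d f) (strict_curve d g))"
proof (cases "ev f (0, 0) = 0 \<and> ev g (0, 0) = 0")
  case True
  have "supp f g = insert [] (\<Union>d\<in>dirs f. (#) d ` supp (strict_curve d f) (strict_curve d g))"
    using True by (intro supp_rec) auto
  then have "fin f g \<longleftrightarrow> (\<forall>d\<in>dirs f. finite ((#) d ` supp (strict_curve d f) (strict_curve d g)))"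
    by (simp add: fin_def finite_dirs[OF assms(1)])
  also have "\<dots> \<longleftrightarrow> (\<forall>d\<in>dirs f. fin (strict_curve d f) (strict_curve d g))"
    by (simp add: fin_def finite_image_iff inj_on_def)
  also have "\<dots> \<longleftrightarrow> (\<forall>d. fin (strict_curve d f) (strict_curve d g))"
    using supp_unit(2) by (auto simp: dirs_def)
  finally show ?thesis .
next
  case False
  then show ?thesis using supp_unit(2) strict_unit by metis
qed

lemma fin_strict: "f \<noteq> 0 \<Longrightarrow> g \<noteq> 0 \<Longrightarrow> fin f g \<Longrightarrow> fin (strict_curve d f) (strict_curve d g)"
  by (simp add: fin_rec)

text \<open>\<open>D\<close> may be any finite set containing the common tangent directions, since
  the other terms are zero; this allows one index set for several sums.\<close>

lemma NN_rec:
  assumes "f \<noteq> 0" "g \<noteq> 0" "fin f g" "finite D" "dirs f \<inter> dirs g \<subseteq> D"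
  shows "NN f g = mult0 f * mult0 g + (\<Sum>d\<in>D. NN (strict_curve d f) (strict_curve d g))"
proof (cases "ev f (0, 0) = 0 \<and> ev g (0, 0) = 0")
  case True
  let ?S = "\<lambda>d. supp (strict_curve d f) (strict_curve d g)"
  let ?h = "\<lambda>ds. mult0 (st ds f) * mult0 (st ds g)"
  have fin: "finite (?S d)" for d using fin_strict[OF assms(1-3)] by (simp add: fin_def)
  have S: "supp f g = insert [] (\<Union>d\<in>D. (#) d ` ?S d)"
    using True assms(5) by (intro supp_rec) auto
  have "NN f g = ?h [] + sum ?h (\<Union>d\<in>D. (#) d ` ?S d)"
    unfolding NN_def S using assms(4) fin by (subst sum.insert) auto
  also have "sum ?h (\<Union>d\<in>D. (#) d ` ?S d) = (\<Sum>d\<in>D. sum ?h ((#) d ` ?S d))"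
    using assms(4) fin by (intro sum.UNION_disjoint) auto
  also have "\<dots> = (\<Sum>d\<in>D. NN (strict_curve d f) (strict_curve d g))"
    unfolding NN_def by (rule sum.cong[OF refl]) (simp add: sum.reindex inj_on_def)
  finally show ?thesis by simp
next
  case False
  then have "NN (strict_curve d f) (strict_curve d g) = 0" for d
    using supp_unit(3) strict_unit by metis
  moreover have "mult0 f * mult0 g = 0"
    using False mult0_eq_0_iff assms by auto
  ultimately show ?thesis using False supp_unit(3) by auto
qed

text \<open>Strict transforms are multiplicative, so the common points with a product are those with
  the factors, and multiplicities add.\<close>

lemma
  assumes "f \<noteq> 0" "g \<noteq> 0" "h \<noteq> 0"
  shows fin_mult: "fin f (g * h) \<longleftrightarrow> fin f g \<and> fin f h"
    and NN_mult: "fin f (g * h) \<Longrightarrow> NN f (g * h) = NN f g + NN f h"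
proof -
  have S: "supp f (g * h) = supp f g \<union> supp f h"
    using assms by (auto simp: supp_def st_mult)
  then show fin: "fin f (g * h) \<longleftrightarrow> fin f g \<and> fin f h" by (simp add: fin_def)
  assume "fin f (g * h)"
  then have fin: "finite (supp f (g * h))" by (simp add: fin_def)
  have z: "mult0 (st ds f) * mult0 (st ds k) = 0" if "ds \<in> supp f (g * h)" "ds \<notin> supp f k" "k \<noteq> 0" for k ds
    using that mult0_eq_0_iff[OF st_ne_0[OF that(3)], of ds] by (auto simp: supp_def)
  have "NN f k = (\<Sum>ds\<in>supp f (g * h). mult0 (st ds f) * mult0 (st ds k))"
    if "k \<noteq> 0" "supp f k \<subseteq> supp f (g * h)" for k
    unfolding NN_def using that z by (intro sum.mono_neutral_left fin) auto
  then have k: "NN f k = (\<Sum>ds\<in>supp f (g * h). mult0 (st ds f) * mult0 (st ds k))"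
    if "k = g \<or> k = h" for k
    using that S assms by blast
  show "NN f (g * h) = NN f g + NN f h"
    unfolding k[of g, simplified] k[of h, simplified] sum.distrib[symmetric] NN_def[of f "g * h"]
    by (intro sum.cong refl) (simp add: st_mult mult0_mult st_ne_0 assms algebra_simps)
qed

lemma fin_power: "f \<noteq> 0 \<Longrightarrow> g \<noteq> 0 \<Longrightarrow> fin f g \<Longrightarrow> fin f (g ^ n)"
  by (induction n) (simp_all add: fin_mult supp_unit)

lemma NN_power: "f \<noteq> 0 \<Longrightarrow> g \<noteq> 0 \<Longrightarrow> fin f g \<Longrightarrow> NN f (g ^ n) = n * NN f g"
  by (induction n) (simp_all add: NN_mult fin_mult fin_power supp_unit)

lemma NN_unit_mult:
  assumes "f \<noteq> 0" "g \<noteq> 0" "ev u (0, 0) \<noteq> 0"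
  shows "fin f (u * g) \<longleftrightarrow> fin f g" "fin f g \<Longrightarrow> NN f (u * g) = NN f g"
proof -
  have u: "u \<noteq> 0" using assms(3) by auto
  show *: "fin f (u * g) \<longleftrightarrow> fin f g" using fin_mult[OF assms(1) u assms(2)] supp_unit(2)[of f u] assms by simp
  show "fin f g \<Longrightarrow> NN f (u * g) = NN f g"
    using NN_mult[OF assms(1) u assms(2)] * supp_unit(3)[of f u] assms by simp
qed

lemma strict_bX: "strict_curve (Some t) bX = 1" "strict_curve None bX = bX" "mult0 bX = 1"
  and strict_bY: "strict_curve (Some t) bY = bY + bconst t" "strict_curve None bY = 1" "mult0 bY = 1"
proof -
  have a: "pb (Some t) bX = exc_eq (Some t) ^ 1 * 1" "\<not> exc_eq (Some t) dvd 1"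
    "pb None bX = exc_eq None ^ 1 * bX" "\<not> exc_eq None dvd bX"
    "pb (Some t) bY = exc_eq (Some t) ^ 1 * (bY + bconst t)" "\<not> exc_eq (Some t) dvd bY + bconst t"
    "pb None bY = exc_eq None ^ 1 * 1" "\<not> exc_eq None dvd 1" for t
    by (simp_all add: pb_def bX_dvd_iff bY_dvd_iff)
  show "strict_curve (Some t) bX = 1" "strict_curve None bX = bX" "mult0 bX = 1"
    "strict_curve (Some t) bY = bY + bconst t" "strict_curve None bY = 1" "mult0 bY = 1"
    using strict_unique[OF _ a(1,2)[of t]] strict_unique[OF _ a(3,4)] strict_unique[OF _ a(5,6)]
      strict_unique[OF _ a(7,8)] by auto
qed

text \<open>Treats both axes at once: \<open>r\<close> restricts to the line \<open>l\<close>, and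
  \<open>d\<close> is its direction. A blowup removes \<open>mult0 f\<close> from the order of the
  restriction and reproduces the same line, so the induction runs on that order.\<close>

lemma axis_induction:
  assumes step: "\<And>f. f \<noteq> 0 \<Longrightarrow> r f \<noteq> 0 \<Longrightarrow> ev f (0, 0) = 0 \<Longrightarrow>
      r f = [:0, 1:] ^ mult0 f * r (strict_curve d f)"
    and r: "\<And>f. poly (r f) 0 = ev f (0, 0)" "r 0 = 0"
    and l: "l \<noteq> 0" "mult0 l = 1" "strict_curve d l = l" "\<And>d'. d' \<noteq> d \<Longrightarrow> ev (strict_curve d' l) (0, 0) \<noteq> 0"
    and f: "r f \<noteq> (0 :: complex poly)"
  shows "fin f l \<and> NN f l = order 0 (r f)"
  using f
proof (induction "order 0 (r f)" arbitrary: f rule: less_induct)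
  case less
  then have f0: "f \<noteq> 0" using r(2) by auto
  show ?case
  proof (cases "ev f (0, 0) = 0")
    case False
    then show ?thesis using supp_unit[of f l] r(1)[of f] order_0I[of "r f" 0] by simp
  next
    case True
    let ?f = "strict_curve d f"
    have eq: "r f = [:- 0, 1:] ^ mult0 f * r ?f" using step[OF f0 less.prems True] by simp
    have r': "r ?f \<noteq> 0" using eq less.prems by auto
    have "order 0 (r f) = order 0 ([:- 0, 1 :: complex:] ^ mult0 f) + order 0 (r ?f)"
      using eq less.prems by (metis order_mult)
    then have o: "order 0 (r f) = mult0 f + order 0 (r ?f)" by (simp only: order_power_n_n)
    have "mult0 f > 0" using True f0 mult0_eq_0_iff by auto
    then have IH: "fin ?f l \<and> NN ?f l = order 0 (r ?f)" using less.hyps[OF _ r'] o by simp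
    have dl: "dirs f \<inter> dirs l \<subseteq> {d}" using l(4) by (auto simp: dirs_def)
    have fin: "fin f l"
      unfolding fin_rec[OF f0 l(1)] using IH l(3) supp_unit(2) l(4) by metis
    show ?thesis using NN_rec[OF f0 l(1) fin _ dl] fin IH l o by simp
  qed
qed

lemma NN_bX: assumes "rX f \<noteq> 0" shows "fin f bX" "NN f bX = order 0 (rX f)"
proof -
  have "fin f bX \<and> NN f bX = order 0 (rX f)"
  proof (rule axis_induction[where d = None])
    fix f :: bipoly assume f: "f \<noteq> 0"
    show "rX f = [:0, 1:] ^ mult0 f * rX (strict_curve None f)"
    proof (rule poly_ext)
      fix y
      have "ev (pb None f) (0, y) = ev f (0, y)" by (simp add: ev_pb)
      then show "poly (rX f) y = poly ([:0, 1:] ^ mult0 f * rX (strict_curve None f)) y"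
        using pb_eq_strict[OF f, of None] by simp
    qed
  next
    show "d' \<noteq> None \<Longrightarrow> ev (strict_curve d' bX) (0, 0) \<noteq> 0" for d' by (cases d') (simp_all add: strict_bX)
  qed (use assms in \<open>simp_all add: strict_bX\<close>)
  then show "fin f bX" "NN f bX = order 0 (rX f)" by auto
qed

lemma NN_bY: assumes "rY f \<noteq> 0" shows "fin f bY" "NN f bY = order 0 (rY f)"
proof -
  have "fin f bY \<and> NN f bY = order 0 (rY f)"
  proof (rule axis_induction[where d = "Some 0"])
    fix f :: bipoly assume f: "f \<noteq> 0"
    show "rY f = [:0, 1:] ^ mult0 f * rY (strict_curve (Some 0) f)"
    proof (rule poly_ext)
      fix y
      have "ev (pb (Some 0) f) (y, 0) = ev f (y, 0)" by (simp add: ev_pb)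
      then show "poly (rY f) y = poly ([:0, 1:] ^ mult0 f * rY (strict_curve (Some 0) f)) y"
        using pb_eq_strict[OF f, of "Some 0"] by simp
    qed
  next
    show "d' \<noteq> Some 0 \<Longrightarrow> ev (strict_curve d' bY) (0, 0) \<noteq> 0" for d' by (cases d') (auto simp: strict_bY)
  qed (use assms in \<open>simp_all add: strict_bY\<close>)
  then show "fin f bY" "NN f bY = order 0 (rY f)" by auto
qed

text \<open>The tangent cone is a form of degree \<open>mult0 f\<close> in two variables and has
  that many zeros on the exceptional line: finite directions are counted by the roots of
  \<open>lead f\<close>, the direction \<open>None\<close> by the drop of its degree.\<close>

lemma
  assumes f: "f \<noteq> 0"
  shows fin_exc: "fin (strict_curve d f) (exc_eq d)"
    and sum_NN_exc: "finite D \<Longrightarrow> dirs f \<subseteq> D \<Longrightarrow> (\<Sum>d\<in>D. NN (strict_curve d f) (exc_eq d)) = mult0 f"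
proof -
  let ?n = "\<lambda>d. NN (strict_curve d f) (exc_eq d)"
  have S: "fin (strict_curve (Some t) f) bX \<and> ?n (Some t) = order t (lead f)" for t
  proof -
    note * = order_shift[OF lead_ne_0[OF f] poly_rX_strict_Some[OF f, of t]]
    show ?thesis using NN_bX[OF *(2)] *(1) by simp
  qed
  have rev: "poly (rY (strict_curve None f)) s = s powi (int (mult0 f)) * poly (lead f) (1 / s)" if "s \<noteq> 0" for s
    using poly_rY_strict_None[OF f that] by simp
  note R = poly_reversal[OF lead_ne_0[OF f] rev, simplified]
  have N: "fin (strict_curve None f) bY \<and> ?n None = order 0 (rY (strict_curve None f))"
    using NN_bY[OF R(1)] by simp
  show "fin (strict_curve d f) (exc_eq d)" using S N by (cases d) auto
  assume D: "finite D" "dirs f \<subseteq> D"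
  let ?D = "insert None (Some ` {t. poly (lead f) t = 0})"
  have finD: "finite ?D" by (simp add: poly_roots_finite lead_ne_0 f)
  have 0: "?n d = 0" if "d \<notin> dirs f" for d
    using that by (intro supp_unit) (auto simp: dirs_def)
  have 00: "?n d = 0" if "d \<notin> ?D" for d
    using that 0 dirs_subset[OF f] by blast
  have "sum ?n D = sum ?n (D \<union> ?D)"
    using D finD 0 by (intro sum.mono_neutral_left) auto
  also have "\<dots> = sum ?n ?D"
    using D(1) finD 00 by (intro sum.mono_neutral_right) blast+
  also have "\<dots> = ?n None + (\<Sum>t | poly (lead f) t = 0. order t (lead f))"
    using S by (subst sum.insert) (auto simp: poly_roots_finite lead_ne_0 f sum.reindex)
  also have "\<dots> = order 0 (rY (strict_curve None f)) + degree (lead f)"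
    using N sum_order[OF lead_ne_0[OF f]] by simp
  finally show "sum ?n D = mult0 f" using R by simp
qed

text \<open>The multiplicity is at most the intersection number with the exceptional curve, which is
  one term of a sum equal to \<open>mult0 f\<close>.\<close>

lemma mult0_strict_le: assumes "f \<noteq> 0" shows "mult0 (strict_curve d f) \<le> mult0 f"
proof -
  have m: "mult0 (exc_eq d) = 1" by (cases d) (simp_all add: strict_bX strict_bY)
  have "mult0 (strict_curve d f) \<le> NN (strict_curve d f) (exc_eq d)"
    using NN_rec[OF strict_ne_0[OF assms] exc_ne_0 fin_exc[OF assms], of "dirs (strict_curve d f)" d]
    by (simp add: m finite_dirs strict_ne_0 assms)
  also have "\<dots> \<le> (\<Sum>d\<in>insert d (dirs f). NN (strict_curve d f) (exc_eq d))"
    by (rule member_le_sum) (simp_all add: finite_dirs assms)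
  also have "\<dots> = mult0 f" using assms by (intro sum_NN_exc) (auto simp: finite_dirs)
  finally show ?thesis .
qed

text \<open>\<open>exc_eq d ^ j * strict_curve d g\<close> is the transform of \<open>g\<close> with virtual multiplicity
  \<open>mult0 g - j\<close>.\<close>

lemma
  assumes f: "f \<noteq> 0" and g: "g \<noteq> 0" and fin: "fin f g"
  shows fin_virtual: "fin (strict_curve d f) (exc_eq d ^ j * strict_curve d g)"
    and NN_virtual: "finite D \<Longrightarrow> dirs f \<subseteq> D \<Longrightarrow>
      (\<Sum>d\<in>D. NN (strict_curve d f) (exc_eq d ^ j * strict_curve d g)) + mult0 f * mult0 g =
        NN f g + j * mult0 f"
proof -
  have nz: "strict_curve d f \<noteq> 0" "strict_curve d g \<noteq> 0" "exc_eq d ^ j \<noteq> 0" for d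
    by (simp_all add: strict_ne_0 f g)
  have fe: "fin (strict_curve d f) (exc_eq d ^ j)" for d
    by (intro fin_power fin_exc nz f) simp
  have fs: "fin (strict_curve d f) (exc_eq d ^ j * strict_curve d g)" for d
    unfolding fin_mult[OF nz(1,3,2)] using fe fin_strict[OF f g fin] by blast
  then show "fin (strict_curve d f) (exc_eq d ^ j * strict_curve d g)" .
  have *: "NN (strict_curve d f) (exc_eq d ^ j * strict_curve d g) =
      j * NN (strict_curve d f) (exc_eq d) + NN (strict_curve d f) (strict_curve d g)" for d
    by (simp add: NN_mult[OF nz(1,3,2) fs] NN_power[OF nz(1) exc_ne_0 fin_exc[OF f]])
  assume D: "finite D" "dirs f \<subseteq> D"
  have "NN f g = mult0 f * mult0 g + (\<Sum>d\<in>D. NN (strict_curve d f) (strict_curve d g))"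
    using D by (intro NN_rec f g fin) auto
  then show "(\<Sum>d\<in>D. NN (strict_curve d f) (exc_eq d ^ j * strict_curve d g)) + mult0 f * mult0 g =
        NN f g + j * mult0 f"
    by (simp add: * sum.distrib flip: sum_distrib_left sum_NN_exc[OF f D])
qed

text \<open>The multiplicities of \<open>g\<close> and \<open>g + h * f\<close> may differ, so both
  are blown up with the common virtual multiplicity \<open>e\<close>: then the transforms again
  differ by a multiple of the strict transform of \<open>f\<close>. As \<open>e\<close> and
  \<open>mult0 f\<close> are positive, the intersection number drops and the induction
  applies.\<close>

lemma NN_cong:
  assumes "f \<noteq> 0" "g \<noteq> 0" "g + h * f \<noteq> 0" "fin f g"
  shows "fin f (g + h * f) \<and> NN f (g + h * f) = NN f g"
  using assms
proof (induction "NN f g" arbitrary: f g h rule: less_induct)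
  case less
  define u where "u = g + h * f"
  note f = less.prems(1) and g = less.prems(2) and fin = less.prems(4)
  have u: "u \<noteq> 0" using less.prems(3) by (simp add: u_def)
  show ?case
  proof (cases "ev f (0, 0) = 0 \<and> ev g (0, 0) = 0")
    case False
    then have "ev f (0, 0) \<noteq> 0 \<or> ev u (0, 0) \<noteq> 0" by (auto simp: u_def)
    then show ?thesis using False supp_unit[of f u] supp_unit[of f g] by (auto simp: u_def)
  next
    case True
    then have u0: "ev u (0, 0) = 0" by (simp add: u_def)
    define e where "e = min (mult0 g) (mult0 u)"
    define G where "G d = exc_eq d ^ (mult0 g - e) * strict_curve d g" for d
    define U where "U d = exc_eq d ^ (mult0 u - e) * strict_curve d u" for d
    have e: "e \<le> mult0 g" "e \<le> mult0 u" "e > 0"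
      using True u0 mult0_eq_0_iff[OF g] mult0_eq_0_iff[OF u] by (auto simp: e_def)
    have m: "mult0 f > 0" using True mult0_eq_0_iff[OF f] by auto
    have pbg: "pb d g = exc_eq d ^ e * G d" for d
      unfolding G_def pb_eq_strict[OF g, of d] mult.assoc[symmetric] power_add[symmetric] using e by simp
    have pbu: "pb d u = exc_eq d ^ e * U d" for d
      unfolding U_def pb_eq_strict[OF u, of d] mult.assoc[symmetric] power_add[symmetric] using e by simp
    have UG: "\<exists>k. U d = G d + k * strict_curve d f" for d
    proof -
      let ?E = "exc_eq d"
      have eq: "?E ^ e * (U d - G d) = pb d h * pb d f"
        using pbg[of d] pbu[of d] by (simp add: u_def algebra_simps)
      \<comment> \<open>The strict transform of \<open>f\<close> is prime to the exceptional
        equation, so the whole power must divide the remaining factor.\<close>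
      have "?E ^ e dvd pb d h * ?E ^ mult0 f"
      proof (rule prime_power_dvd_cancel[OF prime_exc exc_not_dvd_strict[OF f]])
        have "pb d h * ?E ^ mult0 f * strict_curve d f = ?E ^ e * (U d - G d)"
          by (simp only: eq) (simp only: pb_eq_strict[OF f, of d] mult.assoc)
        then show "?E ^ e dvd pb d h * ?E ^ mult0 f * strict_curve d f" by simp
      qed
      then obtain k where "pb d h * ?E ^ mult0 f = ?E ^ e * k" by (blast elim: dvdE)
      then have "?E ^ e * (U d - G d) = ?E ^ e * (k * strict_curve d f)"
        using eq pb_eq_strict[OF f, of d] by (simp add: mult_ac)
      then have "U d - G d = k * strict_curve d f" by simp
      then show ?thesis by (intro exI[of _ k]) (simp add: algebra_simps)
    qed
    let ?D = "dirs f"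
    have D: "finite ?D" "?D \<subseteq> ?D" by (simp_all add: finite_dirs f)
    have finG: "fin (strict_curve d f) (G d)" for d unfolding G_def by (rule fin_virtual[OF f g fin])
    have sG: "(\<Sum>d\<in>?D. NN (strict_curve d f) (G d)) + mult0 f * mult0 g =
        NN f g + (mult0 g - e) * mult0 f"
      unfolding G_def by (rule NN_virtual[OF f g fin D])
    obtain k where k: "mult0 g = e + k" using e(1) le_Suc_ex by blast
    have sG': "(\<Sum>d\<in>?D. NN (strict_curve d f) (G d)) + mult0 f * e = NN f g"
      using sG by (simp add: k algebra_simps)
    have G0: "G d \<noteq> 0" and U0: "U d \<noteq> 0" for d by (simp_all add: G_def U_def strict_ne_0 g u)
    have IH: "fin (strict_curve d f) (U d) \<and> NN (strict_curve d f) (U d) = NN (strict_curve d f) (G d)" for d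
    proof -
      obtain k where k: "U d = G d + k * strict_curve d f" using UG by blast
      have "NN (strict_curve d f) (G d) < NN f g"
      proof (cases "d \<in> ?D")
        case True
        then have "NN (strict_curve d f) (G d) \<le> (\<Sum>d\<in>?D. NN (strict_curve d f) (G d))"
          using D by (intro member_le_sum) auto
        then show ?thesis using sG' mult_pos_pos[OF m e(3)] by linarith
      next
        case False
        then have "NN (strict_curve d f) (G d) = 0" by (intro supp_unit) (auto simp: dirs_def)
        then show ?thesis using sG' mult_pos_pos[OF m e(3)] by linarith
      qed
      then show ?thesis
        using less.hyps[of "strict_curve d f" "G d" k] finG[of d] G0[of d] U0[of d] strict_ne_0[OF f, of d]
        unfolding k by blast
    qed
    have "fin (strict_curve d f) (strict_curve d u)" for d
      using IH[of d] unfolding U_def by (subst (asm) fin_mult) (simp_all add: strict_ne_0 f u)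
    then have finu: "fin f u" by (simp add: fin_rec f u)
    have "(\<Sum>d\<in>?D. NN (strict_curve d f) (U d)) + mult0 f * mult0 u =
        NN f u + (mult0 u - e) * mult0 f"
      unfolding U_def by (rule NN_virtual[OF f u finu D])
    moreover obtain k' where k': "mult0 u = e + k'" using e(2) le_Suc_ex by blast
    ultimately have "(\<Sum>d\<in>?D. NN (strict_curve d f) (U d)) + mult0 f * e = NN f u"
      by (simp add: k' algebra_simps)
    then show ?thesis using sG' IH finu by (simp add: u_def)
  qed
qed

text \<open>Needed at the point at infinity of the plane through which all lines
  \<open>x = r\<close> pass: there they have the equation \<open>u = r * v\<close>. For nonzero
  \<open>r\<close>, one blowup in the direction of the line turns it into a coordinate axis up to a
  constant.\<close>

lemma NN_line:
  assumes f: "f \<noteq> 0" and q: "q \<noteq> 0" "\<And>s. poly q s = ev f (r * s, s)"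
  shows "fin f (bX - bconst r * bY)" "NN f (bX - bconst r * bY) = order 0 q"
proof -
  have "fin f (bX - bconst r * bY) \<and> NN f (bX - bconst r * bY) = order 0 q"
  proof (cases "r = 0")
    case True
    then have "rX f = q" by (intro poly_ext) (simp add: q)
    then show ?thesis using NN_bX[of f] q True by simp
  next
    case False
    let ?l = "bX - bconst r * bY"
    have l0: "?l \<noteq> 0"
    proof
      assume "?l = 0"
      then have "ev ?l (1, 0) = 0" by simp
      then show False by simp
    qed
    define d where "d = Some (1 / r)"
    have "pb d ?l = exc_eq d ^ 1 * (bconst (- r) * bY)"
      by (rule ev_ext) (use False in \<open>simp add: d_def ev_pb algebra_simps\<close>)
    moreover have "\<not> exc_eq d dvd bconst (- r) * bY" using False by (simp add: d_def bX_dvd_iff)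
    ultimately have 1: "mult0 ?l = 1" "strict_curve d ?l = bconst (- r) * bY"
      by (rule strict_unique[OF l0])+
    have 2: "strict_curve (Some t) ?l = 1 - bconst r * (bY + bconst t)" for t
    proof (rule strict_unique(2)[OF l0, of _ 1])
      show "pb (Some t) ?l = exc_eq (Some t) ^ 1 * (1 - bconst r * (bY + bconst t))"
        by (rule ev_ext) (simp add: ev_pb algebra_simps)
      have "rX (1 - bconst r * (bY + bconst t)) \<noteq> 0"
      proof
        assume "rX (1 - bconst r * (bY + bconst t)) = 0"
        then have "poly (rX (1 - bconst r * (bY + bconst t))) (- t) = 0" by (simp only: poly_0)
        then show False by simp
      qed
      then show "\<not> exc_eq (Some t) dvd 1 - bconst r * (bY + bconst t)"
        by (simp only: exc_eq.simps bX_dvd_iff not_False_eq_True)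
    qed
    have 3: "strict_curve None ?l = bX - bconst r"
    proof (rule strict_unique(2)[OF l0, of _ 1])
      show "pb None ?l = exc_eq None ^ 1 * (bX - bconst r)"
        by (rule ev_ext) (simp add: ev_pb algebra_simps)
    qed (simp add: bY_dvd_iff)
    have dl: "dirs ?l \<subseteq> {d}"
    proof
      fix d' assume d': "d' \<in> dirs ?l"
      show "d' \<in> {d}"
      proof (cases d')
        case None
        then show ?thesis using d' False by (simp add: dirs_def 3)
      next
        case (Some t)
        then have "1 - r * t = 0" using d' by (simp add: dirs_def 2)
        then show ?thesis using Some False by (simp add: d_def field_simps)
      qed
    qed
    let ?f = "strict_curve d f"
    have f': "?f \<noteq> 0" by (simp add: strict_ne_0 f)
    have eq: "pcompose q [:0, 1 / r:] = [:- 0, 1:] ^ mult0 f * rY ?f"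
    proof (rule poly_ext)
      fix x
      have "ev (pb d f) (x, 0) = ev f (x, x / r)" by (simp add: d_def ev_pb)
      then show "poly (pcompose q [:0, 1 / r:]) x = poly ([:- 0, 1:] ^ mult0 f * rY ?f) x"
        using pb_eq_strict[OF f, of d] False by (simp add: poly_pcompose q(2) d_def)
    qed
    have q': "pcompose q [:0, 1 / r:] \<noteq> 0"
      using q(1) False by (simp add: pcompose_eq_0_iff)
    have rY0: "rY ?f \<noteq> 0" using eq q' by auto
    have "order 0 (pcompose q [:0, 1 / r:]) = order 0 ([:- 0, 1 :: complex:] ^ mult0 f) + order 0 (rY ?f)"
      using eq q' by (metis order_mult)
    then have o: "order 0 (pcompose q [:0, 1 / r:]) = mult0 f + order 0 (rY ?f)"
      by (simp only: order_power_n_n)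
    have oq: "order 0 (pcompose q [:0, 1 / r:]) = order 0 q"
    proof -
      from order_decomp[OF q(1), of 0] obtain p where
        p: "q = [:- 0, 1:] ^ order 0 q * p" "\<not> [:- 0, 1:] dvd p" by blast
      let ?c = "[:(1 / r) ^ order 0 q:] * pcompose p [:0, 1 / r:]"
      have "pcompose q [:0, 1 / r:] = [:- 0, 1:] ^ order 0 q * ?c"
      proof (rule poly_ext)
        fix x
        have "poly q (x / r) = poly ([:- 0, 1:] ^ order 0 q * p) (x / r)" using p(1) by simp
        then show "poly (pcompose q [:0, 1 / r:]) x = poly ([:- 0, 1:] ^ order 0 q * ?c) x"
          by (simp add: poly_pcompose power_divide)
      qed
      then have "order 0 (pcompose q [:0, 1 / r:]) = order 0 ([:- 0, 1 :: complex:] ^ order 0 q) + order 0 ?c"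
        using q' by (metis order_mult)
      moreover have "order 0 ?c = 0"
        using p(2) False by (intro order_0I) (simp add: poly_pcompose poly_eq_0_iff_dvd)
      ultimately show ?thesis by (simp only: order_power_n_n)
    qed
    have c: "ev (bconst (- r)) (0, 0) \<noteq> 0" using False by simp
    note Y = NN_bY[OF rY0] NN_unit_mult[OF f' bY_ne_0 c]
    have "fin (strict_curve d' f) (strict_curve d' ?l)" for d'
    proof (cases "d' = d")
      case True
      then show ?thesis using Y 1 by simp
    next
      case False
      then have "d' \<notin> dirs ?l" using dl by auto
      then show ?thesis by (intro supp_unit) (simp add: dirs_def)
    qed
    then have fin: "fin f ?l" unfolding fin_rec[OF f l0] by blast
    have "NN f ?l = mult0 f + NN ?f (bconst (- r) * bY)"
      using NN_rec[OF f l0 fin, of "{d}"] dl 1 by auto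
    then show ?thesis using fin Y o oq by simp
  qed
  then show "fin f (bX - bconst r * bY)" "NN f (bX - bconst r * bY) = order 0 q" by auto
qed

section \<open>Line bundles on the surface, Newton polygons and Bezout's theorem\<close>

section \<open>Sections of line bundles and Bezout's theorem\<close>

text \<open>\<open>tau S c u v\<close> are the coordinates in chart 0 of the point \<open>(u, v)\<close> of chart \<open>c\<close>, and
  \<open>chi S d c u v\<close> is the corresponding cocycle of the line bundle of degree \<open>d\<close>.\<close>

definition tau :: "surface \<Rightarrow> nat \<Rightarrow> complex \<Rightarrow> complex \<Rightarrow> complex \<times> complex" where
  "tau S c u v = (case S of
      P2 \<Rightarrow> if c = 0 then (u, v) else if c = 1 then (1 / v, u / v) else (u / v, 1 / v)
    | Hirz \<delta> \<Rightarrow> if c = 0 then (u, v) else if c = 1 then (1 / u, u ^ \<delta> * v)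
        else if c = 2 then (u, 1 / v) else (1 / u, u ^ \<delta> / v))"

definition chi :: "surface \<Rightarrow> deg \<Rightarrow> nat \<Rightarrow> complex \<Rightarrow> complex \<Rightarrow> complex" where
  "chi S d c u v = (case S of
      P2 \<Rightarrow> if c = 0 then 1 else v powi snd d
    | Hirz \<delta> \<Rightarrow> if c = 0 then 1 else if c = 1 then u powi fst d
        else if c = 2 then v powi snd d else u powi fst d * v powi snd d)"

text \<open>A section of the line bundle of degree \<open>d\<close>: by density it is enough to compare the local
  equation in each chart with that in chart 0 on the torus.\<close>

definition sec :: "surface \<Rightarrow> deg \<Rightarrow> (nat \<Rightarrow> bipoly) \<Rightarrow> bool" where
  "sec S d F \<longleftrightarrow> (\<forall>c\<in>charts S. \<forall>u v. u \<noteq> 0 \<longrightarrow> v \<noteq> 0 \<longrightarrow>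
     ev (F c) (u, v) = chi S d c u v * ev (F 0) (tau S c u v))"

text \<open>The Newton polygon of the sections of degree \<open>d\<close> in chart 0.\<close>

definition cap :: "surface \<Rightarrow> deg \<Rightarrow> bipoly \<Rightarrow> bool" where
  "cap S d f \<longleftrightarrow> (\<forall>i j. cf f i j \<noteq> 0 \<longrightarrow> (case S of P2 \<Rightarrow> int i + int j \<le> snd d
     | Hirz \<delta> \<Rightarrow> int j \<le> snd d \<and> int i \<le> fst d + int \<delta> * int j))"

definition dot :: "surface \<Rightarrow> deg \<Rightarrow> deg \<Rightarrow> int" where
  "dot S d d' = (case S of P2 \<Rightarrow> snd d * snd d'
     | Hirz \<delta> \<Rightarrow> fst d * snd d' + snd d * fst d' + int \<delta> * (snd d * snd d'))"

definition trl :: "complex \<Rightarrow> complex \<Rightarrow> bipoly \<Rightarrow> bipoly" where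
  "trl u v f = bsubst f (bX + bconst u) (bY + bconst v)"

definition cz :: "surface \<Rightarrow> (nat \<Rightarrow> bipoly) \<Rightarrow> (nat \<Rightarrow> bipoly) \<Rightarrow> (nat \<times> complex \<times> complex) set" where
  "cz S F G = {(c, u, v). on_surface S (Proper c u v) \<and> ev (F c) (u, v) = 0 \<and> ev (G c) (u, v) = 0}"

definition locN :: "(nat \<Rightarrow> bipoly) \<Rightarrow> (nat \<Rightarrow> bipoly) \<Rightarrow> nat \<times> complex \<times> complex \<Rightarrow> nat" where
  "locN F G = (\<lambda>(c, u, v). NN (trl u v (F c)) (trl u v (G c)))"

definition locfin :: "(nat \<Rightarrow> bipoly) \<Rightarrow> (nat \<Rightarrow> bipoly) \<Rightarrow> nat \<times> complex \<times> complex \<Rightarrow> bool" where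
  "locfin F G = (\<lambda>(c, u, v). fin (trl u v (F c)) (trl u v (G c)))"

text \<open>Bezout's theorem for one pair as a predicate, so that the steps of its proof become
  closure properties. Points are listed through \<open>on_surface\<close>, hence once each.\<close>

definition bez :: "surface \<Rightarrow> (nat \<Rightarrow> bipoly) \<Rightarrow> (nat \<Rightarrow> bipoly) \<Rightarrow> int \<Rightarrow> bool" where
  "bez S F G n \<longleftrightarrow> finite (cz S F G) \<and> (\<forall>q\<in>cz S F G. locfin F G q) \<and>
     int (\<Sum>q\<in>cz S F G. locN F G q) = n"

lemma ev_trl [simp]: "ev (trl u v f) (x, y) = ev f (x + u, y + v)"
  by (simp add: trl_def)

lemma trl_simps [simp]: "trl u v (f + g) = trl u v f + trl u v g" "trl u v (f - g) = trl u v f - trl u v g"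
  "trl u v (f * g) = trl u v f * trl u v g" "trl u v 0 = 0" "trl u v 1 = 1" "trl u v (bconst c) = bconst c"
  "trl u v (f ^ n) = trl u v f ^ n" "trl u v (- f) = - trl u v f"
  by (simp_all add: trl_def bsubst_simps)

lemma trl_eq_0_iff [simp]: "trl u v f = 0 \<longleftrightarrow> f = 0"
proof
  assume 0: "trl u v f = 0"
  show "f = 0"
  proof (rule ev_ext)
    fix x y
    have "ev (trl u v f) (x - u, y - v) = 0" using 0 by simp
    then show "ev f (x, y) = ev 0 (x, y)" by simp
  qed
qed simp

lemma charts_simps: "charts P2 = {0, 1, 2}" "charts (Hirz \<delta>) = {0, 1, 2, 3}"
  by (auto simp: charts_def)

lemma chart0: "0 \<in> charts S"
  by (cases S) (simp_all add: charts_simps)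

lemma on_surface_iff:
  "on_surface P2 (Proper c u v) \<longleftrightarrow> c = 0 \<or> c = 1 \<and> v = 0 \<or> c = 2 \<and> u = 0 \<and> v = 0"
  "on_surface (Hirz \<delta>) (Proper c u v) \<longleftrightarrow>
     c = 0 \<or> c = 1 \<and> u = 0 \<or> c = 2 \<and> v = 0 \<or> c = 3 \<and> u = 0 \<and> v = 0"
proof -
  have l1: "(\<forall>c'<(1 :: nat). P c') \<longleftrightarrow> P 0" for P by simp
  have l2: "(\<forall>c'<(2 :: nat). P c') \<longleftrightarrow> P 0 \<and> P 1" for P by (auto simp: numeral_2_eq_2 All_less_Suc)
  have l3: "(\<forall>c'<(3 :: nat). P c') \<longleftrightarrow> P 0 \<and> P 1 \<and> P 2" for P
    by (auto simp: numeral_3_eq_3 numeral_2_eq_2 All_less_Suc)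
  note defs = overlap_def chart_dom_def hc_def charts_simps
  show "on_surface P2 (Proper c u v) \<longleftrightarrow> c = 0 \<or> c = 1 \<and> v = 0 \<or> c = 2 \<and> u = 0 \<and> v = 0"
  proof (cases "c \<in> charts P2")
    case True
    then consider "c = 0" | "c = 1" | "c = 2" by (auto simp: charts_simps)
    then show ?thesis by cases (simp_all add: defs l2, auto)
  qed (simp add: charts_simps)
  show "on_surface (Hirz \<delta>) (Proper c u v) \<longleftrightarrow>
     c = 0 \<or> c = 1 \<and> u = 0 \<or> c = 2 \<and> v = 0 \<or> c = 3 \<and> u = 0 \<and> v = 0"
  proof (cases "c \<in> charts (Hirz \<delta>)")
    case True
    then consider "c = 0" | "c = 1" | "c = 2" | "c = 3" by (auto simp: charts_simps)
    then show ?thesis by cases (simp_all add: defs l2 l3, auto)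
  qed (simp add: charts_simps)
qed

lemma sec_uniq:
  assumes "sec S d F" "sec S d G" "F 0 = G 0" "c \<in> charts S"
  shows "F c = G c"
  by (rule ev_ext_torus) (use assms in \<open>simp add: sec_def\<close>)

lemma chi_ne_0: "u \<noteq> 0 \<Longrightarrow> v \<noteq> 0 \<Longrightarrow> chi S d c u v \<noteq> 0"
  by (cases S) (auto simp: chi_def power_int_eq_0_iff)

lemma tau_surj:
  assumes "c \<in> charts S" "x \<noteq> 0" "y \<noteq> 0"
  shows "\<exists>u v. u \<noteq> 0 \<and> v \<noteq> 0 \<and> tau S c u v = (x, y)"
proof (cases S)
  case P2
  consider "c = 0" | "c = 1" | "c = 2" using assms(1) P2 by (auto simp: charts_simps)
  then show ?thesis
  proof cases
    case 1 then show ?thesis using assms P2 by (intro exI[of _ x] exI[of _ y]) (simp add: tau_def)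
  next
    case 2 then show ?thesis using assms P2 by (intro exI[of _ "y / x"] exI[of _ "1 / x"]) (simp add: tau_def)
  next
    case 3 then show ?thesis using assms P2 by (intro exI[of _ "x / y"] exI[of _ "1 / y"]) (simp add: tau_def)
  qed
next
  case (Hirz \<delta>)
  consider "c = 0" | "c = 1" | "c = 2" | "c = 3" using assms(1) Hirz by (auto simp: charts_simps)
  then show ?thesis
  proof cases
    case 1 then show ?thesis using assms Hirz by (intro exI[of _ x] exI[of _ y]) (simp add: tau_def)
  next
    case 2 then show ?thesis using assms Hirz
      by (intro exI[of _ "1 / x"] exI[of _ "x ^ \<delta> * y"]) (simp add: tau_def power_one_over)
  next
    case 3 then show ?thesis using assms Hirz by (intro exI[of _ x] exI[of _ "1 / y"]) (simp add: tau_def)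
  next
    case 4 then show ?thesis using assms Hirz
      by (intro exI[of _ "1 / x"] exI[of _ "1 / (x ^ \<delta> * y)"]) (simp add: tau_def power_one_over)
  qed
qed

lemma sec_nonzero:
  assumes "sec S d F" "c \<in> charts S"
  shows "F c = 0 \<longleftrightarrow> F 0 = 0"
proof
  assume "F 0 = 0"
  then show "F c = 0" using assms by (intro ev_ext_torus) (simp add: sec_def)
next
  assume 0: "F c = 0"
  show "F 0 = 0"
  proof (rule ev_ext_torus)
    fix x y :: complex assume "x \<noteq> 0" "y \<noteq> 0"
    then obtain u v where uv: "u \<noteq> 0" "v \<noteq> 0" "tau S c u v = (x, y)"
      using tau_surj[OF assms(2)] by blast
    then have "0 = chi S d c u v * ev (F 0) (x, y)"
      using assms 0 unfolding sec_def by (metis ev_simps(1))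
    then show "ev (F 0) (x, y) = ev 0 (x, y)" using chi_ne_0[OF uv(1,2)] by simp
  qed
qed

lemma chi_add: "u \<noteq> 0 \<Longrightarrow> v \<noteq> 0 \<Longrightarrow> chi S (d + d') c u v = chi S d c u v * chi S d' c u v"
  by (cases S) (auto simp: chi_def power_int_add)

lemma sec_mult: "sec S d F \<Longrightarrow> sec S d' G \<Longrightarrow> sec S (d + d') (\<lambda>c. F c * G c)"
  by (simp add: sec_def chi_add)

lemma sec_diff: "sec S d F \<Longrightarrow> sec S d G \<Longrightarrow> sec S d (\<lambda>c. F c - G c)"
  by (simp add: sec_def algebra_simps)

subsection \<open>Degree bounds in chart 0\<close>

definition cy :: "complex \<Rightarrow> bipoly \<Rightarrow> complex poly" where "cy x f = map_poly (\<lambda>p. poly p x) f"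

lemma poly_cy [simp]: "poly (cy x f) y = ev f (x, y)"
  unfolding cy_def ev_def by (induction f) (auto simp: map_poly_pCons)

lemma coeff_cy: "coeff (cy x f) j = poly (coeff f j) x"
  by (simp add: cy_def coeff_map_poly)

lemma cy_cap:
  assumes "\<And>x. x \<noteq> 0 \<Longrightarrow> cy x f = 0 \<or> int (degree (cy x f)) \<le> n" "cf f i j \<noteq> 0"
  shows "int j \<le> n"
proof (rule ccontr)
  assume j: "\<not> int j \<le> n"
  have "coeff f j = 0"
  proof (rule poly_cofinite_ext[of "{0}"])
    fix x :: complex assume "x \<notin> {0}"
    then have "coeff (cy x f) j = 0" using assms(1)[of x] j by (cases "cy x f = 0") (auto intro!: coeff_eq_0)
    then show "poly (coeff f j) x = poly 0 x" by (simp add: coeff_cy)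
  qed simp
  then show False using assms(2) by (simp add: cf_def)
qed

text \<open>Along a line through the origin \<open>f\<close> becomes a polynomial in one variable
  whose exponents are the total degrees \<open>i + j\<close>; the chart where \<open>X\<close> is
  nonzero bounds its degree.\<close>

lemma cap_P2:
  assumes "\<And>u v. u \<noteq> 0 \<Longrightarrow> v \<noteq> 0 \<Longrightarrow> ev g (u, v) = v powi b * ev f (1 / v, u / v)"
  shows "cap P2 (a, b) f"
  unfolding cap_def
proof (intro allI impI, unfold surface.case snd_conv)
  fix i j assume "cf f i j \<noteq> 0"
  then have "cf (sw (pb (Some 0) f)) j (i + j) \<noteq> 0" by (simp add: cf_sw cf_pb0)
  then have "int (i + j) \<le> b"
  proof (rule cy_cap[rotated])
    fix u :: complex assume u: "u \<noteq> 0"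
    let ?q = "cy u (sw (pb (Some 0) f))"
    have "poly (cy u g) v = v powi b * poly ?q (1 / v)" if "v \<noteq> 0" for v
      using assms[OF u that] by (simp add: ev_pb)
    then show "?q = 0 \<or> int (degree ?q) \<le> b" using poly_reversal(2) by blast
  qed
  then show "int i + int j \<le> b" by simp
qed

text \<open>The bound on \<open>j\<close> comes from the fibers. For \<open>i\<close> the powers of
  \<open>y\<close> are separated: the chart change multiplies \<open>y\<close> by
  \<open>u ^ \<delta>\<close>, so the coefficient of \<open>y ^ j\<close> is a section of degree
  \<open>a + \<delta> * j\<close> on the base.\<close>

lemma cap_Hirz:
  assumes "\<And>u v. u \<noteq> 0 \<Longrightarrow> v \<noteq> 0 \<Longrightarrow> ev g (u, v) = u powi a * ev f (1 / u, u ^ \<delta> * v)"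
    and "\<And>u v. u \<noteq> 0 \<Longrightarrow> v \<noteq> 0 \<Longrightarrow> ev h (u, v) = v powi b * ev f (u, 1 / v)"
  shows "cap (Hirz \<delta>) (a, b) f"
  unfolding cap_def
proof (intro allI impI, unfold surface.case snd_conv fst_conv, intro conjI)
  fix i j assume ij: "cf f i j \<noteq> 0"
  then show "int j \<le> b"
  proof (rule cy_cap[rotated])
    fix u :: complex assume u: "u \<noteq> 0"
    have "poly (cy u h) v = v powi b * poly (cy u f) (1 / v)" if "v \<noteq> 0" for v
      using assms(2)[OF u that] by simp
    then show "cy u f = 0 \<or> int (degree (cy u f)) \<le> b" using poly_reversal(2) by blast
  qed
  have "poly (coeff g j) u = u powi (a + int \<delta> * int j) * poly (coeff f j) (1 / u)" if u: "u \<noteq> 0" for u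
  proof -
    have "cy u g = smult (u powi a) (pcompose (cy (1 / u) f) [:0, u ^ \<delta>:])"
    proof (rule poly_cofinite_ext[of "{0}"])
      fix v :: complex assume "v \<notin> {0}"
      then show "poly (cy u g) v = poly (smult (u powi a) (pcompose (cy (1 / u) f) [:0, u ^ \<delta>:])) v"
        using assms(1)[OF u, of v] by (simp add: poly_pcompose mult.commute)
    qed simp
    then have "coeff (cy u g) j = u powi a * ((u ^ \<delta>) ^ j * coeff (cy (1 / u) f) j)"
      by (simp add: coeff_pcompose_linear)
    also have "u powi a * ((u ^ \<delta>) ^ j * coeff (cy (1 / u) f) j) =
        u powi (a + int \<delta> * int j) * coeff (cy (1 / u) f) j"
      using u by (simp add: power_int_add power_mult flip: power_mult of_nat_mult)
    finally show ?thesis by (simp add: coeff_cy)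
  qed
  moreover have "coeff f j \<noteq> 0" using ij by (auto simp: cf_def)
  ultimately have "int (degree (coeff f j)) \<le> a + int \<delta> * int j" using poly_reversal(2) by blast
  moreover have "i \<le> degree (coeff f j)" using ij by (simp add: cf_def le_degree)
  ultimately show "int i \<le> a + int \<delta> * int j" by linarith
qed

lemma sec_cap: assumes "sec S d F" shows "cap S d (F 0)"
proof (cases S)
  case P2
  then have "ev (F 1) (u, v) = v powi snd d * ev (F 0) (1 / v, u / v)" if "u \<noteq> 0" "v \<noteq> 0" for u v
    using assms that by (simp add: sec_def charts_simps chi_def tau_def)
  from cap_P2[OF this, of "fst d"] show ?thesis using P2 by simp
next
  case (Hirz \<delta>)
  then have "ev (F 1) (u, v) = u powi fst d * ev (F 0) (1 / u, u ^ \<delta> * v)"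
    "ev (F 2) (u, v) = v powi snd d * ev (F 0) (u, 1 / v)" if "u \<noteq> 0" "v \<noteq> 0" for u v
    using assms that by (simp_all add: sec_def charts_simps chi_def tau_def)
  from cap_Hirz[OF this] show ?thesis using Hirz by simp
qed

text \<open>Monomials in the Newton polygon extend to every chart: \<open>e1\<close> and
  \<open>e2\<close> are the exponents of the transformed monomial times the cocycle. Truncation by
  \<open>nat\<close> is harmless, since \<open>cap\<close> makes these exponents nonnegative
  wherever the coefficient is nonzero.\<close>

lemma sec_extend: assumes "cap S d f" shows "\<exists>F. sec S d F \<and> F 0 = f"
proof -
  define e1 where "e1 c i j = (case S of P2 \<Rightarrow> if c = 0 then i else if c = 1 then j else i
    | Hirz \<delta> \<Rightarrow> if c = 0 \<or> c = 2 then i else nat (fst d + int \<delta> * int j - int i))" for c i j :: nat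
  define e2 where "e2 c i j = (case S of P2 \<Rightarrow> if c = 0 then j else nat (snd d - int i - int j)
    | Hirz \<delta> \<Rightarrow> if c = 0 \<or> c = 1 then j else nat (snd d - int j))" for c i j :: nat
  define F where "F c = (\<Sum>j\<le>degree f. \<Sum>i\<le>degree (coeff f j).
      monom (monom (cf f i j) (e1 c i j)) (e2 c i j))" for c :: nat
  have F0: "F 0 = f"
    using monom_expansion[of f] by (cases S) (simp_all add: F_def e1_def e2_def)
  have "sec S d F" unfolding sec_def
  proof (intro ballI allI impI)
    fix c and u v :: complex assume c: "c \<in> charts S" and uv: "u \<noteq> 0" "v \<noteq> 0"
    have *: "cf f i j * u ^ e1 c i j * v ^ e2 c i j =
        chi S d c u v * (cf f i j * fst (tau S c u v) ^ i * snd (tau S c u v) ^ j)" for i j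
    proof (cases "cf f i j = 0")
      case False
      show ?thesis
      proof (cases S)
        case P2
        then have le: "int i + int j \<le> snd d" using assms False by (simp add: cap_def)
        define k where "k = nat (snd d - int i - int j)"
        have d: "snd d = int (i + j + k)" using le by (simp add: k_def)
        have k: "nat (snd d - int i - int j) = k" by (simp add: k_def)
        show ?thesis
          by (simp only: P2 e1_def e2_def chi_def tau_def surface.case k d power_int_of_nat)
            (simp add: power_add power_divide uv)
      next
        case (Hirz \<delta>)
        then have le: "int j \<le> snd d" "int i \<le> fst d + int \<delta> * int j"
          using assms False by (simp_all add: cap_def)
        define k where "k = nat (snd d - int j)"
        define l where "l = nat (fst d + int \<delta> * int j - int i)"
        have d: "snd d = int (j + k)" using le by (simp add: k_def)
        have kl: "nat (snd d - int j) = k" "nat (fst d + int \<delta> * int j - int i) = l"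
          by (simp_all add: k_def l_def)
        have "u powi fst d * u ^ (\<delta> * j) = u powi (fst d + int (\<delta> * j))"
          using uv by (metis power_int_add power_int_of_nat)
        also have "fst d + int (\<delta> * j) = int (i + l)" using le by (simp add: l_def)
        finally have a: "u powi fst d * u ^ (\<delta> * j) = u ^ (i + l)" by (simp only: power_int_of_nat)
        then have a: "u powi fst d * (u ^ \<delta>) ^ j = u ^ i * u ^ l" by (simp add: power_mult power_add)
        have b: "v powi snd d = v ^ j * v ^ k" by (simp only: d power_int_of_nat power_add)
        have a': "u powi fst d * ((1 / u) ^ i * (u ^ \<delta>) ^ j) = u ^ l"
        proof -
          have "u powi fst d * ((1 / u) ^ i * (u ^ \<delta>) ^ j) = (1 / u) ^ i * (u powi fst d * (u ^ \<delta>) ^ j)"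
            by (simp only: mult_ac)
          also have "\<dots> = u ^ l" unfolding a using uv by (simp add: power_one_over)
          finally show ?thesis .
        qed
        consider "c = 0" | "c = 1" | "c = 2" | "c = 3" using c Hirz by (auto simp: charts_simps)
        then show ?thesis
        proof cases
          case 1 then show ?thesis by (simp add: Hirz e1_def e2_def chi_def tau_def)
        next
          case 2
          have "u powi fst d * (cf f i j * (1 / u) ^ i * (u ^ \<delta> * v) ^ j) =
              cf f i j * (u powi fst d * ((1 / u) ^ i * (u ^ \<delta>) ^ j)) * v ^ j"
            by (simp only: power_mult_distrib mult_ac)
          then show ?thesis using 2 a' by (auto simp: Hirz e1_def e2_def chi_def tau_def kl)
        next
          case 3
          then show ?thesis using uv b by (simp add: Hirz e1_def e2_def chi_def tau_def kl power_one_over)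
        next
          case 4
          have "u powi fst d * v powi snd d * (cf f i j * (1 / u) ^ i * (u ^ \<delta> / v) ^ j) =
              cf f i j * (u powi fst d * ((1 / u) ^ i * (u ^ \<delta>) ^ j)) * (v powi snd d * (1 / v) ^ j)"
            by (simp only: power_mult_distrib mult_ac divide_inverse mult_1_left)
          also have "v powi snd d * (1 / v) ^ j = v ^ k" unfolding b using uv by (simp add: power_one_over)
          finally show ?thesis using 4 a' by (auto simp add: Hirz e1_def e2_def chi_def tau_def kl)
        qed
      qed
    qed simp
    have "ev (F c) (u, v) = (\<Sum>j\<le>degree f. \<Sum>i\<le>degree (coeff f j). cf f i j * u ^ e1 c i j * v ^ e2 c i j)"
      by (simp add: F_def ev_sum)
    also have "\<dots> = chi S d c u v * ev f (fst (tau S c u v), snd (tau S c u v))"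
      unfolding ev_altdef2 sum_distrib_left cf_def by (simp only: *[unfolded cf_def])
    finally show "ev (F c) (u, v) = chi S d c u v * ev (F 0) (tau S c u v)" by (simp add: F0)
  qed
  then show ?thesis using F0 by blast
qed

text \<open>Divisibility in chart 0 does not see components at infinity; the bound on the Newton
  polygon of the quotient supplies the missing information.\<close>

lemma peel_extend:
  assumes "sec S d F" "sec S de e" "cap S (d - de) f'" "F 0 = e 0 * f'"
  shows "\<exists>F'. sec S (d - de) F' \<and> F' 0 = f' \<and> (\<forall>c\<in>charts S. F c = e c * F' c)"
proof -
  obtain F' where F': "sec S (d - de) F'" "F' 0 = f'" using sec_extend[OF assms(3)] by blast
  have "sec S (de + (d - de)) (\<lambda>c. e c * F' c)" by (rule sec_mult[OF assms(2) F'(1)])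
  then have "sec S d (\<lambda>c. e c * F' c)" by simp
  then have "F c = e c * F' c" if "c \<in> charts S" for c
    using sec_uniq[OF assms(1) _ _ that, of "\<lambda>c. e c * F' c"] assms(4) F'(2) by simp
  then show ?thesis using F' by blast
qed

subsection \<open>Additivity of total intersection numbers\<close>

lemma locN_zero: "q \<notin> cz S F G \<Longrightarrow> on_surface S (Proper (fst q) (fst (snd q)) (snd (snd q))) \<Longrightarrow> locN F G q = 0 \<and> locfin F G q"
  by (cases q) (auto simp: cz_def locN_def locfin_def intro!: supp_unit)

lemma cz_on_surface: "q \<in> cz S F G \<Longrightarrow> on_surface S (Proper (fst q) (fst (snd q)) (snd (snd q)))"
  by (auto simp: cz_def)

lemma cz_charts: "(c, u, v) \<in> cz S F G \<Longrightarrow> c \<in> charts S"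
  by (auto simp: cz_def)

lemma bezI:
  assumes "finite A" "cz S F G \<subseteq> A" "\<And>q. q \<in> A \<Longrightarrow> on_surface S (Proper (fst q) (fst (snd q)) (snd (snd q)))"
    "\<And>q. q \<in> A \<Longrightarrow> locfin F G q" "int (\<Sum>q\<in>A. locN F G q) = n"
  shows "bez S F G n"
proof -
  have "(\<Sum>q\<in>cz S F G. locN F G q) = (\<Sum>q\<in>A. locN F G q)"
    using assms(1-3) locN_zero by (intro sum.mono_neutral_left) auto
  then show ?thesis using assms finite_subset unfolding bez_def by (metis subsetD)
qed

lemma bez_sum:
  assumes "bez S F G n" "finite A" "cz S F G \<subseteq> A" "\<And>q. q \<in> A \<Longrightarrow> on_surface S (Proper (fst q) (fst (snd q)) (snd (snd q)))"
  shows "int (\<Sum>q\<in>A. locN F G q) = n" "\<And>q. q \<in> A \<Longrightarrow> locfin F G q"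
proof -
  have "(\<Sum>q\<in>cz S F G. locN F G q) = (\<Sum>q\<in>A. locN F G q)"
    using assms locN_zero by (intro sum.mono_neutral_left) auto
  then show "int (\<Sum>q\<in>A. locN F G q) = n" using assms(1) unfolding bez_def by simp
  show "locfin F G q" if "q \<in> A" for q
    using assms(1,4) that locN_zero unfolding bez_def by blast
qed

lemma cz_sym: "cz S F G = cz S G F"
  by (auto simp: cz_def)

lemma bez_sym: "bez S F G n \<Longrightarrow> bez S G F n"
  unfolding bez_def cz_sym[of S F G] locN_def locfin_def by (simp add: fin_sym NN_sym split_def)

lemma cz_mult: "cz S F (\<lambda>c. G c * H c) = cz S F G \<union> cz S F H"
  by (auto simp: cz_def)

lemma cz_cong: "(\<And>c. c \<in> charts S \<Longrightarrow> G c = G' c) \<Longrightarrow> cz S F G = cz S F G'"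
  by (auto simp: cz_def)

lemma bez_cong:
  assumes "\<And>c. c \<in> charts S \<Longrightarrow> G c = G' c" "bez S F G n" shows "bez S F G' n"
proof -
  have cz: "cz S F G = cz S F G'" using assms(1) by (rule cz_cong)
  have "locN F G q = locN F G' q \<and> locfin F G q = locfin F G' q" if "q \<in> cz S F G" for q
    using that assms(1) by (cases q) (auto simp: locN_def locfin_def dest!: cz_charts)
  then show ?thesis using assms(2) unfolding bez_def cz[symmetric] by auto
qed

lemma
  assumes nz: "\<And>c. c \<in> charts S \<Longrightarrow> F c \<noteq> 0 \<and> G c \<noteq> 0 \<and> H c \<noteq> 0"
  shows bez_mult: "bez S F G m \<Longrightarrow> bez S F H n \<Longrightarrow> bez S F (\<lambda>c. G c * H c) (m + n)"
    and bez_cancel: "bez S F (\<lambda>c. G c * H c) k \<Longrightarrow> bez S F G m \<Longrightarrow> bez S F H (k - m)"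
proof -
  let ?A = "cz S F (\<lambda>c. G c * H c)"
  have fin: "locfin F (\<lambda>c. G c * H c) q \<longleftrightarrow> locfin F G q \<and> locfin F H q" if "q \<in> ?A" for q
    using that nz fin_mult by (cases q) (auto simp: locfin_def dest!: cz_charts)
  have N: "locN F (\<lambda>c. G c * H c) q = locN F G q + locN F H q" if "q \<in> ?A" "locfin F (\<lambda>c. G c * H c) q" for q
    using that nz NN_mult by (cases q) (auto simp: locfin_def locN_def dest!: cz_charts)
  have os: "on_surface S (Proper (fst q) (fst (snd q)) (snd (snd q)))" if "q \<in> ?A" for q
    using that by (rule cz_on_surface)
  have sub: "cz S F G \<subseteq> ?A" "cz S F H \<subseteq> ?A" by (simp_all add: cz_mult)
  {
    assume *: "bez S F G m" "bez S F H n"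
    have A: "finite ?A" using * by (simp add: cz_mult bez_def)
    note s = bez_sum[OF *(1) A sub(1) os] bez_sum[OF *(2) A sub(2) os]
    have f: "locfin F (\<lambda>c. G c * H c) q" if "q \<in> ?A" for q using s(2,4) fin that by blast
    have "(\<Sum>q\<in>?A. locN F (\<lambda>c. G c * H c) q) = (\<Sum>q\<in>?A. locN F G q) + (\<Sum>q\<in>?A. locN F H q)"
      unfolding sum.distrib[symmetric] using N f by (intro sum.cong) auto
    then show "bez S F (\<lambda>c. G c * H c) (m + n)"
      using s f by (intro bezI[OF A _ cz_on_surface]) auto
  next
    assume *: "bez S F (\<lambda>c. G c * H c) k" "bez S F G m"
    have A: "finite ?A" using * by (simp add: bez_def)
    note s = bez_sum[OF *(1) A subset_refl os] bez_sum[OF *(2) A sub(1) os]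
    have "(\<Sum>q\<in>?A. locN F (\<lambda>c. G c * H c) q) = (\<Sum>q\<in>?A. locN F G q) + (\<Sum>q\<in>?A. locN F H q)"
      unfolding sum.distrib[symmetric] using N s(2) by (intro sum.cong) auto
    then show "bez S F H (k - m)"
      using s fin sub(2) by (intro bezI[OF A _ cz_on_surface]) auto
  }
qed

lemma bez_add_multiple:
  assumes nz: "\<And>c. c \<in> charts S \<Longrightarrow> F c \<noteq> 0 \<and> G c \<noteq> 0 \<and> G c + K c * F c \<noteq> 0"
    and b: "bez S F G n"
  shows "bez S F (\<lambda>c. G c + K c * F c) n"
proof -
  have cz: "cz S F (\<lambda>c. G c + K c * F c) = cz S F G" by (auto simp: cz_def)
  have "locfin F (\<lambda>c. G c + K c * F c) q \<and> locN F (\<lambda>c. G c + K c * F c) q = locN F G q"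
    if q: "q \<in> cz S F G" for q
  proof -
    obtain c u v where [simp]: "q = (c, u, v)" by (cases q)
    have c: "c \<in> charts S" using q cz_charts by simp
    have "trl u v (G c + K c * F c) \<noteq> 0" using nz[OF c] trl_eq_0_iff by blast
    then have "trl u v (G c) + trl u v (K c) * trl u v (F c) \<noteq> 0" by simp
    from NN_cong[OF _ _ this] show ?thesis
      using b q nz[OF c] by (auto simp: bez_def locfin_def locN_def)
  qed
  then show ?thesis using b unfolding bez_def cz by auto
qed

subsection \<open>Elementary curves\<close>

definition linF :: "surface \<Rightarrow> complex \<Rightarrow> nat \<Rightarrow> bipoly" where
  "linF S r c = (case S of
      P2 \<Rightarrow> if c = 0 then bX - bconst r else if c = 1 then 1 - bconst r * bY else bX - bconst r * bY
    | Hirz \<delta> \<Rightarrow> if c = 0 \<or> c = 2 then bX - bconst r else 1 - bconst r * bX)"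

definition infF :: "surface \<Rightarrow> nat \<Rightarrow> bipoly" where
  "infF S c = (case S of P2 \<Rightarrow> if c = 0 then 1 else bY
     | Hirz \<delta> \<Rightarrow> if c = 0 \<or> c = 2 then 1 else bX)"

definition secF :: "nat \<Rightarrow> bipoly" where
  "secF c = (if c = 0 \<or> c = 1 then 1 else bY)"

definition fdeg :: "surface \<Rightarrow> deg" where "fdeg S = (case S of P2 \<Rightarrow> (0, 1) | Hirz \<delta> \<Rightarrow> (1, 0))"

text \<open>The lines \<open>X = r Z\<close> and \<open>Z = 0\<close> in the plane; the fibers and
  the section \<open>Y0 = 0\<close> of class \<open>M\<close> on a Hirzebruch surface. These are
  rational curves whose equation in chart 0 is free of \<open>y\<close>, which reduces Bezout's
  theorem for them to counting roots.\<close>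

definition elem :: "surface \<Rightarrow> deg \<Rightarrow> (nat \<Rightarrow> bipoly) \<Rightarrow> bool" where
  "elem S de e \<longleftrightarrow> de = fdeg S \<and> ((\<exists>r. e = linF S r) \<or> e = infF S) \<or>
     (\<exists>\<delta>. S = Hirz \<delta> \<and> de = (0, 1) \<and> e = secF)"

lemma elem_sec: "elem S de e \<Longrightarrow> sec S de e"
  by (cases S)
    (auto simp: elem_def sec_def charts_simps linF_def infF_def secF_def fdeg_def chi_def tau_def field_simps)

lemma elem_0: "elem S de e \<Longrightarrow> e 0 \<noteq> 0 \<and> degree (e 0) = 0"
proof -
  have "bX - bconst r = [:[:- r, 1:]:]" for r by (simp add: bX_def bconst_def)
  then show "elem S de e \<Longrightarrow> e 0 \<noteq> 0 \<and> degree (e 0) = 0"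
    by (cases S) (auto simp: elem_def linF_def infF_def secF_def)
qed

lemma elem_nonzero: "elem S de e \<Longrightarrow> c \<in> charts S \<Longrightarrow> e c \<noteq> 0"
  using elem_sec elem_0 sec_nonzero by blast

lemma poly_poly_ev: "poly (poly f [:v:]) u = ev f (u, v)"
  by (simp add: ev_def)

text \<open>The curve \<open>e\<close> is a projective line: the affine line \<open>P\<close> and
  one more point \<open>q\<close>. The restrictions \<open>\<psi>\<close> and \<open>\<psi>'\<close>
  of \<open>F\<close> to its two charts form a section of degree \<open>n\<close>, whose zeros are
  counted by \<open>poly_reversal\<close>.\<close>

lemma base_bezout:
  assumes psi: "\<psi> \<noteq> 0" and rev: "\<And>s. s \<noteq> 0 \<Longrightarrow> poly \<psi>' s = s powi n * poly \<psi> (1 / s)"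
    and pts: "{(c, u, v). on_surface S (Proper c u v) \<and> ev (e c) (u, v) = 0} = insert q (range P)"
      "q \<notin> range P" "inj P"
    and aff: "\<And>s. locfin F e (P s) \<and> locN F e (P s) = order s \<psi>"
      "\<And>s. (case P s of (c, z) \<Rightarrow> ev (F c) z) = poly \<psi> s"
    and infty: "order 0 \<psi>' = locN F e q" "locfin F e q" 
  shows "bez S F e n"
proof (rule bezI)
  let ?A = "insert q (P ` {s. poly \<psi> s = 0})"
  note R = poly_reversal[OF psi rev]
  show fin: "finite ?A" by (simp add: poly_roots_finite psi)
  show "cz S F e \<subseteq> ?A"
  proof
    fix x assume x: "x \<in> cz S F e"
    then have "x \<in> {(c, u, v). on_surface S (Proper c u v) \<and> ev (e c) (u, v) = 0}" by (auto simp: cz_def)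
    then consider "x = q" | s where "x = P s" unfolding pts(1) by blast
    then show "x \<in> ?A"
    proof cases
      case 2
      then have "poly \<psi> s = 0" using x aff(2)[of s] by (auto simp: cz_def)
      then show ?thesis using 2 by blast
    qed simp
  qed
  show "on_surface S (Proper (fst x) (fst (snd x)) (snd (snd x)))" if "x \<in> ?A" for x
  proof -
    have "x \<in> {(c, u, v). on_surface S (Proper c u v) \<and> ev (e c) (u, v) = 0}" unfolding pts(1) using that by blast
    then show ?thesis by auto
  qed
  show "locfin F e x" if "x \<in> ?A" for x using that aff(1) infty by auto
  have "(\<Sum>x\<in>?A. locN F e x) = locN F e q + (\<Sum>s | poly \<psi> s = 0. order s \<psi>)"
    using pts(2,3) aff(1) fin
    by (subst sum.insert) (auto simp: sum.reindex inj_on_def inj_def poly_roots_finite psi)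
  also have "(\<Sum>s | poly \<psi> s = 0. order s \<psi>) = degree \<psi>" by (rule sum_order[OF psi])
  finally show "int (\<Sum>x\<in>?A. locN F e x) = n" using R infty by simp
qed

lemma NN_trl_bX:
  assumes "cy u f \<noteq> 0"
  shows "fin (trl u v f) bX \<and> NN (trl u v f) bX = order v (cy u f)"
proof -
  have "poly (rX (trl u v f)) y = poly (cy u f) (y + v)" for y by simp
  note * = order_shift[OF assms this]
  then show ?thesis using NN_bX[OF *(2)] by simp
qed

lemma NN_trl_bY:
  assumes "poly f [:v:] \<noteq> 0"
  shows "fin (trl u v f) bY \<and> NN (trl u v f) bY = order u (poly f [:v:])"
proof -
  have "poly (rY (trl u v f)) y = poly (poly f [:v:]) (y + u)" for y by (simp add: poly_poly_ev)
  note * = order_shift[OF assms this]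
  then show ?thesis using NN_bY[OF *(2)] by simp
qed

lemma trl_00 [simp]: "trl 0 0 f = f"
  by (rule ev_ext) simp

text \<open>Lets a chart change that is known only off the axes be evaluated on the axis
  \<open>u = 0\<close>.\<close>

lemma ev_cont_fst:
  assumes "\<And>u. u \<noteq> 0 \<Longrightarrow> ev f (u, v) = ev g (u, w) * k"
  shows "ev f (u, v) = ev g (u, w) * k"
proof -
  have "poly f [:v:] = smult k (poly g [:w:])"
    by (rule poly_cofinite_ext[of "{0}"]) (use assms in \<open>auto simp: poly_poly_ev mult.commute\<close>)
  then show ?thesis by (metis poly_poly_ev poly_smult mult.commute)
qed

text \<open>Division by \<open>x - r\<close> lowers the \<open>x\<close>-degree of every nonzero
  coefficient of a power of \<open>y\<close> by one, so the Newton polygon shrinks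
  accordingly.\<close>

lemma cap_peel_lin:
  assumes cap: "cap S d f" and cy: "cy r f = 0"
  shows "\<exists>f'. cap S (d - fdeg S) f' \<and> f = linF S r 0 * f'"
proof -
  have l: "linF S r 0 = [:[:- r, 1:]:]" by (cases S) (simp_all add: linF_def bX_def bconst_def)
  have "poly (coeff f j) r = 0" for j using cy coeff_cy by (metis coeff_0)
  then have "linF S r 0 dvd f" unfolding l by (simp add: const_poly_dvd_iff poly_eq_0_iff_dvd)
  then obtain f' where f': "f = linF S r 0 * f'" by (blast elim: dvdE)
  then have cj: "coeff f j = [:- r, 1:] * coeff f' j" for j by (simp add: l)
  have "cap S (d - fdeg S) f'" unfolding cap_def
  proof (intro allI impI)
    fix i j assume ij: "cf f' i j \<noteq> 0"
    let ?k = "degree (coeff f j)"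
    have nz: "coeff f' j \<noteq> 0" using ij by (auto simp: cf_def)
    then have "?k = Suc (degree (coeff f' j))" unfolding cj by (subst degree_mult_eq) auto
    moreover have "i \<le> degree (coeff f' j)" using ij by (simp add: cf_def le_degree)
    ultimately have "i + 1 \<le> ?k" by simp
    moreover have "cf f ?k j \<noteq> 0" using nz unfolding cf_def cj by (simp only: lead_coeff_mult) simp
    ultimately show "case S of P2 \<Rightarrow> int i + int j \<le> snd (d - fdeg S)
      | Hirz \<delta> \<Rightarrow> int j \<le> snd (d - fdeg S) \<and> int i \<le> fst (d - fdeg S) + int \<delta> * int j"
      using cap by (cases S) (force simp: cap_def fdeg_def)+
  qed
  then show ?thesis using f' by blast
qed

lemma peel_linF:
  assumes s: "sec S d F" and cy: "cy r (F 0) = 0"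
  shows "\<exists>F'. sec S (d - fdeg S) F' \<and> (\<forall>c\<in>charts S. F c = linF S r c * F' c)"
proof -
  from cap_peel_lin[OF sec_cap[OF s] cy] obtain f'
    where "cap S (d - fdeg S) f'" "F 0 = linF S r 0 * f'" by blast
  moreover have "sec S (fdeg S) (linF S r)" by (rule elem_sec) (auto simp: elem_def)
  ultimately show ?thesis using peel_extend[OF s] by blast
qed

lemma powi_pred:
  fixes v :: complex
  assumes "v \<noteq> 0" "v * x = v powi b * y"
  shows "x = v powi (b - 1) * y"
proof -
  have "x = (v * x) / v" using assms(1) by simp
  also have "\<dots> = v powi (b - 1) * y" unfolding assms(2) using assms(1) by (simp add: power_int_diff)
  finally show ?thesis .
qed

text \<open>Everything depends on the restriction of \<open>F\<close> to the curve: if it is not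
  identically zero, \<open>base_bezout\<close> counts its zeros; if it is, the equation of the curve
  splits off.\<close>

lemma elem_dichotomy:
  assumes e: "elem S de e" and s: "sec S d F"
  shows "bez S F e (dot S d de) \<or> (\<exists>F'. sec S (d - de) F' \<and> (\<forall>c\<in>charts S. F c = e c * F' c))"
proof (cases S)
  case [simp]: P2
  have s1: "ev (F 1) (u, v) = v powi snd d * ev (F 0) (1 / v, u / v)"
    and s2: "ev (F 2) (u, v) = v powi snd d * ev (F 0) (u / v, 1 / v)" if "u \<noteq> 0" "v \<noteq> 0" for u v
    using s that by (simp_all add: sec_def charts_simps chi_def tau_def)
  from e consider (lin) r where "e = linF S r" "de = (0, 1)" | (inf) "e = infF S" "de = (0, 1)"
    by (auto simp: elem_def fdeg_def)
  then show ?thesis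
  proof cases
    case lin
    show ?thesis
    proof (cases "cy r (F 0) = 0")
      case True
      then show ?thesis using peel_linF[OF s] unfolding lin by (simp add: fdeg_def)
    next
      case False
      \<comment> \<open>In chart 2 the line \<open>x = r\<close> is \<open>u = r * v\<close>;
        \<open>q\<close> is the restriction of \<open>F\<close> to it.\<close>
      define q where "q = poly (bsubst (F 2) (bconst r * bX) bX) 0"
      have q: "poly q x = ev (F 2) (r * x, x)" for x
        using poly_rY[of "bsubst (F 2) (bconst r * bX) bX" x] by (simp add: q_def rY_def)
      have "bez S F e (snd d)"
      proof (rule base_bezout[OF False, of q _ _ _ "(2, 0, 0)" "\<lambda>s. (0, r, s)"])
        show rev: "poly q x = x powi snd d * poly (cy r (F 0)) (1 / x)" if "x \<noteq> 0" for x
        proof -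
          have "ev (bsubst (F 2) (bX * bY) bY) (u, x) = ev (F 0) (u, 1 / x) * x powi snd d" for u
          proof (rule ev_cont_fst)
            fix u :: complex assume "u \<noteq> 0"
            then show "ev (bsubst (F 2) (bX * bY) bY) (u, x) = ev (F 0) (u, 1 / x) * x powi snd d"
              using s2[of "u * x" x] that by simp
          qed
          then show ?thesis by (simp add: q)
        qed
        note R = poly_reversal[OF False rev]
        show "{(c, u, v). on_surface S (Proper c u v) \<and> ev (e c) (u, v) = 0} =
            insert (2, 0, 0) (range (\<lambda>s. (0, r, s)))"
          by (auto simp: on_surface_iff lin linF_def simp del: on_surface.simps)
        have l0: "trl r s (e 0) = bX" for s by (rule ev_ext) (simp add: lin linF_def)
        show "locfin F e (0, r, s) \<and> locN F e (0, r, s) = order s (cy r (F 0))" for s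
          using NN_trl_bX[OF False, of s] by (simp add: locfin_def locN_def l0)
        have F2: "F 2 \<noteq> 0" using R(1) q by (auto simp: q_def)
        have l2: "e 2 = bX - bconst r * bY" by (simp add: lin linF_def)
        show "order 0 q = locN F e (2, 0, 0)" "locfin F e (2, 0, 0)"
          using NN_line[OF F2 R(1) q] by (simp_all add: locN_def locfin_def l2)
      qed (auto simp: inj_def)
      then show ?thesis using lin by (simp add: dot_def)
    qed
  next
    case inf
    let ?p = "poly (F 1) [:0:]" let ?p' = "poly (F 2) [:0:]"
    show ?thesis
    proof (cases "?p = 0")
      case True
      then have "bY dvd F 1" by (simp add: bY_dvd_iff rY_def)
      then obtain g where g: "F 1 = bY * g" by (blast elim: dvdE)
      have "ev g (u, v) = v powi (snd d - 1) * ev (F 0) (1 / v, u / v)" if "u \<noteq> 0" "v \<noteq> 0" for u v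
        by (rule powi_pred[OF that(2)]) (use s1[OF that, unfolded g] in simp)
      \<comment> \<open>A factor at infinity is \<open>1\<close> in chart 0: the equation there
        stays the same and only the degree drops.\<close>
      from cap_P2[OF this, of "fst d"] have "cap S (d - de) (F 0)" by (simp add: inf minus_prod_def)
      moreover have "F 0 = e 0 * F 0" by (simp add: inf infF_def)
      ultimately show ?thesis using peel_extend[OF s elem_sec[OF e]] by blast
    next
      case False
      have "bez S F e (snd d)"
      proof (rule base_bezout[OF False, of ?p' _ _ _ "(2, 0, 0)" "\<lambda>s. (1, s, 0)"])
        show rev: "poly ?p' x = x powi snd d * poly ?p (1 / x)" if "x \<noteq> 0" for x
        proof -
          have "ev (sw (F 2)) (v, x) = ev (bsubst (F 1) bY (bX * bconst (1 / x))) (v, 1 / x) * x powi snd d" for v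
          proof (rule ev_cont_fst)
            fix v :: complex assume v: "v \<noteq> 0"
            have "ev (F 1) (1 / x, v / x) = (v / x) powi snd d * ev (F 0) (x / v, 1 / v)"
              using s1[of "1 / x" "v / x"] that v by simp
            then show "ev (sw (F 2)) (v, x) = ev (bsubst (F 1) bY (bX * bconst (1 / x))) (v, 1 / x) * x powi snd d"
              using s2[OF that v] that by (simp add: power_int_divide_distrib)
          qed
          from this[of 0] show ?thesis unfolding poly_poly_ev by simp
        qed
        note R = poly_reversal[OF False rev]
        show "{(c, u, v). on_surface S (Proper c u v) \<and> ev (e c) (u, v) = 0} =
            insert (2, 0, 0) (range (\<lambda>s. (1, s, 0)))"
          by (auto simp: on_surface_iff inf infF_def simp del: on_surface.simps)
        have l0: "trl s 0 (e (Suc 0)) = bY" "e 2 = bY" for s by (rule ev_ext, simp add: inf infF_def)+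
        show "locfin F e (1, s, 0) \<and> locN F e (1, s, 0) = order s ?p" for s
          using NN_trl_bY[OF False, of s] by (simp add: locfin_def locN_def l0)
        show "order 0 ?p' = locN F e (2, 0, 0)" "locfin F e (2, 0, 0)"
          using NN_trl_bY[OF R(1), of 0] by (simp_all add: locN_def locfin_def l0)
      qed (auto simp: inj_def ev_def)
      then show ?thesis by (simp add: inf dot_def)
    qed
  qed
next
  case [simp]: (Hirz \<delta>)
  have s1: "ev (F 1) (u, v) = u powi fst d * ev (F 0) (1 / u, u ^ \<delta> * v)"
    and s2: "ev (F 2) (u, v) = v powi snd d * ev (F 0) (u, 1 / v)"
    and s3: "ev (F 3) (u, v) = u powi fst d * v powi snd d * ev (F 0) (1 / u, u ^ \<delta> / v)"
    if "u \<noteq> 0" "v \<noteq> 0" for u v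
    using s that by (simp_all add: sec_def charts_simps chi_def tau_def)
  from e consider (lin) r where "e = linF S r" "de = (1, 0)" | (inf) "e = infF S" "de = (1, 0)"
    | (sec) "e = secF" "de = (0, 1)"
    by (auto simp: elem_def fdeg_def)
  then show ?thesis
  proof cases
    case lin
    show ?thesis
    proof (cases "cy r (F 0) = 0")
      case True
      then show ?thesis using peel_linF[OF s] unfolding lin by (simp add: fdeg_def)
    next
      case False
      have "bez S F e (snd d)"
      proof (rule base_bezout[OF False, of "cy r (F 2)" _ _ _ "(2, r, 0)" "\<lambda>s. (0, r, s)"])
        show rev: "poly (cy r (F 2)) x = x powi snd d * poly (cy r (F 0)) (1 / x)" if "x \<noteq> 0" for x
        proof -
          have "ev (F 2) (u, x) = ev (F 0) (u, 1 / x) * x powi snd d" for u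
            by (rule ev_cont_fst) (simp add: s2 that)
          then show ?thesis by simp
        qed
        note R = poly_reversal[OF False rev]
        show "{(c, u, v). on_surface S (Proper c u v) \<and> ev (e c) (u, v) = 0} =
            insert (2, r, 0) (range (\<lambda>s. (0, r, s)))"
          by (auto simp: on_surface_iff lin linF_def simp del: on_surface.simps)
        have l0: "trl r s (e 0) = bX" "trl r s (e 2) = bX" for s
          by (rule ev_ext, simp add: lin linF_def)+
        show "locfin F e (0, r, s) \<and> locN F e (0, r, s) = order s (cy r (F 0))" for s
          using NN_trl_bX[OF False, of s] by (simp add: locfin_def locN_def l0)
        show "order 0 (cy r (F 2)) = locN F e (2, r, 0)" "locfin F e (2, r, 0)"
          using NN_trl_bX[OF R(1), of 0] by (simp_all add: locN_def locfin_def l0)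
      qed (auto simp: inj_def)
      then show ?thesis using lin by (simp add: dot_def)
    qed
  next
    case inf
    show ?thesis
    proof (cases "cy 0 (F 1) = 0")
      case True
      have "rX (F 1) = cy 0 (F 1)" by (rule poly_ext) simp
      then have "bX dvd F 1" using True by (simp add: bX_dvd_iff)
      then obtain g where g: "F 1 = bX * g" by (blast elim: dvdE)
      have "ev g (u, v) = u powi (fst d - 1) * ev (F 0) (1 / u, u ^ \<delta> * v)" if "u \<noteq> 0" "v \<noteq> 0" for u v
        by (rule powi_pred[OF that(1)]) (use s1[OF that, unfolded g] in simp)
      from cap_Hirz[OF this s2] have "cap S (d - de) (F 0)" by (simp add: inf minus_prod_def)
      moreover have "F 0 = e 0 * F 0" by (simp add: inf infF_def)
      ultimately show ?thesis using peel_extend[OF s elem_sec[OF e]] by blast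
    next
      case False
      have "bez S F e (snd d)"
      proof (rule base_bezout[OF False, of "cy 0 (F 3)" _ _ _ "(3, 0, 0)" "\<lambda>s. (1, 0, s)"])
        show rev: "poly (cy 0 (F 3)) x = x powi snd d * poly (cy 0 (F 1)) (1 / x)" if "x \<noteq> 0" for x
        proof -
          have "ev (F 3) (u, x) = ev (F 1) (u, 1 / x) * x powi snd d" for u
          proof (rule ev_cont_fst)
            fix u :: complex assume "u \<noteq> 0"
            then show "ev (F 3) (u, x) = ev (F 1) (u, 1 / x) * x powi snd d"
              using s1[of u "1 / x"] s3[of u x] that by simp
          qed
          then show ?thesis by simp
        qed
        note R = poly_reversal[OF False rev]
        show "{(c, u, v). on_surface S (Proper c u v) \<and> ev (e c) (u, v) = 0} =
            insert (3, 0, 0) (range (\<lambda>s. (1, 0, s)))"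
          by (auto simp: on_surface_iff inf infF_def simp del: on_surface.simps)
        have l0: "trl 0 s (e (Suc 0)) = bX" "e 3 = bX" for s by (rule ev_ext, simp add: inf infF_def)+
        show "locfin F e (1, 0, s) \<and> locN F e (1, 0, s) = order s (cy 0 (F 1))" for s
          using NN_trl_bX[OF False, of s] by (simp add: locfin_def locN_def l0)
        show "order 0 (cy 0 (F 3)) = locN F e (3, 0, 0)" "locfin F e (3, 0, 0)"
          using NN_trl_bX[OF R(1), of 0] by (simp_all add: locN_def locfin_def l0)
      qed (auto simp: inj_def)
      then show ?thesis by (simp add: inf dot_def)
    qed
  next
    case sec
    let ?p = "poly (F 2) [:0:]" let ?p' = "poly (F 3) [:0:]"
    \<comment> \<open>The intersection number of a divisor \<open>a F + b M\<close> with
      \<open>M\<close> is \<open>a + \<delta> b\<close>.\<close>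
    let ?n = "fst d + int \<delta> * snd d"
    show ?thesis
    proof (cases "?p = 0")
      case True
      then have "bY dvd F 2" by (simp add: bY_dvd_iff rY_def)
      then obtain g where g: "F 2 = bY * g" by (blast elim: dvdE)
      have "ev g (u, v) = v powi (snd d - 1) * ev (F 0) (u, 1 / v)" if "u \<noteq> 0" "v \<noteq> 0" for u v
        by (rule powi_pred[OF that(2)]) (use s2[OF that, unfolded g] in simp)
      from cap_Hirz[OF s1 this] have "cap S (d - de) (F 0)" by (simp add: sec minus_prod_def)
      moreover have "F 0 = e 0 * F 0" by (simp add: sec secF_def)
      ultimately show ?thesis using peel_extend[OF s elem_sec[OF e]] by blast
    next
      case False
      have "bez S F e ?n"
      proof (rule base_bezout[OF False, of ?p' _ _ _ "(3, 0, 0)" "\<lambda>s. (2, s, 0)"])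
        show rev: "poly ?p' x = x powi ?n * poly ?p (1 / x)" if "x \<noteq> 0" for x
        proof -
          have "ev (sw (F 3)) (v, x) = ev (bsubst (F 2) bY (bX * bconst (1 / x ^ \<delta>))) (v, 1 / x) * x powi ?n" for v
          proof (rule ev_cont_fst)
            fix v :: complex assume v: "v \<noteq> 0"
            have "ev (F 2) (1 / x, v / x ^ \<delta>) = (v / x ^ \<delta>) powi snd d * ev (F 0) (1 / x, x ^ \<delta> / v)"
              using s2[of "1 / x" "v / x ^ \<delta>"] that v by simp
            moreover have "(x ^ \<delta>) powi snd d = x powi (int \<delta> * snd d)"
              by (simp add: power_int_mult)
            ultimately show "ev (sw (F 3)) (v, x) =
                ev (bsubst (F 2) bY (bX * bconst (1 / x ^ \<delta>))) (v, 1 / x) * x powi ?n"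
              using s3[OF that v] that by (simp add: power_int_divide_distrib power_int_add)
          qed
          from this[of 0] show ?thesis unfolding poly_poly_ev by simp
        qed
        note R = poly_reversal[OF False rev]
        show "{(c, u, v). on_surface S (Proper c u v) \<and> ev (e c) (u, v) = 0} =
            insert (3, 0, 0) (range (\<lambda>s. (2, s, 0)))"
          by (auto simp: on_surface_iff sec secF_def simp del: on_surface.simps)
        have l0: "trl s 0 (e 2) = bY" "e 3 = bY" for s by (rule ev_ext, simp add: sec secF_def)+
        show "locfin F e (2, s, 0) \<and> locN F e (2, s, 0) = order s ?p" for s
          using NN_trl_bY[OF False, of s] by (simp add: locfin_def locN_def l0)
        show "order 0 ?p' = locN F e (3, 0, 0)" "locfin F e (3, 0, 0)"
          using NN_trl_bY[OF R(1), of 0] by (simp_all add: locN_def locfin_def l0)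
      qed (auto simp: inj_def ev_def)
      then show ?thesis by (simp add: sec dot_def)
    qed
  qed
qed

subsection \<open>Bezout's theorem\<close>

lemma dot_diff_right: "dot S d (d1 - d2) = dot S d d1 - dot S d d2"
  and dot_add_left: "dot S (d1 + d2) d = dot S d1 d + dot S d2 d"
  and dot_sym: "dot S d1 d2 = dot S d2 d1"
  by (cases S; simp add: dot_def algebra_simps)+

lemma elem_infinite: assumes "elem S de e" shows "infinite {(c, u, v). on_surface S (Proper c u v) \<and> ev (e c) (u, v) = 0}"
proof -
  have "\<exists>P :: complex \<Rightarrow> nat \<times> complex \<times> complex. inj P \<and> range P \<subseteq> {(c, u, v). on_surface S (Proper c u v) \<and> ev (e c) (u, v) = 0}"
  proof (cases S)
    case P2
    from assms consider (lin) r where "e = linF S r" | (inf) "e = infF S"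
      using P2 by (auto simp: elem_def)
    then show ?thesis
    proof cases
      case lin
      then show ?thesis using P2 by (intro exI[of _ "\<lambda>s. (0, r, s)"])
        (auto simp: on_surface_iff inj_def linF_def simp del: on_surface.simps)
    next
      case inf
      then show ?thesis using P2 by (intro exI[of _ "\<lambda>s. (1, s, 0)"])
        (auto simp: on_surface_iff inj_def infF_def simp del: on_surface.simps)
    qed
  next
    case (Hirz \<delta>)
    from assms consider (lin) r where "e = linF S r" | (inf) "e = infF S" | (sec) "e = secF"
      by (auto simp: elem_def)
    then show ?thesis
    proof cases
      case lin
      then show ?thesis using Hirz by (intro exI[of _ "\<lambda>s. (0, r, s)"])
        (auto simp: on_surface_iff inj_def linF_def simp del: on_surface.simps)
    next
      case inf
      then show ?thesis using Hirz by (intro exI[of _ "\<lambda>s. (1, 0, s)"])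
        (auto simp: on_surface_iff inj_def infF_def simp del: on_surface.simps)
    next
      case sec
      then show ?thesis using Hirz by (intro exI[of _ "\<lambda>s. (2, s, 0)"])
        (auto simp: on_surface_iff inj_def secF_def simp del: on_surface.simps)
    qed
  qed
  then obtain P :: "complex \<Rightarrow> nat \<times> complex \<times> complex" where
    "inj P" "range P \<subseteq> {(c, u, v). on_surface S (Proper c u v) \<and> ev (e c) (u, v) = 0}" by blast
  moreover from this(1) have "infinite (range P)"
    using finite_imageD[of P UNIV] infinite_UNIV_char_0[where 'a = complex] by blast
  ultimately show ?thesis using finite_subset[of "range P"] by blast
qed

text \<open>The termination measure: linear in the degree, nonnegative on degrees with a nonzero
  section, and smaller after removal of an elementary factor.\<close>

definition dsize :: "surface \<Rightarrow> deg \<Rightarrow> int" where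
  "dsize S d = (case S of P2 \<Rightarrow> snd d | Hirz \<delta> \<Rightarrow> fst d + int \<delta> * snd d + snd d)"

lemma cap_dsize: assumes "cap S d f" "f \<noteq> 0" shows "dsize S d \<ge> 0"
proof -
  obtain i j where ij: "cf f i j \<noteq> 0" using assms(2) cf_ext[of f 0] by auto
  show ?thesis
  proof (cases S)
    case P2
    then have "int i + int j \<le> snd d" using assms(1) ij by (simp add: cap_def)
    then show ?thesis using P2 by (simp add: dsize_def)
  next
    case (Hirz \<delta>)
    then have "int j \<le> snd d" "int i \<le> fst d + int \<delta> * int j" using assms(1) ij by (auto simp: cap_def)
    moreover from this(1) have "int \<delta> * int j \<le> int \<delta> * snd d" by (intro mult_left_mono) auto
    ultimately have "0 \<le> fst d + int \<delta> * snd d + snd d" by linarith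
    then show ?thesis using Hirz by (simp add: dsize_def)
  qed
qed

lemma elem_dsize: "elem S de e \<Longrightarrow> dsize S (d - de) < dsize S d"
  by (cases S) (auto simp: elem_def dsize_def fdeg_def algebra_simps)

text \<open>A section whose equation in chart 0 does not involve \<open>y\<close> is a product of elementary ones.\<close>

lemma bez_elementary:
  assumes "sec S d F" "F 0 \<noteq> 0" "sec S d' G" "G 0 \<noteq> 0" "degree (G 0) = 0"
  shows "bez S F G (dot S d d') \<or> (\<exists>de e F'. elem S de e \<and> sec S (d - de) F' \<and>
     (\<forall>c\<in>charts S. F c = e c * F' c) \<and> (\<forall>c\<in>charts S. e c dvd G c))"
  using assms(3-5)
proof (induction "nat (dsize S d')" arbitrary: d' G rule: less_induct)
  case less
  note sG = less.prems(1) and G0 = less.prems(2)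
  obtain \<gamma> where \<gamma>: "G 0 = [:\<gamma>:]" using less.prems(3) by (auto elim: degree_eq_zeroE)
  have cap: "cap S d' (G 0)" by (rule sec_cap[OF sG])
  have nn: "dsize S d' \<ge> 0" by (rule cap_dsize[OF cap G0])
  have step: ?case if e: "elem S de e" and G': "sec S (d' - de) G'" "\<forall>c\<in>charts S. G c = e c * G' c" for de e G'
  proof -
    have eq0: "G 0 = e 0 * G' 0" using G'(2) chart0 by blast
    then have G'0: "G' 0 \<noteq> 0" using G0 by auto
    have "degree (G' 0) = 0"
      using eq0 less.prems(3) G'0 elem_0[OF e] by (simp add: degree_mult_eq)
    moreover have "nat (dsize S (d' - de)) < nat (dsize S d')"
      using elem_dsize[OF e, of d'] cap_dsize[OF sec_cap[OF G'(1)] G'0] by linarith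
    ultimately consider "bez S F G' (dot S d (d' - de))"
      | de' e' F' where "elem S de' e'" "sec S (d - de') F'" "\<forall>c\<in>charts S. F c = e' c * F' c"
         "\<forall>c\<in>charts S. e' c dvd G' c"
      using less.hyps[OF _ G'(1) G'0] by blast
    then show ?thesis
    proof cases
      case 1
      consider "bez S F e (dot S d de)" | F' where "sec S (d - de) F'" "\<forall>c\<in>charts S. F c = e c * F' c"
        using elem_dichotomy[OF e assms(1)] by blast
      then show ?thesis
      proof cases
        case 1
        have "bez S F (\<lambda>c. e c * G' c) (dot S d de + dot S d (d' - de))"
          using elem_nonzero[OF e] sec_nonzero[OF assms(1)] sec_nonzero[OF G'(1)] assms(2) G'0 1
            \<open>bez S F G' (dot S d (d' - de))\<close>
          by (intro bez_mult) auto
        then have "bez S F G (dot S d de + dot S d (d' - de))"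
          by (rule bez_cong[rotated]) (simp add: G'(2))
        then show ?thesis by (simp add: dot_diff_right)
      next
        case 2
        then show ?thesis using e G'(2) by (metis dvd_triv_left)
      qed
    next
      case 2
      then show ?thesis using G'(2) by (metis dvd_mult)
    qed
  qed
  show ?case
  proof (cases "degree \<gamma> = 0")
    case False
    then obtain r where r: "poly \<gamma> r = 0"
      using fundamental_theorem_of_algebra[of \<gamma>] constant_degree[of \<gamma>] by auto
    have "cy r (G 0) = 0" by (rule poly_ext) (simp add: \<gamma> r)
    from peel_linF[OF sG this] obtain G' where
      "sec S (d' - fdeg S) G'" "\<forall>c\<in>charts S. G c = linF S r c * G' c" by blast
    then show ?thesis using step[of "fdeg S" "linF S r"] by (auto simp: elem_def)
  next
    \<comment> \<open>A section that is constant in chart 0 may still vanish at infinity; unless its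
      degree is zero, a curve at infinity is split off.\<close>
    case True
    then obtain k where k: "G 0 = bconst k" "k \<noteq> 0"
      using \<gamma> G0 by (auto simp: bconst_def elim!: degree_eq_zeroE)
    have cfk: "cf (G 0) i j = (if i = 0 \<and> j = 0 then k else 0)" for i j
      unfolding k bconst_def cf_def by (cases i; cases j; simp)
    have peel: ?thesis if "elem S de e" "e 0 = 1" "cap S (d' - de) (G 0)" for de e
    proof -
      have "G 0 = e 0 * G 0" using that by simp
      then show ?thesis using peel_extend[OF sG elem_sec[OF that(1)] that(3)] step[OF that(1)] by blast
    qed
    show ?thesis
    proof (cases S)
      case P2
      show ?thesis
      proof (cases "snd d' = 0")
        case True
        have "ev (G c) (u, v) \<noteq> 0" if "on_surface S (Proper c u v)" for c u v
        proof -
          have c: "c \<in> charts S" using that by simp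
          have "G c = bconst k"
            by (rule ev_ext_torus) (use sG c True P2 k in \<open>auto simp: sec_def chi_def\<close>)
          then show ?thesis using k by simp
        qed
        then have "cz S F G = {}" by (auto simp: cz_def)
        then show ?thesis using P2 True by (simp add: bez_def dot_def)
      next
        case False
        have "snd d' > 0" using nn False P2 by (simp add: dsize_def)
        then have "cap S (d' - (0, 1)) (G 0)" using P2 by (auto simp: cap_def cfk)
        then show ?thesis using peel[of "(0, 1)" "infF S"] P2 by (simp add: elem_def fdeg_def infF_def)
      qed
    next
      case (Hirz \<delta>)
      have "cf (G 0) 0 0 \<noteq> 0" using cfk k(2) by simp
      then have nn2: "snd d' \<ge> 0" "fst d' \<ge> 0"
        using cap[unfolded cap_def, rule_format, of 0 0] Hirz by simp_all
      consider "snd d' = 0" "fst d' = 0" | "snd d' > 0" | "fst d' > 0" using nn2 by linarith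
      then show ?thesis
      proof cases
        case 1
        have "ev (G c) (u, v) \<noteq> 0" if "on_surface S (Proper c u v)" for c u v
        proof -
          have c: "c \<in> charts S" using that by simp
          have "G c = bconst k"
            by (rule ev_ext_torus) (use sG c 1 Hirz k in \<open>auto simp: sec_def chi_def\<close>)
          then show ?thesis using k by simp
        qed
        then have "cz S F G = {}" by (auto simp: cz_def)
        then show ?thesis using Hirz 1 by (simp add: bez_def dot_def)
      next
        case 2
        then have "cap S (d' - (0, 1)) (G 0)" using Hirz nn2 by (auto simp: cap_def cfk)
        then show ?thesis using peel[of "(0, 1)" secF] Hirz by (simp add: elem_def secF_def)
      next
        case 3
        then have "cap S (d' - (1, 0)) (G 0)" using Hirz nn2 by (auto simp: cap_def cfk)
        then show ?thesis using peel[of "(1, 0)" "infF S"] Hirz by (simp add: elem_def infF_def fdeg_def)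
      qed
    qed
  qed
qed

lemma ev_dvd: "f dvd g \<Longrightarrow> ev f z = 0 \<Longrightarrow> ev g z = 0"
  by (auto elim!: dvdE)

lemma common_elem_infinite:
  assumes "elem S de e" "\<And>c. c \<in> charts S \<Longrightarrow> e c dvd F c" "\<And>c. c \<in> charts S \<Longrightarrow> e c dvd G c"
  shows "infinite (cz S F G)"
proof
  assume "finite (cz S F G)"
  moreover have "{(c, u, v). on_surface S (Proper c u v) \<and> ev (e c) (u, v) = 0} \<subseteq> cz S F G"
    using assms(2,3) by (auto simp: cz_def intro: ev_dvd)
  ultimately show False using elem_infinite[OF assms(1)] finite_subset by blast
qed

text \<open>The degree of the homogeneous coordinate \<open>Y\<close>, resp. \<open>Y1\<close>,
  which is \<open>y\<close> in chart 0.\<close>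

definition ydeg :: "surface \<Rightarrow> deg" where
  "ydeg S = (case S of P2 \<Rightarrow> (0, 1) | Hirz \<delta> \<Rightarrow> (- int \<delta>, 1))"

definition mdeg :: "surface \<Rightarrow> nat \<Rightarrow> deg" where
  "mdeg S n = (int n * fst (ydeg S), int n * snd (ydeg S))"

text \<open>Lowering the power of \<open>y\<close> by \<open>r\<close> is division by the
  \<open>r\<close>-th power of the coordinate of degree \<open>ydeg S\<close>; this makes the
  multipliers of the pseudo-division below into sections.\<close>

lemma cap_leading:
  assumes "cap S d f" "r \<le> degree f" "f \<noteq> 0"
  shows "cap S (d - mdeg S r) (monom (lead_coeff f) (degree f - r))"
  unfolding cap_def
proof (intro allI impI)
  fix i j assume "cf (monom (lead_coeff f) (degree f - r)) i j \<noteq> 0"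
  then have "cf f i (degree f) \<noteq> 0" "j = degree f - r"
    by (auto simp: cf_def split: if_splits)
  then show "case S of P2 \<Rightarrow> int i + int j \<le> snd (d - mdeg S r)
      | Hirz \<delta> \<Rightarrow> int j \<le> snd (d - mdeg S r) \<and> int i \<le> fst (d - mdeg S r) + int \<delta> * int j"
    using assms(1,2) unfolding cap_def
    by (cases S) (force simp: mdeg_def ydeg_def algebra_simps of_nat_diff)+
qed

text \<open>Euclid's algorithm in \<open>y\<close>. With \<open>C\<close> the leading coefficient of
  \<open>G\<close> and \<open>K\<close> that of \<open>F\<close> times a power of \<open>y\<close>,
  the section \<open>C F - K G\<close> has smaller \<open>y\<close>-degree and meets
  \<open>G\<close> in the same number as \<open>C F\<close>; the contribution of \<open>C\<close> is
  known from the elementary case and is subtracted. The inner induction removes elementary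
  components of \<open>G\<close>, which leaves the \<open>y\<close>-degrees unchanged.\<close>

theorem bezout:
  assumes "sec S d F" "F 0 \<noteq> 0" "sec S d' G" "G 0 \<noteq> 0" "finite (cz S F G)"
  shows "bez S F G (dot S d d')"
  using assms
proof (induction "degree (F 0) + degree (G 0)" arbitrary: F G d d' rule: less_induct)
  case outer: less
  have main: "bez S F' G' (dot S d d')"
    if "degree (F' 0) + degree (G' 0) = degree (F 0) + degree (G 0)" "degree (G' 0) \<le> degree (F' 0)"
      "sec S d F'" "F' 0 \<noteq> 0" "sec S d' G'" "G' 0 \<noteq> 0" "finite (cz S F' G')" for F' G' d d'
    using that
  proof (induction "nat (dsize S d')" arbitrary: G' d' rule: less_induct)
    case less
    note sF = less.prems(3) and F0 = less.prems(4) and sG = less.prems(5) and G0 = less.prems(6)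
      and fin = less.prems(7)
    have peel: ?case if e: "elem S de e" and G'': "sec S (d' - de) G''" "\<forall>c\<in>charts S. G' c = e c * G'' c" for de e G''
    proof -
      have b1: "bez S F' e (dot S d de)"
      proof (rule ccontr)
        assume "\<not> bez S F' e (dot S d de)"
        then obtain F'' where "\<forall>c\<in>charts S. F' c = e c * F'' c" using elem_dichotomy[OF e sF] by blast
        then have "infinite (cz S F' G')" using G'' by (intro common_elem_infinite[OF e]) auto
        then show False using fin by simp
      qed
      have eq0: "G' 0 = e 0 * G'' 0" using G''(2) chart0 by blast
      then have G''0: "G'' 0 \<noteq> 0" using G0 by auto
      have deg: "degree (G'' 0) = degree (G' 0)"
        using eq0 G''0 elem_0[OF e] by (simp add: degree_mult_eq)
      have "nat (dsize S (d' - de)) < nat (dsize S d')"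
        using elem_dsize[OF e, of d'] cap_dsize[OF sec_cap[OF G''(1)] G''0] by linarith
      moreover have "cz S F' G'' \<subseteq> cz S F' G'" using G''(2) by (auto simp: cz_def)
      then have "finite (cz S F' G'')" using fin finite_subset by blast
      ultimately have b2: "bez S F' G'' (dot S d (d' - de))"
        using less.hyps[OF _ _ _ sF F0 G''(1) G''0] less.prems(1,2) deg by simp
      have "bez S F' (\<lambda>c. e c * G'' c) (dot S d de + dot S d (d' - de))"
        using elem_nonzero[OF e] sec_nonzero[OF sF] sec_nonzero[OF G''(1)] F0 G''0 b1 b2
        by (intro bez_mult) auto
      then have "bez S F' G' (dot S d de + dot S d (d' - de))"
        by (rule bez_cong[rotated]) (simp add: G''(2))
      then show ?thesis by (simp add: dot_diff_right)
    qed
    show ?case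
    proof (cases "degree (G' 0) = 0")
      case True
      then consider "bez S F' G' (dot S d d')" |
        de e F'' where "elem S de e" "\<forall>c\<in>charts S. F' c = e c * F'' c" "\<forall>c\<in>charts S. e c dvd G' c"
        using bez_elementary[OF sF F0 sG G0] by blast
      then show ?thesis
      proof cases
        case 2
        then have "infinite (cz S F' G')" by (intro common_elem_infinite[OF 2(1)]) auto
        then show ?thesis using fin by simp
      qed
    next
      case False
      define r where "r = degree (G' 0)"
      define s where "s = degree (F' 0)"
      have rs: "r \<le> s" "r > 0" using False less.prems(2) by (simp_all add: r_def s_def)
      define D where "D = mdeg S r"
      have "cap S (d' - D) (monom (lead_coeff (G' 0)) (r - r))"
        unfolding D_def r_def by (rule cap_leading[OF sec_cap[OF sG] order_refl G0])
      then have "cap S (d' - D) [:lead_coeff (G' 0):]" by (simp add: monom_0)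
      then obtain C where C: "sec S (d' - D) C" "C 0 = [:lead_coeff (G' 0):]"
        using sec_extend by blast
      have "cap S (d - D) (monom (lead_coeff (F' 0)) (s - r))"
        unfolding D_def s_def using rs by (intro cap_leading[OF sec_cap[OF sF] _ F0]) (simp add: s_def)
      then obtain K where K: "sec S (d - D) K" "K 0 = monom (lead_coeff (F' 0)) (s - r)"
        using sec_extend by blast
      have C0: "C 0 \<noteq> 0" using C G0 by simp
      \<comment> \<open>\<open>C\<close> and \<open>G'\<close> may share an elementary component; in
        that case it is split off first.\<close>
      from bez_elementary[OF sG G0 C(1) C0] C(2)
      consider (ok) "bez S G' C (dot S d' (d' - D))"
        | (peel) de e G'' where "elem S de e" "sec S (d' - de) G''" "\<forall>c\<in>charts S. G' c = e c * G'' c"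
        by fastforce
      then show ?thesis
      proof cases
        case peel
        then show ?thesis using \<open>\<And>G'' e de. elem S de e \<Longrightarrow> sec S (d' - de) G'' \<Longrightarrow> \<forall>c\<in>charts S. G' c = e c * G'' c \<Longrightarrow> bez S F' G' (dot S d d')\<close> by blast
      next
        case ok
        define F1 where "F1 c = C c * F' c - K c * G' c" for c
        have s1: "sec S (d' - D + d) (\<lambda>c. C c * F' c)" by (rule sec_mult[OF C(1) sF])
        have s2: "sec S (d - D + d') (\<lambda>c. K c * G' c)" by (rule sec_mult[OF K(1) sG])
        have deq: "d - D + d' = d' - D + d" by simp
        have sF1: "sec S (d' - D + d) F1" unfolding F1_def using s1 s2[unfolded deq] by (rule sec_diff)
        have finCF: "finite (cz S G' (\<lambda>c. C c * F' c))"
          using ok fin by (simp add: cz_mult bez_def cz_sym[of S G' F'])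
        have czF1: "cz S G' F1 = cz S G' (\<lambda>c. C c * F' c)" by (auto simp: cz_def F1_def)
        \<comment> \<open>Otherwise every zero of \<open>G'\<close>, of which there are infinitely
          many, would be a common zero with \<open>C F'\<close>.\<close>
        have F10: "F1 0 \<noteq> 0"
        proof
          assume "F1 0 = 0"
          then have "\<And>c. c \<in> charts S \<Longrightarrow> F1 c = 0" using sec_nonzero[OF sF1] by blast
          then have "(\<lambda>(u, v). (0, u, v)) ` {z. ev (G' 0) z = 0} \<subseteq> cz S G' F1"
            using chart0 by (auto simp: cz_def)
          then have "finite ((\<lambda>(u, v). (0 :: nat, u, v)) ` {z. ev (G' 0) z = 0})"
            using finCF finite_subset unfolding czF1 by blast
          then have "finite {z. ev (G' 0) z = 0}" by (rule finite_imageD) (auto simp: inj_on_def)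
          moreover have "\<not> G' 0 dvd 1" using False by (auto simp: is_unit_poly_iff)
          ultimately show False using nonunit_infinite_zeros[OF G0] by blast
        qed
        have degF1: "degree (F1 0) < s"
        proof -
          have "coeff (F1 0) j = 0" if "j \<ge> s" for j
          proof (cases "j = s")
            case True
            have "coeff (K 0 * G' 0) s = lead_coeff (F' 0) * coeff (G' 0) r"
              unfolding K(2) using rs by (simp add: coeff_monom_mult)
            then show ?thesis using True by (simp add: F1_def C(2) s_def r_def)
          next
            case False
            then have j: "j > s" using that by simp
            then have "coeff (F' 0) j = 0" by (simp add: s_def coeff_eq_0)
            moreover have "coeff (G' 0) (j - (s - r)) = 0" using j rs by (intro coeff_eq_0) (simp add: r_def)
            ultimately show ?thesis using j by (simp add: F1_def C(2) K(2) coeff_monom_mult)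
          qed
          then show ?thesis using rs F10 by (metis leading_coeff_0_iff not_le)
        qed
        have "bez S F1 G' (dot S (d' - D + d) d')"
        proof (rule outer.hyps[OF _ sF1 F10 sG G0])
          show "degree (F1 0) + degree (G' 0) < degree (F 0) + degree (G 0)"
            using degF1 less.prems(1) by (simp add: s_def)
          show "finite (cz S F1 G')" using finCF czF1 cz_sym by metis
        qed
        then have b: "bez S G' F1 (dot S (d' - D + d) d')" by (rule bez_sym)
        have nzG: "G' c \<noteq> 0" and nzF: "F' c \<noteq> 0" and nzC: "C c \<noteq> 0" and nzF1: "F1 c \<noteq> 0"
          if "c \<in> charts S" for c
          using sec_nonzero[OF sG that] sec_nonzero[OF sF that] sec_nonzero[OF C(1) that]
            sec_nonzero[OF sF1 that] G0 F0 C0 F10 by auto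
        have "bez S G' (\<lambda>c. F1 c + K c * G' c) (dot S (d' - D + d) d')"
          by (rule bez_add_multiple[OF _ b]) (use nzG nzF nzC nzF1 in \<open>auto simp: F1_def\<close>)
        then have "bez S G' (\<lambda>c. C c * F' c) (dot S (d' - D + d) d')"
          by (rule bez_cong[rotated]) (simp add: F1_def)
        then have "bez S G' F' (dot S (d' - D + d) d' - dot S d' (d' - D))"
          using ok nzG nzF nzC by (intro bez_cancel[where G = C]) auto
        then have "bez S F' G' (dot S (d' - D + d) d' - dot S d' (d' - D))" by (rule bez_sym)
        moreover have "dot S (d' - D + d) d' - dot S d' (d' - D) = dot S d d'"
          using dot_sym[of S d' "d' - D"] by (simp add: dot_add_left)
        ultimately show ?thesis by simp
      qed
    qed
  qed
  show ?case
  proof (cases "degree (G 0) \<le> degree (F 0)")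
    case True
    then show ?thesis using main[of F G d d'] outer.prems by simp
  next
    case False
    then have "bez S G F (dot S d' d)"
      using main[of G F d' d] outer.prems by (simp add: cz_sym[of S G F])
    then show ?thesis by (subst dot_sym) (rule bez_sym)
  qed
qed

section \<open>Pullback of foliations: the exceptional exponent, coprimality, stability of
  non-ordinary points\<close>

section \<open>Blowups of foliations\<close>

lemma pullback_bl:
  "pullback w bX (bX * (bY + bconst t)) =
     (pb (Some t) (fst w) + (bY + bconst t) * pb (Some t) (snd w), bX * pb (Some t) (snd w))"
  "pullback w (bX * bY) bY =
     (bY * pb None (fst w), bX * pb None (fst w) + pb None (snd w))"
  by (simp_all add: pullback_def pb_def d_simps mult.commute)

lemma pb_axes: "pb (Some t) bX = bX" "pb (Some t) bY = bX * (bY + bconst t)"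
  "pb None bX = bX * bY" "pb None bY = bY"
  by (simp_all add: pb_def)

lemma dx_pb: "dx (pb (Some t) f) = pb (Some t) (dx f) + (bY + bconst t) * pb (Some t) (dy f)"
  "dx (pb None f) = bY * pb None (dx f)"
  and dy_pb: "dy (pb (Some t) f) = bX * pb (Some t) (dy f)"
  "dy (pb None f) = bX * pb None (dx f) + pb None (dy f)"
  by (simp_all add: pb_def dx_bsubst dy_bsubst d_simps algebra_simps)

subsection \<open>The order of a form and the exponent of the exceptional curve\<close>

lemma oge_nu:
  assumes "w \<noteq> (0, 0)"
  shows "n \<le> nu_form w \<longleftrightarrow> oge n (fst w) \<and> oge n (snd w)"
proof -
  let ?P = "\<lambda>n. hpart n (fst w) \<noteq> 0 \<or> hpart n (snd w) \<noteq> 0"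
  have "\<exists>n. ?P n" using assms hpart_nonzero by (cases w) auto
  then have "?P (nu_form w)" unfolding nu_form_def by (rule LeastI_ex)
  moreover have "k < nu_form w \<Longrightarrow> \<not> ?P k" for k
    unfolding nu_form_def using not_less_Least by blast
  ultimately show ?thesis unfolding oge_hpart by (meson less_le_trans not_le)
qed

text \<open>The contraction of the form with the radial vector field. Its part of degree
  \<open>nu_form w + 1\<close> is the polynomial in the definition of terminal dicritical
  points.\<close>

definition eul :: "form \<Rightarrow> bipoly" where "eul w = bX * fst w + bY * snd w"

lemma cf_bX: "cf (bX * f) i j = (if i = 0 then 0 else cf f (i - 1) j)"
  and cf_bY: "cf (bY * f) i j = (if j = 0 then 0 else cf f i (j - 1))"
proof -
  have "bX * f = smult [:0, 1:] f" by (simp add: bX_def)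
  then show "cf (bX * f) i j = (if i = 0 then 0 else cf f (i - 1) j)"
    by (cases i) (simp_all add: cf_def)
  have "bY * f = pCons 0 f" by (simp add: bY_def)
  then show "cf (bY * f) i j = (if j = 0 then 0 else cf f i (j - 1))"
    by (cases j) (simp_all add: cf_def)
qed

lemma hpart_eul: "bX * hpart m (fst w) + bY * hpart m (snd w) = hpart (Suc m) (eul w)"
proof (rule cf_ext)
  fix i j
  show "cf (bX * hpart m (fst w) + bY * hpart m (snd w)) i j = cf (hpart (Suc m) (eul w)) i j"
    by (cases i; cases j) (simp_all add: eul_def cf_bX cf_bY cf_hpart)
qed

lemma oge_eul: "oge n (fst w) \<Longrightarrow> oge n (snd w) \<Longrightarrow> oge (Suc n) (eul w)"
  unfolding oge_def eul_def
proof (intro allI impI)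
  fix i j
  assume "\<forall>i j. i + j < n \<longrightarrow> cf (fst w) i j = 0" "\<forall>i j. i + j < n \<longrightarrow> cf (snd w) i j = 0" "i + j < Suc n"
  then show "cf (bX * fst w + bY * snd w) i j = 0"
    by (cases i; cases j) (simp_all add: cf_bX cf_bY)
qed

text \<open>The parts of degree up to \<open>nu_form w\<close> vanish anyway. Vanishing of the next
  one forces a singular point: at a regular point it is the nonzero linear form built from the two
  constant terms.\<close>

lemma terminal_dicritical_iff:
  assumes "w \<noteq> (0, 0)"
  shows "terminal_dicritical w \<longleftrightarrow> oge (nu_form w + 2) (eul w)"
proof -
  have nu: "oge (nu_form w) (fst w)" "oge (nu_form w) (snd w)" using oge_nu[OF assms, of "nu_form w"] by auto
  have "oge (nu_form w + 2) (eul w) \<longleftrightarrow> hpart (Suc (nu_form w)) (eul w) = 0"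
    using oge_eul[OF nu] by (simp add: oge_hpart All_less_Suc)
  moreover have "nu_form w \<ge> 1" if "hpart (Suc (nu_form w)) (eul w) = 0"
  proof (rule ccontr)
    assume "\<not> nu_form w \<ge> 1"
    then have 0: "nu_form w = 0" by simp
    then have "cf (eul w) 1 0 = 0" "cf (eul w) 0 1 = 0" using that by (auto simp: hpart_eq_0_iff)
    then have "oge 1 (fst w)" "oge 1 (snd w)" by (simp_all add: eul_def cf_bX cf_bY oge_def)
    then show False using oge_nu[OF assms, of 1] 0 by simp
  qed
  ultimately show ?thesis unfolding terminal_dicritical_def Let_def hpart_eul by blast
qed

text \<open>The power of the exceptional equation contained in the pullback of the form; it is the
  coefficient \<open>\<nu> + \<epsilon>\<close> of the class of the foliation on the blown-up
  surface.\<close>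

definition kexp :: "form \<Rightarrow> nat" where
  "kexp w = nu_form w + (if terminal_dicritical w then 1 else 0)"

text \<open>By the relation \<open>x a + y b = 0\<close> between the parts of degree
  \<open>nu_form w\<close>, one of them vanishes only together with the other, and they do not both
  vanish.\<close>

lemma dic_oge:
  assumes "w \<noteq> (0, 0)" "terminal_dicritical w" "oge (Suc (nu_form w)) (snd w) \<or> oge (Suc (nu_form w)) (fst w)"
  shows False
proof -
  have e: "oge (nu_form w + 2) (eul w)" using assms terminal_dicritical_iff by blast
  have nn: "\<not> (oge (Suc (nu_form w)) (fst w) \<and> oge (Suc (nu_form w)) (snd w))"
    using oge_nu[OF assms(1), of "Suc (nu_form w)"] by simp
  have "oge (Suc (nu_form w)) (fst w)" if "oge (Suc (nu_form w)) (snd w)"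
    unfolding oge_def
  proof (intro allI impI)
    fix i j assume ij: "i + j < Suc (nu_form w)"
    have "cf (eul w) (Suc i) j = 0" using e ij by (simp add: oge_def)
    moreover have "j \<noteq> 0 \<Longrightarrow> cf (snd w) (Suc i) (j - 1) = 0" using that ij by (simp add: oge_def)
    ultimately show "cf (fst w) i j = 0" by (auto simp: eul_def cf_bX cf_bY split: if_splits)
  qed
  moreover have "oge (Suc (nu_form w)) (snd w)" if "oge (Suc (nu_form w)) (fst w)"
    unfolding oge_def
  proof (intro allI impI)
    fix i j assume ij: "i + j < Suc (nu_form w)"
    have "cf (eul w) i (Suc j) = 0" using e ij by (simp add: oge_def)
    moreover have "i \<noteq> 0 \<Longrightarrow> cf (fst w) (i - 1) (Suc j) = 0" using that ij by (simp add: oge_def)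
    ultimately show "cf (snd w) i j = 0" by (auto simp: eul_def cf_bX cf_bY split: if_splits)
  qed
  ultimately show False using assms(3) nn by blast
qed

lemma exc_power_dvd_pullback:
  assumes "w \<noteq> (0, 0)"
  defines "P d \<equiv> pullback w (bl_x d) (bl_y d)"
  shows "exc_eq d ^ j dvd fst (P d) \<and> exc_eq d ^ j dvd snd (P d) \<longleftrightarrow> j \<le> kexp w"
proof -
  let ?n = "nu_form w" and ?E = "exc_eq d"
  obtain X Y where XY: "fst (P d) = X" "snd (P d) = Y" by simp
  \<comment> \<open>\<open>p\<close> is the component at the differential of the exceptional
    equation: the radial contraction pulls back to \<open>?E * p\<close>, while the other component
    is \<open>?E\<close> times the pullback of a coefficient.\<close>
  define p where "p = (case d of None \<Rightarrow> Y | Some t \<Rightarrow> X)"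
  define q where "q = (case d of None \<Rightarrow> X | Some t \<Rightarrow> Y)"
  define r where "r = (case d of None \<Rightarrow> fst w | Some t \<Rightarrow> snd w)"
  have pe: "pb d (eul w) = ?E * p" and q: "q = ?E * pb d r"
  proof -
    show "pb d (eul w) = ?E * p"
    proof (cases d)
      case None
      have "p = bX * pb None (fst w) + pb None (snd w)"
        using XY None by (simp add: P_def pullback_bl p_def)
      then show ?thesis by (simp add: None eul_def pb_axes distrib_left mult_ac)
    next
      case (Some t)
      have "p = pb (Some t) (fst w) + (bY + bconst t) * pb (Some t) (snd w)"
        using XY Some by (simp add: P_def pullback_bl p_def)
      then show ?thesis by (simp add: Some eul_def pb_axes distrib_left distrib_right mult_ac)
    qed
    show "q = ?E * pb d r"
      using XY by (cases d) (simp_all add: P_def pullback_bl q_def r_def)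
  qed
  have nu: "oge ?n (fst w)" "oge ?n (snd w)" using oge_nu[OF assms(1), of ?n] by auto
  have r: "oge ?n r" using nu by (simp add: r_def split: option.split)
  have p_iff: "?E ^ i dvd p \<longleftrightarrow> oge (Suc i) (eul w)" for i
    unfolding exc_power_dvd_pb[of d, symmetric] pe by simp
  have q_iff: "?E ^ Suc i dvd q \<longleftrightarrow> oge i r" for i
    unfolding exc_power_dvd_pb[of d, symmetric] q by simp
  have "?E ^ kexp w dvd p \<and> ?E ^ kexp w dvd q"
  proof (cases "terminal_dicritical w")
    case True
    then show ?thesis using terminal_dicritical_iff[OF assms(1)] q_iff[of ?n] p_iff[of "Suc ?n"] r
      by (simp add: kexp_def)
  next
    case False
    have "?E ^ ?n dvd q" using q_iff[of ?n] r by (simp add: dvd_mult_right)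
    then show ?thesis using False p_iff[of ?n] oge_eul[OF nu] by (simp add: kexp_def)
  qed
  moreover have "\<not> (?E ^ Suc (kexp w) dvd p \<and> ?E ^ Suc (kexp w) dvd q)"
  proof
    assume *: "?E ^ Suc (kexp w) dvd p \<and> ?E ^ Suc (kexp w) dvd q"
    show False
    proof (cases "terminal_dicritical w")
      case True
      then have "oge (Suc ?n) r" using * q_iff[of "Suc ?n"] by (simp add: kexp_def)
      then show False using dic_oge[OF assms(1) True] by (auto simp: r_def split: option.splits)
    next
      case False
      then have "oge (?n + 2) (eul w)" using * p_iff[of "Suc ?n"] by (simp add: kexp_def)
      then show False using False terminal_dicritical_iff[OF assms(1)] by blast
    qed
  qed
  ultimately have "?E ^ j dvd p \<and> ?E ^ j dvd q \<longleftrightarrow> j \<le> kexp w"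
    by (meson dvd_trans le_imp_power_dvd not_less_eq_eq)
  then show ?thesis using XY by (cases d) (auto simp: p_def q_def)
qed

lemma strict_form:
  assumes "w \<noteq> (0, 0)"
  shows "fst (pullback w (bl_x d) (bl_y d)) = exc_eq d ^ kexp w * fst (strict_form d w)"
    and "snd (pullback w (bl_x d) (bl_y d)) = exc_eq d ^ kexp w * snd (strict_form d w)"
    and "\<not> (exc_eq d dvd fst (strict_form d w) \<and> exc_eq d dvd snd (strict_form d w))"
proof -
  obtain A B where AB: "pullback w (bl_x d) (bl_y d) = (A, B)" by (cases "pullback w (bl_x d) (bl_y d)")
  note iff = exc_power_dvd_pullback[OF assms, of d, unfolded AB fst_conv snd_conv]
  have "(GREATEST k. exc_eq d ^ k dvd A \<and> exc_eq d ^ k dvd B) = kexp w"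
    by (rule Greatest_equality) (simp_all add: iff)
  then have s: "strict_form d w = (A div exc_eq d ^ kexp w, B div exc_eq d ^ kexp w)"
    by (simp add: strict_form_def AB Let_def)
  have dvd: "exc_eq d ^ kexp w dvd A" "exc_eq d ^ kexp w dvd B" using iff[of "kexp w"] by auto
  then have eq: "A = exc_eq d ^ kexp w * fst (strict_form d w)" "B = exc_eq d ^ kexp w * snd (strict_form d w)"
    by (simp_all add: s)
  then show "fst (pullback w (bl_x d) (bl_y d)) = exc_eq d ^ kexp w * fst (strict_form d w)"
    "snd (pullback w (bl_x d) (bl_y d)) = exc_eq d ^ kexp w * snd (strict_form d w)"
    by (simp_all add: AB)
  show "\<not> (exc_eq d dvd fst (strict_form d w) \<and> exc_eq d dvd snd (strict_form d w))"
  proof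
    assume "exc_eq d dvd fst (strict_form d w) \<and> exc_eq d dvd snd (strict_form d w)"
    then have "exc_eq d ^ Suc (kexp w) dvd A \<and> exc_eq d ^ Suc (kexp w) dvd B"
      unfolding eq(1) eq(2) by (simp add: mult_dvd_mono mult.commute)
    then show False by (simp only: iff)
  qed
qed

subsection \<open>Coprimality under blowups\<close>

lemma coprime_finite_zeros: "coprime (f :: bipoly) g \<Longrightarrow> finite {z. ev f z = 0 \<and> ev g z = 0}"
proof (cases "f = 0")
  case True
  assume "coprime f g"
  then have "g dvd 1" using True by simp
  then show ?thesis by (auto simp: bipoly_is_unit_iff)
qed (simp add: coprime_iff_finite_zeros)

lemma bl_inj:
  "inj_on (\<lambda>z. (ev (bl_x d) z, ev (bl_y d) z)) {z. ev (exc_eq d) z \<noteq> 0}"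
  by (cases d) (auto simp: inj_on_def)

text \<open>The blowup map is injective off the exceptional curve, so a common component other than
  that curve would carry infinitely many common zeros down to a coprime pair.\<close>

lemma coprime_blowup:
  assumes "coprime (f :: bipoly) g"
    and "\<And>z. ev (exc_eq d) z \<noteq> 0 \<Longrightarrow> ev F z = 0 \<Longrightarrow> ev G z = 0 \<Longrightarrow> ev (pb d f) z = 0 \<and> ev (pb d g) z = 0"
    and "\<not> (exc_eq d dvd F \<and> exc_eq d dvd G)"
  shows "coprime F G"
  unfolding coprime_prime_iff
proof (intro conjI notI)
  assume "F = 0 \<and> G = 0"
  then show False using assms(3) by simp
next
  assume "\<exists>\<phi>. prime_elem \<phi> \<and> \<phi> dvd F \<and> \<phi> dvd G"
  then obtain \<phi> where phi: "prime_elem \<phi>" "\<phi> dvd F" "\<phi> dvd G" by blast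
  let ?Z = "{z. ev \<phi> z = 0 \<and> ev (exc_eq d) z \<noteq> 0}"
  let ?b = "\<lambda>z. (ev (bl_x d) z, ev (bl_y d) z)"
  have "\<not> \<phi> dvd exc_eq d"
  proof
    assume "\<phi> dvd exc_eq d"
    then obtain k where k: "exc_eq d = \<phi> * k" by (blast elim: dvdE)
    then have "k dvd 1" using irreducibleD[OF prime_elem_imp_irreducible[OF prime_exc] k] phi(1)
      by (auto simp: prime_elem_def)
    then have "exc_eq d dvd \<phi>" using k by (simp add: mult_unit_dvd_iff)
    then show False using phi(2,3) assms(3) dvd_trans by blast
  qed
  then have "finite {z. ev \<phi> z = 0 \<and> ev (exc_eq d) z = 0}" by (rule prime_finite_common_zeros[OF phi(1)])
  moreover have "{z. ev \<phi> z = 0} \<subseteq> ?Z \<union> {z. ev \<phi> z = 0 \<and> ev (exc_eq d) z = 0}" by auto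
  ultimately have "infinite ?Z"
    using prime_infinite_zeros[OF phi(1)] finite_subset finite_UnI by blast
  moreover have "inj_on ?b ?Z" by (rule inj_on_subset[OF bl_inj]) auto
  ultimately have "infinite (?b ` ?Z)" using finite_imageD by blast
  moreover have "?b ` ?Z \<subseteq> {z. ev f z = 0 \<and> ev g z = 0}"
    using assms(2) phi(2,3) ev_dvd by (fastforce simp: pb_def)
  ultimately show False using coprime_finite_zeros[OF assms(1)] finite_subset by blast
qed

lemma coprime_ne_0: "coprime (a :: bipoly) b \<Longrightarrow> (a, b) \<noteq> (0, 0)"
  by auto

lemma coprime_strict_form:
  assumes "coprime (fst w) (snd w)"
  shows "coprime (fst (strict_form d w)) (snd (strict_form d w))"
proof (rule coprime_blowup[OF assms])
  have w: "w \<noteq> (0, 0)" using assms by auto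
  note s = strict_form[OF w, of d]
  show "\<not> (exc_eq d dvd fst (strict_form d w) \<and> exc_eq d dvd snd (strict_form d w))" by (rule s(3))
  fix z assume z: "ev (exc_eq d) z \<noteq> 0" "ev (fst (strict_form d w)) z = 0" "ev (snd (strict_form d w)) z = 0"
  have "ev (fst (pullback w (bl_x d) (bl_y d))) z = 0" "ev (snd (pullback w (bl_x d) (bl_y d))) z = 0"
    using z by (simp_all add: s(1,2))
  then show "ev (pb d (fst w)) z = 0 \<and> ev (pb d (snd w)) z = 0"
    using z(1) by (cases d) (auto simp: pullback_bl)
qed

subsection \<open>Non-ordinary points stay non-ordinary\<close>

definition adm :: "complex \<Rightarrow> complex \<Rightarrow> bool" where
  "adm l1 l2 \<longleftrightarrow> (l1 * l2 \<noteq> 0 \<and> l1 / l2 \<notin> of_rat ` {r. 0 < r} \<or> l1 * l2 = 0 \<and> l1\<^sup>2 + l2\<^sup>2 \<noteq> 0)"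

lemma adm_sym: "adm l1 l2 \<Longrightarrow> adm l2 l1"
proof -
  have "l1 / l2 \<in> of_rat ` {r. 0 < r}" if "l2 / l1 \<in> of_rat ` {r. 0 < r}"
  proof -
    from that obtain r where "l2 / l1 = of_rat r" "r > 0" by auto
    then have "l1 / l2 = of_rat (1 / r)" by (metis inverse_divide inverse_eq_divide of_rat_inverse)
    then show ?thesis using \<open>r > 0\<close> by (intro image_eqI[of _ _ "1 / r"]) auto
  qed
  then show "adm l1 l2 \<Longrightarrow> adm l2 l1" by (auto simp: adm_def mult.commute add.commute)
qed

text \<open>These are the eigenvalues of the saddle that appears over a regular point.\<close>

lemma adm_neg: "c \<noteq> 0 \<Longrightarrow> adm c (- c)"
proof -
  assume c: "c \<noteq> 0"
  have "c / - c \<notin> of_rat ` {r. 0 < r}"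
  proof
    assume "c / - c \<in> of_rat ` {r. 0 < r}"
    then obtain r where r: "(-1 :: complex) = of_rat r" "r > 0" using c by auto
    then have "of_rat (-1) = (of_rat r :: complex)" by simp
    then have "r = -1" by (metis of_rat_eq_iff)
    then show False using r by simp
  qed
  then show ?thesis using c by (simp add: adm_def)
qed

lemma adm_refl: "\<not> adm c c"
proof -
  have "(1 :: complex) \<in> of_rat ` {r. 0 < r}" by (rule image_eqI[of _ _ 1]) auto
  then show ?thesis by (cases "c = 0") (auto simp: adm_def)
qed

text \<open>Blowing up changes the eigenvalues in this way. A positive rational quotient
  \<open>r\<close> afterwards would come from the quotient \<open>r / (r + 1)\<close>
  before.\<close>

lemma adm_diff: assumes "adm l1 l2" shows "adm l1 (l2 - l1)"
proof (cases "l1 = 0 \<or> l2 = 0")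
  case True
  then show ?thesis using assms adm_neg[of l1] by (auto simp: adm_def)
next
  case False
  then have ne: "l1 \<noteq> l2" using assms adm_refl by auto
  have "l1 / (l2 - l1) \<notin> of_rat ` {r. 0 < r}"
  proof
    assume "l1 / (l2 - l1) \<in> of_rat ` {r. 0 < r}"
    then obtain r where r: "l1 / (l2 - l1) = of_rat r" "r > 0" by auto
    have r1: "of_rat r + 1 \<noteq> (0 :: complex)"
    proof -
      have "of_rat (r + 1) \<noteq> (0 :: complex)" using r(2) by (simp only: of_rat_eq_0_iff)
      then show ?thesis by (simp add: of_rat_add)
    qed
    have "l1 = of_rat r * (l2 - l1)" using r ne by (simp add: field_simps)
    then have "l1 * (of_rat r + 1) = of_rat r * l2" by (simp add: algebra_simps)
    then have "l1 / l2 = of_rat r / (of_rat r + 1)" using False r1 by (simp add: field_simps)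
    also have "\<dots> = of_rat (r / (r + 1))" by (simp add: of_rat_divide of_rat_add)
    finally have "l1 / l2 \<in> of_rat ` {r. 0 < r}" using r(2) by auto
    then show False using assms False by (simp add: adm_def)
  qed
  then show ?thesis using False ne by (simp add: adm_def)
qed

lemma linear_matrix_eigenvalues:
  "eigenvalues2 (linear_matrix w) l1 l2 \<longleftrightarrow>
     l1 + l2 = cf (snd w) 1 0 - cf (fst w) 0 1 \<and>
     l1 * l2 = cf (snd w) 0 1 * cf (fst w) 1 0 - cf (snd w) 1 0 * cf (fst w) 0 1"
proof -
  let ?p = "cf (snd w) 1 0" and ?q = "cf (snd w) 0 1" and ?r = "cf (fst w) 1 0" and ?s = "cf (fst w) 0 1"
  have J: "linear_matrix w = vector [vector [?p, ?q], vector [- ?r, - ?s]]"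
    unfolding linear_matrix_def Let_def cf_10[symmetric] cf_01[symmetric] by (simp add: cf_hpart)
  have "det (mat t - linear_matrix w) = (t - ?p) * (t + ?s) + ?q * ?r" for t
    by (simp add: det_2 J mat_def algebra_simps)
  then have "eigenvalues2 (linear_matrix w) l1 l2 \<longleftrightarrow>
      (\<forall>t. (t - ?p) * (t + ?s) + ?q * ?r = (t - l1) * (t - l2))"
    by (simp add: eigenvalues2_def)
  also have "\<dots> \<longleftrightarrow> l1 + l2 = ?p - ?s \<and> l1 * l2 = ?q * ?r - ?p * ?s"
  proof (intro iffI allI conjI)
    assume *: "\<forall>t. (t - ?p) * (t + ?s) + ?q * ?r = (t - l1) * (t - l2)"
    show 1: "l1 * l2 = ?q * ?r - ?p * ?s" using *[rule_format, of 0] by simp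
    show "l1 + l2 = ?p - ?s" using *[rule_format, of 1] 1 by (simp add: algebra_simps)
  next
    fix t assume *: "l1 + l2 = ?p - ?s \<and> l1 * l2 = ?q * ?r - ?p * ?s"
    have "(t - l1) * (t - l2) = t * t - t * (l1 + l2) + l1 * l2" by (simp add: algebra_simps)
    then show "(t - ?p) * (t + ?s) + ?q * ?r = (t - l1) * (t - l2)"
      using * by (simp add: algebra_simps)
  qed
  finally show ?thesis .
qed

lemma nu_ge_1: "w \<noteq> (0, 0) \<Longrightarrow> nu_form w \<ge> 1 \<longleftrightarrow> cf (fst w) 0 0 = 0 \<and> cf (snd w) 0 0 = 0"
  by (simp add: oge_nu oge_def)

text \<open>Multiplicity one follows from the eigenvalues: with a vanishing linear part both would
  be \<open>0\<close>, contrary to \<open>adm\<close>.\<close>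

lemma simple_singI:
  assumes "w \<noteq> (0, 0)" "cf (fst w) 0 0 = 0" "cf (snd w) 0 0 = 0" "adm l1 l2"
    "l1 + l2 = cf (snd w) 1 0 - cf (fst w) 0 1"
    "l1 * l2 = cf (snd w) 0 1 * cf (fst w) 1 0 - cf (snd w) 1 0 * cf (fst w) 0 1"
  shows "simple_sing w"
proof -
  have "\<not> nu_form w \<ge> 2"
  proof
    assume "nu_form w \<ge> 2"
    then have "oge 2 (fst w)" "oge 2 (snd w)" using oge_nu[OF assms(1)] by auto
    then have "cf (fst w) 0 1 = 0" "cf (snd w) 1 0 = 0" "cf (fst w) 1 0 = 0" "cf (snd w) 0 1 = 0"
      by (simp_all add: oge_def)
    then have "l1 + l2 = 0" "l1 * l2 = 0" using assms(5,6) by simp_all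
    then have "l1 = 0 \<and> l2 = 0" by auto
    then show False using assms(4) by (simp add: adm_def)
  qed
  moreover have "nu_form w \<ge> 1" using assms nu_ge_1 by blast
  ultimately have "nu_form w = 1" by simp
  then show ?thesis
    unfolding simple_sing_def linear_matrix_eigenvalues using assms(4-6) unfolding adm_def by blast
qed

lemma simple_singD:
  assumes "w \<noteq> (0, 0)" "simple_sing w"
  obtains l1 l2 where "nu_form w = 1" "cf (fst w) 0 0 = 0" "cf (snd w) 0 0 = 0" "adm l1 l2"
    "l1 + l2 = cf (snd w) 1 0 - cf (fst w) 0 1"
    "l1 * l2 = cf (snd w) 0 1 * cf (fst w) 1 0 - cf (snd w) 1 0 * cf (fst w) 0 1"
proof -
  from assms(2) obtain l1 l2 where *: "nu_form w = 1" "adm l1 l2" "eigenvalues2 (linear_matrix w) l1 l2"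
    unfolding simple_sing_def adm_def by blast
  then show ?thesis using that nu_ge_1[OF assms(1)] unfolding linear_matrix_eigenvalues by auto
qed

text \<open>In multiplicity one the dicritical relation makes the linear part a scalar matrix, and
  two equal eigenvalues never satisfy \<open>adm\<close>.\<close>

lemma terminal_dicritical_ordinary:
  assumes "w \<noteq> (0, 0)" "terminal_dicritical w" shows "ordinary_sing w"
  unfolding ordinary_sing_def
proof (intro conjI notI)
  show "1 \<le> nu_form w" using assms(2) by (simp add: terminal_dicritical_def)
  assume "simple_sing w"
  then obtain l1 l2 where *: "nu_form w = 1" "adm l1 l2" "l1 + l2 = cf (snd w) 1 0 - cf (fst w) 0 1"
    "l1 * l2 = cf (snd w) 0 1 * cf (fst w) 1 0 - cf (snd w) 1 0 * cf (fst w) 0 1"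
    using simple_singD[OF assms(1)] by metis
  have "oge 3 (eul w)" using assms terminal_dicritical_iff *(1) by (metis one_add_one add.commute numeral_Bit1 numeral_One add.assoc)
  then have "cf (eul w) 2 0 = 0" "cf (eul w) 0 2 = 0" "cf (eul w) 1 1 = 0" by (simp_all add: oge_def)
  then have z: "cf (fst w) 1 0 = 0" "cf (snd w) 0 1 = 0" "cf (fst w) 0 1 = - cf (snd w) 1 0"
    by (simp_all add: eul_def cf_bX cf_bY add_eq_0_iff2 numeral_2_eq_2)
  let ?c = "cf (snd w) 1 0"
  have "l1 + l2 = 2 * ?c" "l1 * l2 = ?c * ?c" using *(3,4) z by simp_all
  then have "(l1 - ?c) * (l1 - ?c) = 0" "l2 = 2 * ?c - l1" by (algebra, simp add: algebra_simps)
  then have "l1 = ?c" "l2 = ?c" by auto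
  then show False using *(2) adm_refl by simp
qed

lemma cf_11: "cf f 1 1 = ev (dx (dy f)) (0, 0)"
  by (simp add: cf_def ev_def poly_0_coeff_0 dx_def dy_def coeff_map_poly coeff_pderiv)

text \<open>The stability part of Seidenberg's reduction. Over a regular point the only singular
  point lies in the tangent direction and has eigenvalues \<open>c\<close> and \<open>- c\<close>;
  over a simple singularity the singular points lie in the eigendirections, and
  \<open>adm_diff\<close> applies.\<close>

lemma nonordinary_blowup:
  assumes w: "w \<noteq> (0, 0)" and "\<not> ordinary_sing w"
  shows "\<not> ordinary_sing (strict_form d w)"
proof
  assume ord: "ordinary_sing (strict_form d w)"
  have ndic: "\<not> terminal_dicritical w" using terminal_dicritical_ordinary assms by blast
  then have k: "kexp w = nu_form w" by (simp add: kexp_def)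
  let ?w = "strict_form d w"
  note s = strict_form[OF w, of d, unfolded k]
  have w': "?w \<noteq> (0, 0)" using s(3) by auto
  have nu': "cf (fst ?w) 0 0 = 0" "cf (snd ?w) 0 0 = 0"
    using ord nu_ge_1[OF w'] by (simp_all add: ordinary_sing_def)
  have ns: "\<not> simple_sing ?w" using ord by (simp add: ordinary_sing_def)
  let ?a = "fst w" and ?b = "snd w"
  define a00 where "a00 = ev ?a (0, 0)" define b00 where "b00 = ev ?b (0, 0)"
  define a10 where "a10 = ev (dx ?a) (0, 0)" define a01 where "a01 = ev (dy ?a) (0, 0)"
  define b10 where "b10 = ev (dx ?b) (0, 0)" define b01 where "b01 = ev (dy ?b) (0, 0)"
  note defs = a00_def b00_def a10_def a01_def b10_def b01_def
  show False
  proof (cases "nu_form w = 0")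
    case True
    then have ne: "\<not> (a00 = 0 \<and> b00 = 0)" using nu_ge_1[OF w] by (simp add: cf_00 defs)
    show False
    proof (cases d)
      case (Some t)
      have A: "fst ?w = pb d ?a + (bY + bconst t) * pb d ?b" and B: "snd ?w = bX * pb d ?b"
        using s(1,2) True Some by (simp_all add: pullback_bl)
      have "a00 + t * b00 = 0" using nu'(1) unfolding A cf_00 by (simp add: defs)
      then have b0: "b00 \<noteq> 0" using ne by auto
      have "cf (snd ?w) 1 0 = b00" "cf (snd ?w) 0 1 = 0" "cf (fst ?w) 0 1 = b00"
        unfolding cf_10 cf_01 A B by (simp_all add: Some d_simps dx_pb dy_pb defs)
      then show False using ns simple_singI[OF w' nu' adm_neg[OF b0]] by simp
    next
      case None
      have A: "fst ?w = bY * pb d ?a" and B: "snd ?w = bX * pb d ?a + pb d ?b"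
        using s(1,2) True None by (simp_all add: pullback_bl)
      have "b00 = 0" using nu'(2) unfolding B cf_00 by (simp add: defs)
      then have a0: "a00 \<noteq> 0" using ne by auto
      have "cf (snd ?w) 1 0 = a00" "cf (fst ?w) 1 0 = 0" "cf (fst ?w) 0 1 = a00"
        unfolding cf_10 cf_01 A B by (simp_all add: None d_simps dx_pb dy_pb defs)
      then show False using ns simple_singI[OF w' nu' adm_neg[OF a0]] by simp
    qed
  next
    case False
    then have "simple_sing w" using assms(2) by (simp add: ordinary_sing_def)
    from simple_singD[OF w this] obtain l1 l2 where
      nu1: "nu_form w = 1" and z: "a00 = 0" "b00 = 0" and ad: "adm l1 l2"
      and tr: "l1 + l2 = b10 - a01" and dt: "l1 * l2 = b01 * a10 - b10 * a01"
      unfolding cf_00 cf_10 cf_01 defs by metis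
    show False
    proof (cases d)
      case (Some t)
      have A: "bX * fst ?w = pb d ?a + (bY + bconst t) * pb d ?b" and B: "bX * snd ?w = bX * pb d ?b"
        using s(1,2) nu1 Some by (simp_all add: pullback_bl)
      then have B: "snd ?w = pb d ?b" by simp
      \<comment> \<open>\<open>?l\<close> is the eigenvalue of the vector (1, t) once
        \<open>t\<close> is an eigendirection; \<open>?m\<close> is the trace minus
        \<open>2 * ?l\<close>, that is, the other eigenvalue minus \<open>?l\<close>.\<close>
      let ?l = "b10 + t * b01" let ?m = "- (a01 + b10 + 2 * (t * b01))"
      \<comment> \<open>Only \<open>bX * fst ?w\<close> is given explicitly, so each coefficient of
        \<open>fst ?w\<close> is read one power of \<open>x\<close> higher.\<close>
      have "cf (fst ?w) 0 0 = cf (bX * fst ?w) 1 0" by (simp add: cf_bX)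
      also have "\<dots> = a10 + t * a01 + t * ?l"
        unfolding A cf_10 using z by (simp add: Some d_simps dx_pb dy_pb defs)
      finally have q: "a10 + t * a01 + t * ?l = 0" using nu'(1) by simp
      have "cf (fst ?w) 0 1 = cf (bX * fst ?w) 1 1" by (simp add: cf_bX)
      also have "\<dots> = - ?m"
        unfolding A cf_11 using z by (simp add: Some d_simps dx_pb dy_pb defs)
      finally have j1: "cf (fst ?w) 0 1 = - ?m" .
      have j2: "cf (snd ?w) 1 0 = ?l" "cf (snd ?w) 0 1 = 0"
        unfolding cf_10 cf_01 B using z by (simp_all add: Some d_simps dx_pb dy_pb defs)
      have "(?l - l1) * (?l - l2) = ?l * ?l - ?l * (l1 + l2) + l1 * l2" by (simp add: algebra_simps)
      also have "\<dots> = b01 * (a10 + t * a01 + t * ?l)" unfolding tr dt by (simp add: algebra_simps)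
      finally have "?l = l1 \<or> ?l = l2" using q by auto
      moreover have "?m = (l1 + l2) - 2 * ?l" unfolding tr by (simp add: algebra_simps)
      ultimately have "?l = l1 \<and> ?m = l2 - l1 \<or> ?l = l2 \<and> ?m = l1 - l2" by auto
      then have "adm ?l ?m" using adm_diff[OF ad] adm_diff[OF adm_sym[OF ad]] by metis
      moreover have "?l + ?m = cf (snd ?w) 1 0 - cf (fst ?w) 0 1" unfolding j1 j2(1) by simp
      moreover have "?l * ?m = cf (snd ?w) 0 1 * cf (fst ?w) 1 0 - cf (snd ?w) 1 0 * cf (fst ?w) 0 1"
        unfolding j1 j2 mult_zero_left mult_minus_right by simp
      ultimately have "simple_sing ?w" by (rule simple_singI[OF w' nu'])
      then show False using ns by blast
    next
      case None
      have A: "bY * fst ?w = bY * pb d ?a" and B: "bY * snd ?w = bX * pb d ?a + pb d ?b"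
        using s(1,2) nu1 None by (simp_all add: pullback_bl)
      then have A: "fst ?w = pb d ?a" by simp
      have "cf (snd ?w) 0 0 = cf (bY * snd ?w) 0 1" by (simp add: cf_bY)
      also have "\<dots> = b01"
        unfolding B cf_01 using z by (simp add: None d_simps dx_pb dy_pb defs)
      finally have q: "b01 = 0" using nu'(2) by simp
      have "cf (snd ?w) 1 0 = cf (bY * snd ?w) 1 1" by (simp add: cf_bY)
      also have "\<dots> = b10 + a01"
        unfolding B cf_11 using z by (simp add: None d_simps dx_pb dy_pb defs)
      finally have j1: "cf (snd ?w) 1 0 = b10 + a01" .
      have j2: "cf (fst ?w) 1 0 = 0" "cf (fst ?w) 0 1 = a01"
        unfolding cf_10 cf_01 A using z by (simp_all add: None d_simps dx_pb dy_pb defs)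
      have "(- a01 - l1) * (- a01 - l2) = a01 * a01 + a01 * (l1 + l2) + l1 * l2" by (simp add: algebra_simps)
      also have "\<dots> = 0" unfolding tr dt q by (simp add: algebra_simps)
      finally have "- a01 = l1 \<or> - a01 = l2" by auto
      moreover have "b10 + a01 = (l1 + l2) - 2 * (- a01)" unfolding tr by (simp add: algebra_simps)
      ultimately have "- a01 = l1 \<and> b10 + a01 = l2 - l1 \<or> - a01 = l2 \<and> b10 + a01 = l1 - l2" by auto
      then have "adm (- a01) (b10 + a01)" using adm_diff[OF ad] adm_diff[OF adm_sym[OF ad]] by metis
      from simple_singI[OF w' nu' this] show False using ns j1 j2 by (simp add: algebra_simps)
    qed
  qed
qed

section \<open>Pencils: virtual transforms, dicritical points, base points, general members\<close>

section \<open>Pencils of curves and their blowups\<close>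

text \<open>The multiplicity of a general member of the pencil, see
  \<open>general_member\<close>.\<close>

definition pm :: "bipoly \<Rightarrow> bipoly \<Rightarrow> nat" where "pm f g = min (mult0 f) (mult0 g)"

text \<open>The virtual transform: the total transform minus \<open>m\<close> times the exceptional curve.\<close>

definition vt :: "complex option \<Rightarrow> nat \<Rightarrow> bipoly \<Rightarrow> bipoly" where
  "vt d m f = pb d f div exc_eq d ^ m"

lemma vt: "oge m f \<Longrightarrow> pb d f = exc_eq d ^ m * vt d m f"
  unfolding vt_def by (simp add: exc_power_dvd_pb)

lemma vt_strict: "f \<noteq> 0 \<Longrightarrow> m \<le> mult0 f \<Longrightarrow> vt d m f = exc_eq d ^ (mult0 f - m) * strict_curve d f"
proof -
  assume f: "f \<noteq> 0" and m: "m \<le> mult0 f"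
  have "exc_eq d ^ m * (exc_eq d ^ (mult0 f - m) * strict_curve d f) = pb d f"
    unfolding pb_eq_strict[OF f, of d] mult.assoc[symmetric] power_add[symmetric] using m by simp
  then show ?thesis unfolding vt_def by (metis exc_ne_0 nonzero_mult_div_cancel_left power_not_zero)
qed

lemma oge_add: "oge n f \<Longrightarrow> oge n g \<Longrightarrow> oge n (f + g)"
  and oge_bconst: "oge n f \<Longrightarrow> oge n (bconst c * f)"
  by (simp_all add: oge_def)

lemma oge_bconst_iff: "c \<noteq> 0 \<Longrightarrow> oge n (bconst c * f) \<longleftrightarrow> oge n f"
  by (simp add: oge_def)

lemma vt_lin:
  assumes "oge m f" "oge m g"
  shows "vt d m (bconst \<alpha> * f + bconst \<beta> * g) = bconst \<alpha> * vt d m f + bconst \<beta> * vt d m g"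
proof -
  have "oge m (bconst \<alpha> * f + bconst \<beta> * g)" using assms by (intro oge_add oge_bconst)
  from vt[OF this, of d] have "exc_eq d ^ m * vt d m (bconst \<alpha> * f + bconst \<beta> * g) =
      bconst \<alpha> * pb d f + bconst \<beta> * pb d g" by simp
  also have "\<dots> = exc_eq d ^ m * (bconst \<alpha> * vt d m f + bconst \<beta> * vt d m g)"
    by (simp only: vt[OF assms(1), of d] vt[OF assms(2), of d] distrib_left mult_ac)
  finally show ?thesis by simp
qed

lemma exc_dvd_vt: "oge m f \<Longrightarrow> exc_eq d dvd vt d m f \<longleftrightarrow> oge (Suc m) f"
proof -
  assume m: "oge m f"
  have "oge (Suc m) f \<longleftrightarrow> exc_eq d ^ m * exc_eq d dvd exc_eq d ^ m * vt d m f"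
    unfolding exc_power_dvd_pb[of d, symmetric] vt[OF m, of d] by (simp add: mult.commute)
  then show ?thesis by simp
qed

lemma pm_oge: "f \<noteq> 0 \<Longrightarrow> g \<noteq> 0 \<Longrightarrow> oge (pm f g) f \<and> oge (pm f g) g"
  by (simp add: oge_mult0 pm_def)

lemma pm_not_oge: "f \<noteq> 0 \<Longrightarrow> g \<noteq> 0 \<Longrightarrow> \<not> (oge (Suc (pm f g)) f \<and> oge (Suc (pm f g)) g)"
  by (auto simp: oge_mult0 pm_def)

lemma pm_pos_iff: "f \<noteq> 0 \<Longrightarrow> g \<noteq> 0 \<Longrightarrow> pm f g > 0 \<longleftrightarrow> ev f (0, 0) = 0 \<and> ev g (0, 0) = 0"
  unfolding pm_def using mult0_eq_0_iff[of f] mult0_eq_0_iff[of g]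
  by (metis min_less_iff_conj neq0_conv)

lemma vt_ne_0: "f \<noteq> 0 \<Longrightarrow> oge m f \<Longrightarrow> vt d m f \<noteq> 0"
  using vt[of m f d] by (metis mult_zero_right pb_eq_0_iff)

lemma coprime_vt:
  assumes "f \<noteq> 0" "g \<noteq> 0" "coprime f g"
  shows "coprime (vt d (pm f g) f) (vt d (pm f g) g)"
proof (rule coprime_blowup[OF assms(3)])
  note o = pm_oge[OF assms(1,2)]
  show "\<not> (exc_eq d dvd vt d (pm f g) f \<and> exc_eq d dvd vt d (pm f g) g)"
    using o pm_not_oge[OF assms(1,2)] by (simp add: exc_dvd_vt)
  show "ev (pb d f) z = 0 \<and> ev (pb d g) z = 0"
    if "ev (vt d (pm f g) f) z = 0" "ev (vt d (pm f g) g) z = 0" for z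
    using that vt[of "pm f g" f d] vt[of "pm f g" g d] o by simp
qed

text \<open>The same multiple of the exceptional curve is removed from both generators; for the one
  attaining the minimum this is the strict transform, so \<open>NN_virtual\<close> applies.\<close>

lemma
  assumes f: "f \<noteq> 0" and g: "g \<noteq> 0" and fin: "fin f g"
  shows fin_vt: "fin (vt d (pm f g) f) (vt d (pm f g) g)"
    and NN_vt: "finite D \<Longrightarrow> dirs f \<union> dirs g \<subseteq> D \<Longrightarrow>
      NN f g = pm f g * pm f g + (\<Sum>d\<in>D. NN (vt d (pm f g) f) (vt d (pm f g) g))"
proof -
  have *: "fin (vt d (pm f g) f) (vt d (pm f g) g) \<and>
      (finite D \<longrightarrow> dirs f \<union> dirs g \<subseteq> D \<longrightarrow>
        NN f g = pm f g * pm f g + (\<Sum>d\<in>D. NN (vt d (pm f g) f) (vt d (pm f g) g)))"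
    if f: "f \<noteq> 0" and g: "g \<noteq> 0" and fin: "fin f g" and le: "mult0 f \<le> mult0 g" for f g d D
  proof -
    have m: "pm f g = mult0 f" using le by (simp add: pm_def)
    obtain k where k: "mult0 g = mult0 f + k" using le le_Suc_ex by blast
    have v: "vt d (mult0 f) f = strict_curve d f" "vt d (mult0 f) g = exc_eq d ^ k * strict_curve d g" for d
      using vt_strict[OF f order_refl, of d] vt_strict[OF g le, of d] k by simp_all
    show ?thesis unfolding m v
      using fin_virtual[OF f g fin] NN_virtual[OF f g fin, of D k] k by (auto simp: algebra_simps)
  qed
  have sym: "pm f g = pm g f" for f g by (simp add: pm_def min.commute)
  consider "mult0 f \<le> mult0 g" | "mult0 g \<le> mult0 f" by linarith
  then have "fin (vt d (pm f g) f) (vt d (pm f g) g) \<and>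
      (finite D \<longrightarrow> dirs f \<union> dirs g \<subseteq> D \<longrightarrow>
        NN f g = pm f g * pm f g + (\<Sum>d\<in>D. NN (vt d (pm f g) f) (vt d (pm f g) g)))"
  proof cases
    case 1 then show ?thesis using *[OF f g fin] by blast
  next
    case 2
    have "fin g f" using fin by (simp add: fin_sym)
    from *[OF g f this 2, of d D] show ?thesis
      by (simp add: sym[of f g] fin_sym[of "vt d (pm g f) f"] NN_sym[of f g] NN_sym[of "vt _ (pm g f) f"] Un_commute)
  qed
  then show "fin (vt d (pm f g) f) (vt d (pm f g) g)"
    "finite D \<Longrightarrow> dirs f \<union> dirs g \<subseteq> D \<Longrightarrow>
      NN f g = pm f g * pm f g + (\<Sum>d\<in>D. NN (vt d (pm f g) f) (vt d (pm f g) g))" by auto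
qed

subsection \<open>The foliation of a pencil\<close>

text \<open>\<open>g df - f dg\<close> is proportional to the differential of \<open>f / g\<close>;
  \<open>w\<close> is its reduced form and \<open>h\<close> its divisor of zeros, where nonzero
  \<open>h\<close> means that \<open>f / g\<close> is not constant.\<close>

definition fpen :: "bipoly \<Rightarrow> bipoly \<Rightarrow> form \<Rightarrow> bipoly \<Rightarrow> bool" where
  "fpen f g w h \<longleftrightarrow> f \<noteq> 0 \<and> g \<noteq> 0 \<and> coprime f g \<and> coprime (fst w) (snd w) \<and> h \<noteq> 0 \<and>
     g * dx f - f * dx g = h * fst w \<and> g * dy f - f * dy g = h * snd w"

lemma coprime_parallel:
  assumes "coprime (a :: bipoly) b" "a * q = b * p"
  shows "\<exists>h. p = h * a \<and> q = h * b"
proof (cases "a = 0")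
  case True
  then have "b dvd 1" using assms(1) by simp
  then obtain c where "1 = b * c" by (blast elim: dvdE)
  then have "q = (q * c) * b" by (metis mult.assoc mult.commute mult_1_right)
  moreover have "p = 0" using True assms by auto
  ultimately show ?thesis using True by (intro exI[of _ "q * c"]) simp
next
  case False
  have "a dvd b * p" using assms(2) by (metis dvd_triv_left)
  then have "a dvd p" using assms(1) by (simp add: coprime_dvd_mult_right_iff)
  then obtain h where h: "p = a * h" by (blast elim: dvdE)
  then have "a * q = a * (h * b)" using assms(2) by (simp add: mult_ac)
  then show ?thesis using False h by (intro exI[of _ h]) (simp add: mult.commute)
qed

text \<open>A count of powers of the exceptional equation: the differential of the pencil
  contributes \<open>2 * m\<close>, the pulled back form \<open>kexp w\<close> and the old cofactor
  its multiplicity. The first claim makes the new exponent a genuine difference.\<close>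

lemma fpen_step:
  assumes fp: "fpen f g w h"
  defines "m \<equiv> pm f g"
  defines "h' \<equiv> \<lambda>d. exc_eq d ^ (kexp w + mult0 h - 2 * m) * strict_curve d h"
  shows "2 * m \<le> kexp w + mult0 h"
    and "fpen (vt d m f) (vt d m g) (strict_form d w) (h' d)"
proof -
  have f: "f \<noteq> 0" and g: "g \<noteq> 0" and cop: "coprime f g" and cw: "coprime (fst w) (snd w)" and h: "h \<noteq> 0"
    and e1: "g * dx f - f * dx g = h * fst w" and e2: "g * dy f - f * dy g = h * snd w"
    using fp by (auto simp: fpen_def)
  have w: "w \<noteq> (0, 0)" using cw by auto
  have *: "2 * m \<le> kexp w + mult0 h \<and> fpen (vt d m f) (vt d m g) (strict_form d w) (h' d)" for d
  proof -
    let ?E = "exc_eq d" and ?f = "vt d m f" and ?g = "vt d m g"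
    let ?A = "fst (strict_form d w)" and ?B = "snd (strict_form d w)"
    have pf: "pb d f = ?E ^ m * ?f" and pg: "pb d g = ?E ^ m * ?g"
      using pm_oge[OF f g] vt unfolding m_def by blast+
    have cr: "pb d g * dx (pb d f) - pb d f * dx (pb d g) = pb d h * fst (pullback w (bl_x d) (bl_y d))"
      "pb d g * dy (pb d f) - pb d f * dy (pb d g) = pb d h * snd (pullback w (bl_x d) (bl_y d))"
    proof -
      have p1: "pb d g * pb d (dx f) - pb d f * pb d (dx g) = pb d h * pb d (fst w)"
        and p2: "pb d g * pb d (dy f) - pb d f * pb d (dy g) = pb d h * pb d (snd w)"
        using arg_cong[OF e1, of "pb d"] arg_cong[OF e2, of "pb d"] by simp_all
      have ux: "pb d g * dx (pb d f) - pb d f * dx (pb d g) =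
        (pb d g * pb d (dx f) - pb d f * pb d (dx g)) * dx (bl_x d) +
        (pb d g * pb d (dy f) - pb d f * pb d (dy g)) * dx (bl_y d)"
        unfolding pb_def dx_bsubst by (simp add: algebra_simps)
      show "pb d g * dx (pb d f) - pb d f * dx (pb d g) = pb d h * fst (pullback w (bl_x d) (bl_y d))"
        unfolding ux p1 p2 by (simp add: pullback_def pb_def algebra_simps)
      have uy: "pb d g * dy (pb d f) - pb d f * dy (pb d g) =
        (pb d g * pb d (dx f) - pb d f * pb d (dx g)) * dy (bl_x d) +
        (pb d g * pb d (dy f) - pb d f * pb d (dy g)) * dy (bl_y d)"
        unfolding pb_def dy_bsubst by (simp add: algebra_simps)
      show "pb d g * dy (pb d f) - pb d f * dy (pb d g) = pb d h * snd (pullback w (bl_x d) (bl_y d))"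
        unfolding uy p1 p2 by (simp add: pullback_def pb_def algebra_simps)
    qed
    let ?X = "?g * dx ?f - ?f * dx ?g" and ?Y = "?g * dy ?f - ?f * dy ?g"
    let ?Em = "?E ^ m" and ?Ek = "?E ^ kexp w"
    have "?Em * ?Em * ?X = pb d g * dx (pb d f) - pb d f * dx (pb d g)"
      unfolding pf pg dx_mult by (simp add: algebra_simps)
    then have X: "?Em * ?Em * ?X = pb d h * ?Ek * ?A"
      unfolding cr strict_form(1)[OF w, of d] by (simp only: mult.assoc)
    have "?Em * ?Em * ?Y = pb d g * dy (pb d f) - pb d f * dy (pb d g)"
      unfolding pf pg dy_mult by (simp add: algebra_simps)
    then have Y: "?Em * ?Em * ?Y = pb d h * ?Ek * ?B"
      unfolding cr strict_form(2)[OF w, of d] by (simp only: mult.assoc)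
    have "?Em * ?Em * (?A * ?Y) = ?A * (?Em * ?Em * ?Y)" by (simp only: mult_ac)
    also have "\<dots> = ?B * (pb d h * ?Ek * ?A)" unfolding Y by (simp only: mult_ac)
    also have "\<dots> = ?Em * ?Em * (?B * ?X)" unfolding X[symmetric] by (simp only: mult_ac)
    finally have "?A * ?Y = ?B * ?X" by simp
    then obtain k where k: "?X = k * ?A" "?Y = k * ?B"
      using coprime_parallel[OF coprime_strict_form[OF cw]] by blast
    have "?Em * ?Em * k * ?A = pb d h * ?Ek * ?A" "?Em * ?Em * k * ?B = pb d h * ?Ek * ?B"
      using X Y k by (simp_all add: mult.assoc)
    moreover have "?A \<noteq> 0 \<or> ?B \<noteq> 0" using strict_form(3)[OF w, of d] by auto
    ultimately have ek: "?Em * ?Em * k = pb d h * ?Ek" by auto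
    have ek': "?E ^ (2 * m) * k = ?E ^ (kexp w + mult0 h) * strict_curve d h"
      using ek unfolding pb_eq_strict[OF h, of d] mult_2 power_add by (simp only: mult_ac)
    have le: "2 * m \<le> kexp w + mult0 h"
    proof (rule ccontr)
      assume "\<not> 2 * m \<le> kexp w + mult0 h"
      then obtain i where i: "2 * m = kexp w + mult0 h + Suc i" using less_imp_Suc_add by (metis add_Suc_right not_le)
      have "?E ^ (kexp w + mult0 h) * (?E * (?E ^ i * k)) = ?E ^ (kexp w + mult0 h) * strict_curve d h"
        using ek' unfolding i by (simp add: power_add mult_ac)
      then have "?E dvd strict_curve d h" by (metis dvd_triv_left exc_ne_0 mult_cancel_left power_not_zero)
      then show False using exc_not_dvd_strict[OF h] by blast
    qed
    have "?E ^ (2 * m) * k = ?E ^ (2 * m) * h' d"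
      unfolding ek' h'_def mult.assoc[symmetric] power_add[symmetric] using le by simp
    then have k': "k = h' d" by simp
    have "h' d \<noteq> 0" by (simp add: h'_def strict_ne_0 h)
    then have "fpen ?f ?g (strict_form d w) (h' d)"
      unfolding fpen_def using k k' coprime_vt[OF f g cop, of d] coprime_strict_form[OF cw, of d]
        vt_ne_0 pm_oge[OF f g] f g by (simp add: m_def)
    then show ?thesis using le by blast
  qed
  show "2 * m \<le> kexp w + mult0 h" using * by blast
  show "fpen (vt d m f) (vt d m g) (strict_form d w) (h' d)" using * by blast
qed

text \<open>\<open>indep f g\<close> says that \<open>f / g\<close> is not constant on the exceptional curve.\<close>

definition indep :: "bipoly \<Rightarrow> bipoly \<Rightarrow> bool" where
  "indep f g \<longleftrightarrow> (\<forall>\<alpha> \<beta>. oge (Suc (pm f g)) (bconst \<alpha> * f + bconst \<beta> * g) \<longrightarrow> \<alpha> = 0 \<and> \<beta> = 0)"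

text \<open>Choose \<open>c\<close> so that \<open>F - c G\<close> vanishes at a point where
  \<open>G\<close> does not. If it were nonzero, differentiation would lower its order there by one,
  against the relation.\<close>

lemma wronskian_dependent:
  assumes "G * pderiv F = F * pderiv (G :: complex poly)" "G \<noteq> 0"
  shows "\<exists>c. F = smult c G"
proof -
  have "finite {x. poly G x = 0}" using assms(2) by (rule poly_roots_finite)
  then obtain x where x: "poly G x \<noteq> 0" using infinite_UNIV_char_0[where 'a = complex] by (metis (mono_tags, lifting) UNIV_eq_I mem_Collect_eq)
  define c where "c = poly F x / poly G x"
  define H where "H = F - smult c G"
  have eq: "G * pderiv H = H * pderiv G"
    using assms(1) by (simp add: H_def pderiv_diff pderiv_smult algebra_simps)
  have "H = 0"
  proof (rule ccontr)
    assume H: "H \<noteq> 0"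
    have "poly H x = 0" using x by (simp add: H_def c_def)
    then have o: "order x H \<noteq> 0" using H by (simp add: order_root)
    have "\<not> poly (pderiv H) x \<noteq> 0 \<or> pderiv H \<noteq> 0" by auto
    have pd: "pderiv H \<noteq> 0"
    proof
      assume "pderiv H = 0"
      then have "degree H = 0" by (simp add: pderiv_eq_0_iff)
      then show False using H \<open>poly H x = 0\<close> by (auto elim!: degree_eq_zeroE)
    qed
    then have "order x H = Suc (order x (pderiv H))" using order_pderiv[OF H \<open>poly H x = 0\<close>] by simp
    moreover have "pderiv G \<noteq> 0" using eq pd assms(2) by auto
    then have "order x G + order x (pderiv H) = order x H + order x (pderiv G)"
      using eq H pd assms(2) by (metis order_mult mult_eq_0_iff)
    moreover have "order x G = 0" using x by (rule order_0I)
    ultimately show False by simp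
  qed
  then show ?thesis by (auto simp: H_def)
qed

lemma dy_bX_power: "dy (bX ^ r * c) = bX ^ r * dy c"
  by (simp add: dy_mult dy_power)

lemma dx_bX_power: "dx (bX ^ Suc r * c) = bX ^ r * (of_nat (Suc r) * c + bX * dx c)"
  unfolding dx_mult dx_power by (simp add: algebra_simps)

text \<open>On the exceptional curve the Wronskian of the restricted generators is the product of
  the restrictions of the cofactor and of the component \<open>b\<close>, and \<open>b\<close>
  vanishes there exactly if the curve is invariant, the non-dicritical case. A nonzero Wronskian
  also keeps the exceptional curve out of the cofactor, whence the equation between
  exponents.\<close>

lemma dicritical_iff_indep:
  assumes fp: "fpen f g w h"
  shows "terminal_dicritical w \<longleftrightarrow> indep f g"
    and "terminal_dicritical w \<Longrightarrow> kexp w + mult0 h = 2 * pm f g"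
proof -
  define m where "m = pm f g"
  have f: "f \<noteq> 0" and g: "g \<noteq> 0" and h: "h \<noteq> 0" and w: "w \<noteq> (0, 0)"
    using fp by (auto simp: fpen_def)
  let ?d = "Some 0 :: complex option"
  define f' g' where "f' = vt ?d m f" and "g' = vt ?d m g"
  define F G where "F = rX f'" and "G = rX g'"
  obtain a b where ab: "strict_form ?d w = (a, b)" by (cases "strict_form ?d w")
  define j where "j = kexp w + mult0 h - 2 * m"
  define h' where "h' = bX ^ j * strict_curve ?d h"
  note fs = fpen_step[OF fp, folded m_def]
  have fp': "fpen f' g' (a, b) h'"
    using fs(2)[of ?d] by (simp add: ab f'_def g'_def h'_def j_def)
  then have ex: "g' * dx f' - f' * dx g' = h' * a" and ey: "g' * dy f' - f' * dy g' = h' * b"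
    and f'0: "f' \<noteq> 0" and g'0: "g' \<noteq> 0" by (auto simp: fpen_def)
  have om: "oge m f" "oge m g" using pm_oge[OF f g] by (auto simp: m_def)
  have dep_iff: "oge (Suc m) (bconst \<alpha> * f + bconst \<beta> * g) \<longleftrightarrow> rX (bconst \<alpha> * f' + bconst \<beta> * g') = 0" for \<alpha> \<beta>
    using exc_dvd_vt[of m "bconst \<alpha> * f + bconst \<beta> * g" ?d] om vt_lin[OF om, of ?d]
    by (simp add: oge_add oge_bconst bX_dvd_iff f'_def g'_def)
  have FG: "F \<noteq> 0 \<or> G \<noteq> 0"
    using pm_not_oge[OF f g] exc_dvd_vt[OF om(1), of ?d] exc_dvd_vt[OF om(2), of ?d]
    by (auto simp: F_def G_def bX_dvd_iff f'_def g'_def m_def)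
  have W: "G * pderiv F - F * pderiv G = rX h' * rX b"
    using arg_cong[OF ey, of rX] by (simp add: F_def G_def rX_dy)
  have W0: "G * pderiv F - F * pderiv G \<noteq> 0" if "indep f g"
  proof
    assume "G * pderiv F - F * pderiv G = 0"
    then have eq: "G * pderiv F = F * pderiv G" by simp
    have "\<exists>\<alpha> \<beta>. (\<alpha>, \<beta>) \<noteq> (0, 0) \<and> smult \<alpha> F + smult \<beta> G = 0"
    proof (cases "G = 0")
      case True
      then show ?thesis by (intro exI[of _ 0] exI[of _ 1]) simp
    next
      case False
      then obtain c where "F = smult c G" using wronskian_dependent[OF eq] by blast
      then show ?thesis by (intro exI[of _ 1] exI[of _ "- c"]) simp
    qed
    then obtain \<alpha> \<beta> where "(\<alpha>, \<beta>) \<noteq> (0, 0)" "rX (bconst \<alpha> * f' + bconst \<beta> * g') = 0"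
      by (auto simp: F_def G_def)
    then show False using that dep_iff by (auto simp: indep_def m_def)
  qed
  have sf: "snd (pullback w (bl_x ?d) (bl_y ?d)) = bX ^ kexp w * b"
    "fst (pullback w (bl_x ?d) (bl_y ?d)) = bX ^ kexp w * a" "\<not> (bX dvd a \<and> bX dvd b)"
    using strict_form[OF w, of ?d] by (simp_all add: ab)
  have pl: "snd (pullback w (bl_x ?d) (bl_y ?d)) = bX * pb ?d (snd w)" using pullback_bl(1)[of w 0] by simp
  have nu: "bX ^ nu_form w dvd pb ?d (snd w)"
    using exc_power_dvd_pb[of ?d "nu_form w" "snd w"] oge_nu[OF w, of "nu_form w"] by simp
  have rb: "rX b \<noteq> 0" if "terminal_dicritical w"
  proof
    assume "rX b = 0"
    then obtain c where c: "b = bX * c" using bX_dvd_iff by (auto elim: dvdE)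
    have "bX * pb ?d (snd w) = bX * (bX ^ Suc (nu_form w) * c)"
      unfolding pl[symmetric] sf(1) c using that by (simp add: kexp_def mult_ac)
    then have "pb ?d (snd w) = bX ^ Suc (nu_form w) * c" by (simp only: mult_cancel_left bX_ne_0 simp_thms)
    then have "oge (Suc (nu_form w)) (snd w)"
      using exc_power_dvd_pb[of ?d "Suc (nu_form w)" "snd w"] by simp
    then show False using dic_oge[OF w that] by blast
  qed
  show iff: "terminal_dicritical w \<longleftrightarrow> indep f g"
  proof
    assume ind: "indep f g"
    show "terminal_dicritical w"
    proof (rule ccontr)
      assume "\<not> terminal_dicritical w"
      then have "bX ^ nu_form w * b = bX * pb ?d (snd w)" using sf(1) pl by (simp add: kexp_def)
      moreover obtain c where "pb ?d (snd w) = bX ^ nu_form w * c" using nu by (blast elim: dvdE)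
      ultimately have "bX ^ nu_form w * b = bX ^ nu_form w * (bX * c)" by (simp add: mult_ac)
      then have "rX b = 0" by simp
      then show False using W W0[OF ind] by simp
    qed
  next
    assume dic: "terminal_dicritical w"
    show "indep f g" unfolding indep_def
    proof (intro allI impI, rule ccontr)
      fix \<alpha> \<beta> assume og: "oge (Suc (pm f g)) (bconst \<alpha> * f + bconst \<beta> * g)" and ne: "\<not> (\<alpha> = 0 \<and> \<beta> = 0)"
      \<comment> \<open>A member vanishing to order \<open>r\<close> on the exceptional curve would
        bring \<open>bX ^ r\<close> into the cofactor by the \<open>dy\<close>-component, while the
        \<open>dx\<close>-component contains only the power \<open>r - 1\<close>.\<close>
      define U where "U = bconst \<alpha> * f' + bconst \<beta> * g'"
      have rU: "rX U = 0" using og dep_iff by (simp add: U_def m_def)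
      \<comment> \<open>\<open>V\<close> completes \<open>U\<close> to a basis of the pencil, and
        \<open>\<kappa>\<close> is the factor by which the form \<open>g df - f dg\<close>
        changes.\<close>
      define V where "V = (if \<alpha> = 0 then f' else g')"
      define \<kappa> where "\<kappa> = (if \<alpha> = 0 then - \<beta> else \<alpha>)"
      have k0: "\<kappa> \<noteq> 0" using ne by (auto simp: \<kappa>_def)
      have rV: "rX V \<noteq> 0"
        using rU FG ne by (auto simp: V_def U_def F_def G_def)
      have vx: "V * dx U - U * dx V = bconst \<kappa> * h' * a" and vy: "V * dy U - U * dy V = bconst \<kappa> * h' * b"
      proof -
        have "V * dx U - U * dx V = bconst \<kappa> * (g' * dx f' - f' * dx g')"
          "V * dy U - U * dy V = bconst \<kappa> * (g' * dy f' - f' * dy g')"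
          using ne by (rule_tac [!] ev_ext) (auto simp: V_def U_def \<kappa>_def d_simps algebra_simps)
        then show "V * dx U - U * dx V = bconst \<kappa> * h' * a" "V * dy U - U * dy V = bconst \<kappa> * h' * b"
          unfolding ex ey by (simp_all only: mult.assoc)
      qed
      have U0: "U \<noteq> 0"
      proof
        assume "U = 0"
        then have "bconst \<kappa> * h' * b = 0" using vy by simp
        then show False using k0 fp' rb[OF dic] by (auto simp: fpen_def)
      qed
      have "finite {n. bX ^ n dvd U}" using U0 by (intro finite_divisor_powers) (auto simp: bX_def is_unit_const_poly_iff is_unit_poly_iff)
      define r where "r = Max {n. bX ^ n dvd U}"
      have r1: "bX ^ r dvd U" and r2: "\<not> bX ^ Suc r dvd U" and r3: "r \<ge> 1"
      proof -
        note fin = \<open>finite {n. bX ^ n dvd U}\<close>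
        have "0 \<in> {n. bX ^ n dvd U}" by simp
        then have "r \<in> {n. bX ^ n dvd U}" unfolding r_def by (intro Max_in fin) blast
        then show "bX ^ r dvd U" by simp
        show "\<not> bX ^ Suc r dvd U" using Max_ge[OF fin, of "Suc r"] by (auto simp: r_def)
        show "r \<ge> 1" unfolding r_def using rU by (intro Max_ge fin) (simp add: bX_dvd_iff)
      qed
      obtain c where c: "U = bX ^ r * c" using r1 by (blast elim: dvdE)
      have rc: "rX c \<noteq> 0"
      proof
        assume "rX c = 0"
        then obtain e where "c = bX * e" using bX_dvd_iff by (auto elim: dvdE)
        then have "U = bX ^ Suc r * e" using c by (simp add: mult_ac)
        then show False using r2 by (metis dvd_triv_left)
      qed
      obtain r' where r': "r = Suc r'" using r3 by (cases r) auto
      have "bX ^ r * (V * dy c - c * dy V) = bconst \<kappa> * h' * b"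
        unfolding vy[symmetric] c dy_bX_power by (simp add: algebra_simps)
      then have "bX ^ r dvd (bconst \<kappa> * h') * b" by (metis dvd_triv_left)
      moreover have "\<not> bX dvd b" using rb[OF dic] by (simp add: bX_dvd_iff)
      ultimately have "bX ^ r dvd bconst \<kappa> * h'" using prime_power_dvd_cancel[OF prime_bX] by blast
      then have "bX ^ r dvd bconst \<kappa> * h' * a" by (rule dvd_mult2)
      moreover have "bconst \<kappa> * h' * a = bX ^ r' * (of_nat r * (V * c) + bX * (V * dx c - c * dx V))"
        unfolding vx[symmetric] c r' dx_bX_power by (simp add: algebra_simps)
      ultimately have "bX ^ r' * bX dvd bX ^ r' * (of_nat r * (V * c) + bX * (V * dx c - c * dx V))"
        by (simp add: r' mult.commute)
      then have "bX dvd of_nat r * (V * c) + bX * (V * dx c - c * dx V)" by simp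
      then have "rX (of_nat r * (V * c)) = 0" by (simp add: bX_dvd_iff)
      moreover have "rX (of_nat r :: bipoly) = of_nat r"
        unfolding bconst_of_nat[symmetric] by (simp add: of_nat_poly)
      moreover have "(of_nat r :: complex poly) \<noteq> 0" using r3 by simp
      ultimately show False using rV rc by (metis mult_eq_0_iff rX_hom(3))
    qed
  qed
  assume "terminal_dicritical w"
  then have "rX h' \<noteq> 0" using W W0 iff by auto
  then have "j = 0" by (cases j) (auto simp: h'_def)
  then show "kexp w + mult0 h = 2 * pm f g" using fs(1) by (simp add: j_def m_def)
qed

subsection \<open>Base points\<close>

text \<open>Some combination of the generators vanishes on the whole exceptional curve, so a zero
  there of a generator of least multiplicity is a zero of the other one too. Such a zero exists
  since the tangent cone has positive degree.\<close>

lemma next_base_direction: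
  assumes f: "f \<noteq> 0" and g: "g \<noteq> 0" and base: "pm f g > 0" and dep: "\<not> indep f g"
  shows "\<exists>d. ev (vt d (pm f g) f) (0, 0) = 0 \<and> ev (vt d (pm f g) g) (0, 0) = 0"
proof -
  define m where "m = pm f g"
  have om: "oge m f" "oge m g" using pm_oge[OF f g] by (auto simp: m_def)
  obtain \<alpha> \<beta> where ab: "oge (Suc m) (bconst \<alpha> * f + bconst \<beta> * g)" "\<not> (\<alpha> = 0 \<and> \<beta> = 0)"
    using dep by (auto simp: indep_def m_def)
  have "exc_eq d dvd bconst \<alpha> * vt d m f + bconst \<beta> * vt d m g" for d
    using ab(1) exc_dvd_vt[of m "bconst \<alpha> * f + bconst \<beta> * g" d] vt_lin[OF om, of d]
    by (simp add: oge_add oge_bconst om)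
  then have 0: "\<alpha> * ev (vt d m f) (0, 0) + \<beta> * ev (vt d m g) (0, 0) = 0" for d
    using ev_dvd[of "exc_eq d" _ "(0, 0)"] by fastforce
  have dir: "\<exists>d. ev (vt d m k) (0, 0) = 0" if "k \<noteq> 0" "mult0 k = m" for k
  proof -
    have "(\<Sum>d\<in>dirs k. NN (strict_curve d k) (exc_eq d)) = m"
      using sum_NN_exc[OF that(1) finite_dirs[OF that(1)] order_refl] that(2) by simp
    then have "dirs k \<noteq> {}" using base by (auto simp: m_def)
    then show ?thesis using vt_strict[OF that(1), of m] that(2) by (auto simp: dirs_def)
  qed
  consider "mult0 f = m" | "mult0 g = m" unfolding m_def pm_def by linarith
  then show ?thesis unfolding m_def[symmetric]
  proof cases
    case 1
    then have "\<beta> \<noteq> 0" using ab oge_mult0[OF f, of "Suc m"] by (auto simp: oge_bconst_iff)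
    then show "\<exists>d. ev (vt d m f) (0, 0) = 0 \<and> ev (vt d m g) (0, 0) = 0"
      using dir[OF f 1] 0 by (metis add_0 mult_eq_0_iff mult_zero_right)
  next
    case 2
    then have "\<alpha> \<noteq> 0" using ab oge_mult0[OF g, of "Suc m"] by (auto simp: oge_bconst_iff)
    then show "\<exists>d. ev (vt d m f) (0, 0) = 0 \<and> ev (vt d m g) (0, 0) = 0"
      using dir[OF g 2] 0 by (metis add.right_neutral mult_eq_0_iff mult_zero_right)
  qed
qed

lemma NN_vt_less:
  assumes "f \<noteq> 0" "g \<noteq> 0" "fin f g" "pm f g > 0"
  shows "NN (vt d (pm f g) f) (vt d (pm f g) g) < NN f g"
proof -
  let ?D = "insert d (dirs f \<union> dirs g)"
  have D: "finite ?D" "dirs f \<union> dirs g \<subseteq> ?D" using finite_dirs assms by auto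
  have "NN (vt d (pm f g) f) (vt d (pm f g) g) \<le> (\<Sum>d\<in>?D. NN (vt d (pm f g) f) (vt d (pm f g) g))"
    using D by (intro member_le_sum) auto
  then show ?thesis using NN_vt[OF assms(1-3) D] mult_pos_pos[OF assms(4) assms(4)] by linarith
qed

text \<open>Follow base points upwards until a dicritical one, which must occur as \<open>NN\<close>
  drops; it is ordinary, and ordinariness descends by the contrapositive of
  \<open>nonordinary_blowup\<close>.\<close>

lemma base_point_ordinary:
  assumes "fpen f g w h" "fin f g" "pm f g > 0"
  shows "ordinary_sing w"
  using assms
proof (induction "NN f g" arbitrary: f g w h rule: less_induct)
  case less
  note fp = less.prems(1)
  have f: "f \<noteq> 0" and g: "g \<noteq> 0" and w: "w \<noteq> (0, 0)" using fp by (auto simp: fpen_def)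
  show ?case
  proof (cases "indep f g")
    case True
    then show ?thesis using dicritical_iff_indep[OF fp] terminal_dicritical_ordinary[OF w] by blast
  next
    case False
    then obtain d where d: "ev (vt d (pm f g) f) (0, 0) = 0" "ev (vt d (pm f g) g) (0, 0) = 0"
      using next_base_direction[OF f g less.prems(3)] by blast
    let ?f = "vt d (pm f g) f" and ?g = "vt d (pm f g) g"
    have nz: "?f \<noteq> 0" "?g \<noteq> 0" using vt_ne_0 pm_oge[OF f g] f g by auto
    have "ordinary_sing (strict_form d w)"
      using less.hyps[OF NN_vt_less[OF f g less.prems(2,3)] fpen_step(2)[OF fp] fin_vt[OF f g less.prems(2)]]
        d pm_pos_iff[OF nz] by simp
    then show ?thesis using nonordinary_blowup[OF w] by blast
  qed
qed

subsection \<open>General members\<close>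

definition bad :: "bipoly \<Rightarrow> bipoly \<Rightarrow> complex set" where
  "bad f g = {k. oge (Suc (pm f g)) (f + bconst k * g)}"

text \<open>Two such parameters would force both generators to have order above the minimum of their
  orders.\<close>

lemma finite_bad: assumes "f \<noteq> 0" "g \<noteq> 0" shows "finite (bad f g)"
proof -
  have "k = l" if "k \<in> bad f g" "l \<in> bad f g" for k l
  proof (rule ccontr)
    assume "k \<noteq> l"
    let ?n = "Suc (pm f g)"
    have *: "cf f i j + k * cf g i j = 0" "cf f i j + l * cf g i j = 0" if "i + j < ?n" for i j
      using \<open>k \<in> bad f g\<close> \<open>l \<in> bad f g\<close> that by (auto simp: bad_def oge_def)
    have "cf f i j = 0 \<and> cf g i j = 0" if "i + j < ?n" for i j
    proof -
      have "(k - l) * cf g i j = (cf f i j + k * cf g i j) - (cf f i j + l * cf g i j)"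
        by (simp add: algebra_simps)
      then have "(k - l) * cf g i j = 0" using *[OF that] by simp
      then show ?thesis using \<open>k \<noteq> l\<close> *[OF that] by auto
    qed
    then have "oge ?n f \<and> oge ?n g" by (auto simp: oge_def)
    then show False using pm_not_oge[OF assms] by blast
  qed
  then show ?thesis by (metis finite.emptyI finite.insertI finite_subset insertI1 subsetI singleton_iff equals0I)
qed

lemma general_member:
  assumes "f \<noteq> 0" "g \<noteq> 0" "k \<notin> bad f g"
  shows "f + bconst k * g \<noteq> 0" "mult0 (f + bconst k * g) = pm f g"
    "strict_curve d (f + bconst k * g) = vt d (pm f g) f + bconst k * vt d (pm f g) g"
proof -
  let ?F = "f + bconst k * g"
  have no: "\<not> oge (Suc (pm f g)) ?F" using assms(3) by (simp add: bad_def)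
  then show F: "?F \<noteq> 0" by auto
  have o: "oge (pm f g) ?F" using pm_oge[OF assms(1,2)] by (intro oge_add oge_bconst) auto
  show m: "mult0 ?F = pm f g" using no o oge_mult0[OF F] by (metis le_antisym not_less_eq_eq)
  have "strict_curve d ?F = vt d (pm f g) ?F" using vt_strict[OF F, of "pm f g" d] m by simp
  also have "\<dots> = vt d (pm f g) f + bconst k * vt d (pm f g) g"
    using vt_lin[of "pm f g" f g d 1 k] pm_oge[OF assms(1,2)] by simp
  finally show "strict_curve d ?F = vt d (pm f g) f + bconst k * vt d (pm f g) g" .
qed

definition mem :: "complex \<times> complex \<Rightarrow> bipoly \<Rightarrow> bipoly \<Rightarrow> bipoly" where
  "mem p f g = bconst (fst p) * f + bconst (snd p) * g"

text \<open>\<open>K\<close> restricts the parameters \<open>k\<close> of the members \<open>f + k g\<close>; the member \<open>g\<close> is always allowed.\<close>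

definition Mem :: "complex set \<Rightarrow> bipoly \<Rightarrow> bipoly \<Rightarrow> bipoly \<Rightarrow> bool" where
  "Mem K f g F \<longleftrightarrow> (\<exists>L. F dvd prod_list (map (\<lambda>p. mem p f g) L) \<and>
     (\<forall>p\<in>set L. p \<noteq> (0, 0) \<and> (fst p \<noteq> 0 \<longrightarrow> snd p / fst p \<in> K)))"

lemma Mem_mono: "Mem K f g F \<Longrightarrow> K \<subseteq> K' \<Longrightarrow> Mem K' f g F"
  unfolding Mem_def by blast

lemma Mem_mult: assumes "Mem K f g F" "Mem K f g G" shows "Mem K f g (F * G)"
proof -
  obtain L L' where
    "F dvd prod_list (map (\<lambda>p. mem p f g) L)" "G dvd prod_list (map (\<lambda>p. mem p f g) L')"
    "\<forall>p\<in>set L. p \<noteq> (0, 0) \<and> (fst p \<noteq> 0 \<longrightarrow> snd p / fst p \<in> K)"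
    "\<forall>p\<in>set L'. p \<noteq> (0, 0) \<and> (fst p \<noteq> 0 \<longrightarrow> snd p / fst p \<in> K)"
    using assms unfolding Mem_def by blast
  then show ?thesis unfolding Mem_def by (intro exI[of _ "L @ L'"]) (auto intro: mult_dvd_mono)
qed

lemma Mem_1: "Mem K f g 1"
  unfolding Mem_def by (intro exI[of _ "[]"]) simp

lemma Mem_power: "Mem K f g F \<Longrightarrow> Mem K f g (F ^ n)"
  by (induction n) (auto intro: Mem_mult Mem_1)

lemma Mem_dvd: "Mem K f g F \<Longrightarrow> G dvd F \<Longrightarrow> Mem K f g G"
  unfolding Mem_def using dvd_trans by blast

text \<open>A point on two different members of a pencil is a base point.\<close>

lemma Mem_avoid:
  assumes "Mem K f g F" "k \<notin> K" "ev F z = 0" "ev (f + bconst k * g) z = 0"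
  shows "ev f z = 0 \<and> ev g z = 0"
proof -
  obtain L where L: "F dvd prod_list (map (\<lambda>p. mem p f g) L)"
    "\<forall>p\<in>set L. p \<noteq> (0, 0) \<and> (fst p \<noteq> 0 \<longrightarrow> snd p / fst p \<in> K)"
    using assms(1) unfolding Mem_def by blast
  have "ev (prod_list (map (\<lambda>p. mem p f g) L)) z = 0" using ev_dvd[OF L(1) assms(3)] .
  then have "\<exists>p\<in>set L. ev (mem p f g) z = 0" by (induction L) auto
  then obtain \<alpha> \<beta> where p: "(\<alpha>, \<beta>) \<in> set L" "\<alpha> * ev f z + \<beta> * ev g z = 0" by (auto simp: mem_def)
  have e: "ev f z = - k * ev g z" using assms(4) by (simp add: add_eq_0_iff2)
  then have "(\<beta> - \<alpha> * k) * ev g z = 0" using p(2) by (simp add: algebra_simps)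
  moreover have "\<beta> - \<alpha> * k \<noteq> 0" using L(2) p(1) assms(2) by (cases "\<alpha> = 0") (auto simp: field_simps)
  ultimately show ?thesis using e by simp
qed

lemma dvd_prime_power_cancel:
  fixes p :: "'a :: idom"
  assumes "prime_elem p" "\<not> p dvd a" "a dvd p ^ n * b"
  shows "a dvd b"
proof -
  obtain c where c: "p ^ n * b = a * c" using assms(3) by (blast elim: dvdE)
  then have "p ^ n dvd c * a" by (metis dvd_triv_left mult.commute)
  then obtain e where "c = p ^ n * e" using prime_power_dvd_cancel[OF assms(1,2)] by (blast elim: dvdE)
  then have "p ^ n * b = p ^ n * (a * e)" using c by (simp add: mult_ac)
  then show ?thesis using assms(1) by auto
qed

text \<open>The virtual transform is linear, so every member keeps its parameter; the exceptional
  factors that remain are prime to the strict transform and cancel.\<close>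

lemma Mem_strict:
  assumes f: "f \<noteq> 0" and g: "g \<noteq> 0" and M: "Mem K f g F" and F: "F \<noteq> 0"
  shows "Mem K (vt d (pm f g) f) (vt d (pm f g) g) (strict_curve d F)"
proof -
  let ?m = "pm f g" and ?E = "exc_eq d"
  obtain L where L: "F dvd prod_list (map (\<lambda>p. mem p f g) L)"
    "\<forall>p\<in>set L. p \<noteq> (0, 0) \<and> (fst p \<noteq> 0 \<longrightarrow> snd p / fst p \<in> K)"
    using M unfolding Mem_def by blast
  have pe: "pb d (mem p f g) = ?E ^ ?m * mem p (vt d ?m f) (vt d ?m g)" for p
    using vt[of ?m f d] vt[of ?m g d] pm_oge[OF f g] by (simp add: mem_def algebra_simps)
  have "pb d (prod_list (map (\<lambda>p. mem p f g) L)) =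
      ?E ^ (?m * length L) * prod_list (map (\<lambda>p. mem p (vt d ?m f) (vt d ?m g)) L)"
    by (induction L) (simp_all add: pe power_add algebra_simps)
  moreover have "pb d F dvd pb d (prod_list (map (\<lambda>p. mem p f g) L))"
    using L(1) by (auto elim!: dvdE)
  ultimately have "strict_curve d F dvd ?E ^ (?m * length L) * prod_list (map (\<lambda>p. mem p (vt d ?m f) (vt d ?m g)) L)"
    using pb_eq_strict[OF F, of d] by (metis dvd_mult_right)
  then have "strict_curve d F dvd prod_list (map (\<lambda>p. mem p (vt d ?m f) (vt d ?m g)) L)"
    by (rule dvd_prime_power_cancel[OF prime_exc exc_not_dvd_strict[OF F]])
  then show ?thesis unfolding Mem_def using L(2) by blast
qed

text \<open>At a non-dicritical point one member of the pencil contains the exceptional curve; if it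
  has the form \<open>f + k g\<close>, its multiplicity is too large, so \<open>k\<close> is in
  \<open>bad f g\<close>.\<close>

lemma Mem_exc:
  assumes f: "f \<noteq> 0" and g: "g \<noteq> 0" and dep: "\<not> indep f g"
  shows "Mem (bad f g) (vt d (pm f g) f) (vt d (pm f g) g) (exc_eq d)"
proof -
  let ?m = "pm f g"
  have om: "oge ?m f" "oge ?m g" using pm_oge[OF f g] by auto
  obtain \<alpha> \<beta> where ab: "oge (Suc ?m) (bconst \<alpha> * f + bconst \<beta> * g)" "\<not> (\<alpha> = 0 \<and> \<beta> = 0)"
    using dep by (auto simp: indep_def)
  have "exc_eq d dvd mem (\<alpha>, \<beta>) (vt d ?m f) (vt d ?m g)"
    using ab(1) exc_dvd_vt[of ?m "bconst \<alpha> * f + bconst \<beta> * g" d] vt_lin[OF om, of d]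
    by (simp add: oge_add oge_bconst om mem_def)
  moreover have "\<beta> / \<alpha> \<in> bad f g" if "\<alpha> \<noteq> 0"
  proof -
    have "bconst \<alpha> * f + bconst \<beta> * g = bconst \<alpha> * (f + bconst (\<beta> / \<alpha>) * g)"
      by (rule ev_ext) (use that in \<open>simp add: field_simps\<close>)
    then show ?thesis using ab(1) that by (simp add: bad_def oge_bconst_iff)
  qed
  ultimately show ?thesis unfolding Mem_def using ab(2) by (intro exI[of _ "[(\<alpha>, \<beta>)]"]) auto
qed

section \<open>Existence of holomorphic leaves and their relation to the pencil\<close>

section \<open>Leaves\<close>

subsection \<open>Local existence of leaves\<close>

text \<open>Boundedness and the Lipschitz condition share one constant because only together are
  they closed under products; this carries them to all polynomials on a bounded bidisc.\<close>

definition blip :: "(complex \<times> complex) set \<Rightarrow> (complex \<times> complex \<Rightarrow> complex) \<Rightarrow> bool" where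
  "blip B F \<longleftrightarrow> (\<exists>M\<ge>0. (\<forall>p\<in>B. norm (F p) \<le> M) \<and>
     (\<forall>p\<in>B. \<forall>q\<in>B. norm (F p - F q) \<le> M * (norm (fst p - fst q) + norm (snd p - snd q))))"

lemma blip_const: "blip B (\<lambda>p. c)"
  unfolding blip_def by (intro exI[of _ "norm c"]) simp

lemma blip_add: assumes "blip B F" "blip B G" shows "blip B (\<lambda>p. F p + G p)"
proof -
  obtain M N where MN: "M \<ge> 0" "N \<ge> 0" "\<forall>p\<in>B. norm (F p) \<le> M" "\<forall>p\<in>B. norm (G p) \<le> N"
    "\<forall>p\<in>B. \<forall>q\<in>B. norm (F p - F q) \<le> M * (norm (fst p - fst q) + norm (snd p - snd q))"
    "\<forall>p\<in>B. \<forall>q\<in>B. norm (G p - G q) \<le> N * (norm (fst p - fst q) + norm (snd p - snd q))"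
    using assms unfolding blip_def by blast
  show ?thesis unfolding blip_def
  proof (intro exI[of _ "M + N"] conjI ballI)
    show "0 \<le> M + N" using MN by simp
    show "norm (F p + G p) \<le> M + N" if "p \<in> B" for p
      using MN(3,4) that by (intro norm_triangle_le add_mono) auto
    show "norm (F p + G p - (F q + G q)) \<le> (M + N) * (norm (fst p - fst q) + norm (snd p - snd q))"
      if "p \<in> B" "q \<in> B" for p q
    proof -
      have "norm ((F p - F q) + (G p - G q)) \<le> M * (norm (fst p - fst q) + norm (snd p - snd q)) +
          N * (norm (fst p - fst q) + norm (snd p - snd q))"
        using MN(5,6) that by (intro norm_triangle_le add_mono) auto
      then show ?thesis by (simp add: algebra_simps)
    qed
  qed
qed

lemma blip_mult: assumes "blip B F" "blip B G" shows "blip B (\<lambda>p. F p * G p)"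
proof -
  obtain M N where MN: "M \<ge> 0" "N \<ge> 0" "\<forall>p\<in>B. norm (F p) \<le> M" "\<forall>p\<in>B. norm (G p) \<le> N"
    "\<forall>p\<in>B. \<forall>q\<in>B. norm (F p - F q) \<le> M * (norm (fst p - fst q) + norm (snd p - snd q))"
    "\<forall>p\<in>B. \<forall>q\<in>B. norm (G p - G q) \<le> N * (norm (fst p - fst q) + norm (snd p - snd q))"
    using assms unfolding blip_def by blast
  show ?thesis unfolding blip_def
  proof (intro exI[of _ "2 * (M * N)"] conjI ballI)
    show "0 \<le> 2 * (M * N)" using MN by simp
    show "norm (F p * G p) \<le> 2 * (M * N)" if "p \<in> B" for p
    proof -
      have "norm (F p * G p) \<le> M * N"
        unfolding norm_mult using MN that by (intro mult_mono) auto
      moreover have "0 \<le> M * N" using MN by simp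
      ultimately show ?thesis by linarith
    qed
    show "norm (F p * G p - F q * G q) \<le> 2 * (M * N) * (norm (fst p - fst q) + norm (snd p - snd q))"
      if "p \<in> B" "q \<in> B" for p q
    proof -
      let ?d = "norm (fst p - fst q) + norm (snd p - snd q)"
      have "F p * G p - F q * G q = F p * (G p - G q) + (F p - F q) * G q" by (simp add: algebra_simps)
      also have "norm \<dots> \<le> M * (N * ?d) + (M * ?d) * N"
        unfolding norm_mult[symmetric]
        by (intro norm_triangle_le add_mono; unfold norm_mult; intro mult_mono) (use MN that in auto)
      finally show ?thesis by (simp add: algebra_simps)
    qed
  qed
qed

lemma blip_coord: "blip (cball x 1 \<times> cball y 1) fst" "blip (cball x 1 \<times> cball y 1) snd"
proof -
  show "blip (cball x 1 \<times> cball y 1) fst" unfolding blip_def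
  proof (intro exI[of _ "norm x + 1"] conjI ballI)
    fix p q assume pq: "p \<in> cball x 1 \<times> cball y 1" "q \<in> cball x 1 \<times> cball y 1"
    have "norm (fst p - fst q) \<le> 1 * (norm (fst p - fst q) + norm (snd p - snd q))" by simp
    also have "\<dots> \<le> (norm x + 1) * (norm (fst p - fst q) + norm (snd p - snd q))"
      by (intro mult_right_mono) auto
    finally show "norm (fst p - fst q) \<le> (norm x + 1) * (norm (fst p - fst q) + norm (snd p - snd q))" .
  next
    fix p assume "p \<in> cball x 1 \<times> cball y 1"
    then have "norm (x - fst p) \<le> 1" by (auto simp: dist_norm)
    then show "norm (fst p) \<le> norm x + 1"
      using norm_triangle_sub[of "fst p" x] by (simp add: norm_minus_commute)
  qed simp
  show "blip (cball x 1 \<times> cball y 1) snd" unfolding blip_def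
  proof (intro exI[of _ "norm y + 1"] conjI ballI)
    fix p q assume pq: "p \<in> cball x 1 \<times> cball y 1" "q \<in> cball x 1 \<times> cball y 1"
    have "norm (snd p - snd q) \<le> 1 * (norm (fst p - fst q) + norm (snd p - snd q))" by simp
    also have "\<dots> \<le> (norm y + 1) * (norm (fst p - fst q) + norm (snd p - snd q))"
      by (intro mult_right_mono) auto
    finally show "norm (snd p - snd q) \<le> (norm y + 1) * (norm (fst p - fst q) + norm (snd p - snd q))" .
  next
    fix p assume "p \<in> cball x 1 \<times> cball y 1"
    then have "norm (y - snd p) \<le> 1" by (auto simp: dist_norm)
    then show "norm (snd p) \<le> norm y + 1"
      using norm_triangle_sub[of "snd p" y] by (simp add: norm_minus_commute)
  qed simp
qed

lemma blip_ev: "blip (cball x 1 \<times> cball y 1) (ev f)"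
proof -
  let ?B = "cball x 1 \<times> cball y 1"
  have p: "blip ?B (\<lambda>z. poly a (fst z))" for a
    by (induction a) (auto intro!: blip_const blip_add blip_mult blip_coord)
  have "blip ?B (\<lambda>z. ev f z)"
  proof (induction f)
    case 0
    then show ?case by (simp add: blip_const)
  next
    case (pCons a f)
    have "(\<lambda>z. ev (pCons a f) z) = (\<lambda>z. poly a (fst z) + snd z * ev f z)"
      by (auto simp: ev_pCons fun_eq_iff)
    then show ?case using pCons by (auto intro!: blip_add blip_mult blip_coord p)
  qed
  then show ?thesis by simp
qed

text \<open>The primitive is normalized at \<open>0\<close> so that it serves as the integral
  operator of the Picard iteration.\<close>

definition prim :: "(complex \<Rightarrow> complex) \<Rightarrow> complex \<Rightarrow> complex" where
  "prim F = (SOME G. G 0 = 0 \<and> (\<forall>s\<in>ball 0 1. (G has_field_derivative F s) (at s)))"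

lemma prim:
  assumes "F holomorphic_on ball 0 1"
  shows "prim F 0 = 0" "\<And>s. s \<in> ball 0 1 \<Longrightarrow> (prim F has_field_derivative F s) (at s)"
proof -
  obtain G where G: "\<And>x. x \<in> ball 0 1 \<Longrightarrow> (G has_field_derivative F x) (at x within ball 0 1)"
    using holomorphic_convex_primitive'[OF convex_ball open_ball assms] by blast
  have G': "(G has_field_derivative F s) (at s)" if "s \<in> ball 0 1" for s
    using G[OF that] at_within_open[OF that open_ball] by simp
  have "((\<lambda>s. G s - G 0) has_field_derivative F s) (at s)" if "s \<in> ball 0 1" for s
    using DERIV_diff[OF G'[OF that] DERIV_const[of "G 0"]] by simp
  then have "\<exists>G. G 0 = 0 \<and> (\<forall>s\<in>ball 0 1. (G has_field_derivative F s) (at s))"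
    by (intro exI[of _ "\<lambda>s. G s - G 0"] conjI ballI) simp_all
  from someI_ex[OF this] show "prim F 0 = 0" "\<And>s. s \<in> ball 0 1 \<Longrightarrow> (prim F has_field_derivative F s) (at s)"
    unfolding prim_def by auto
qed

text \<open>On the unit disc, integration from the center does not enlarge a uniform bound.\<close>

lemma prim_bound:
  assumes "F holomorphic_on ball 0 1" "G holomorphic_on ball 0 1"
    "\<And>s. s \<in> ball 0 1 \<Longrightarrow> norm (F s - G s) \<le> B" "s \<in> ball 0 1" "B \<ge> 0"
  shows "norm (prim F s - prim G s) \<le> B"
proof -
  have "norm ((prim F s - prim G s) - (prim F 0 - prim G 0)) \<le> B * norm (s - 0)"
  proof (rule field_differentiable_bound[OF convex_ball])
    fix z :: complex assume "z \<in> ball 0 1"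
    then show "((\<lambda>s. prim F s - prim G s) has_field_derivative F z - G z) (at z within ball 0 1)"
      by (intro has_field_derivative_at_within[OF DERIV_diff] prim(2) assms(1,2))
  qed (use assms in auto)
  also have "\<dots> \<le> B * 1" using assms by (intro mult_left_mono) auto
  finally show ?thesis using prim(1)[OF assms(1)] prim(1)[OF assms(2)] by simp
qed

lemma prim_0: "s \<in> ball 0 1 \<Longrightarrow> prim (\<lambda>s. 0) s = 0"
proof -
  assume s: "s \<in> ball 0 1"
  have "norm (prim (\<lambda>s. 0) s - prim (\<lambda>s. 0) 0) \<le> 0 * norm (s - 0)"
    by (rule field_differentiable_bound[OF convex_ball[of 0 1],
          OF has_field_derivative_at_within[OF prim(2)[OF holomorphic_on_const]]])
      (use s in auto)
  then show ?thesis using prim(1)[OF holomorphic_on_const] by simp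
qed

lemma holomorphic_ev:
  "g holomorphic_on S \<Longrightarrow> h holomorphic_on S \<Longrightarrow> open S \<Longrightarrow> (\<lambda>s. ev f (g s, h s)) holomorphic_on S"
proof -
  assume *: "g holomorphic_on S" "h holomorphic_on S" "open S"
  have "(\<lambda>s. ev f (g s, h s)) field_differentiable at s" if "s \<in> S" for s
    using DERIV_ev[OF holomorphic_derivI[OF *(1,3) that] holomorphic_derivI[OF *(2,3) that]]
    unfolding field_differentiable_def by blast
  then show ?thesis unfolding holomorphic_on_def by (auto intro: field_differentiable_at_within)
qed

text \<open>Picard iteration for the vector field \<open>\<epsilon> (f1, f2)\<close> with small \<open>\<epsilon>\<close> on the unit disc.\<close>

lemma picard:
  fixes f1 f2 :: bipoly
  assumes "\<delta> > 0"
  shows "\<exists>g h \<epsilon>. g holomorphic_on ball 0 1 \<and> h holomorphic_on ball 0 1 \<and> g 0 = x \<and> h 0 = y \<and>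
     \<epsilon> \<noteq> 0 \<and> (\<forall>s\<in>ball 0 1. norm (g s - x) < \<delta> \<and> norm (h s - y) < \<delta> \<and>
       deriv g s = \<epsilon> * ev f1 (g s, h s) \<and> deriv h s = \<epsilon> * ev f2 (g s, h s))"
proof -
  let ?B = "cball x 1 \<times> cball y 1" and ?U = "ball 0 1 :: complex set"
  obtain M1 M2 where M: "M1 \<ge> 0" "M2 \<ge> 0" "\<forall>p\<in>?B. norm (ev f1 p) \<le> M1" "\<forall>p\<in>?B. norm (ev f2 p) \<le> M2"
    "\<forall>p\<in>?B. \<forall>q\<in>?B. norm (ev f1 p - ev f1 q) \<le> M1 * (norm (fst p - fst q) + norm (snd p - snd q))"
    "\<forall>p\<in>?B. \<forall>q\<in>?B. norm (ev f2 p - ev f2 q) \<le> M2 * (norm (fst p - fst q) + norm (snd p - snd q))"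
    using blip_ev[of x y f1] blip_ev[of x y f2] unfolding blip_def by blast
  define M where "M = M1 + M2 + 1"
  \<comment> \<open>The disc is fixed and the field is scaled instead. A Lipschitz constant of at
    most 1/4 for the sum of the two component distances halves the bound in each step;
    \<open>\<delta> / 2\<close> keeps the solution near the initial point.\<close>
  define \<rho> where "\<rho> = min (1 / 4) (\<delta> / 2)"
  define e where "e = \<rho> / M"
  define \<epsilon> where "\<epsilon> = complex_of_real e"
  have M0: "M > 0" using M by (simp add: M_def)
  have rho: "\<rho> > 0" "\<rho> \<le> 1 / 4" "\<rho> < \<delta>" using assms by (auto simp: \<rho>_def)
  have e0: "e > 0" and eM: "e * M = \<rho>" using M0 rho by (simp_all add: e_def)
  have bnd: "norm (\<epsilon> * ev f p) \<le> \<rho>" if "p \<in> ?B" "f = f1 \<or> f = f2" for p f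
  proof -
    have "norm (ev f p) \<le> M1 \<or> norm (ev f p) \<le> M2" using M(3,4) that by blast
    then have "norm (ev f p) \<le> M" using M(1,2) unfolding M_def by linarith
    then have "e * norm (ev f p) \<le> e * M" using e0 by (intro mult_left_mono) auto
    then show ?thesis using e0 eM by (simp add: norm_mult \<epsilon>_def)
  qed
  have lip: "norm (\<epsilon> * ev f p - \<epsilon> * ev f q) \<le> \<rho> * (norm (fst p - fst q) + norm (snd p - snd q))"
    if "p \<in> ?B" "q \<in> ?B" "f = f1 \<or> f = f2" for p q f
  proof -
    let ?d = "norm (fst p - fst q) + norm (snd p - snd q)"
    have "norm (ev f p - ev f q) \<le> M1 * ?d \<or> norm (ev f p - ev f q) \<le> M2 * ?d" using M that by blast
    moreover have "M1 * ?d \<le> M * ?d" "M2 * ?d \<le> M * ?d"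
      using M unfolding M_def by (intro mult_right_mono; simp)+
    ultimately have "norm (ev f p - ev f q) \<le> M * ?d" by linarith
    then have "e * norm (ev f p - ev f q) \<le> e * (M * ?d)" using e0 by (intro mult_left_mono) auto
    also have "e * (M * ?d) = \<rho> * ?d" using eM by simp
    finally show ?thesis using e0 by (simp add: \<epsilon>_def norm_mult flip: right_diff_distrib)
  qed
  define step where "step = (\<lambda>(g, h). (\<lambda>s. x + prim (\<lambda>s. \<epsilon> * ev f1 (g s, h s)) s,
    \<lambda>s :: complex. y + prim (\<lambda>s. \<epsilon> * ev f2 (g s, h s)) s))"
  define it where "it n = (step ^^ n) (\<lambda>s. x, \<lambda>s. y)" for n
  define G where "G n = fst (it n)" for n
  define H where "H n = snd (it n)" for n
  have G0: "G 0 = (\<lambda>s. x)" and H0: "H 0 = (\<lambda>s. y)" by (simp_all add: G_def H_def it_def)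
  have GS: "G (Suc n) = (\<lambda>s. x + prim (\<lambda>s. \<epsilon> * ev f1 (G n s, H n s)) s)" for n
    by (simp add: G_def H_def it_def step_def split_def)
  have HS: "H (Suc n) = (\<lambda>s. y + prim (\<lambda>s. \<epsilon> * ev f2 (G n s, H n s)) s)" for n
    by (simp add: G_def H_def it_def step_def split_def)
  have inv: "G n holomorphic_on ?U \<and> H n holomorphic_on ?U \<and> G n 0 = x \<and> H n 0 = y \<and>
      (\<forall>s\<in>?U. norm (G n s - x) \<le> \<rho> \<and> norm (H n s - y) \<le> \<rho>)" for n
  proof (induction n)
    case 0
    then show ?case using rho by (simp add: G0 H0)
  next
    case (Suc n)
    then have hol: "(\<lambda>s. \<epsilon> * ev f (G n s, H n s)) holomorphic_on ?U" for f
      by (intro holomorphic_intros holomorphic_ev) auto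
    have inB: "(G n s, H n s) \<in> ?B" if "s \<in> ?U" for s
      using Suc that rho by (fastforce simp: dist_norm norm_minus_commute)
    have ph: "prim (\<lambda>s. \<epsilon> * ev f (G n s, H n s)) holomorphic_on ?U" for f
      by (intro iffD2[OF holomorphic_on_open[OF open_ball]] ballI exI) (rule prim(2)[OF hol])
    have pb: "norm (prim (\<lambda>s. \<epsilon> * ev f (G n s, H n s)) s) \<le> \<rho>" if "s \<in> ?U" "f = f1 \<or> f = f2" for s f
      using prim_bound[OF hol[of f], of "\<lambda>s. 0" \<rho> s] that bnd[OF inB] rho by (simp add: prim_0)
    show ?case
      unfolding GS HS using ph pb prim(1)[OF hol] by (auto intro!: holomorphic_intros)
  qed
  have hol: "(\<lambda>s. \<epsilon> * ev f (G n s, H n s)) holomorphic_on ?U" for f n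
    using inv by (intro holomorphic_intros holomorphic_ev) auto
  have inB: "(G n s, H n s) \<in> ?B" if "s \<in> ?U" for s n
    using inv[of n] that rho by (fastforce simp: dist_norm norm_minus_commute)
  have cauchy: "\<forall>s\<in>?U. norm (G (Suc n) s - G n s) \<le> (1 / 2) ^ n \<and> norm (H (Suc n) s - H n s) \<le> (1 / 2) ^ n" for n
  proof (induction n)
    case 0
    show ?case using inv[of "Suc 0"] rho by (fastforce simp: G0 H0)
  next
    case (Suc n)
    have d: "norm (\<epsilon> * ev f (G (Suc n) s, H (Suc n) s) - \<epsilon> * ev f (G n s, H n s)) \<le> (1 / 2) ^ Suc n"
      if "s \<in> ?U" "f = f1 \<or> f = f2" for s f
    proof -
      let ?d = "norm (G (Suc n) s - G n s) + norm (H (Suc n) s - H n s)"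
      have "norm (\<epsilon> * ev f (G (Suc n) s, H (Suc n) s) - \<epsilon> * ev f (G n s, H n s)) \<le> \<rho> * ?d"
        using lip[OF inB[OF that(1)] inB[OF that(1)] that(2)] by simp
      also have "\<dots> \<le> (1 / 4) * ((1 / 2) ^ n + (1 / 2) ^ n)"
        using Suc that rho by (intro mult_mono add_mono) auto
      finally show ?thesis by simp
    qed
    show ?case
    proof
      fix s assume s: "s \<in> ?U"
      show "norm (G (Suc (Suc n)) s - G (Suc n) s) \<le> (1 / 2) ^ Suc n \<and>
          norm (H (Suc (Suc n)) s - H (Suc n) s) \<le> (1 / 2) ^ Suc n"
        unfolding GS[of "Suc n"] GS[of n] HS[of "Suc n"] HS[of n] add_diff_cancel_left
        using prim_bound[OF hol[of f1 "Suc n"] hol[of f1 n] d s] prim_bound[OF hol[of f2 "Suc n"] hol[of f2 n] d s]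
        by (simp add: GS HS)
    qed
  qed
  \<comment> \<open>Geometrically bounded increments make the telescoping series converge
    uniformly.\<close>
  have lim: "\<exists>l. uniform_limit ?U A l sequentially"
    if "\<And>n s. s \<in> ?U \<Longrightarrow> norm (A (Suc n) s - A n s) \<le> (1 / 2) ^ n" for A :: "nat \<Rightarrow> complex \<Rightarrow> complex"
  proof -
    have "uniform_limit ?U (\<lambda>n s. \<Sum>i<n. A (Suc i) s - A i s) (\<lambda>s. suminf (\<lambda>i. A (Suc i) s - A i s)) sequentially"
      by (rule Weierstrass_m_test[of _ _ "\<lambda>n. (1 / 2) ^ n"]) (use that in \<open>auto intro: summable_geometric\<close>)
    then have "uniform_limit ?U (\<lambda>n s. A 0 s + (\<Sum>i<n. A (Suc i) s - A i s)) (\<lambda>s. A 0 s + suminf (\<lambda>i. A (Suc i) s - A i s)) sequentially"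
      by (intro uniform_limit_intros)
    moreover have "A 0 s + (\<Sum>i<n. A (Suc i) s - A i s) = A n s" for n s
      using sum_lessThan_telescope[of "\<lambda>i. A i s" n] by simp
    ultimately show ?thesis by auto
  qed
  obtain g where g: "uniform_limit ?U G g sequentially" using lim[of G] cauchy by blast
  obtain h where h: "uniform_limit ?U H h sequentially" using lim[of H] cauchy by blast
  have pt: "(\<lambda>n. G n s) \<longlonglongrightarrow> g s" "(\<lambda>n. H n s) \<longlonglongrightarrow> h s" if "s \<in> ?U" for s
    using tendsto_uniform_limitI[OF g that] tendsto_uniform_limitI[OF h that] by auto
  have sub: "\<exists>d>0. cball s d \<subseteq> ?U \<and> uniform_limit (cball s d) A l sequentially"
    if s: "s \<in> ?U" and A: "uniform_limit ?U A l sequentially" for s A and l :: "complex \<Rightarrow> complex"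
  proof -
    obtain d where d: "d > 0" "cball s d \<subseteq> ?U" using open_contains_cball_eq[OF open_ball, of 0 1] s by blast
    then show ?thesis using uniform_limit_on_subset[OF A] by blast
  qed
  have ctn: "isCont (ev f) p" for f p
  proof -
    have "ev f = (\<lambda>z. poly (poly f [:snd z:]) (fst z))" by (simp add: ev_def fun_eq_iff)
    moreover have "isCont (\<lambda>z. \<Sum>j\<le>degree f. poly (coeff f j) (fst z) * snd z ^ j) p"
      by (intro continuous_intros)
    moreover have "ev f = (\<lambda>z. \<Sum>j\<le>degree f. poly (coeff f j) (fst z) * snd z ^ j)"
      using ev_altdef by fastforce
    ultimately show ?thesis by simp
  qed
  \<comment> \<open>Uniform limits of holomorphic functions may be differentiated termwise, so the
    recursion of the iterates becomes the differential equation.\<close>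
  have der: "(l has_field_derivative \<epsilon> * ev f (g s, h s)) (at s)"
    if s: "s \<in> ?U" and A: "\<And>n. A (Suc n) = (\<lambda>s. c + prim (\<lambda>s. \<epsilon> * ev f (G n s, H n s)) s)"
      and l: "uniform_limit ?U A l sequentially" for s A l c f
  proof -
    have "uniform_limit ?U (\<lambda>n. A (Suc n)) l sequentially"
      using l by (rule filterlim_compose[OF _ filterlim_Suc])
    then have "\<exists>l'. \<forall>s\<in>?U. (l has_field_derivative l' s) (at s) \<and>
        (\<lambda>n. \<epsilon> * ev f (G n s, H n s)) \<longlonglongrightarrow> l' s"
      by (intro has_complex_derivative_uniform_sequence[of _ "\<lambda>n. A (Suc n)"] sub)
        (auto simp: A intro!: derivative_eq_intros prim(2)[OF hol])
    then obtain l' where l': "(l has_field_derivative l') (at s)" "(\<lambda>n. \<epsilon> * ev f (G n s, H n s)) \<longlonglongrightarrow> l'"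
      using s by blast
    have "(\<lambda>n. \<epsilon> * ev f (G n s, H n s)) \<longlonglongrightarrow> \<epsilon> * ev f (g s, h s)"
      by (intro tendsto_intros isCont_tendsto_compose[OF ctn] tendsto_Pair pt s)
    then have "l' = \<epsilon> * ev f (g s, h s)" using l'(2) LIMSEQ_unique by blast
    then show ?thesis using l'(1) by simp
  qed
  have dg: "(g has_field_derivative \<epsilon> * ev f1 (g s, h s)) (at s)"
    and dh: "(h has_field_derivative \<epsilon> * ev f2 (g s, h s)) (at s)" if "s \<in> ?U" for s
    using der[OF that GS g] der[OF that HS h] by auto
  have "g holomorphic_on ?U" "h holomorphic_on ?U" 
    by (intro iffD2[OF holomorphic_on_open[OF open_ball]] ballI exI, erule dg dh)+
  moreover have "g 0 = x" "h 0 = y"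
  proof -
    have "(\<lambda>n. x) \<longlonglongrightarrow> g 0" "(\<lambda>n. y) \<longlonglongrightarrow> h 0" using pt[of 0] by (simp_all add: inv)
    then show "g 0 = x" "h 0 = y" by (simp_all add: LIMSEQ_const_iff)
  qed
  moreover have "norm (g s - x) < \<delta>" "norm (h s - y) < \<delta>" if "s \<in> ?U" for s
  proof -
    have "norm (g s - x) \<le> \<rho>"
      by (rule LIMSEQ_le_const2[OF tendsto_norm[OF tendsto_diff[OF pt(1)[OF that] tendsto_const]]])
        (use inv that in auto)
    moreover have "norm (h s - y) \<le> \<rho>"
      by (rule LIMSEQ_le_const2[OF tendsto_norm[OF tendsto_diff[OF pt(2)[OF that] tendsto_const]]])
        (use inv that in auto)
    ultimately show "norm (g s - x) < \<delta>" "norm (h s - y) < \<delta>" using rho by auto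
  qed
  ultimately show ?thesis
    using dg dh e0 by (intro exI[of _ g] exI[of _ h] exI[of _ \<epsilon>]) (auto simp: \<epsilon>_def intro: DERIV_imp_deriv)
qed

text \<open>A finite connected set has at most one point, so a finite image would make both
  functions constant and both derivatives zero.\<close>

lemma infinite_disc_image:
  assumes g: "g holomorphic_on ball s0 \<rho>" and h: "h holomorphic_on ball s0 \<rho>" and "\<rho> > 0"
    and nz: "deriv g s0 \<noteq> 0 \<or> deriv h s0 \<noteq> 0"
  shows "infinite ((\<lambda>s. (g s, h s)) ` ball s0 \<rho>)"
proof
  assume fin: "finite ((\<lambda>s. (g s, h s)) ` ball s0 \<rho>)"
  have "deriv k s0 = 0" if k: "k holomorphic_on ball s0 \<rho>" and fk: "finite (k ` ball s0 \<rho>)" for k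
  proof -
    have "connected (k ` ball s0 \<rho>)"
      using connected_continuous_image[OF holomorphic_on_imp_continuous_on[OF k] connected_ball] .
    then have "k ` ball s0 \<rho> = {} \<or> (\<exists>a. k ` ball s0 \<rho> = {a})"
      using fk connected_finite_iff_sing by blast
    then obtain a where "k ` ball s0 \<rho> \<subseteq> {a}" by blast
    then have a: "\<And>s. s \<in> ball s0 \<rho> \<Longrightarrow> k s = a" by blast
    have "((\<lambda>s. a) has_field_derivative 0) (at s0)" by simp
    then have "(k has_field_derivative 0) (at s0)"
      by (rule has_field_derivative_transform_within_open[OF _ open_ball[of s0 \<rho>]])
        (use a \<open>\<rho> > 0\<close> in auto)
    then show ?thesis by (rule DERIV_imp_deriv)
  qed
  moreover have "g ` ball s0 \<rho> = fst ` (\<lambda>s. (g s, h s)) ` ball s0 \<rho>"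
    "h ` ball s0 \<rho> = snd ` (\<lambda>s. (g s, h s)) ` ball s0 \<rho>" by force+
  ultimately show False using g h nz fin by (metis finite_imageI)
qed

lemma leaf_disc:
  assumes "\<not> (ev (fst w) (x, y) = 0 \<and> ev (snd w) (x, y) = 0)"
  shows "\<exists>g h \<epsilon>. g holomorphic_on ball 0 1 \<and> h holomorphic_on ball 0 1 \<and> g 0 = x \<and> h 0 = y \<and> \<epsilon> \<noteq> 0 \<and>
    (\<forall>s\<in>ball 0 1. \<not> (ev (fst w) (g s, h s) = 0 \<and> ev (snd w) (g s, h s) = 0) \<and>
       deriv g s = \<epsilon> * ev (snd w) (g s, h s) \<and> deriv h s = - \<epsilon> * ev (fst w) (g s, h s))"
proof -
  obtain f where f: "f = fst w \<or> f = snd w" "ev f (x, y) \<noteq> 0" using assms by blast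
  have "ev f = (\<lambda>z. \<Sum>j\<le>degree f. poly (coeff f j) (fst z) * snd z ^ j)"
    using ev_altdef by fastforce
  moreover have "continuous_on UNIV (\<lambda>z. \<Sum>j\<le>degree f. poly (coeff f j) (fst z) * snd z ^ j)"
    by (intro continuous_intros)
  ultimately have "continuous_on UNIV (ev f)" by simp
  then have "open {z. ev f z \<noteq> 0}" by (rule open_Collect_neq[OF _ continuous_on_const])
  from openE[OF this, of "(x, y)"] obtain e where e: "e > 0" "ball (x, y) e \<subseteq> {z. ev f z \<noteq> 0}"
    using f(2) by blast
  obtain g h \<epsilon> where gh: "g holomorphic_on ball 0 1" "h holomorphic_on ball 0 1" "g 0 = x" "h 0 = y" "\<epsilon> \<noteq> 0"
    "\<And>s. s \<in> ball 0 1 \<Longrightarrow> norm (g s - x) < e / 2 \<and> norm (h s - y) < e / 2 \<and>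
       deriv g s = \<epsilon> * ev (snd w) (g s, h s) \<and> deriv h s = \<epsilon> * ev (- fst w) (g s, h s)"
    using picard[of "e / 2" x y "snd w" "- fst w"] e(1) by auto
  have "\<not> (ev (fst w) (g s, h s) = 0 \<and> ev (snd w) (g s, h s) = 0)" if "s \<in> ball 0 1" for s
  proof -
    have "dist (x, y) (g s, h s) \<le> dist x (g s) + dist y (h s)"
      unfolding dist_Pair_Pair by (rule sqrt_sum_squares_le_sum) auto
    also have "\<dots> < e" using gh(6)[OF that] by (simp add: dist_norm norm_minus_commute)
    finally have "ev f (g s, h s) \<noteq> 0" using e(2) by auto
    then show ?thesis using f(1) by auto
  qed
  then show ?thesis using gh by (intro exI[of _ g] exI[of _ h] exI[of _ \<epsilon>]) simp
qed

lemma deriv_ev_disc: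
  assumes "g holomorphic_on ball 0 1" "h holomorphic_on ball 0 1" "s \<in> ball 0 1"
  shows "((\<lambda>s. ev f (g s, h s)) has_field_derivative
    (ev (dx f) (g s, h s) * deriv g s + ev (dy f) (g s, h s) * deriv h s)) (at s)"
  using assms by (intro DERIV_ev holomorphic_derivI[OF _ open_ball])

text \<open>The Hamiltonian field of \<open>\<phi>\<close> is tangent to the curve and annihilates \<open>g df - f dg\<close> on it, so
  \<open>f / g\<close> is constant along its integral curves.\<close>

lemma invariant_curve_in_member:
  assumes phi: "prime_elem \<phi>" and fg: "f \<noteq> 0" "g \<noteq> 0" "coprime f g"
    and inv: "\<phi> dvd (g * dx f - f * dx g) * dy \<phi> - (g * dy f - f * dy g) * dx \<phi>"
  shows "\<exists>p. p \<noteq> (0, 0) \<and> \<phi> dvd mem p f g"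
proof -
  \<comment> \<open>A smooth point of the curve is needed. It exists since some partial derivative
    is nonzero of smaller degree and therefore not divisible by \<open>\<phi>\<close>.\<close>
  have "\<exists>k\<in>{dx \<phi>, dy \<phi>}. \<not> \<phi> dvd k"
  proof (cases "degree \<phi> = 0")
    case False
    have "\<not> \<phi> dvd dy \<phi>"
    proof
      assume "\<phi> dvd dy \<phi>"
      moreover have "dy \<phi> \<noteq> 0" using False by (simp add: dy_def pderiv_eq_0_iff)
      ultimately have "degree \<phi> \<le> degree (dy \<phi>)" by (rule dvd_imp_degree_le)
      then show False using False by (simp add: dy_def degree_pderiv)
    qed
    then show ?thesis by blast
  next
    case True
    then obtain p where p: "\<phi> = [:p:]" by (auto elim: degree_eq_zeroE)
    have "degree p \<noteq> 0"
    proof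
      assume "degree p = 0"
      then obtain c where "p = [:c:]" by (auto elim: degree_eq_zeroE)
      then have "\<phi> = bconst c" using p by (simp add: bconst_def)
      then show False using phi bconst_dvd_1[of c] by (cases "c = 0") auto
    qed
    have "\<not> \<phi> dvd dx \<phi>"
    proof
      assume "\<phi> dvd dx \<phi>"
      then have "[:p:] dvd [:pderiv p:]" using p by (simp add: dx_pCons)
      then have "p dvd pderiv p" by (simp only: const_poly_dvd_const_poly_iff)
      moreover have "pderiv p \<noteq> 0" using \<open>degree p \<noteq> 0\<close> by (simp add: pderiv_eq_0_iff)
      ultimately have "degree p \<le> degree (pderiv p)" by (rule dvd_imp_degree_le)
      then show False using \<open>degree p \<noteq> 0\<close> by (simp add: degree_pderiv)
    qed
    then show ?thesis by blast
  qed
  then obtain k where k: "k \<in> {dx \<phi>, dy \<phi>}" "\<not> \<phi> dvd k" by blast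
  have "\<exists>z. ev \<phi> z = 0 \<and> ev k z \<noteq> 0"
  proof (rule ccontr)
    assume "\<not> ?thesis"
    then have "{z. ev \<phi> z = 0} \<subseteq> {z. ev \<phi> z = 0 \<and> ev k z = 0}" by blast
    then show False
      using prime_finite_common_zeros[OF phi k(2)] prime_infinite_zeros[OF phi] finite_subset by blast
  qed
  then obtain x y where xy: "ev \<phi> (x, y) = 0" "ev k (x, y) \<noteq> 0" by auto
  then have "\<not> (ev (fst (dx \<phi>, dy \<phi>)) (x, y) = 0 \<and> ev (snd (dx \<phi>, dy \<phi>)) (x, y) = 0)" using k(1) by auto
  from leaf_disc[OF this] obtain X Y \<epsilon> where
    hol: "X holomorphic_on ball 0 1" "Y holomorphic_on ball 0 1" and "X 0 = x" "Y 0 = y" "\<epsilon> \<noteq> 0"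
    and D: "\<And>s. s \<in> ball 0 1 \<Longrightarrow> \<not> (ev (dx \<phi>) (X s, Y s) = 0 \<and> ev (dy \<phi>) (X s, Y s) = 0) \<and>
       deriv X s = \<epsilon> * ev (dy \<phi>) (X s, Y s) \<and> deriv Y s = - \<epsilon> * ev (dx \<phi>) (X s, Y s)"
    by (simp only: fst_conv snd_conv) blast
  let ?U = "ball 0 1 :: complex set"
  have d: "((\<lambda>s. ev k (X s, Y s)) has_field_derivative
    \<epsilon> * (ev (dx k) (X s, Y s) * ev (dy \<phi>) (X s, Y s) - ev (dy k) (X s, Y s) * ev (dx \<phi>) (X s, Y s))) (at s)"
    if "s \<in> ?U" for s k
    using deriv_ev_disc[OF hol that, of k] D[OF that] by (simp add: algebra_simps)
  have on: "ev \<phi> (X s, Y s) = 0" if "s \<in> ?U" for s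
  proof -
    have "\<exists>c. \<forall>s\<in>?U. ev \<phi> (X s, Y s) = c"
      by (rule has_field_derivative_zero_constant[OF convex_ball])
        (use d[of _ \<phi>] in \<open>auto intro: has_field_derivative_at_within simp: mult.commute\<close>)
    then obtain c where c: "\<And>s. s \<in> ?U \<Longrightarrow> ev \<phi> (X s, Y s) = c" by blast
    have "c = 0" using c[of 0] xy(1) \<open>X 0 = x\<close> \<open>Y 0 = y\<close> by simp
    then show ?thesis using c that by simp
  qed
  let ?n = "\<lambda>s. ev f (X s, Y s)" and ?d = "\<lambda>s. ev g (X s, Y s)"
  \<comment> \<open>If \<open>g\<close> vanishes along the disc, the member is \<open>g\<close>
    itself; otherwise the quotient is constant on a smaller disc without zeros of
    \<open>g\<close>.\<close>
  have "\<exists>p s0 \<rho>. p \<noteq> (0, 0) \<and> \<rho> > 0 \<and> ball s0 \<rho> \<subseteq> ?U \<and> (\<forall>s\<in>ball s0 \<rho>. ev (mem p f g) (X s, Y s) = 0)"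
  proof (cases "\<forall>s\<in>?U. ?d s = 0")
    case True
    then show ?thesis by (intro exI[of _ "(0, 1)"] exI[of _ 0] exI[of _ 1]) (simp add: mem_def)
  next
    case False
    then obtain s0 where s0: "s0 \<in> ?U" "?d s0 \<noteq> 0" by blast
    have "continuous_on ?U ?d"
      using holomorphic_on_imp_continuous_on[OF holomorphic_ev[OF hol open_ball]] .
    then have "open {s\<in>?U. ?d s \<noteq> 0}"
      using continuous_open_preimage[OF _ open_ball, of 0 1 ?d "- {0}"] by (simp add: vimage_def Int_def open_Compl)
    then obtain \<rho> where r: "\<rho> > 0" "ball s0 \<rho> \<subseteq> {s\<in>?U. ?d s \<noteq> 0}"
      using s0 unfolding open_contains_ball by blast
    have "\<exists>c. \<forall>s\<in>ball s0 \<rho>. ?n s / ?d s = c"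
    proof (rule has_field_derivative_zero_constant[OF convex_ball])
      fix s assume "s \<in> ball s0 \<rho>"
      then have s: "s \<in> ?U" "?d s \<noteq> 0" using r(2) by auto
      have "ev ((g * dx f - f * dx g) * dy \<phi> - (g * dy f - f * dy g) * dx \<phi>) (X s, Y s) = 0"
        using ev_dvd[OF inv on[OF s(1)]] .
      moreover define A where "A k = ev (dx k) (X s, Y s) * ev (dy \<phi>) (X s, Y s) -
        ev (dy k) (X s, Y s) * ev (dx \<phi>) (X s, Y s)" for k
      have "\<epsilon> * A f * ?d s - ?n s * (\<epsilon> * A g) =
          \<epsilon> * ev ((g * dx f - f * dx g) * dy \<phi> - (g * dy f - f * dy g) * dx \<phi>) (X s, Y s)"
        by (simp add: A_def algebra_simps)
      ultimately have e0: "\<epsilon> * A f * ?d s - ?n s * (\<epsilon> * A g) = 0" by simp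
      have "((\<lambda>s. ?n s / ?d s) has_field_derivative 0) (at s)"
        using DERIV_divide[OF d[OF s(1), of f] d[OF s(1), of g] s(2), folded A_def]
        by (simp only: e0 div_0)
      then show "((\<lambda>s. ?n s / ?d s) has_field_derivative 0) (at s within ball s0 \<rho>)"
        by (rule has_field_derivative_at_within)
    qed
    then obtain c where c: "\<And>s. s \<in> ball s0 \<rho> \<Longrightarrow> ?n s / ?d s = c" by blast
    have "ev (mem (1, - c) f g) (X s, Y s) = 0" if "s \<in> ball s0 \<rho>" for s
      using c[OF that] r(2) that by (auto simp: mem_def field_simps)
    then show ?thesis using r by (intro exI[of _ "(1, - c)"] exI[of _ s0] exI[of _ \<rho>]) auto
  qed
  then obtain p s0 \<rho> where p: "p \<noteq> (0, 0)" "\<rho> > 0" "ball s0 \<rho> \<subseteq> ?U"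
    "\<And>s. s \<in> ball s0 \<rho> \<Longrightarrow> ev (mem p f g) (X s, Y s) = 0" by blast
  have "infinite ((\<lambda>s. (X s, Y s)) ` ball s0 \<rho>)"
  proof (rule infinite_disc_image)
    have "s0 \<in> ?U" using p(2,3) by (meson centre_in_ball subsetD)
    then show "deriv X s0 \<noteq> 0 \<or> deriv Y s0 \<noteq> 0" using D[of s0] \<open>\<epsilon> \<noteq> 0\<close> by auto
  qed (use p hol in \<open>auto intro: holomorphic_on_subset\<close>)
  then have "\<phi> dvd mem p f g"
    by (rule prime_dvd_of_infinite[OF phi]) (use p on in auto)
  then show ?thesis using p(1) by blast
qed

text \<open>On a disc lying in a member, the equation of the member and its derivative along the
  leaf both vanish. These are two linear equations for the coefficients of the member, and their
  determinant is the asserted identity.\<close>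

lemma pencil_leaves_proportional:
  assumes "\<And>X Y. \<lbrakk>X holomorphic_on ball 0 1; Y holomorphic_on ball 0 1;
      \<And>s. s \<in> ball 0 1 \<Longrightarrow> \<not> (ev (fst w) (X s, Y s) = 0 \<and> ev (snd w) (X s, Y s) = 0);
      \<And>s. s \<in> ball 0 1 \<Longrightarrow> form_ev w (X s, Y s) (deriv X s, deriv Y s) = 0\<rbrakk> \<Longrightarrow>
      \<exists>p. p \<noteq> (0, 0) \<and> (\<forall>s\<in>ball 0 1. ev (mem p f g) (X s, Y s) = 0)"
  shows "(g * dx f - f * dx g) * snd w = (g * dy f - f * dy g) * fst w"
proof (rule ev_ext)
  fix x y
  show "ev ((g * dx f - f * dx g) * snd w) (x, y) = ev ((g * dy f - f * dy g) * fst w) (x, y)"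
  proof (cases "ev (fst w) (x, y) = 0 \<and> ev (snd w) (x, y) = 0")
    case False
    from leaf_disc[OF this] obtain X Y \<epsilon> where
      hol: "X holomorphic_on ball 0 1" "Y holomorphic_on ball 0 1" and XY: "X 0 = x" "Y 0 = y" "\<epsilon> \<noteq> 0"
      and D: "\<And>s. s \<in> ball 0 1 \<Longrightarrow> \<not> (ev (fst w) (X s, Y s) = 0 \<and> ev (snd w) (X s, Y s) = 0) \<and>
         deriv X s = \<epsilon> * ev (snd w) (X s, Y s) \<and> deriv Y s = - \<epsilon> * ev (fst w) (X s, Y s)"
      by blast
    have "\<exists>p. p \<noteq> (0, 0) \<and> (\<forall>s\<in>ball 0 1. ev (mem p f g) (X s, Y s) = 0)"
      by (rule assms[OF hol]) (use D in \<open>auto simp: form_ev_def\<close>)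
    then obtain p where p: "p \<noteq> (0, 0)" "\<And>s. s \<in> ball 0 1 \<Longrightarrow> ev (mem p f g) (X s, Y s) = 0" by blast
    have z: "(0 :: complex) \<in> ball 0 1" by simp
    let ?a = "ev (fst w) (x, y)" and ?b = "ev (snd w) (x, y)"
    have "((\<lambda>s. 0) has_field_derivative (ev (dx (mem p f g)) (x, y) * deriv X 0 + ev (dy (mem p f g)) (x, y) * deriv Y 0)) (at 0)"
      using deriv_ev_disc[OF hol z, of "mem p f g"] unfolding XY
      by (rule has_field_derivative_transform_within_open[OF _ open_ball[of 0 1] z]) (use p(2) in auto)
    then have "ev (dx (mem p f g)) (x, y) * deriv X 0 + ev (dy (mem p f g)) (x, y) * deriv Y 0 = 0"
      using DERIV_unique DERIV_const by blast
    then have "\<epsilon> * (ev (dx (mem p f g)) (x, y) * ?b - ev (dy (mem p f g)) (x, y) * ?a) = 0"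
      using D[OF z] XY by (simp add: algebra_simps)
    then have "ev (dx (mem p f g)) (x, y) * ?b - ev (dy (mem p f g)) (x, y) * ?a = 0"
      using XY(3) by (simp only: mult_eq_0_iff simp_thms)
    then have "fst p * (ev (dx f) (x, y) * ?b - ev (dy f) (x, y) * ?a) +
        snd p * (ev (dx g) (x, y) * ?b - ev (dy g) (x, y) * ?a) = 0"
      by (simp add: mem_def d_simps algebra_simps)
    moreover have "fst p * ev f (x, y) + snd p * ev g (x, y) = 0" using p(2)[OF z] XY by (simp add: mem_def)
    \<comment> \<open>Elimination: each coefficient of the member is annihilated by the determinant,
      and one of them is nonzero.\<close>
    ultimately have E: "(ev g (x, y) * (ev (dx f) (x, y) * ?b - ev (dy f) (x, y) * ?a) -
        ev f (x, y) * (ev (dx g) (x, y) * ?b - ev (dy g) (x, y) * ?a)) * c = 0" if "c = fst p \<or> c = snd p" for c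
      using that by algebra
    obtain c where c: "c = fst p \<or> c = snd p" "c \<noteq> 0" using p(1) by (cases p) auto
    have "ev g (x, y) * (ev (dx f) (x, y) * ?b - ev (dy f) (x, y) * ?a) -
        ev f (x, y) * (ev (dx g) (x, y) * ?b - ev (dy g) (x, y) * ?a) = 0"
      using E[OF c(1)] c(2) by (simp only: mult_eq_0_iff simp_thms)
    then show ?thesis by (simp add: algebra_simps)
  qed simp
qed

section \<open>Homogeneous equations, the torus action and the charts of the surface\<close>

section \<open>Homogeneous polynomials and charts\<close>

definition nvars :: "surface \<Rightarrow> nat" where "nvars S = (case S of P2 \<Rightarrow> 3 | Hirz \<delta> \<Rightarrow> 4)"

lemma homogeneous_keys: "homogeneous S d f \<Longrightarrow> m \<in> Poly_Mapping.keys f \<Longrightarrow>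
    Poly_Mapping.keys m \<subseteq> {..<nvars S} \<and> weight S m = d"
  unfolding homogeneous_def nvars_def by (cases S) auto

lemma meval_superset:
  assumes "C 0 = 0" "finite A" "Poly_Mapping.keys f \<subseteq> A"
  shows "meval C X f = (\<Sum>m\<in>A. C (Poly_Mapping.lookup f m) *
           (\<Prod>i\<in>Poly_Mapping.keys m. (X ! i) ^ Poly_Mapping.lookup m i))"
  unfolding meval_def using assms
  by (intro sum.mono_neutral_left) (auto simp: in_keys_iff)

lemma meval_add:
  assumes "C 0 = 0" "\<And>a b. C (a + b) = C a + C b"
  shows "meval C X (f + g) = meval C X f + meval C X g"
proof -
  let ?A = "Poly_Mapping.keys f \<union> Poly_Mapping.keys g"
  have A: "finite ?A" "Poly_Mapping.keys f \<subseteq> ?A" "Poly_Mapping.keys g \<subseteq> ?A" "Poly_Mapping.keys (f + g) \<subseteq> ?A"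
    using Poly_Mapping.keys_add[of f g] by auto
  show ?thesis
    unfolding meval_superset[where C = C, OF assms(1) A(1) A(2)] meval_superset[where C = C, OF assms(1) A(1) A(3)]
      meval_superset[where C = C, OF assms(1) A(1) A(4)] sum.distrib[symmetric]
    by (intro sum.cong refl) (simp add: lookup_add assms(2) distrib_right)
qed

lemma lookup_cst_mult: "Poly_Mapping.lookup (cst k * f) m = k * Poly_Mapping.lookup f m"
proof -
  have "cst k * f = Poly_Mapping.map ((*) k) f" unfolding cst_def by (simp add: mult_map_scale_conv_mult)
  then show ?thesis by (simp add: map.rep_eq when_def)
qed

lemma keys_cst_mult: "Poly_Mapping.keys (cst k * f) \<subseteq> Poly_Mapping.keys f"
  by (auto simp: in_keys_iff lookup_cst_mult)

lemma meval_cst_mult: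
  assumes "C 0 = 0" "\<And>a b. C (a * b) = C a * C b"
  shows "meval C X (cst k * f) = C k * meval C X f"
  unfolding meval_superset[of C "Poly_Mapping.keys f" "cst k * f" X, OF assms(1) finite_keys keys_cst_mult]
    meval_def[of C X f] sum_distrib_left
  by (intro sum.cong refl) (simp add: lookup_cst_mult assms(2) mult.assoc)

lemma bconst_hom: "bconst 0 = 0" "bconst (a + b) = bconst a + bconst b" "bconst (a * b) = bconst a * bconst b"
  by (simp_all add: bconst_def)

lemma dehom_add: "dehom S (f + g) c = dehom S f c + dehom S g c"
  unfolding dehom_def by (intro meval_add bconst_hom)

lemma dehom_cst_mult: "dehom S (cst k * f) c = bconst k * dehom S f c"
  unfolding dehom_def by (intro meval_cst_mult bconst_hom)

lemma length_hc: "length (hc S c u v) = nvars S"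
  by (cases S) (auto simp: hc_def nvars_def)

lemma ev_hc_nth: "i < nvars S \<Longrightarrow> ev (hc S c bX bY ! i) (u, v) = hc S c u v ! i"
  by (cases S) (auto simp: hc_def nvars_def nth_Cons' less_Suc_eq numeral_3_eq_3 numeral_eq_Suc)

lemma ev_dehom:
  assumes "homogeneous S d f"
  shows "ev (dehom S f c) (u, v) = meval id (hc S c u v) f"
proof -
  have "ev (dehom S f c) (u, v) = (\<Sum>m\<in>Poly_Mapping.keys f. Poly_Mapping.lookup f m *
      (\<Prod>i\<in>Poly_Mapping.keys m. ev (hc S c bX bY ! i) (u, v) ^ Poly_Mapping.lookup m i))"
    unfolding dehom_def meval_def by (simp add: ev_sum ev_prod)
  also have "\<dots> = meval id (hc S c u v) f"
    unfolding meval_def id_def using homogeneous_keys[OF assms]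
    by (intro sum.cong refl arg_cong2[of _ _ _ _ "(*)"] prod.cong) (auto simp: ev_hc_nth subset_iff)
  finally show ?thesis .
qed

lemma homogeneous_combination:
  assumes "homogeneous S d P" "homogeneous S d Q"
  shows "homogeneous S d (P + cst k * Q)" "homogeneous S d (cst a * P + cst b * Q)"
proof -
  have "Poly_Mapping.keys (P + cst k * Q) \<subseteq> Poly_Mapping.keys P \<union> Poly_Mapping.keys Q" for k P Q
    using Poly_Mapping.keys_add[of P "cst k * Q"] keys_cst_mult[of k Q] by blast
  then show "homogeneous S d (P + cst k * Q)" "homogeneous S d (cst a * P + cst b * Q)"
    using assms keys_cst_mult[of a P] unfolding homogeneous_def by blast+
qed

lemma hdeg_eq:
  assumes "homogeneous S d f" "f \<noteq> 0"
  shows "hdeg S f = d"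
proof -
  obtain m where m: "m \<in> Poly_Mapping.keys f" using assms(2) keys_eq_empty[of f] by blast
  show ?thesis unfolding hdeg_def
  proof (rule the_equality[where P = "\<lambda>d. homogeneous S d f", OF assms(1)])
    fix d' assume "homogeneous S d' f"
    then show "d' = d" using m assms(1) by (metis homogeneous_keys)
  qed
qed

lemma prod_vars:
  assumes "Poly_Mapping.keys m \<subseteq> {..<n :: nat}"
  shows "(\<Prod>i\<in>Poly_Mapping.keys m. X i ^ Poly_Mapping.lookup m i) = (\<Prod>i<n. (X i :: complex) ^ Poly_Mapping.lookup m i)"
  using assms by (intro prod.mono_neutral_left) (auto simp: in_keys_iff)

lemma meval_act:
  assumes "homogeneous S d f" "l \<noteq> 0" "m \<noteq> 0"
  shows "meval id (act S l m X) f = l powi fst d * m powi snd d * meval id X f"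
proof -
  have "(\<Prod>i\<in>Poly_Mapping.keys \<mu>. (act S l m X ! i) ^ Poly_Mapping.lookup \<mu> i) =
      l powi fst d * m powi snd d * (\<Prod>i\<in>Poly_Mapping.keys \<mu>. (X ! i) ^ Poly_Mapping.lookup \<mu> i)"
    if \<mu>: "\<mu> \<in> Poly_Mapping.keys f" for \<mu>
  proof -
    let ?e = "Poly_Mapping.lookup \<mu>"
    have k: "Poly_Mapping.keys \<mu> \<subseteq> {..<nvars S}" and w: "weight S \<mu> = d"
      using homogeneous_keys[OF assms(1) \<mu>] by auto
    show ?thesis
    proof (cases S)
      case P2
      have d: "d = (0, int (?e 0 + ?e 1 + ?e 2))" using w P2 by (simp add: weight_def Let_def)
      show ?thesis
        unfolding prod_vars[OF k] P2 nvars_def d surface.case fst_conv snd_conv power_int_of_nat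
        by (simp add: act_def numeral_3_eq_3 numeral_2_eq_2 power_mult_distrib power_add)
    next
      case (Hirz \<delta>)
      have d: "d = (int (?e 0 + ?e 1) - int (\<delta> * ?e 3), int (?e 2 + ?e 3))"
        using w Hirz by (simp add: weight_def Let_def)
      have l: "l powi (int (?e 0 + ?e 1) - int (\<delta> * ?e 3)) = l ^ ?e 0 * l ^ ?e 1 * (l powi (- int \<delta>)) ^ ?e 3"
        using assms(2) by (simp add: power_int_diff power_add power_int_minus power_mult power_inverse divide_inverse
            flip: of_nat_add of_nat_mult)
      have four: "{..<4 :: nat} = {0, 1, 2, 3}" by auto
      show ?thesis
        unfolding prod_vars[OF k] Hirz nvars_def d surface.case fst_conv snd_conv l power_int_of_nat four
        by (simp add: act_def power_mult_distrib power_add numeral_3_eq_3)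
    qed
  qed
  then show ?thesis unfolding meval_def id_def sum_distrib_left
    by (intro sum.cong refl) (simp add: mult_ac)
qed

text \<open>The torus element that carries the normalized coordinates of a point in chart 0 to those
  in chart \<open>c\<close>.\<close>

definition lm :: "surface \<Rightarrow> nat \<Rightarrow> complex \<Rightarrow> complex \<Rightarrow> complex \<times> complex" where
  "lm S c u v = (case S of P2 \<Rightarrow> if c = 0 then (1, 1) else (1, v)
    | Hirz \<delta> \<Rightarrow> if c = 0 then (1, 1) else if c = 1 then (u, 1) else if c = 2 then (1, v) else (u, v))"

lemma chi_lm: "chi S d c u v = fst (lm S c u v) powi fst d * snd (lm S c u v) powi snd d"
  by (cases S) (auto simp: chi_def lm_def)

lemma lm_ne_0: "u \<noteq> 0 \<Longrightarrow> v \<noteq> 0 \<Longrightarrow> fst (lm S c u v) \<noteq> 0 \<and> snd (lm S c u v) \<noteq> 0 \<and> (S = P2 \<longrightarrow> fst (lm S c u v) = 1)"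
  by (cases S) (auto simp: lm_def)

lemma hc_lm:
  assumes "c \<in> charts S" "u \<noteq> 0" "v \<noteq> 0"
  shows "hc S c u v = act S (fst (lm S c u v)) (snd (lm S c u v)) (hc S 0 (fst (tau S c u v)) (snd (tau S c u v)))"
    and "hc S 0 (fst (tau S c u v)) (snd (tau S c u v)) = act S (1 / fst (lm S c u v)) (1 / snd (lm S c u v)) (hc S c u v)"
  using assms by (cases S; auto simp: charts_simps lm_def hc_def act_def tau_def power_int_minus field_simps power_one_over)+

lemma sec_dehom:
  assumes "homogeneous S d f" shows "sec S d (dehom S f)"
  unfolding sec_def
proof (intro ballI allI impI)
  fix c and u v :: complex assume c: "c \<in> charts S" and uv: "u \<noteq> 0" "v \<noteq> 0"
  obtain x y where xy: "tau S c u v = (x, y)" by (cases "tau S c u v")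
  show "ev (dehom S f c) (u, v) = chi S d c u v * ev (dehom S f 0) (tau S c u v)"
    unfolding xy ev_dehom[OF assms] chi_lm hc_lm(1)[OF c uv] fst_conv snd_conv
    using lm_ne_0[OF uv, of S c] by (intro meval_act[OF assms]) auto
qed

text \<open>The exponents of \<open>X\<close> and \<open>Y\<close>, resp. \<open>X1\<close> and
  \<open>Y1\<close>, determine the remaining ones through the weight, so different monomials of
  \<open>f\<close> stay different in chart 0.\<close>

lemma dehom_0_inj:
  assumes "homogeneous S d f" "dehom S f 0 = 0" shows "f = 0"
proof -
  define ix iy where "ix = (case S of P2 \<Rightarrow> (0 :: nat) | Hirz \<delta> \<Rightarrow> 1)" and "iy = (case S of P2 \<Rightarrow> (1 :: nat) | Hirz \<delta> \<Rightarrow> 3)"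
  let ?K = "Poly_Mapping.keys f"
  have "dehom S f 0 = (\<Sum>m\<in>?K. monom (monom (Poly_Mapping.lookup f m) (Poly_Mapping.lookup m ix)) (Poly_Mapping.lookup m iy))"
  proof (rule ev_ext)
    fix u v :: complex
    have "(\<Prod>i\<in>Poly_Mapping.keys m. hc S 0 u v ! i ^ Poly_Mapping.lookup m i) =
        u ^ Poly_Mapping.lookup m ix * v ^ Poly_Mapping.lookup m iy" if "m \<in> ?K" for m
    proof -
      have k: "Poly_Mapping.keys m \<subseteq> {..<nvars S}" using homogeneous_keys[OF assms(1) that] by blast
      have "{..<3 :: nat} = {0, 1, 2}" "{..<4 :: nat} = {0, 1, 2, 3}" by auto
      then show ?thesis unfolding prod_vars[OF k]
        by (cases S) (simp_all add: nvars_def hc_def ix_def iy_def numeral_3_eq_3)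
    qed
    then show "ev (dehom S f 0) (u, v) = ev (\<Sum>m\<in>?K. monom (monom (Poly_Mapping.lookup f m) (Poly_Mapping.lookup m ix)) (Poly_Mapping.lookup m iy)) (u, v)"
      unfolding ev_dehom[OF assms(1)] meval_def ev_sum by (intro sum.cong) (auto simp: mult_ac)
  qed
  moreover have inj: "m = m'" if "m \<in> ?K" "m' \<in> ?K" "Poly_Mapping.lookup m ix = Poly_Mapping.lookup m' ix"
    "Poly_Mapping.lookup m iy = Poly_Mapping.lookup m' iy" for m m'
  proof (rule poly_mapping_eqI)
    fix k
    have w: "weight S m = d" "weight S m' = d" and k: "Poly_Mapping.keys m \<subseteq> {..<nvars S}" "Poly_Mapping.keys m' \<subseteq> {..<nvars S}"
      using homogeneous_keys[OF assms(1)] that by auto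
    show "Poly_Mapping.lookup m k = Poly_Mapping.lookup m' k"
    proof (cases "k < nvars S")
      case False
      then have "k \<notin> Poly_Mapping.keys m" "k \<notin> Poly_Mapping.keys m'" using k by auto
      then show ?thesis by (simp add: in_keys_iff)
    next
      case True
      show ?thesis
      proof (cases S)
        case P2
        then have "k = 0 \<or> k = 1 \<or> k = 2" using True by (auto simp: nvars_def)
        then show ?thesis using P2 w that(3,4) by (auto simp: ix_def iy_def weight_def Let_def)
      next
        case (Hirz \<delta>)
        then have k: "k = 0 \<or> k = 1 \<or> k = 2 \<or> k = 3" using True by (auto simp: nvars_def)
        have "int (Poly_Mapping.lookup m 0) = int (Poly_Mapping.lookup m' 0)"
          "int (Poly_Mapping.lookup m 2) = int (Poly_Mapping.lookup m' 2)"
          using Hirz w that(3,4) by (auto simp: ix_def iy_def weight_def Let_def)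
        then show ?thesis using k Hirz that(3,4) by (auto simp: ix_def iy_def)
      qed
    qed
  qed
  ultimately have "cf (dehom S f 0) (Poly_Mapping.lookup m ix) (Poly_Mapping.lookup m iy) = Poly_Mapping.lookup f m"
    if "m \<in> ?K" for m
  proof -
    have "cf (dehom S f 0) (Poly_Mapping.lookup m ix) (Poly_Mapping.lookup m iy) =
        (\<Sum>m'\<in>?K. if m' = m then Poly_Mapping.lookup f m' else 0)"
      unfolding \<open>dehom S f 0 = sum _ _\<close> cf_sum cf_monom using inj that by (intro sum.cong) auto
    then show ?thesis using that by simp
  qed
  then have "m \<notin> ?K" for m using assms(2) by (auto simp: in_keys_iff)
  then have "?K = {}" by blast
  then show ?thesis by (simp only: keys_eq_empty)
qed

lemma chart_act:
  assumes "l \<noteq> 0" "m \<noteq> 0"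
  shows "chart_dom S c (act S l m X) \<longleftrightarrow> chart_dom S c X" "chart_coords S c (act S l m X) = chart_coords S c X"
proof -
  show "chart_dom S c (act S l m X) \<longleftrightarrow> chart_dom S c X"
    using assms by (cases S) (auto simp: chart_dom_def act_def numeral_3_eq_3 power_int_eq_0_iff)
  show "chart_coords S c (act S l m X) = chart_coords S c X"
  proof (cases S)
    case P2
    then show ?thesis using assms by (simp add: chart_coords_def act_def)
  next
    case (Hirz \<delta>)
    have p: "(l * x) ^ \<delta> * (l powi (- int \<delta>) * m * y) = m * (x ^ \<delta> * y)" for x y
      using assms by (simp add: power_mult_distrib power_int_minus)
    show ?thesis unfolding Hirz using assms by (simp add: chart_coords_def act_def numeral_3_eq_3 p)
  qed
qed

lemma chart_dom_hc: "c \<in> charts S \<Longrightarrow> chart_dom S c (hc S c u v)"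
  and chart_coords_hc: "c \<in> charts S \<Longrightarrow> chart_coords S c (hc S c u v) = (u, v)"
  by (cases S; auto simp: charts_simps chart_dom_def chart_coords_def hc_def numeral_3_eq_3)+

lemma hc_chart_coords:
  assumes "length X = nvars S" "chart_dom S c X" "c \<in> charts S"
  shows "\<exists>l m. l \<noteq> 0 \<and> m \<noteq> 0 \<and> (S = P2 \<longrightarrow> l = 1) \<and>
    hc S c (fst (chart_coords S c X)) (snd (chart_coords S c X)) = act S l m X"
proof (cases S)
  case P2
  then obtain x y z where X: "X = [x, y, z]" using assms(1)
    by (auto simp: nvars_def length_Suc_conv numeral_3_eq_3)
  have "c = 0 \<or> c = 1 \<or> c = 2" using assms(3) P2 by (simp add: charts_simps)
  then consider "c = 0" | "c = 1" | "c = 2" by blast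
  then show ?thesis
  proof cases
    case 1 then show ?thesis using assms(2) P2 X
      by (intro exI[of _ 1] exI[of _ "1 / z"]) (auto simp: chart_dom_def chart_coords_def hc_def act_def)
  next
    case 2 then show ?thesis using assms(2) P2 X
      by (intro exI[of _ 1] exI[of _ "1 / x"]) (auto simp: chart_dom_def chart_coords_def hc_def act_def)
  next
    case 3 then show ?thesis using assms(2) P2 X
      by (intro exI[of _ 1] exI[of _ "1 / y"]) (auto simp: chart_dom_def chart_coords_def hc_def act_def)
  qed
next
  case (Hirz \<delta>)
  then obtain x y z w where X: "X = [x, y, z, w]" using assms(1)
    by (auto simp: nvars_def length_Suc_conv numeral_eq_Suc)
  note defs = chart_dom_def chart_coords_def hc_def act_def power_int_minus power_int_divide_distrib power_one_over
    power_divide numeral_3_eq_3 field_simps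
  consider "c = 0" | "c = 1" | "c = 2" | "c = 3" using assms(3) Hirz by (auto simp: charts_simps)
  then show ?thesis
  proof cases
    case 1 then show ?thesis using assms(2) Hirz X
      by (intro exI[of _ "1 / x"] exI[of _ "1 / z"]) (auto simp: defs)
  next
    case 2 then show ?thesis using assms(2) Hirz X
      by (intro exI[of _ "1 / y"] exI[of _ "1 / z"]) (auto simp: defs)
  next
    case 3 then show ?thesis using assms(2) Hirz X
      by (intro exI[of _ "1 / x"] exI[of _ "1 / (x ^ \<delta> * w)"]) (auto simp: defs)
  next
    case 4 then show ?thesis using assms(2) Hirz X
      by (intro exI[of _ "1 / y"] exI[of _ "1 / (y ^ \<delta> * w)"]) (auto simp: defs)
  qed
qed

text \<open>Among the charts containing the point the first one is taken, which is the
  representative chosen by \<open>on_surface\<close>.\<close>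

lemma point_representative:
  assumes "c \<in> charts S"
  shows "\<exists>c0 u v l m. on_surface S (Proper c0 u v) \<and> l \<noteq> 0 \<and> m \<noteq> 0 \<and> (S = P2 \<longrightarrow> l = 1) \<and>
     hc S c0 u v = act S l m (hc S c x y) \<and> (x, y) = chart_coords S c (hc S c0 u v)"
proof -
  let ?P = "\<lambda>c'. c' \<in> charts S \<and> chart_dom S c' (hc S c x y)"
  have "?P c" using assms chart_dom_hc by blast
  then have P0: "?P (LEAST c'. ?P c')" and least: "\<And>c'. c' < (LEAST c'. ?P c') \<Longrightarrow> \<not> ?P c'"
    using LeastI[of ?P c] not_less_Least[of _ ?P] by blast+
  define c0 where "c0 = (LEAST c'. ?P c')"
  obtain l m where lm: "l \<noteq> 0" "m \<noteq> 0" "S = P2 \<longrightarrow> l = 1"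
    "hc S c0 (fst (chart_coords S c0 (hc S c x y))) (snd (chart_coords S c0 (hc S c x y))) = act S l m (hc S c x y)"
    using hc_chart_coords[of "hc S c x y" S c0] P0 length_hc unfolding c0_def by blast
  obtain u v where uv: "chart_coords S c0 (hc S c x y) = (u, v)" by (cases "chart_coords S c0 (hc S c x y)")
  have eq: "hc S c0 u v = act S l m (hc S c x y)" using lm(4) uv by simp
  have charts_down: "c' \<in> charts S" if "c' < c0" for c'
    using that P0 unfolding c0_def by (cases S) (auto simp: charts_def)
  have "on_surface S (Proper c0 u v)"
  proof -
    have "\<not> chart_dom S c' (hc S c0 u v)" if "c' < c0" for c'
      unfolding eq chart_act(1)[OF lm(1,2)] using least[of c'] that charts_down[OF that] unfolding c0_def by blast
    moreover have "c0 \<in> charts S" using P0 unfolding c0_def by blast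
    ultimately show ?thesis by (simp add: overlap_def)
  qed
  moreover have "(x, y) = chart_coords S c (hc S c0 u v)"
    unfolding eq chart_act(2)[OF lm(1,2)] using chart_coords_hc[OF assms] by simp
  ultimately show ?thesis using lm eq by blast
qed

section \<open>From rational first integrals to pencils in the charts\<close>

section \<open>First integrals in charts\<close>

lemma poly_slice_dx: "pderiv (poly f [:y:]) = poly (dx f) [:y:]"
proof (rule poly_ext)
  fix x
  have "((\<lambda>x. ev f (x, y)) has_field_derivative poly (pderiv (poly f [:y:])) x) (at x)"
    using poly_DERIV[of "poly f [:y:]" x] by (simp add: poly_poly_ev)
  then show "poly (pderiv (poly f [:y:])) x = poly (poly (dx f) [:y:]) x"
    using ev_dx_unique by (simp add: poly_poly_ev)
qed

lemma cy_dy: "pderiv (cy x f) = cy x (dy f)"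
proof (rule poly_ext)
  fix y
  have "((\<lambda>y. ev f (x, y)) has_field_derivative poly (pderiv (cy x f)) y) (at y)"
    using poly_DERIV[of "cy x f" y] by simp
  then show "poly (pderiv (cy x f)) y = poly (cy x (dy f)) y"
    using ev_dy_unique by simp
qed

text \<open>The Wronskian criterion is applied on one horizontal line and then on the vertical lines
  through its points.\<close>

lemma zero_differential_proportional:
  assumes x: "g * dx f = f * dx g" and y: "g * dy f = f * dy g" and g: "g \<noteq> 0"
  shows "\<exists>k. f = bconst k * g"
proof -
  obtain x0 y0 where g0: "ev g (x0, y0) \<noteq> 0" using g ev_ext[of g 0] by auto
  define k where "k = ev f (x0, y0) / ev g (x0, y0)"
  define u where "u = f - bconst k * g"
  have ux: "g * dx u = u * dx g" and uy: "g * dy u = u * dy g"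
    using x y by (simp_all add: u_def d_simps algebra_simps)
  have u0: "ev u (x0, y0) = 0" using g0 by (simp add: u_def k_def)
  have row: "ev u (x, y0) = 0" for x
  proof -
    let ?U = "poly u [:y0:]" and ?G = "poly g [:y0:]"
    have "?G * pderiv ?U = ?U * pderiv ?G"
      unfolding poly_slice_dx using arg_cong[OF ux, of "\<lambda>f. poly f [:y0:]"] by simp
    moreover have "?G \<noteq> 0" using g0 by (auto simp flip: poly_poly_ev)
    ultimately obtain c where c: "?U = smult c ?G" using wronskian_dependent by blast
    have "c * ev g (x0, y0) = 0" using u0 arg_cong[OF c, of "\<lambda>p. poly p x0"] by (simp add: poly_poly_ev)
    then have "?U = 0" using c g0 by simp
    then show ?thesis by (simp flip: poly_poly_ev)
  qed
  have col: "ev u (x, y) = 0" if "ev g (x, y0) \<noteq> 0" for x y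
  proof -
    have "cy x g * pderiv (cy x u) = cy x u * pderiv (cy x g)"
      unfolding cy_dy by (rule poly_ext) (use arg_cong[OF uy, of "\<lambda>f. ev f (x, _)"] in \<open>simp add: fun_eq_iff flip: ev_simps(6)\<close>)
    moreover have "cy x g \<noteq> 0" using that by (metis poly_0 poly_cy)
    ultimately obtain c where c: "cy x u = smult c (cy x g)" using wronskian_dependent by blast
    have "c * ev g (x, y0) = 0" using row[of x] arg_cong[OF c, of "\<lambda>p. poly p y0"] by simp
    then have "cy x u = 0" using c that by simp
    then show ?thesis by (metis poly_0 poly_cy)
  qed
  have "u = 0"
  proof (rule ev_zero_ext)
    have "poly g [:y0:] \<noteq> 0" using g0 by (auto simp flip: poly_poly_ev)
    then show "infinite (- {x. poly (poly g [:y0:]) x = 0})" by (intro infinite_complex_Compl poly_roots_finite)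
    fix x assume "x \<in> - {x. poly (poly g [:y0:]) x = 0}"
    then have "{y. ev u (x, y) = 0} = UNIV" using col by (auto simp: poly_poly_ev)
    then show "infinite {y. ev u (x, y) = 0}" by (simp add: infinite_UNIV_char_0)
  qed
  then show ?thesis by (auto simp: u_def)
qed

context
  fixes S :: surface and W :: "nat \<Rightarrow> form" and SF :: "ipt set" and P Q :: mpoly and d :: deg
  assumes fi: "first_integral S W SF P Q" and hom: "homogeneous S d P" "homogeneous S d Q"
    and fol: "foliation_on S W" and finSF: "finite SF"
begin

lemma first_integral_nz: "c \<in> charts S \<Longrightarrow> dehom S P c \<noteq> 0" "c \<in> charts S \<Longrightarrow> dehom S Q c \<noteq> 0"
proof -
  have "P \<noteq> 0" "Q \<noteq> 0" using fi unfolding first_integral_def by simp_all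
  then show "c \<in> charts S \<Longrightarrow> dehom S P c \<noteq> 0" "c \<in> charts S \<Longrightarrow> dehom S Q c \<noteq> 0"
    using dehom_0_inj[OF hom(1)] dehom_0_inj[OF hom(2)] sec_nonzero[OF sec_dehom[OF hom(1)]]
      sec_nonzero[OF sec_dehom[OF hom(2)]] by auto
qed

lemma first_integral_common_zeros:
  "on_surface S (Proper c u v) \<Longrightarrow> ev (dehom S P c) (u, v) = 0 \<Longrightarrow> ev (dehom S Q c) (u, v) = 0 \<Longrightarrow> Proper c u v \<in> SF"
  using fi unfolding first_integral_def by (auto simp: vanishing_def ev_dehom[OF hom(1)] ev_dehom[OF hom(2)])

text \<open>Common zeros are points of indeterminacy and belong to the finite set
  \<open>SF\<close>.\<close>

lemma first_integral_coprime:
  assumes c: "c \<in> charts S" shows "coprime (dehom S P c) (dehom S Q c)"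
proof -
  let ?f = "\<lambda>p. case p of Proper c0 u v \<Rightarrow> chart_coords S c (hc S c0 u v) | Near q e \<Rightarrow> (0, 0)"
  have "{z. ev (dehom S P c) z = 0 \<and> ev (dehom S Q c) z = 0} \<subseteq> ?f ` SF"
  proof clarify
    fix x y assume z: "ev (dehom S P c) (x, y) = 0" "ev (dehom S Q c) (x, y) = 0"
    obtain c0 u v l m where *: "on_surface S (Proper c0 u v)" "l \<noteq> 0" "m \<noteq> 0" "S = P2 \<longrightarrow> l = 1"
      "hc S c0 u v = act S l m (hc S c x y)" "(x, y) = chart_coords S c (hc S c0 u v)"
      using point_representative[OF c] by blast
    have "ev (dehom S R c0) (u, v) = 0" if "homogeneous S d R" "ev (dehom S R c) (x, y) = 0" for R
      unfolding ev_dehom[OF that(1)] *(5) meval_act[OF that(1) *(2,3)] using that(2)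
      unfolding ev_dehom[OF that(1)] by simp
    then have "Proper c0 u v \<in> SF" using first_integral_common_zeros[OF *(1)] z hom by blast
    moreover have "(x, y) = ?f (Proper c0 u v)" using *(6) by simp
    ultimately show "(x, y) \<in> ?f ` SF" by (rule rev_image_eqI)
  qed
  then have "finite {z. ev (dehom S P c) z = 0 \<and> ev (dehom S Q c) z = 0}" using finSF finite_surj by blast
  then show ?thesis using coprime_iff_finite_zeros first_integral_nz[OF c] by blast
qed

lemma first_integral_not_proportional:
  assumes c: "c \<in> charts S" shows "dehom S P c \<noteq> bconst k * dehom S Q c"
proof
  assume eq: "dehom S P c = bconst k * dehom S Q c"
  let ?R = "P + cst (- k) * Q"
  have h: "homogeneous S d ?R" by (rule homogeneous_combination(1)[OF hom])
  have bk: "bconst (- k) = - bconst k" by (simp add: bconst_def)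
  have "dehom S ?R c = 0" using eq by (simp add: dehom_add dehom_cst_mult bk)
  then have "dehom S ?R 0 = 0" using sec_nonzero[OF sec_dehom[OF h] c] by blast
  then have "?R = 0" by (rule dehom_0_inj[OF h])
  moreover have "cst (- k) = - cst k" by (simp add: cst_def single_uminus)
  ultimately have "P = cst k * Q" by simp
  then show False using fi unfolding first_integral_def by blast
qed

lemma first_integral_fpen:
  assumes c: "c \<in> charts S" shows "\<exists>h. fpen (dehom S P c) (dehom S Q c) (W c) h"
proof -
  let ?f = "dehom S P c" and ?g = "dehom S Q c"
  have cop: "coprime (fst (W c)) (snd (W c))" using fol c unfolding foliation_on_def by blast
  have leaves: "\<exists>\<alpha> \<beta>. (\<alpha>, \<beta>) \<noteq> (0, 0) \<and> leaf S W p \<subseteq> vanishing S (cst \<alpha> * P + cst \<beta> * Q)"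
    if "nonsing S W p" for p
    using fi that unfolding first_integral_def by (elim conjE allE[of _ p] impE)
  have "(?g * dx ?f - ?f * dx ?g) * snd (W c) = (?g * dy ?f - ?f * dy ?g) * fst (W c)"
  proof (rule pencil_leaves_proportional)
    fix X Y assume hol: "X holomorphic_on ball 0 1" "Y holomorphic_on ball 0 1"
      and ns: "\<And>s. s \<in> ball 0 1 \<Longrightarrow> \<not> (ev (fst (W c)) (X s, Y s) = 0 \<and> ev (snd (W c)) (X s, Y s) = 0)"
      and tg: "\<And>s. s \<in> ball 0 1 \<Longrightarrow> form_ev (W c) (X s, Y s) (deriv X s, deriv Y s) = 0"
    have nsg: "nonsing S W (c, X s, Y s)" if "s \<in> ball 0 1" for s
      using ns[OF that] c by (simp add: nonsing_def)
    have z: "(0 :: complex) \<in> ball 0 1" by simp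
    obtain \<alpha> \<beta> where ab: "(\<alpha>, \<beta>) \<noteq> (0, 0)" "leaf S W (c, X 0, Y 0) \<subseteq> vanishing S (cst \<alpha> * P + cst \<beta> * Q)"
      using leaves[OF nsg[OF z]] by auto
    have "ev (mem (\<alpha>, \<beta>) ?f ?g) (X s, Y s) = 0" if s: "s \<in> ball 0 1" for s
    proof -
      have "same_leaf S W (c, X 0, Y 0) (c, X s, Y s)"
        by (rule same_leaf.disc[OF hol nsg tg z s])
      then have "(c, X s, Y s) \<in> vanishing S (cst \<alpha> * P + cst \<beta> * Q)" using ab(2) by (auto simp: leaf_def)
      then have "ev (dehom S (cst \<alpha> * P + cst \<beta> * Q) c) (X s, Y s) = 0"
        by (simp add: vanishing_def ev_dehom[OF homogeneous_combination(2)[OF hom]])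
      then show ?thesis by (simp add: mem_def dehom_add dehom_cst_mult)
    qed
    then show "\<exists>p. p \<noteq> (0, 0) \<and> (\<forall>s\<in>ball 0 1. ev (mem p ?f ?g) (X s, Y s) = 0)" using ab(1) by blast
  qed
  then have "fst (W c) * (?g * dy ?f - ?f * dy ?g) = snd (W c) * (?g * dx ?f - ?f * dx ?g)"
    by (simp only: mult.commute)
  from coprime_parallel[OF cop this] obtain h where
    h: "?g * dx ?f - ?f * dx ?g = h * fst (W c)" "?g * dy ?f - ?f * dy ?g = h * snd (W c)" by blast
  have "h \<noteq> 0"
  proof
    assume "h = 0"
    then have "\<exists>k. ?f = bconst k * ?g"
      using h first_integral_nz[OF c] by (intro zero_differential_proportional) auto
    then show False using first_integral_not_proportional[OF c] by blast
  qed
  then show ?thesis unfolding fpen_def using h cop first_integral_nz[OF c] first_integral_coprime[OF c] by blast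
qed

end

section \<open>Cocycles: the canonical bundles of surface and foliation, and the divisor of
  \<open>Q dP - P dQ\<close>\<close>

section \<open>The canonical degree\<close>

text \<open>The degree of the canonical class of \<open>S\<close>, before any blowup.\<close>

definition kzdeg :: "surface \<Rightarrow> deg" where
  "kzdeg S = (case S of P2 \<Rightarrow> (0, -3) | Hirz \<delta> \<Rightarrow> (int \<delta> - 2, -2))"

text \<open>The sign between the Jacobian determinant of the chart change and the cocycle
  \<open>chi\<close>; it is constant on each chart and can be absorbed in the
  trivializations.\<close>

definition orient :: "surface \<Rightarrow> nat \<Rightarrow> complex" where
  "orient S c = (case S of P2 \<Rightarrow> if c = 2 then -1 else 1 | Hirz \<delta> \<Rightarrow> if c = 0 \<or> c = 3 then 1 else -1)"

lemma transition_0: "c \<in> charts S \<Longrightarrow> transition S c 0 = (\<lambda>z. tau S c (fst z) (snd z))"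
  by (cases S) (auto simp: transition_def chart_coords_def hc_def tau_def charts_simps numeral_3_eq_3 fun_eq_iff)

lemma overlap_torus: "c \<in> charts S \<Longrightarrow> u \<noteq> 0 \<Longrightarrow> v \<noteq> 0 \<Longrightarrow> (u, v) \<in> overlap S c 0"
  by (cases S) (auto simp: overlap_def chart_dom_def hc_def charts_simps)

text \<open>The Jacobian determinant of a chart change is the cocycle of the canonical bundle. The
  condition \<open>B = 0\<close> records that on a Hirzebruch surface fibers go to fibers.\<close>

lemma tau_has_derivative:
  assumes c: "c \<in> charts S" and uv: "u \<noteq> 0" "v \<noteq> 0"
  shows "\<exists>A B C D. ((\<lambda>z. tau S c (fst z) (snd z)) has_derivative
           (\<lambda>t. (A * fst t + B * snd t, C * fst t + D * snd t))) (at (u, v)) \<and>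
         A * D - B * C = orient S c * chi S (kzdeg S) c u v \<and> (S \<noteq> P2 \<longrightarrow> B = 0 \<and> A \<noteq> 0 \<and> (c = 2 \<longrightarrow> A = 1))"
proof (cases S)
  case P2
  have v3: "v powi (-3) = 1 / v ^ 3"
    by (simp add: power_int_minus divide_inverse)
  consider "c = 0" | "c = 1" | "c = 2" using c P2 by (auto simp: charts_simps)
  then show ?thesis
  proof cases
    case 1 then show ?thesis using P2
      by (intro exI[of _ 1] exI[of _ 0] exI[of _ 0] exI[of _ 1])
        (auto simp: tau_def orient_def chi_def intro!: derivative_eq_intros)
  next
    case 2 then show ?thesis using P2 uv
      by (intro exI[of _ 0] exI[of _ "- 1 / v\<^sup>2"] exI[of _ "1 / v"] exI[of _ "- u / v\<^sup>2"])
        (auto simp: tau_def orient_def chi_def kzdeg_def v3 field_simps power2_eq_square power3_eq_cube fun_eq_iff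
          intro!: derivative_eq_intros)
  next
    case 3 then show ?thesis using P2 uv
      by (intro exI[of _ "1 / v"] exI[of _ "- u / v\<^sup>2"] exI[of _ 0] exI[of _ "- 1 / v\<^sup>2"])
        (auto simp: tau_def orient_def chi_def kzdeg_def v3 field_simps power2_eq_square power3_eq_cube fun_eq_iff
          intro!: derivative_eq_intros)
  qed
next
  case (Hirz \<delta>)
  have v2: "v powi (-2) = 1 / v\<^sup>2" by (simp add: power_int_minus divide_inverse)
  have u2: "u powi (int \<delta> - 2) = u ^ \<delta> / u\<^sup>2" using uv by (simp add: power_int_diff)
  have inv: "((\<lambda>z. 1 / g z) has_derivative (\<lambda>t. - (1 / (g (u, v))\<^sup>2) * g' t)) (at (u, v))"
    if "(g has_derivative g') (at (u, v))" "g (u, v) \<noteq> 0" for g g' :: "complex \<times> complex \<Rightarrow> complex"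
    using that by (auto intro!: derivative_eq_intros simp: fun_eq_iff divide_inverse power2_eq_square)
  have f: "(fst has_derivative fst) (at (u, v))" and s: "(snd has_derivative snd) (at (u, v))"
    by (auto intro!: derivative_eq_intros)
  have i1: "((\<lambda>z. 1 / fst z) has_derivative (\<lambda>t. - (1 / u\<^sup>2) * fst t)) (at (u, v))"
    and i2: "((\<lambda>z. 1 / snd z) has_derivative (\<lambda>t. - (1 / v\<^sup>2) * snd t)) (at (u, v))"
    using inv[OF f] inv[OF s] uv by simp_all
  have pw: "((\<lambda>z. fst z ^ \<delta>) has_derivative (\<lambda>t. of_nat \<delta> * u ^ (\<delta> - 1) * fst t)) (at (u, v))"
    by (auto intro!: derivative_eq_intros simp: fun_eq_iff)
  have m: "((\<lambda>z. fst z ^ \<delta> * g z) has_derivative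
      (\<lambda>t. (of_nat \<delta> * u ^ (\<delta> - 1) * g (u, v)) * fst t + u ^ \<delta> * g' t)) (at (u, v))"
    if "(g has_derivative g') (at (u, v))" for g g' :: "complex \<times> complex \<Rightarrow> complex"
    using has_derivative_mult[OF pw that] by (simp add: algebra_simps)
  consider "c = 0" | "c = 1" | "c = 2" | "c = 3" using c Hirz by (auto simp: charts_simps)
  then show ?thesis
  proof cases
    case 1 then show ?thesis using Hirz
      by (intro exI[of _ 1] exI[of _ 0] exI[of _ 0] exI[of _ 1])
        (auto simp: tau_def orient_def chi_def intro!: derivative_eq_intros)
  next
    case 2 then show ?thesis using Hirz uv has_derivative_Pair[OF i1 m[OF s]]
      by (intro exI[of _ "- (1 / u\<^sup>2)"] exI[of _ 0] exI[of _ "of_nat \<delta> * u ^ (\<delta> - 1) * v"] exI[of _ "u ^ \<delta>"])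
        (simp add: tau_def orient_def chi_def kzdeg_def u2)
  next
    case 3 then show ?thesis using Hirz uv has_derivative_Pair[OF f i2]
      by (intro exI[of _ 1] exI[of _ 0] exI[of _ 0] exI[of _ "- (1 / v\<^sup>2)"])
        (simp add: tau_def orient_def chi_def kzdeg_def v2)
  next
    case 4 then show ?thesis using Hirz uv has_derivative_Pair[OF i1 m[OF i2]]
      by (intro exI[of _ "- (1 / u\<^sup>2)"] exI[of _ 0] exI[of _ "of_nat \<delta> * u ^ (\<delta> - 1) * (1 / v)"] exI[of _ "- (u ^ \<delta> * (1 / v\<^sup>2))"])
        (simp add: tau_def orient_def chi_def kzdeg_def u2 v2)
  qed
qed

lemma canonical_transition:
  assumes "canonical_degree S W kd"
  shows "\<exists>\<kappa>. (\<forall>c\<in>charts S. \<kappa> c \<noteq> 0) \<and> (\<forall>c\<in>charts S. \<forall>u v. u \<noteq> 0 \<longrightarrow> v \<noteq> 0 \<longrightarrow>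
     frechet_derivative (\<lambda>z. tau S c (fst z) (snd z)) (at (u, v)) (vfield (W c) (u, v)) =
       (\<kappa> c / \<kappa> 0 * chi S kd c u v * fst (vfield (W 0) (tau S c u v)),
        \<kappa> c / \<kappa> 0 * chi S kd c u v * snd (vfield (W 0) (tau S c u v))))"
proof -
  obtain \<kappa> where \<kappa>: "\<forall>c\<in>charts S. \<kappa> c \<noteq> 0" and can: "\<And>c c' z l m. \<lbrakk>c \<in> charts S; c' \<in> charts S; z \<in> overlap S c c';
      l \<noteq> 0; m \<noteq> 0; hc S c' (fst (transition S c c' z)) (snd (transition S c c' z)) = act S l m (hc S c (fst z) (snd z))\<rbrakk> \<Longrightarrow>
      frechet_derivative (transition S c c') (at z) (vfield (W c) z) =
        (\<kappa> c / \<kappa> c' * inverse (l powi fst kd * m powi snd kd) * fst (vfield (W c') (transition S c c' z)),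
         \<kappa> c / \<kappa> c' * inverse (l powi fst kd * m powi snd kd) * snd (vfield (W c') (transition S c c' z)))"
    using assms unfolding canonical_degree_def Let_def by blast
  show ?thesis
  proof (intro exI[of _ \<kappa>] conjI ballI allI impI)
    show "\<kappa> c \<noteq> 0" if "c \<in> charts S" for c using \<kappa> that by blast
    fix c and u v :: complex assume c: "c \<in> charts S" and uv: "u \<noteq> 0" "v \<noteq> 0"
    let ?l = "1 / fst (lm S c u v)" and ?m = "1 / snd (lm S c u v)"
    have nz: "fst (lm S c u v) \<noteq> 0" "snd (lm S c u v) \<noteq> 0" using lm_ne_0[OF uv] by blast+
    have inv: "inverse (?l powi fst kd * ?m powi snd kd) = chi S kd c u v"
      unfolding chi_lm by (simp add: power_int_divide_distrib divide_inverse power_int_inverse)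
    have "hc S 0 (fst (transition S c 0 (u, v))) (snd (transition S c 0 (u, v))) = act S ?l ?m (hc S c (fst (u, v)) (snd (u, v)))"
      unfolding transition_0[OF c] using hc_lm(2)[OF c uv] by simp
    from can[OF c chart0 overlap_torus[OF c uv] _ _ this] nz
    show "frechet_derivative (\<lambda>z. tau S c (fst z) (snd z)) (at (u, v)) (vfield (W c) (u, v)) =
       (\<kappa> c / \<kappa> 0 * chi S kd c u v * fst (vfield (W 0) (tau S c u v)),
        \<kappa> c / \<kappa> 0 * chi S kd c u v * snd (vfield (W 0) (tau S c u v)))"
      unfolding inv transition_0[OF c] by simp
  qed
qed

text \<open>The cocycle cancels in \<open>P c * Q 0 = Q c * P 0\<close>, the factors with index
  \<open>0\<close> being taken at the transformed point. Differentiating this relation along a line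
  avoids the derivative of \<open>chi\<close>.\<close>

lemma quotient_derivative:
  assumes P: "sec S d P" and Q: "sec S d Q" and c: "c \<in> charts S" and uv: "u \<noteq> 0" "v \<noteq> 0"
    and tau: "((\<lambda>z. tau S c (fst z) (snd z)) has_derivative
           (\<lambda>t. (A * fst t + B * snd t, C * fst t + D * snd t))) (at (u, v))"
  defines "\<eta> \<equiv> \<lambda>c. (Q c * dx (P c) - P c * dx (Q c), Q c * dy (P c) - P c * dy (Q c))"
  shows "form_ev (\<eta> c) (u, v) t = (chi S d c u v)\<^sup>2 *
           form_ev (\<eta> 0) (tau S c u v) (A * fst t + B * snd t, C * fst t + D * snd t)"
proof -
  obtain x y where xy: "tau S c u v = (x, y)" by (cases "tau S c u v")
  obtain p q where t: "t = (p, q)" by (cases t)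
  let ?w = "\<lambda>s. (u + s * p, v + s * q)"
  let ?g = "\<lambda>s. fst (tau S c (u + s * p) (v + s * q))" and ?h = "\<lambda>s. snd (tau S c (u + s * p) (v + s * q))"
  have w: "(?w has_derivative (\<lambda>s. (s * p, s * q))) (at 0)" by (auto intro!: derivative_eq_intros)
  have tau': "((\<lambda>z. tau S c (fst z) (snd z)) has_derivative
           (\<lambda>t. (A * fst t + B * snd t, C * fst t + D * snd t))) (at (?w 0))" using tau by simp
  have "((\<lambda>s. tau S c (u + s * p) (v + s * q)) has_derivative
           (\<lambda>s. (A * (s * p) + B * (s * q), C * (s * p) + D * (s * q)))) (at 0)"
    using has_derivative_compose[OF w tau'] by simp
  from has_derivative_fst[OF this] has_derivative_snd[OF this]
  have g: "(?g has_field_derivative A * p + B * q) (at 0)" and h: "(?h has_field_derivative C * p + D * q) (at 0)"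
    by (auto intro: has_derivative_imp_has_field_derivative simp: algebra_simps)
  have dl: "((\<lambda>s. u + s * p) has_field_derivative p) (at 0)" "((\<lambda>s. v + s * q) has_field_derivative q) (at 0)"
    by (auto intro!: derivative_eq_intros)
  let ?D = "\<lambda>f x y p q. ev (dx f) (x, y) * p + ev (dy f) (x, y) * q"
  let ?p = "A * p + B * q" and ?q = "C * p + D * q"
  have Dc: "((\<lambda>s. ev f (u + s * p, v + s * q)) has_field_derivative ?D f u v p q) (at 0)" for f
    using DERIV_ev[OF dl, of f] by simp
  have D0: "((\<lambda>s. ev f (?g s, ?h s)) has_field_derivative ?D f x y ?p ?q) (at 0)" for f
    using DERIV_ev[OF g h, of f] xy by simp
  let ?U = "{s. u + s * p \<noteq> 0 \<and> v + s * q \<noteq> 0}"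
  have U: "open ?U" by (intro open_Collect_conj open_Collect_neq continuous_intros)
  have eq: "ev (P c) (u + s * p, v + s * q) * ev (Q 0) (?g s, ?h s) =
      ev (Q c) (u + s * p, v + s * q) * ev (P 0) (?g s, ?h s)" if "s \<in> ?U" for s
    using P Q c that unfolding sec_def by (simp add: mult.assoc mult.left_commute mult.commute)
  let ?pc = "ev (P c) (u, v)" and ?qc = "ev (Q c) (u, v)" and ?Pz = "ev (P 0) (x, y)" and ?Qz = "ev (Q 0) (x, y)"
  let ?X = "chi S d c u v"
  have pq: "?pc = ?X * ?Pz" "?qc = ?X * ?Qz" using P Q c uv xy unfolding sec_def by auto
  have 1: "((\<lambda>s. ev (P c) (u + s * p, v + s * q) * ev (Q 0) (?g s, ?h s)) has_field_derivative
      ?D (P c) u v p q * ?Qz + ?D (Q 0) x y ?p ?q * ?pc) (at 0)"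
    using DERIV_mult[OF Dc[of "P c"] D0[of "Q 0"]] xy by simp
  have 2: "((\<lambda>s. ev (Q c) (u + s * p, v + s * q) * ev (P 0) (?g s, ?h s)) has_field_derivative
      ?D (Q c) u v p q * ?Pz + ?D (P 0) x y ?p ?q * ?qc) (at 0)"
    using DERIV_mult[OF Dc[of "Q c"] D0[of "P 0"]] xy by simp
  have "((\<lambda>s. ev (Q c) (u + s * p, v + s * q) * ev (P 0) (?g s, ?h s)) has_field_derivative
      ?D (P c) u v p q * ?Qz + ?D (Q 0) x y ?p ?q * ?pc) (at 0)"
    by (rule has_field_derivative_transform_within_open[OF 1 U]) (use uv eq in auto)
  from DERIV_unique[OF this 2]
  have key: "?D (P c) u v p q * ?Qz + ?D (Q 0) x y ?p ?q * ?pc = ?D (Q c) u v p q * ?Pz + ?D (P 0) x y ?p ?q * ?qc" .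
  have "form_ev (\<eta> c) (u, v) t = ?qc * ?D (P c) u v p q - ?pc * ?D (Q c) u v p q"
    unfolding \<eta>_def form_ev_def t by (simp add: algebra_simps)
  also have "\<dots> = ?X * (?D (P c) u v p q * ?Qz - ?D (Q c) u v p q * ?Pz)" unfolding pq by (simp add: algebra_simps)
  also have "\<dots> = ?X * (?D (P 0) x y ?p ?q * ?qc - ?D (Q 0) x y ?p ?q * ?pc)"
    by (rule arg_cong[where f = "(*) ?X"]) (use key in \<open>simp add: algebra_simps\<close>)
  also have "\<dots> = ?X\<^sup>2 * (?Qz * ?D (P 0) x y ?p ?q - ?Pz * ?D (Q 0) x y ?p ?q)"
    unfolding pq by (simp add: algebra_simps power2_eq_square)
  also have "?Qz * ?D (P 0) x y ?p ?q - ?Pz * ?D (Q 0) x y ?p ?q = form_ev (\<eta> 0) (tau S c u v) (?p, ?q)"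
    unfolding \<eta>_def form_ev_def xy by (simp add: algebra_simps)
  finally show ?thesis unfolding t by simp
qed

lemma chi_inverse: "u \<noteq> 0 \<Longrightarrow> v \<noteq> 0 \<Longrightarrow> chi S (d - d') c u v = chi S d c u v / chi S d' c u v"
  using chi_add[of u v S "d - d'" d' c] chi_ne_0[of u v S d' c] by (simp add: field_simps)

lemma continuous_tau_chi:
  assumes "c \<in> charts S" "u \<noteq> 0" "v \<noteq> 0"
  shows "isCont (\<lambda>u. fst (tau S c u v)) u" "isCont (\<lambda>u. snd (tau S c u v)) u" "isCont (\<lambda>u. chi S d c u v) u"
  using assms by (cases S; auto simp: tau_def chi_def charts_simps intro!: continuous_intros)+

lemma continuous_ev: "isCont g u \<Longrightarrow> isCont h u \<Longrightarrow> isCont (\<lambda>u. ev f (g u, h u)) u"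
  unfolding ev_altdef by (intro continuous_intros)

text \<open>On a line with constant \<open>v\<close> only finitely many points are excluded, and
  both sides are continuous at the given one.\<close>

lemma torus_continuation:
  assumes c: "c \<in> charts S" and fin: "finite Z" and uv: "u \<noteq> 0" "v \<noteq> 0"
    and eq: "\<And>u v. u \<noteq> 0 \<Longrightarrow> v \<noteq> 0 \<Longrightarrow> (u, v) \<notin> Z \<Longrightarrow> ev g (u, v) = k * chi S e c u v * ev f (tau S c u v)"
  shows "ev g (u, v) = k * chi S e c u v * ev f (tau S c u v)"
proof -
  let ?\<phi> = "\<lambda>u. ev g (u, v) - k * chi S e c u v * ev f (fst (tau S c u v), snd (tau S c u v))"
  have "isCont ?\<phi> u"
    by (intro continuous_intros continuous_ev continuous_tau_chi[OF c uv])
  then have lim: "?\<phi> \<midarrow>u\<rightarrow> ?\<phi> u" by (simp add: isCont_def)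
  have "finite (insert 0 (fst ` Z) - {u})" using fin by simp
  then have U: "open (- (insert 0 (fst ` Z) - {u}))" by (intro open_Compl finite_imp_closed)
  then have "eventually (\<lambda>s. s \<in> - (insert 0 (fst ` Z) - {u})) (at u)"
    by (intro eventually_at_in_open') simp_all
  moreover have "eventually (\<lambda>s. s \<noteq> u) (at u)" by (simp add: eventually_at_filter)
  ultimately have "eventually (\<lambda>s. ?\<phi> s = 0) (at u)"
  proof eventually_elim
    case (elim s)
    then have "s \<noteq> 0" "(s, v) \<notin> Z" by force+
    then show ?case using eq[of s v] uv by simp
  qed
  then have "?\<phi> \<midarrow>u\<rightarrow> 0" by (simp add: tendsto_eventually)
  then have "?\<phi> u = 0" using lim tendsto_unique[OF at_neq_bot] by blast
  then show ?thesis by simp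
qed

lemma form_ev_vfield: "form_ev w z t = fst (vfield w z) * snd t - snd (vfield w z) * fst t"
  by (simp add: form_ev_def vfield_def)

text \<open>The line bundle of the divisorial part of \<open>Q dP - P dQ\<close>.\<close>

lemma differential_section:
  assumes P: "sec S d P" and Q: "sec S d Q" and can: "canonical_degree S W kd"
    and fp: "\<And>c. c \<in> charts S \<Longrightarrow> fpen (P c) (Q c) (W c) (h c)"
  shows "\<exists>\<kappa>. (\<forall>c\<in>charts S. \<kappa> c \<noteq> 0) \<and> sec S (d + d - kd + kzdeg S) (\<lambda>c. bconst (\<kappa> c) * h c)"
proof -
  obtain \<kappa> where \<kappa>: "\<forall>c\<in>charts S. \<kappa> c \<noteq> 0" and can': "\<And>c u v. c \<in> charts S \<Longrightarrow> u \<noteq> 0 \<Longrightarrow> v \<noteq> 0 \<Longrightarrow>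
     frechet_derivative (\<lambda>z. tau S c (fst z) (snd z)) (at (u, v)) (vfield (W c) (u, v)) =
       (\<kappa> c / \<kappa> 0 * chi S kd c u v * fst (vfield (W 0) (tau S c u v)),
        \<kappa> c / \<kappa> 0 * chi S kd c u v * snd (vfield (W 0) (tau S c u v)))"
    using canonical_transition[OF can] by blast
  let ?\<eta> = "\<lambda>c. (Q c * dx (P c) - P c * dx (Q c), Q c * dy (P c) - P c * dy (Q c))"
  \<comment> \<open>The form \<open>Q dP - P dQ\<close> has values in degree \<open>d + d\<close>,
    and the forms \<open>W c\<close> have values in the normal bundle of the foliation, of degree
    \<open>kd - kzdeg S\<close>; \<open>h\<close> accounts for the difference.\<close>
  let ?e = "d + d - kd + kzdeg S"
  have \<kappa>0: "\<kappa> 0 \<noteq> 0" using \<kappa> chart0 by blast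
  have \<eta>: "form_ev (?\<eta> c) z t = ev (h c) z * form_ev (W c) z t" if "c \<in> charts S" for c z t
    using fp[OF that] unfolding fpen_def form_ev_def by (simp add: algebra_simps)
  have main: "ev (h c) (u, v) = \<kappa> 0 / \<kappa> c * orient S c * chi S ?e c u v * ev (h 0) (tau S c u v)"
    if c: "c \<in> charts S" and uv: "u \<noteq> 0" "v \<noteq> 0" for c u v
  proof (rule torus_continuation[OF c _ uv])
    show "finite {z. ev (fst (W c)) z = 0 \<and> ev (snd (W c)) z = 0}"
      using fp[OF c] coprime_finite_zeros unfolding fpen_def by blast
    fix u v :: complex assume uv: "u \<noteq> 0" "v \<noteq> 0" and ns: "(u, v) \<notin> {z. ev (fst (W c)) z = 0 \<and> ev (snd (W c)) z = 0}"
    obtain A B C D where tau: "((\<lambda>z. tau S c (fst z) (snd z)) has_derivative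
           (\<lambda>t. (A * fst t + B * snd t, C * fst t + D * snd t))) (at (u, v))"
      and det: "A * D - B * C = orient S c * chi S (kzdeg S) c u v"
      using tau_has_derivative[OF c uv] by blast
    define v0 v1 where "v0 = fst (vfield (W c) (u, v))" and "v1 = snd (vfield (W c) (u, v))"
    define w0 w1 where "w0 = fst (vfield (W 0) (tau S c u v))" and "w1 = snd (vfield (W 0) (tau S c u v))"
    define g where "g = \<kappa> c / \<kappa> 0 * chi S kd c u v"
    have g0: "g \<noteq> 0" using \<kappa> \<kappa>0 c chi_ne_0[OF uv] by (simp add: g_def)
    have pf: "A * v0 + B * v1 = g * w0" "C * v0 + D * v1 = g * w1"
      using can'[OF c uv] unfolding frechet_derivative_at[OF tau, symmetric] v0_def v1_def w0_def w1_def g_def by auto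
    \<comment> \<open>A linear map multiplies the alternating pairing of two vectors by its
      determinant.\<close>
    have fw: "g * form_ev (W 0) (tau S c u v) (A * fst t + B * snd t, C * fst t + D * snd t) =
        (A * D - B * C) * form_ev (W c) (u, v) t" for t
    proof -
      have "g * form_ev (W 0) (tau S c u v) (A * fst t + B * snd t, C * fst t + D * snd t) =
          (g * w0) * (C * fst t + D * snd t) - (g * w1) * (A * fst t + B * snd t)"
        unfolding form_ev_vfield w0_def w1_def by (simp add: algebra_simps)
      also have "\<dots> = (A * D - B * C) * (v0 * snd t - v1 * fst t)"
        unfolding pf[symmetric] by (simp add: algebra_simps)
      finally show ?thesis unfolding form_ev_vfield v0_def v1_def .
    qed
    obtain t where t: "form_ev (W c) (u, v) t \<noteq> 0"
    proof (cases "ev (fst (W c)) (u, v) = 0")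
      case True
      then have "form_ev (W c) (u, v) (0, 1) \<noteq> 0" using ns by (simp add: form_ev_def)
      then show ?thesis using that by blast
    next
      case False
      then have "form_ev (W c) (u, v) (1, 0) \<noteq> 0" by (simp add: form_ev_def)
      then show ?thesis using that by blast
    qed
    have "g * (ev (h c) (u, v) * form_ev (W c) (u, v) t) = g * form_ev (?\<eta> c) (u, v) t"
      unfolding \<eta>[OF c] by simp
    also have "\<dots> = g * ((chi S d c u v)\<^sup>2 * form_ev (?\<eta> 0) (tau S c u v) (A * fst t + B * snd t, C * fst t + D * snd t))"
      unfolding quotient_derivative[OF P Q c uv tau] by simp
    also have "\<dots> = (chi S d c u v)\<^sup>2 * ev (h 0) (tau S c u v) * (g * form_ev (W 0) (tau S c u v) (A * fst t + B * snd t, C * fst t + D * snd t))"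
      unfolding \<eta>[OF chart0] by (simp only: mult_ac)
    also have "\<dots> = (chi S d c u v)\<^sup>2 * ev (h 0) (tau S c u v) * (orient S c * chi S (kzdeg S) c u v) * form_ev (W c) (u, v) t"
      unfolding fw det by (simp only: mult_ac)
    finally have "g * ev (h c) (u, v) = (chi S d c u v)\<^sup>2 * ev (h 0) (tau S c u v) * (orient S c * chi S (kzdeg S) c u v)"
      using t by (simp add: mult.assoc[symmetric])
    then have "ev (h c) (u, v) = (chi S d c u v)\<^sup>2 * ev (h 0) (tau S c u v) * (orient S c * chi S (kzdeg S) c u v) / g"
      using g0 by (simp add: field_simps)
    then show "ev (h c) (u, v) = \<kappa> 0 / \<kappa> c * orient S c * chi S ?e c u v * ev (h 0) (tau S c u v)"
      unfolding g_def chi_add[OF uv] chi_inverse[OF uv] power2_eq_square by (simp add: field_simps)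
  qed
  let ?k = "\<lambda>c. \<kappa> c / \<kappa> 0 * orient S c"
  have o: "orient S c * orient S c = 1" "orient S c \<noteq> 0" "orient S 0 = 1" for c
    by (cases S; auto simp: orient_def)+
  show ?thesis
  proof (intro exI[of _ ?k] conjI ballI)
    show "?k c \<noteq> 0" if "c \<in> charts S" for c using \<kappa> \<kappa>0 o that by simp
    show "sec S ?e (\<lambda>c. bconst (?k c) * h c)"
      unfolding sec_def
    proof (intro ballI allI impI)
      fix c and u v :: complex assume c: "c \<in> charts S" and uv: "u \<noteq> 0" "v \<noteq> 0"
      have "ev (bconst (?k c) * h c) (u, v) = (\<kappa> c / \<kappa> 0) * (\<kappa> 0 / \<kappa> c) * (orient S c * orient S c) * (chi S ?e c u v * ev (h 0) (tau S c u v))"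
        unfolding ev_simps main[OF c uv] by (simp only: mult_ac)
      also have "\<dots> = chi S ?e c u v * ev (h 0) (tau S c u v)" unfolding o(1) using \<kappa> c \<kappa>0 by simp
      finally show "ev (bconst (?k c) * h c) (u, v) = chi S ?e c u v * ev (bconst (?k 0) * h 0) (tau S c u v)"
        using o(3) \<kappa>0 by simp
    qed
  qed
qed

section \<open>Local forms at infinitely near points\<close>

section \<open>Local forms\<close>

lemma trl_trl: "trl u v (trl (- u) (- v) f) = f"
  by (rule ev_ext) simp

lemma coprime_trl:
  assumes "coprime f g" shows "coprime (trl u v f) (trl u v g)"
proof (rule coprimeI)
  have inv: "trl (- u) (- v) (trl u v h) = h" for h using trl_trl[of "- u" "- v" h] by simp
  have dvd: "trl a b f dvd trl a b g" if "f dvd g" for a b f g using that by (auto simp: dvd_def)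
  fix e assume "e dvd trl u v f" "e dvd trl u v g"
  then have "trl (- u) (- v) e dvd f" "trl (- u) (- v) e dvd g" using dvd[of e _ "- u" "- v"] inv by metis+
  then have "trl (- u) (- v) e dvd 1" using assms coprime_common_divisor by blast
  then show "is_unit e" using dvd[of "trl (- u) (- v) e" 1 u v] by (simp add: trl_trl)
qed

lemma local_form_Proper: "local_form W (Proper c u v) = (trl u v (fst (W c)), trl u v (snd (W c)))"
  by (simp add: pullback_def trl_def d_simps)

lemma dx_trl: "dx (trl u v f) = trl u v (dx f)" and dy_trl: "dy (trl u v f) = trl u v (dy f)"
  by (simp_all add: trl_def dx_bsubst dy_bsubst d_simps)

lemma fpen_trl:
  assumes "fpen f g w h"
  shows "fpen (trl u v f) (trl u v g) (trl u v (fst w), trl u v (snd w)) (trl u v h)"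
  using assms unfolding fpen_def
  by (auto simp: coprime_trl dx_trl dy_trl simp flip: trl_simps)

lemma coprime_local_form:
  assumes "foliation_on S W" "on_surface S p"
  shows "coprime (fst (local_form W p)) (snd (local_form W p))"
  using assms(2)
proof (induction p)
  case (Proper c u v)
  then show ?case using assms(1) by (simp add: local_form_Proper foliation_on_def coprime_trl del: local_form.simps)
next
  case (Near p d)
  then show ?case by (simp add: coprime_strict_form)
qed

lemma local_form_ne_0:
  assumes "foliation_on S W" "on_surface S p" shows "local_form W p \<noteq> (0, 0)"
  using coprime_ne_0[OF coprime_local_form[OF assms]] by simp

text \<open>Degree \<open>-2\<close> on the fibers forces the foliation to be the ruling, which has no singularities.\<close>

lemma ruling_not_ordinary:
  assumes fol: "foliation_on (Hirz \<delta>) W" and can: "canonical_degree (Hirz \<delta>) W kd" and kd: "snd kd = -2"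
    and p: "on_surface (Hirz \<delta>) p"
  shows "\<not> ordinary_sing (local_form W p)"
proof -
  let ?S = "Hirz \<delta>"
  obtain \<kappa> where \<kappa>: "\<forall>c\<in>charts ?S. \<kappa> c \<noteq> 0" and can': "\<And>c u v. c \<in> charts ?S \<Longrightarrow> u \<noteq> 0 \<Longrightarrow> v \<noteq> 0 \<Longrightarrow>
     frechet_derivative (\<lambda>z. tau ?S c (fst z) (snd z)) (at (u, v)) (vfield (W c) (u, v)) =
       (\<kappa> c / \<kappa> 0 * chi ?S kd c u v * fst (vfield (W 0) (tau ?S c u v)),
        \<kappa> c / \<kappa> 0 * chi ?S kd c u v * snd (vfield (W 0) (tau ?S c u v)))"
    using canonical_transition[OF can] by blast
  have b: "\<exists>A. A \<noteq> 0 \<and> (c = 2 \<longrightarrow> A = 1) \<and>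
      A * ev (snd (W c)) (u, v) = \<kappa> c / \<kappa> 0 * chi ?S kd c u v * ev (snd (W 0)) (tau ?S c u v)"
    if c: "c \<in> charts ?S" and uv: "u \<noteq> 0" "v \<noteq> 0" for c u v
  proof -
    obtain A C D where tau: "((\<lambda>z. tau ?S c (fst z) (snd z)) has_derivative
           (\<lambda>t. (A * fst t + 0 * snd t, C * fst t + D * snd t))) (at (u, v))" and A: "A \<noteq> 0" "c = 2 \<longrightarrow> A = 1"
      using tau_has_derivative[OF c uv] by auto
    show ?thesis using can'[OF c uv] A unfolding frechet_derivative_at[OF tau, symmetric]
      by (intro exI[of _ A]) (simp add: vfield_def)
  qed
  \<comment> \<open>On a fiber the horizontal component of the vector field is a section of degree
    \<open>-2\<close>, so it vanishes and the field is tangent to the fibers.\<close>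
  have "cy u (snd (W 0)) = 0" if u: "u \<noteq> 0" for u
  proof (rule ccontr)
    assume nz: "cy u (snd (W 0)) \<noteq> 0"
    have "poly (cy u (snd (W 2))) v = v powi (-2) * poly (smult (\<kappa> 2 / \<kappa> 0) (cy u (snd (W 0)))) (1 / v)" if "v \<noteq> 0" for v
    proof -
      have "2 \<in> charts ?S" by (simp add: charts_simps)
      from b[OF this u that] show ?thesis by (auto simp: chi_def tau_def kd)
    qed
    moreover have "smult (\<kappa> 2 / \<kappa> 0) (cy u (snd (W 0))) \<noteq> 0" using \<kappa> nz by (simp add: charts_simps)
    ultimately show False using poly_reversal(2)[of "smult (\<kappa> 2 / \<kappa> 0) (cy u (snd (W 0)))" "cy u (snd (W 2))" "-2"] by force
  qed
  then have "ev (snd (W 0)) (u, v) = 0" if "u \<noteq> 0" for u v using that by (metis poly_0 poly_cy)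
  then have b0: "snd (W 0) = 0" by (intro ev_ext_torus) simp
  have bc: "snd (W c) = 0" if "c \<in> charts ?S" for c
  proof (rule ev_ext_torus)
    fix u v :: complex assume "u \<noteq> 0" "v \<noteq> 0"
    from b[OF that this] show "ev (snd (W c)) (u, v) = ev 0 (u, v)" by (auto simp: b0)
  qed
  show ?thesis using p
  proof (induction p)
    case (Proper c u v)
    then have c: "c \<in> charts ?S" by simp
    have "fst (W c) dvd 1" using fol c bc[OF c] by (auto simp: foliation_on_def)
    then have "ev (fst (local_form W (Proper c u v))) (0, 0) \<noteq> 0"
      by (auto simp: local_form_Proper bipoly_is_unit_iff simp del: local_form.simps)
    then show ?case using nu_ge_1[OF local_form_ne_0[OF fol Proper]] unfolding ordinary_sing_def cf_00 by blast
  next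
    case (Near p d)
    then show ?case using nonordinary_blowup[OF local_form_ne_0[OF fol]] by simp
  qed
qed

section \<open>Noether's formula over a finite configuration\<close>

section \<open>Noether's formula over a configuration\<close>

lemma inf_near_refl [simp]: "inf_near p p"
  by (cases p) auto

lemma inf_near_trans: "inf_near p q \<Longrightarrow> inf_near q r \<Longrightarrow> inf_near p r"
  by (induction r) auto

lemma inf_near_Near: "inf_near (Near p d) q \<Longrightarrow> inf_near p q \<and> q \<noteq> p"
  using inf_near_trans[of p "Near p d" q] inf_near_size[of "Near p d" q] by auto

lemma inf_near_child: "inf_near p q \<Longrightarrow> q \<noteq> p \<Longrightarrow> \<exists>d. inf_near (Near p d) q"
  by (induction q) auto

lemma inf_near_child_unique: "inf_near (Near p d) q \<Longrightarrow> inf_near (Near p d') q \<Longrightarrow> d = d'"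
  by (induction q) (auto dest: inf_near_size)

lemma inf_near_root: "\<exists>c u v. inf_near (Proper c u v) q"
  by (induction q) auto

lemma inf_near_root_unique: "inf_near (Proper c u v) q \<Longrightarrow> inf_near (Proper c' u' v') q \<Longrightarrow> Proper c u v = Proper c' u' v'"
  by (induction q) auto

lemma configuration_inf_near: "configuration S B \<Longrightarrow> q \<in> B \<Longrightarrow> inf_near p q \<Longrightarrow> p \<in> B"
  by (induction q) (auto simp: configuration_def)

lemma configuration_child:
  assumes "configuration S B" "p \<in> B" "Near p d \<notin> B"
  shows "blown_up_point S B (Near p d)"
  using assms configuration_inf_near[OF assms(1,2)] by (auto simp: blown_up_point_def configuration_def)

text \<open>\<open>e q\<close> is the virtual multiplicity of \<open>G\<close>: only that multiple
  of the exceptional curve is taken from the total transform. It may be negative, as for an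
  exceptional curve at its own center. The sum falls short of the local number by the intersection
  that is left after blowing up \<open>B\<close>, which is nonnegative.\<close>

lemma virtual_noether:
  fixes H G :: "ipt \<Rightarrow> bipoly" and e :: "ipt \<Rightarrow> int"
  assumes B: "configuration S B"
    and nz: "\<And>q. q \<in> B \<Longrightarrow> H q \<noteq> 0 \<and> G q \<noteq> 0"
    and HN: "\<And>q d. q \<in> B \<Longrightarrow> H (Near q d) = strict_curve d (H q)"
    and GN: "\<And>q. q \<in> B \<Longrightarrow> \<exists>j. (\<forall>d. G (Near q d) = exc_eq d ^ j * strict_curve d (G q)) \<and>
        int j = int (mult0 (G q)) - e q"
    and fin: "fin (H p) (G p)" and p: "p \<in> B \<or> blown_up_point S B p"
  shows "(\<Sum>q\<in>{q\<in>B. inf_near p q}. int (mult0 (H q)) * e q) \<le> int (NN (H p) (G p)) \<and>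
    ((\<forall>q. blown_up_point S B q \<longrightarrow> \<not> (ev (H q) (0, 0) = 0 \<and> ev (G q) (0, 0) = 0)) \<longrightarrow>
      (\<Sum>q\<in>{q\<in>B. inf_near p q}. int (mult0 (H q)) * e q) = int (NN (H p) (G p)))"
    (is "?le p \<and> (?NV \<longrightarrow> ?eq p)")
  using fin p
proof (induction "card {q\<in>B. inf_near p q}" arbitrary: p rule: less_induct)
  case (less p)
  have finB: "finite B" using B by (simp add: configuration_def)
  let ?T = "\<lambda>p. {q\<in>B. inf_near p q}" and ?s = "\<lambda>q. int (mult0 (H q)) * e q"
  show ?case
  proof (cases "p \<in> B")
    case False
    then have T0: "?T p = {}" using configuration_inf_near[OF B] by blast
    have "blown_up_point S B p" using less.prems False by blast
    moreover have "NN (H p) (G p) = 0" if "\<not> (ev (H p) (0, 0) = 0 \<and> ev (G p) (0, 0) = 0)"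
      using supp_unit(3) that by blast
    ultimately show ?thesis unfolding T0 by auto
  next
    case True
    obtain j where j: "\<And>d. G (Near p d) = exc_eq d ^ j * strict_curve d (G p)" "int j = int (mult0 (G p)) - e p"
      using GN[OF True] by blast
    have Hp: "H p \<noteq> 0" and Gp: "G p \<noteq> 0" using nz[OF True] by auto
    \<comment> \<open>The directions have to cover the tangents of \<open>H\<close>, for
      \<open>NN_virtual\<close>, and the points of \<open>B\<close>, for the sum.\<close>
    define D where "D = dirs (H p) \<union> Near p -` B"
    have inj: "inj (Near p)" by (rule injI) simp
    have D: "finite D" "dirs (H p) \<subseteq> D" unfolding D_def
      using finite_dirs[OF Hp] finite_vimageI[OF finB inj] by blast+
    have child: "?le (Near p d) \<and> (?NV \<longrightarrow> ?eq (Near p d))" for d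
    proof (rule less.hyps)
      have "?T (Near p d) \<subseteq> ?T p" "p \<in> ?T p" "p \<notin> ?T (Near p d)" using True by (auto dest: inf_near_Near)
      then have "?T (Near p d) \<subset> ?T p" by blast
      then show "card (?T (Near p d)) < card (?T p)" using finB by (intro psubset_card_mono) auto
      show "fin (H (Near p d)) (G (Near p d))" unfolding HN[OF True] j(1) by (rule fin_virtual[OF Hp Gp less.prems(1)])
      show "Near p d \<in> B \<or> blown_up_point S B (Near p d)" using configuration_child[OF B True] by blast
    qed
    have T: "?T p = insert p (\<Union>d\<in>D. ?T (Near p d))"
    proof -
      have "\<exists>d\<in>D. inf_near (Near p d) q" if "q \<in> B" "inf_near p q" "q \<noteq> p" for q
        using inf_near_child[OF that(2,3)] configuration_inf_near[OF B that(1)] unfolding D_def by blast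
      then show ?thesis using True by (auto dest: inf_near_Near)
    qed
    have "(\<Sum>q\<in>?T p. ?s q) = ?s p + (\<Sum>q\<in>(\<Union>d\<in>D. ?T (Near p d)). ?s q)"
      unfolding T using finB D(1) by (intro sum.insert) (auto dest: inf_near_Near)
    also have "(\<Sum>q\<in>(\<Union>d\<in>D. ?T (Near p d)). ?s q) = (\<Sum>d\<in>D. \<Sum>q\<in>?T (Near p d). ?s q)"
      using finB D(1) by (intro sum.UNION_disjoint) (auto simp: disjoint_iff dest: inf_near_child_unique)
    finally have S: "(\<Sum>q\<in>?T p. ?s q) = ?s p + (\<Sum>d\<in>D. \<Sum>q\<in>?T (Near p d). ?s q)" .
    have "(\<Sum>d\<in>D. NN (H (Near p d)) (G (Near p d))) + mult0 (H p) * mult0 (G p) = NN (H p) (G p) + j * mult0 (H p)"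
      unfolding HN[OF True] j(1) by (rule NN_virtual[OF Hp Gp less.prems(1) D])
    then have "int (\<Sum>d\<in>D. NN (H (Near p d)) (G (Near p d))) + int (mult0 (H p)) * int (mult0 (G p)) =
        int (NN (H p) (G p)) + int j * int (mult0 (H p))"
      by (simp only: of_nat_add[symmetric] of_nat_mult[symmetric] of_nat_eq_iff)
    then have N: "int (NN (H p) (G p)) = ?s p + (\<Sum>d\<in>D. int (NN (H (Near p d)) (G (Near p d))))"
      unfolding j(2) by (simp add: algebra_simps)
    have "(\<Sum>d\<in>D. \<Sum>q\<in>?T (Near p d). ?s q) \<le> (\<Sum>d\<in>D. int (NN (H (Near p d)) (G (Near p d))))"
      using child by (intro sum_mono) blast
    moreover have "(\<Sum>d\<in>D. \<Sum>q\<in>?T (Near p d). ?s q) = (\<Sum>d\<in>D. int (NN (H (Near p d)) (G (Near p d))))" if ?NV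
      using child that by (intro sum.cong refl) blast
    ultimately show ?thesis unfolding S N by simp
  qed
qed

text \<open>Bezout's theorem gives the total of the local numbers at the points of the surface, and
  the local formula is applied at each of them. The constant in \<open>GP\<close> allows for the
  rescaling that makes the cofactors of the charts into a section.\<close>

lemma noether_sum:
  fixes H G :: "ipt \<Rightarrow> bipoly" and e :: "ipt \<Rightarrow> int"
  assumes B: "configuration S B"
    and F: "sec S d F" "F 0 \<noteq> 0" and G': "sec S d' G'" "G' 0 \<noteq> 0" and cz: "finite (cz S F G')"
    and HP: "\<And>c u v. on_surface S (Proper c u v) \<Longrightarrow> H (Proper c u v) = trl u v (F c)"
    and GP: "\<And>c u v. on_surface S (Proper c u v) \<Longrightarrow> \<exists>k. k \<noteq> 0 \<and> trl u v (G' c) = bconst k * G (Proper c u v)"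
    and nz: "\<And>q. q \<in> B \<Longrightarrow> H q \<noteq> 0 \<and> G q \<noteq> 0"
    and HN: "\<And>q d. q \<in> B \<Longrightarrow> H (Near q d) = strict_curve d (H q)"
    and GN: "\<And>q. q \<in> B \<Longrightarrow> \<exists>j. (\<forall>d. G (Near q d) = exc_eq d ^ j * strict_curve d (G q)) \<and>
        int j = int (mult0 (G q)) - e q"
  shows "(\<Sum>q\<in>B. int (mult0 (H q)) * e q) \<le> dot S d d'"
    and "(\<And>q. blown_up_point S B q \<Longrightarrow> \<not> (ev (H q) (0, 0) = 0 \<and> ev (G q) (0, 0) = 0)) \<Longrightarrow>
      (\<Sum>q\<in>B. int (mult0 (H q)) * e q) = dot S d d'"
proof -
  have finB: "finite B" and surfB: "\<And>q. q \<in> B \<Longrightarrow> on_surface S q" using B by (auto simp: configuration_def)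
  let ?P = "\<lambda>(c, u, v). Proper c u v"
  let ?T = "\<lambda>p. {q\<in>B. inf_near p q}" and ?s = "\<lambda>q. int (mult0 (H q)) * e q"
  define A where "A = cz S F G' \<union> ?P -` B"
  have "inj ?P" by (auto simp: inj_on_def)
  then have finA: "finite A" using cz finB by (simp add: A_def finite_vimageI)
  have surfA: "on_surface S (Proper c u v)" if "(c, u, v) \<in> A" for c u v
    using that surfB by (auto simp: A_def cz_def simp del: on_surface.simps)
  have bz: "bez S F G' (dot S d d')" by (rule bezout[OF F G' cz])
  have "cz S F G' \<subseteq> A" by (simp add: A_def)
  from bez_sum[OF bz finA this] surfA
  have sum: "int (\<Sum>q\<in>A. locN F G' q) = dot S d d'" and lf: "\<And>q. q \<in> A \<Longrightarrow> locfin F G' q"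
    by (auto simp del: on_surface.simps)
  have F0: "F c \<noteq> 0" and G0: "G' c \<noteq> 0" if "c \<in> charts S" for c
    using sec_nonzero[OF F(1) that] sec_nonzero[OF G'(1) that] F(2) G'(2) by auto
  have loc: "fin (H (?P q)) (G (?P q)) \<and> locN F G' q = NN (H (?P q)) (G (?P q))" if "q \<in> A" for q
  proof -
    obtain c u v where q: "q = (c, u, v)" by (cases q) auto
    have s: "on_surface S (Proper c u v)" using surfA that q by blast
    then have c: "c \<in> charts S" by simp
    obtain k where k: "k \<noteq> 0" "trl u v (G' c) = bconst k * G (Proper c u v)" using GP[OF s] by blast
    have "G (Proper c u v) \<noteq> 0" using k(2) G0[OF c] by auto
    moreover have "H (Proper c u v) \<noteq> 0" unfolding HP[OF s] using F0[OF c] by simp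
    ultimately show ?thesis using lf[OF that] k NN_unit_mult[of "H (Proper c u v)" "G (Proper c u v)" "bconst k"]
      unfolding q by (simp add: locfin_def locN_def HP[OF s, symmetric])
  qed
  have root: "?P q \<in> B \<or> blown_up_point S B (?P q)" if "q \<in> A" for q
    using that surfA by (cases q) (auto simp: blown_up_point_def simp del: on_surface.simps)
  note vn = virtual_noether[where e = e and H = H and G = G, OF B nz HN GN loc[THEN conjunct1] root]
  have U: "B = (\<Union>a\<in>A. ?T (?P a))"
  proof -
    have "\<exists>a\<in>A. inf_near (?P a) q" if q: "q \<in> B" for q
    proof -
      obtain c u v where cuv: "inf_near (Proper c u v) q" using inf_near_root by blast
      then have "(c, u, v) \<in> A" using configuration_inf_near[OF B q] by (simp add: A_def)
      then show ?thesis using cuv by (intro bexI[of _ "(c, u, v)"]) simp_all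
    qed
    then show ?thesis by blast
  qed
  have "(\<Sum>q\<in>B. ?s q) = (\<Sum>q\<in>(\<Union>a\<in>A. ?T (?P a)). ?s q)" using U by simp
  also have "\<dots> = (\<Sum>a\<in>A. \<Sum>q\<in>?T (?P a). ?s q)"
  proof (rule sum.UNION_disjoint[OF finA])
    show "\<forall>a\<in>A. finite (?T (?P a))" using finB by simp
    show "\<forall>a\<in>A. \<forall>a'\<in>A. a \<noteq> a' \<longrightarrow> ?T (?P a) \<inter> ?T (?P a') = {}"
      using inf_near_root_unique by (fastforce simp: disjoint_iff)
  qed
  finally have S: "(\<Sum>q\<in>B. ?s q) = (\<Sum>a\<in>A. \<Sum>q\<in>?T (?P a). ?s q)" .
  have N: "dot S d d' = (\<Sum>a\<in>A. int (NN (H (?P a)) (G (?P a))))" unfolding sum[symmetric] of_nat_sum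
    using loc by (intro sum.cong) auto
  show "(\<Sum>q\<in>B. ?s q) \<le> dot S d d'" unfolding S N using vn by (intro sum_mono) blast
  assume "\<And>q. blown_up_point S B q \<Longrightarrow> \<not> (ev (H q) (0, 0) = 0 \<and> ev (G q) (0, 0) = 0)"
  then show "(\<Sum>q\<in>B. ?s q) = dot S d d'" unfolding S N using vn by (intro sum.cong) blast+
qed

section \<open>Invariant curves and zeros of the differential as parts of members\<close>

section \<open>Invariant curves and members of a pencil\<close>

lemma Mem_of_prime_divisors:
  assumes "\<phi> \<noteq> 0" "\<And>\<psi>. prime_elem \<psi> \<Longrightarrow> \<psi> dvd \<phi> \<Longrightarrow> \<exists>p. p \<noteq> (0, 0) \<and> \<psi> dvd mem p f g"
  shows "\<exists>K. finite K \<and> Mem K f g \<phi>"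
  using assms
proof (induction \<phi> rule: prime_divisors_induct)
  case zero
  then show ?case by simp
next
  case (unit \<phi>)
  then have "Mem {} f g \<phi>" by (intro Mem_dvd[OF Mem_1])
  then show ?case by blast
next
  case (factor \<psi> \<phi>)
  have "\<phi> \<noteq> 0" using factor.prems(1) by auto
  then obtain K where K: "finite K" "Mem K f g \<phi>" using factor.IH factor.prems(2) by (meson dvd_mult)
  obtain p where p: "p \<noteq> (0, 0)" "\<psi> dvd mem p f g"
    using factor.prems(2)[of \<psi>] factor.hyps by (auto simp: prime_def)
  have "Mem {snd p / fst p} f g \<psi>" unfolding Mem_def using p by (intro exI[of _ "[p]"]) simp
  then have "Mem (insert (snd p / fst p) K) f g (\<psi> * \<phi>)"
    using K(2) by (intro Mem_mult) (auto elim: Mem_mono)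
  then show ?case using K(1) by blast
qed

text \<open>The operator sending \<open>f\<close> to \<open>a * dy f - b * dx f\<close> is a
  derivation. Applied to \<open>\<psi> ^ n * r\<close>, it gives modulo \<open>\<psi> ^ n\<close>
  the image of \<open>\<psi>\<close> times \<open>n * \<psi> ^ (n - 1) * r\<close>, and
  \<open>n * r\<close> is not divisible by \<open>\<psi>\<close>.\<close>

lemma invariant_prime_divisor:
  assumes psi: "prime_elem \<psi>" and dvd: "\<psi> dvd \<phi>" and nz: "\<phi> \<noteq> 0" and inv: "\<phi> dvd a * dy \<phi> - b * dx \<phi>"
  shows "\<psi> dvd a * dy \<psi> - b * dx \<psi>"
proof -
  let ?D = "\<lambda>f. a * dy f - b * dx f"
  define n where "n = multiplicity \<psi> \<phi>"
  obtain r where r: "\<phi> = \<psi> ^ n * r" "\<not> \<psi> dvd r"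
    using multiplicity_decompose'[OF nz, of \<psi>] psi unfolding n_def by (auto simp: prime_elem_def)
  then obtain n' where n: "n = Suc n'" using dvd by (cases n) auto
  have psi0: "\<psi> \<noteq> 0" using psi by auto
  have "?D \<phi> = \<psi> ^ n * ?D r + \<psi> ^ n' * (of_nat n * ?D \<psi> * r)"
    unfolding r(1) d_simps dx_power dy_power by (simp add: n algebra_simps)
  moreover have "\<psi> ^ n dvd ?D \<phi>" using r(1) inv dvd_trans dvd_triv_left by metis
  ultimately have "\<psi> ^ n dvd \<psi> ^ n' * (of_nat n * ?D \<psi> * r)" by (metis dvd_add_right_iff dvd_triv_left)
  then have "\<psi> ^ n' * \<psi> dvd \<psi> ^ n' * (of_nat n * ?D \<psi> * r)" by (simp add: n mult.commute)
  then have "\<psi> dvd of_nat n * ?D \<psi> * r" using psi0 by simp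
  moreover have "\<not> \<psi> dvd of_nat n"
  proof
    assume "\<psi> dvd of_nat n"
    moreover have "of_nat n dvd (1 :: bipoly)" unfolding bconst_of_nat[symmetric] using n
      by (intro bconst_dvd_1) (simp only: of_nat_eq_0_iff)
    ultimately show False using psi dvd_trans unfolding prime_elem_def by blast
  qed
  ultimately show ?thesis using psi r(2) by (auto simp: prime_elem_dvd_mult_iff)
qed

lemma fpen_invariant_Mem:
  assumes fp: "fpen f g w h" and nz: "\<phi> \<noteq> 0" and inv: "\<phi> dvd fst w * dy \<phi> - snd w * dx \<phi>"
  shows "\<exists>K. finite K \<and> Mem K f g \<phi>"
proof (rule Mem_of_prime_divisors[OF nz])
  fix \<psi> assume psi: "prime_elem \<psi>" "\<psi> dvd \<phi>"
  have "(g * dx f - f * dx g) * dy \<psi> - (g * dy f - f * dy g) * dx \<psi> = h * (fst w * dy \<psi> - snd w * dx \<psi>)"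
    using fp unfolding fpen_def by (simp add: algebra_simps)
  then have "\<psi> dvd (g * dx f - f * dx g) * dy \<psi> - (g * dy f - f * dy g) * dx \<psi>"
    using invariant_prime_divisor[OF psi nz inv] by simp
  then show "\<exists>p. p \<noteq> (0, 0) \<and> \<psi> dvd mem p f g"
    using fp unfolding fpen_def by (intro invariant_curve_in_member[OF psi(1)]) auto
qed

lemma fpen_cofactor_Mem:
  assumes fp: "fpen f g w h" shows "\<exists>K. finite K \<and> Mem K f g h"
proof (rule Mem_of_prime_divisors)
  show "h \<noteq> 0" using fp by (simp add: fpen_def)
  fix \<psi> assume psi: "prime_elem \<psi>" "\<psi> dvd h"
  have "(g * dx f - f * dx g) * dy \<psi> - (g * dy f - f * dy g) * dx \<psi> = h * (fst w * dy \<psi> - snd w * dx \<psi>)"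
    using fp unfolding fpen_def by (simp add: algebra_simps)
  then have "\<psi> dvd (g * dx f - f * dx g) * dy \<psi> - (g * dy f - f * dy g) * dx \<psi>"
    using psi(2) by simp
  then show "\<exists>p. p \<noteq> (0, 0) \<and> \<psi> dvd mem p f g"
    using fp unfolding fpen_def by (intro invariant_curve_in_member[OF psi(1)]) auto
qed

lemma Mem_trl:
  assumes "Mem K f g F" shows "Mem K (trl u v f) (trl u v g) (trl u v F)"
proof -
  obtain L where L: "F dvd prod_list (map (\<lambda>p. mem p f g) L)"
    "\<forall>p\<in>set L. p \<noteq> (0, 0) \<and> (fst p \<noteq> 0 \<longrightarrow> snd p / fst p \<in> K)"
    using assms unfolding Mem_def by blast
  have "trl u v (prod_list (map (\<lambda>p. mem p f g) L)) = prod_list (map (\<lambda>p. mem p (trl u v f) (trl u v g)) L)"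
    by (induction L) (auto simp: mem_def)
  moreover have "trl u v F dvd trl u v (prod_list (map (\<lambda>p. mem p f g) L))"
    using L(1) by (auto simp: dvd_def)
  ultimately show ?thesis unfolding Mem_def using L(2) by metis
qed

lemma bconst_minus: "bconst (- k) = - bconst k"
  by (simp add: bconst_def)

section \<open>Multiplicities of exceptional curves and proximity\<close>

section \<open>Exceptional curves\<close>

lemma strict_1: "strict_curve d 1 = 1" and mult0_1: "mult0 1 = 0"
proof -
  have *: "pb d 1 = exc_eq d ^ 0 * 1" "\<not> exc_eq d dvd 1" for d
    using prime_exc[of d] by (auto simp: prime_elem_def)
  show "strict_curve d 1 = 1" "mult0 1 = 0" using strict_unique[OF _ *] by auto
qed

lemma mult0_exc: "mult0 (exc_eq d) = 1"
  by (cases d) (simp_all add: strict_bX(3) strict_bY(3))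

lemma local_exc_1: "\<not> (inf_near p q \<and> q \<noteq> p) \<Longrightarrow> local_exc p q = 1"
proof (induction q)
  case (Near q d)
  then have "q \<noteq> p" by (auto dest: inf_near_size)
  moreover have "\<not> (inf_near p q \<and> q \<noteq> p)" using Near.prems by (auto dest: inf_near_size)
  ultimately show ?case using Near.IH by (simp add: strict_1)
qed simp

lemma local_exc_ne_0: "local_exc p q \<noteq> 0"
  by (induction q) (auto simp: strict_ne_0)

text \<open>An exceptional curve is smooth where it is created, and multiplicities of strict
  transforms do not increase.\<close>

lemma mult0_local_exc:
  assumes "q \<noteq> p" shows "mult0 (local_exc p q) = (if proximate q p then 1 else 0)"
proof (cases "inf_near p q")
  case False
  then show ?thesis by (simp add: proximate_def local_exc_1 mult0_1)
next
  case True
  have "mult0 (local_exc p q) \<le> 1" if "inf_near p q" "q \<noteq> p" for q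
    using that
  proof (induction q)
    case (Near q d)
    show ?case
    proof (cases "q = p")
      case True
      then show ?thesis by (simp add: mult0_exc)
    next
      case False
      then have "mult0 (local_exc p q) \<le> 1" using Near by auto
      then show ?thesis using False mult0_strict_le[OF local_exc_ne_0, of d p q] by simp
    qed
  qed simp
  then have "mult0 (local_exc p q) \<le> 1" using True assms by blast
  moreover have "mult0 (local_exc p q) = 0 \<longleftrightarrow> \<not> proximate q p"
    using mult0_eq_0_iff[OF local_exc_ne_0] True assms by (simp add: proximate_def)
  ultimately show ?thesis by auto
qed

section \<open>The pencil of a first integral on the tree of infinitely near points\<close>

section \<open>The pencil at infinitely near points\<close>

fun pen :: "surface \<Rightarrow> mpoly \<Rightarrow> mpoly \<Rightarrow> ipt \<Rightarrow> bipoly \<times> bipoly" where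
  "pen S P Q (Proper c u v) = (trl u v (dehom S P c), trl u v (dehom S Q c))"
| "pen S P Q (Near p d) =
     (let (f, g) = pen S P Q p in (vt d (pm f g) f, vt d (pm f g) g))"

text \<open>The cofactor \<open>h\<close> in \<open>g df - f dg = h w\<close>, where \<open>w\<close> is the strict transform of the foliation.\<close>

fun cofactor :: "(nat \<Rightarrow> bipoly) \<Rightarrow> (nat \<Rightarrow> form) \<Rightarrow> (ipt \<Rightarrow> nat) \<Rightarrow> ipt \<Rightarrow> bipoly" where
  "cofactor h W m (Proper c u v) = trl u v (h c)"
| "cofactor h W m (Near p d) =
     exc_eq d ^ (kexp (local_form W p) + mult0 (cofactor h W m p) - 2 * m p) *
     strict_curve d (cofactor h W m p)"

locale first_integral_pencil =
  fixes S :: surface and W :: "nat \<Rightarrow> form" and SF :: "ipt set" and P Q :: mpoly and d :: deg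
    and h :: "nat \<Rightarrow> bipoly"
  assumes fi: "first_integral S W SF P Q" and homP: "homogeneous S d P" and homQ: "homogeneous S d Q"
    and fol: "foliation_on S W" and red: "reduces S W SF"
    and fp: "\<And>c. c \<in> charts S \<Longrightarrow> fpen (dehom S P c) (dehom S Q c) (W c) (h c)"
begin

abbreviation f where "f p \<equiv> fst (pen S P Q p)"
abbreviation g where "g p \<equiv> snd (pen S P Q p)"
definition m where "m p = pm (f p) (g p)"
abbreviation hh where "hh \<equiv> cofactor h W m"
abbreviation B where "B \<equiv> dicritical_config W SF"

lemma pen_Near: "f (Near p e) = vt e (m p) (f p)" "g (Near p e) = vt e (m p) (g p)"
  by (simp_all add: split_def Let_def m_def)

lemma conf: "configuration S SF" and finSF: "finite SF"
  using red by (auto simp: reduces_def configuration_def)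

lemma P_nz: "c \<in> charts S \<Longrightarrow> dehom S P c \<noteq> 0" and Q_nz: "c \<in> charts S \<Longrightarrow> dehom S Q c \<noteq> 0"
  using fp by (auto simp: fpen_def)

lemma cz_SF: "(c, u, v) \<in> cz S (dehom S P) (dehom S Q) \<Longrightarrow> Proper c u v \<in> SF"
  using first_integral_common_zeros[OF fi homP homQ fol finSF] by (auto simp: cz_def simp del: on_surface.simps)

lemma finite_cz: "finite (cz S (dehom S P) (dehom S Q))"
proof -
  have "inj (\<lambda>(c, u, v). Proper c u v)" by (auto simp: inj_on_def)
  from finite_vimageI[OF finSF this] show ?thesis
    by (rule finite_subset[rotated]) (use cz_SF in auto)
qed

lemma root_fin:
  assumes "on_surface S (Proper c u v)"
  shows "fin (trl u v (dehom S P c)) (trl u v (dehom S Q c))"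
proof (cases "(c, u, v) \<in> cz S (dehom S P) (dehom S Q)")
  case True
  have "bez S (dehom S P) (dehom S Q) (dot S d d)"
    by (rule bezout[OF sec_dehom[OF homP] P_nz[OF chart0] sec_dehom[OF homQ] Q_nz[OF chart0] finite_cz])
  then show ?thesis using True unfolding bez_def locfin_def by fastforce
next
  case False
  then show ?thesis using locN_zero[OF False] assms by (simp add: locfin_def)
qed

lemma tree: "on_surface S p \<Longrightarrow> fpen (f p) (g p) (local_form W p) (hh p) \<and> fin (f p) (g p)"
proof (induction p)
  case (Proper c u v)
  then have "c \<in> charts S" by simp
  from fpen_trl[OF fp[OF this]] root_fin[OF Proper] show ?case
    by (simp add: local_form_Proper del: local_form.simps)
next
  case (Near p e)
  then have IH: "fpen (f p) (g p) (local_form W p) (hh p)" "fin (f p) (g p)" by auto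
  have nz: "f p \<noteq> 0" "g p \<noteq> 0" using IH(1) by (auto simp: fpen_def)
  show ?case using fpen_step(2)[OF IH(1), of e] fin_vt[OF nz IH(2), of e]
    unfolding pen_Near local_form.simps cofactor.simps m_def[symmetric] by simp
qed

lemma tree_nz: "on_surface S p \<Longrightarrow> f p \<noteq> 0" "on_surface S p \<Longrightarrow> g p \<noteq> 0" "on_surface S p \<Longrightarrow> hh p \<noteq> 0"
  using tree[of p] unfolding fpen_def by blast+

lemma m_pos_iff: "on_surface S p \<Longrightarrow> m p > 0 \<longleftrightarrow> ev (f p) (0, 0) = 0 \<and> ev (g p) (0, 0) = 0"
  unfolding m_def by (intro pm_pos_iff tree_nz)

lemma m_pos_Near:
  assumes s: "on_surface S p" and "m (Near p e) > 0" shows "m p > 0"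
proof (rule ccontr)
  assume m: "\<not> m p > 0"
  have "vt e 0 F = pb e F" for F using vt[of 0 F e] by simp
  then have "ev (f (Near p e)) (0, 0) = ev (f p) (0, 0)" "ev (g (Near p e)) (0, 0) = ev (g p) (0, 0)"
    using m unfolding pen_Near by simp_all
  then show False using m m_pos_iff[OF s] m_pos_iff[of "Near p e"] s assms(2) by auto
qed

text \<open>A base point just above the configuration would be ordinary, whereas blowing up
  \<open>SF\<close> leaves no ordinary point.\<close>

lemma base_SF: "on_surface S p \<Longrightarrow> m p > 0 \<Longrightarrow> p \<in> SF"
proof (induction p)
  case (Proper c u v)
  then have "(c, u, v) \<in> cz S (dehom S P) (dehom S Q)" using m_pos_iff[OF Proper(1)] by (auto simp: cz_def)
  then show ?case by (rule cz_SF)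
next
  case (Near p e)
  then have p: "on_surface S p" "p \<in> SF" using m_pos_Near by auto
  show ?case
  proof (rule ccontr)
    assume "Near p e \<notin> SF"
    then have "blown_up_point S SF (Near p e)" by (rule configuration_child[OF conf p(2)])
    then have "\<not> ordinary_sing (local_form W (Near p e))" using red unfolding reduces_def by blast
    moreover have "ordinary_sing (local_form W (Near p e))"
      using base_point_ordinary tree[OF Near.prems(1)] Near.prems(2) unfolding m_def by blast
    ultimately show False by blast
  qed
qed

lemma dicritical_iff: "on_surface S p \<Longrightarrow> term_dic_at W p \<longleftrightarrow> indep (f p) (g p)"
  unfolding term_dic_at_def using dicritical_iff_indep(1) tree by blast

text \<open>Above every base point there is a dicritical one, reached by following base points while
  the intersection number drops; so no base point is lost in passing from \<open>SF\<close> to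
  \<open>B\<close>.\<close>

lemma base_B: "on_surface S p \<Longrightarrow> m p > 0 \<Longrightarrow> p \<in> B"
proof (induction "NN (f p) (g p)" arbitrary: p rule: less_induct)
  case (less p)
  note s = less.prems(1) and nz = tree_nz(1,2)[OF less.prems(1)]
  have SF: "p \<in> SF" by (rule base_SF[OF less.prems])
  have pm: "pm (f p) (g p) > 0" using less.prems(2) by (simp add: m_def)
  show ?case
  proof (cases "indep (f p) (g p)")
    case True
    then show ?thesis using SF dicritical_iff[OF s] inf_near_refl unfolding dicritical_config_def by blast
  next
    case False
    obtain e where e: "ev (vt e (m p) (f p)) (0, 0) = 0" "ev (vt e (m p) (g p)) (0, 0) = 0"
      using next_base_direction[OF nz pm False] unfolding m_def by blast
    have s': "on_surface S (Near p e)" using s by simp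
    have "m (Near p e) > 0" unfolding m_pos_iff[OF s'] pen_Near using e by blast
    moreover have "NN (f (Near p e)) (g (Near p e)) < NN (f p) (g p)"
      unfolding pen_Near unfolding m_def using NN_vt_less[OF nz _ pm] tree[OF s] by blast
    ultimately have "Near p e \<in> B" using less.hyps s' by blast
    then show ?thesis using SF inf_near_trans[of p "Near p e"] unfolding dicritical_config_def by auto
  qed
qed

lemma B_SF: "B \<subseteq> SF" by (auto simp: dicritical_config_def)

lemma confB: "configuration S B"
  unfolding configuration_def
proof (intro conjI ballI allI impI)
  show "finite B" using B_SF finSF finite_subset by blast
  show "on_surface S p" if "p \<in> B" for p using that B_SF conf by (auto simp: configuration_def)
  show "p \<in> B" if "Near p e \<in> B" for p e
    using that conf inf_near_trans[of p "Near p e"] by (auto simp: dicritical_config_def configuration_def)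
qed

lemma finB: "finite B" and surfB: "p \<in> B \<Longrightarrow> on_surface S p"
  using confB by (auto simp: configuration_def)

text \<open>Parameters of members whose multiplicity is too large at some point of \<open>B\<close>;
  the other members are general at all points of \<open>B\<close> at once.\<close>

definition K0 where "K0 = (\<Union>p\<in>B. bad (f p) (g p))"

lemma finK0: "finite K0"
  unfolding K0_def using finB finite_bad tree_nz surfB by blast

abbreviation member where "member k \<equiv> P + cst k * Q"

lemma sec_member: "sec S d (dehom S (member k))"
  by (intro sec_dehom homogeneous_combination(1) homP homQ)

lemma member_nz: "c \<in> charts S \<Longrightarrow> dehom S (member k) c \<noteq> 0"
proof
  assume c: "c \<in> charts S" and "dehom S (member k) c = 0"
  then have "dehom S P c = bconst (- k) * dehom S Q c"
    by (simp add: dehom_add dehom_cst_mult eq_neg_iff_add_eq_0 bconst_minus)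
  then show False using first_integral_not_proportional[OF fi homP homQ fol finSF c] by blast
qed

lemma local_curve_Proper: "local_curve S R (Proper c u v) = trl u v (dehom S R c)"
  by (simp add: trl_def)

lemma local_member:
  assumes "k \<notin> K0" "on_surface S p" "\<And>q. inf_near q p \<Longrightarrow> q \<noteq> p \<Longrightarrow> q \<in> B"
  shows "local_curve S (member k) p = f p + bconst k * g p"
  using assms(2,3)
proof (induction p)
  case (Proper c u v)
  show ?case unfolding local_curve_Proper by (simp add: dehom_add dehom_cst_mult)
next
  case (Near p e)
  have p: "p \<in> B" "on_surface S p" using Near.prems by (auto dest: inf_near_size)
  have "local_curve S (member k) p = f p + bconst k * g p"
    using configuration_inf_near[OF confB p(1)] by (intro Near.IH p(2)) blast
  moreover have "k \<notin> bad (f p) (g p)" using assms(1) p(1) by (auto simp: K0_def)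
  ultimately show ?case using general_member(3)[OF tree_nz(1,2)[OF p(2)], of k e]
    unfolding pen_Near local_curve.simps m_def by simp
qed

lemma local_member_B:
  assumes "k \<notin> K0" "p \<in> B"
  shows "local_curve S (member k) p = f p + bconst k * g p" "local_curve S (member k) p \<noteq> 0"
    "mult0 (local_curve S (member k) p) = m p"
proof -
  have k: "k \<notin> bad (f p) (g p)" using assms by (auto simp: K0_def)
  show eq: "local_curve S (member k) p = f p + bconst k * g p"
    using configuration_inf_near[OF confB assms(2)] by (intro local_member assms(1) surfB assms(2))
  show "local_curve S (member k) p \<noteq> 0" "mult0 (local_curve S (member k) p) = m p"
    unfolding eq m_def using general_member(1,2)[OF tree_nz(1,2)[OF surfB[OF assms(2)]] k] by auto
qed

lemma general_mult_eq:
  assumes "p \<in> B" shows "general_mult S P Q p = m p"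
  unfolding general_mult_def
proof (rule the_equality)
  have "{k. curve_mult S (member k) p \<noteq> m p} \<subseteq> K0" using local_member_B(3) assms by (auto simp: curve_mult_def)
  then show fin: "finite {k. curve_mult S (member k) p \<noteq> m p}" using finK0 finite_subset by blast
  fix n assume "finite {k. curve_mult S (member k) p \<noteq> n}"
  then have "finite ({k. curve_mult S (member k) p \<noteq> n} \<union> {k. curve_mult S (member k) p \<noteq> m p})"
    using fin by blast
  then have "{k. curve_mult S (member k) p \<noteq> n} \<union> {k. curve_mult S (member k) p \<noteq> m p} \<noteq> UNIV"
    using infinite_UNIV_char_0 by metis
  then show "n = m p" by blast
qed

lemma blown_up_not_base: "blown_up_point S B q \<Longrightarrow> \<not> (ev (f q) (0, 0) = 0 \<and> ev (g q) (0, 0) = 0)"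
  using base_B m_pos_iff by (auto simp: blown_up_point_def)

lemma pencil_sum:
  fixes G :: "ipt \<Rightarrow> bipoly" and e :: "ipt \<Rightarrow> int"
  assumes K: "finite K" "K0 \<subseteq> K" and G': "sec S d' G'" "G' 0 \<noteq> 0"
    and GP: "\<And>c u v. on_surface S (Proper c u v) \<Longrightarrow> \<exists>k. k \<noteq> 0 \<and> trl u v (G' c) = bconst k * G (Proper c u v)"
    and nz: "\<And>q. q \<in> B \<Longrightarrow> G q \<noteq> 0"
    and GN: "\<And>q. q \<in> B \<Longrightarrow> \<exists>j. (\<forall>d. G (Near q d) = exc_eq d ^ j * strict_curve d (G q)) \<and>
        int j = int (mult0 (G q)) - e q \<and> (indep (f q) (g q) \<longrightarrow> j = 0)"
    and M: "\<And>c u v. on_surface S (Proper c u v) \<Longrightarrow> Mem K (f (Proper c u v)) (g (Proper c u v)) (G (Proper c u v))"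
  shows "(\<Sum>q\<in>B. int (m q) * e q) = dot S d d'"
proof -
  obtain k where k: "k \<notin> K" using ex_new_if_finite[OF infinite_UNIV_char_0 K(1)] by blast
  have k0: "k \<notin> K0" using k K(2) by blast
  let ?H = "local_curve S (member k)"
  have Mt: "Mem K (f p) (g p) (G p)" if "on_surface S p" "\<And>q. inf_near q p \<Longrightarrow> q \<noteq> p \<Longrightarrow> q \<in> B" for p
    using that
  proof (induction p)
    case (Proper c u v)
    then show ?case using M by blast
  next
    case (Near p d)
    have p: "p \<in> B" "on_surface S p" using Near.prems by (auto dest: inf_near_size)
    have IH: "Mem K (f p) (g p) (G p)"
      using configuration_inf_near[OF confB p(1)] by (intro Near.IH p(2)) blast
    note nzp = tree_nz(1,2)[OF p(2)]
    obtain j where j: "G (Near p d) = exc_eq d ^ j * strict_curve d (G p)" "indep (f p) (g p) \<longrightarrow> j = 0"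
      using GN[OF p(1)] by blast
    have 1: "Mem K (f (Near p d)) (g (Near p d)) (strict_curve d (G p))"
      unfolding pen_Near unfolding m_def by (rule Mem_strict[OF nzp IH nz[OF p(1)]])
    have 2: "Mem K (f (Near p d)) (g (Near p d)) (exc_eq d ^ j)"
    proof (cases "indep (f p) (g p)")
      case True
      then show ?thesis using j(2) Mem_1 by simp
    next
      case False
      have "bad (f p) (g p) \<subseteq> K" using K(2) p(1) by (auto simp: K0_def)
      then show ?thesis unfolding pen_Near unfolding m_def by (intro Mem_power Mem_mono[OF Mem_exc[OF nzp False]])
    qed
    show ?case unfolding j(1) by (rule Mem_mult[OF 2 1])
  qed
  have NV: "\<not> (ev (?H q) (0, 0) = 0 \<and> ev (G q) (0, 0) = 0)" if q: "blown_up_point S B q" for q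
  proof -
    have s: "on_surface S q" "\<And>r. inf_near r q \<Longrightarrow> r \<noteq> q \<Longrightarrow> r \<in> B" using q by (auto simp: blown_up_point_def)
    show ?thesis
    proof
      assume 0: "ev (?H q) (0, 0) = 0 \<and> ev (G q) (0, 0) = 0"
      then have "ev (f q + bconst k * g q) (0, 0) = 0" using local_member[OF k0 s] by simp
      from Mem_avoid[OF Mt[OF s] k _ this] 0 show False using blown_up_not_base[OF q] by simp
    qed
  qed
  have H0: "dehom S (member k) 0 \<noteq> 0" by (rule member_nz[OF chart0])
  have HP: "?H (Proper c u v) = trl u v (dehom S (member k) c)" for c u v by (rule local_curve_Proper)
  have cz: "finite (cz S (dehom S (member k)) G')"
  proof -
    have "inj (\<lambda>(c, u, v). Proper c u v)" by (auto simp: inj_on_def)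
    from finite_vimageI[OF finB this] show ?thesis
    proof (rule finite_subset[rotated], clarify)
      fix c u v assume z: "(c, u, v) \<in> cz S (dehom S (member k)) G'"
      then have s: "on_surface S (Proper c u v)" unfolding cz_def by blast
      obtain k' where k': "k' \<noteq> 0" "trl u v (G' c) = bconst k' * G (Proper c u v)" using GP[OF s] by blast
      have "ev (?H (Proper c u v)) (0, 0) = 0" unfolding HP using z by (simp add: cz_def)
      moreover have "ev (bconst k' * G (Proper c u v)) (0, 0) = 0" unfolding k'(2)[symmetric] using z by (simp add: cz_def)
      ultimately have "\<not> blown_up_point S B (Proper c u v)" using NV k'(1) by auto
      then show "(c, u, v) \<in> (\<lambda>(c, u, v). Proper c u v) -` B" using s by (auto simp: blown_up_point_def)
    qed
  qed
  have nz': "?H q \<noteq> 0 \<and> G q \<noteq> 0" if "q \<in> B" for q using nz[OF that] local_member_B(2)[OF k0 that] by blast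
  have GN': "\<exists>j. (\<forall>d. G (Near q d) = exc_eq d ^ j * strict_curve d (G q)) \<and> int j = int (mult0 (G q)) - e q"
    if "q \<in> B" for q using GN[OF that] by blast
  have "(\<Sum>q\<in>B. int (mult0 (?H q)) * e q) = dot S d d'"
    by (rule noether_sum(2)[where H = ?H and G = G, OF confB sec_member H0 G' cz HP GP nz' local_curve.simps(2) GN' NV])
  then show ?thesis using local_member_B(3)[OF k0] by simp
qed

end

section \<open>Intersection numbers of a general member\<close>

section \<open>Intersection numbers of the pencil\<close>

lemma sec_1: "sec S 0 (\<lambda>c. 1)"
  unfolding sec_def by (cases S) (simp_all add: chi_def)

lemma dot_0: "dot S d 0 = 0"
  by (cases S) (simp_all add: dot_def)

text \<open>The value \<open>-1\<close> is the virtual multiplicity of an exceptional curve at its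
  own center: the equation is \<open>1\<close> there and gains one exceptional factor after the
  blowup. The same number occurs in \<open>strict_exc_cls\<close>.\<close>

lemma local_exc_Near:
  "\<exists>j. (\<forall>d. local_exc p (Near q d) = exc_eq d ^ j * strict_curve d (local_exc p q)) \<and>
     int j = int (mult0 (local_exc p q)) - (if q = p then -1 else int (mult0 (local_exc p q))) \<and> (q \<noteq> p \<longrightarrow> j = 0)"
proof (cases "q = p")
  case True
  then show ?thesis by (intro exI[of _ 1]) (simp add: local_exc_1 strict_1 mult0_1)
qed (intro exI[of _ 0], simp)

lemma ev_vt_Some:
  assumes "oge n f" shows "ev (vt (Some t) n f) (0, 0) = poly (rX (vt (Some 0) n f)) t"
proof -
  have "exc_eq (Some t) ^ n * vt (Some t) n f = bsubst (pb (Some 0) f) bX (bY + bconst t)"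
    unfolding vt[OF assms, symmetric] pb_Some[symmetric] ..
  also have "\<dots> = exc_eq (Some t) ^ n * bsubst (vt (Some 0) n f) bX (bY + bconst t)"
    unfolding vt[OF assms, of "Some 0"] by (simp add: bsubst_simps)
  finally have "vt (Some t) n f = bsubst (vt (Some 0) n f) bX (bY + bconst t)" by simp
  then show ?thesis by simp
qed

context first_integral_pencil
begin

lemma root_Mem:
  assumes "\<And>c. c \<in> charts S \<Longrightarrow> \<exists>K. finite K \<and> Mem K (dehom S P c) (dehom S Q c) (F c)"
  shows "\<exists>K. finite K \<and> K0 \<subseteq> K \<and> (\<forall>c u v. on_surface S (Proper c u v) \<longrightarrow>
    Mem K (f (Proper c u v)) (g (Proper c u v)) (trl u v (F c)))"
proof -
  obtain K where K: "\<And>c. c \<in> charts S \<Longrightarrow> finite (K c) \<and> Mem (K c) (dehom S P c) (dehom S Q c) (F c)"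
    using assms by metis
  have fc: "finite (charts S)" by (cases S) (simp_all add: charts_def)
  show ?thesis
  proof (intro exI[of _ "K0 \<union> (\<Union>c\<in>charts S. K c)"] conjI allI impI)
    show "finite (K0 \<union> (\<Union>c\<in>charts S. K c))" using finK0 fc K by blast
    fix c u v assume "on_surface S (Proper c u v)"
    then have c: "c \<in> charts S" by simp
    then have "K c \<subseteq> K0 \<union> (\<Union>c\<in>charts S. K c)" by blast
    then show "Mem (K0 \<union> (\<Union>c\<in>charts S. K c)) (f (Proper c u v)) (g (Proper c u v)) (trl u v (F c))"
      using K[OF c] by (auto intro: Mem_trl Mem_mono)
  qed blast
qed

text \<open>A fixed member \<open>k\<close> plays the role of the curve; putting \<open>k\<close>
  into the set of avoided parameters makes the general member a different one.\<close>

lemma self_intersection: "(\<Sum>q\<in>B. int (m q) * int (m q)) = dot S d d"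
proof -
  obtain k where k: "k \<notin> K0" using ex_new_if_finite[OF infinite_UNIV_char_0 finK0] by blast
  let ?K = "insert k K0"
  show ?thesis
  proof (rule pencil_sum[of ?K d "dehom S (member k)" "local_curve S (member k)"])
    show "finite ?K" "K0 \<subseteq> ?K" using finK0 by auto
    show "sec S d (dehom S (member k))" by (rule sec_member)
    show "dehom S (member k) 0 \<noteq> 0" by (rule member_nz[OF chart0])
    show "\<exists>k'. k' \<noteq> 0 \<and> trl u v (dehom S (member k) c) = bconst k' * local_curve S (member k) (Proper c u v)" for c u v
      unfolding local_curve_Proper by (intro exI[of _ 1]) simp
    show "local_curve S (member k) q \<noteq> 0" if "q \<in> B" for q by (rule local_member_B(2)[OF k that])
    show "\<exists>j. (\<forall>d. local_curve S (member k) (Near q d) = exc_eq d ^ j * strict_curve d (local_curve S (member k) q)) \<and>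
        int j = int (mult0 (local_curve S (member k) q)) - int (m q) \<and> (indep (f q) (g q) \<longrightarrow> j = 0)" if "q \<in> B" for q
      using local_member_B(3)[OF k that] by (intro exI[of _ 0]) simp
    show "Mem ?K (f (Proper c u v)) (g (Proper c u v)) (local_curve S (member k) (Proper c u v))" for c u v
      unfolding local_curve_Proper Mem_def
      by (intro exI[of _ "[(1, k)]"]) (simp add: mem_def dehom_add dehom_cst_mult)
  qed
qed

lemma curve_intersection:
  assumes C: "integral_curve S C" "invariant_curve S W C"
  shows "(\<Sum>q\<in>B. int (m q) * int (curve_mult S C q)) = dot S d (hdeg S C)"
proof -
  have "C \<noteq> 0" using C(1) by (auto simp: integral_curve_def)
  obtain d' where hom: "homogeneous S d' C" using C(1) by (auto simp: integral_curve_def)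
  have hd: "hdeg S C = d'" by (rule hdeg_eq[OF hom \<open>C \<noteq> 0\<close>])
  have C0: "dehom S C 0 \<noteq> 0" using dehom_0_inj[OF hom] \<open>C \<noteq> 0\<close> by blast
  have Cc: "dehom S C c \<noteq> 0" if "c \<in> charts S" for c using sec_nonzero[OF sec_dehom[OF hom] that] C0 by simp
  have "\<exists>K. finite K \<and> Mem K (dehom S P c) (dehom S Q c) (dehom S C c)" if "c \<in> charts S" for c
    using C(2) that by (intro fpen_invariant_Mem[OF fp[OF that] Cc[OF that]]) (auto simp: invariant_curve_def)
  from root_Mem[OF this] obtain K where K: "finite K" "K0 \<subseteq> K" and M: "\<And>c u v. on_surface S (Proper c u v) \<Longrightarrow>
    Mem K (f (Proper c u v)) (g (Proper c u v)) (trl u v (dehom S C c))" by blast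
  have nz: "local_curve S C q \<noteq> 0" if "on_surface S q" for q
    using that
  proof (induction q)
    case (Proper c u v)
    then show ?case using Cc by (simp add: local_curve_Proper del: local_curve.simps)
  qed (simp add: strict_ne_0)
  show ?thesis unfolding hd
  proof (rule pencil_sum[of K d' "dehom S C" "local_curve S C"])
    show "sec S d' (dehom S C)" by (rule sec_dehom[OF hom])
    show "\<exists>k'. k' \<noteq> 0 \<and> trl u v (dehom S C c) = bconst k' * local_curve S C (Proper c u v)" for c u v
      unfolding local_curve_Proper by (intro exI[of _ 1]) simp
    show "local_curve S C q \<noteq> 0" if "q \<in> B" for q using nz surfB[OF that] by blast
    show "\<exists>j. (\<forall>d. local_curve S C (Near q d) = exc_eq d ^ j * strict_curve d (local_curve S C q)) \<and>
        int j = int (mult0 (local_curve S C q)) - int (curve_mult S C q) \<and> (indep (f q) (g q) \<longrightarrow> j = 0)" for q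
      by (intro exI[of _ 0]) (simp add: curve_mult_def)
    show "Mem K (f (Proper c u v)) (g (Proper c u v)) (local_curve S C (Proper c u v))"
      if "on_surface S (Proper c u v)" for c u v
      unfolding local_curve_Proper by (rule M[OF that])
  qed (use K C0 in auto)
qed

lemma kexp_nu_eps: "int (kexp (local_form W q)) = int (nu W q) + int (eps W q)"
  by (simp add: kexp_def nu_def eps_def term_dic_at_def)

text \<open>By the count of exponents in \<open>fpen_step\<close> the cofactor has virtual
  multiplicity \<open>2 m - (\<nu> + \<epsilon>)\<close>. At dicritical points this is its actual
  multiplicity, so no exceptional factor arises where \<open>pencil_sum\<close> forbids it.\<close>

lemma canonical_intersection:
  assumes can: "canonical_degree S W kd"
  shows "(\<Sum>q\<in>B. int (m q) * (2 * int (m q) - (int (nu W q) + int (eps W q)))) = dot S d (d + d - kd + kzdeg S)"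
proof -
  let ?e = "d + d - kd + kzdeg S"
  obtain \<kappa> where \<kappa>: "\<forall>c\<in>charts S. \<kappa> c \<noteq> 0" and s: "sec S ?e (\<lambda>c. bconst (\<kappa> c) * h c)"
    using differential_section[OF sec_dehom[OF homP] sec_dehom[OF homQ] can fp] by blast
  have h0: "h c \<noteq> 0" if "c \<in> charts S" for c using fp[OF that] by (simp add: fpen_def)
  have "\<exists>K. finite K \<and> Mem K (dehom S P c) (dehom S Q c) (h c)" if "c \<in> charts S" for c
    by (rule fpen_cofactor_Mem[OF fp[OF that]])
  from root_Mem[OF this] obtain K where K: "finite K" "K0 \<subseteq> K" and M: "\<And>c u v. on_surface S (Proper c u v) \<Longrightarrow>
    Mem K (f (Proper c u v)) (g (Proper c u v)) (trl u v (h c))" by blast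
  show ?thesis
  proof (rule pencil_sum[OF K s, of hh])
    show "bconst (\<kappa> 0) * h 0 \<noteq> 0" using \<kappa> h0 chart0 by simp
    show "\<exists>k. k \<noteq> 0 \<and> trl u v (bconst (\<kappa> c) * h c) = bconst k * hh (Proper c u v)"
      if "on_surface S (Proper c u v)" for c u v
      using \<kappa> that by (intro exI[of _ "\<kappa> c"]) simp
    show "hh q \<noteq> 0" if "q \<in> B" for q using tree_nz(3) surfB[OF that] by blast
    show "\<exists>j. (\<forall>d. hh (Near q d) = exc_eq d ^ j * strict_curve d (hh q)) \<and>
        int j = int (mult0 (hh q)) - (2 * int (m q) - (int (nu W q) + int (eps W q))) \<and> (indep (f q) (g q) \<longrightarrow> j = 0)"
      if "q \<in> B" for q
    proof -
      let ?j = "kexp (local_form W q) + mult0 (hh q) - 2 * m q"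
      have t: "fpen (f q) (g q) (local_form W q) (hh q)" using tree surfB[OF that] by blast
      have "2 * m q \<le> kexp (local_form W q) + mult0 (hh q)" using fpen_step(1)[OF t] by (simp add: m_def)
      then have "int ?j = int (mult0 (hh q)) - (2 * int (m q) - (int (nu W q) + int (eps W q)))"
        unfolding kexp_nu_eps[symmetric] by simp
      moreover have "?j = 0" if "indep (f q) (g q)" using dicritical_iff_indep[OF t] that by (simp add: m_def)
      ultimately show ?thesis by (intro exI[of _ ?j]) simp
    qed
    show "Mem K (f (Proper c u v)) (g (Proper c u v)) (hh (Proper c u v))"
      if "on_surface S (Proper c u v)" for c u v
      using M[OF that] by simp
  qed
qed

lemma exceptional_sum:
  assumes p: "p \<in> B"
  shows "(\<Sum>q\<in>B. int (m q) * (if q = p then -1 else int (mult0 (local_exc p q)))) =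
    (\<Sum>q\<in>{q\<in>B. proximate q p}. int (m q)) - int (m p)"
proof -
  have "(\<Sum>q\<in>B. int (m q) * (if q = p then -1 else int (mult0 (local_exc p q)))) =
      - int (m p) + (\<Sum>q\<in>B - {p}. int (m q) * (if q = p then -1 else int (mult0 (local_exc p q))))"
    by (subst sum.remove[OF finB p]) simp
  also have "(\<Sum>q\<in>B - {p}. int (m q) * (if q = p then -1 else int (mult0 (local_exc p q)))) =
      (\<Sum>q\<in>B - {p}. if proximate q p then int (m q) else 0)"
    by (intro sum.cong) (auto simp: mult0_local_exc)
  also have "\<dots> = (\<Sum>q\<in>(B - {p}) \<inter> {q. proximate q p}. int (m q))" using finB by (simp add: sum.inter_restrict)
  also have "(B - {p}) \<inter> {q. proximate q p} = {q\<in>B. proximate q p}" by (auto simp: proximate_def)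
  finally show ?thesis by simp
qed

text \<open>An exceptional curve has no equation on \<open>S\<close> itself, so the global section
  is the constant \<open>1\<close> of degree \<open>0\<close>, and \<open>local_exc p\<close> is its
  transform with the virtual multiplicity \<open>-1\<close> at \<open>p\<close>.\<close>

lemma proximity_equality:
  assumes p: "p \<in> B" "\<not> term_dic_at W p"
  shows "m p = (\<Sum>q\<in>{q\<in>B. proximate q p}. m q)"
proof -
  have "(\<Sum>q\<in>B. int (m q) * (if q = p then -1 else int (mult0 (local_exc p q)))) = dot S d 0"
  proof (rule pencil_sum[OF finK0 subset_refl sec_1, of "local_exc p"])
    show "\<exists>k. k \<noteq> 0 \<and> trl u v 1 = bconst k * local_exc p (Proper c u v)" for c u v
      by (intro exI[of _ 1]) simp
    show "\<exists>j. (\<forall>d. local_exc p (Near q d) = exc_eq d ^ j * strict_curve d (local_exc p q)) \<and>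
        int j = int (mult0 (local_exc p q)) - (if q = p then -1 else int (mult0 (local_exc p q))) \<and>
        (indep (f q) (g q) \<longrightarrow> j = 0)" for q
      using local_exc_Near[of p q] p dicritical_iff[OF surfB[OF p(1)]] by blast
  qed (simp_all add: local_exc_ne_0 Mem_1)
  then have "int (m p) = int (\<Sum>q\<in>{q\<in>B. proximate q p}. m q)"
    unfolding exceptional_sum[OF p(1)] dot_0 by simp
  then show ?thesis by (simp only: of_nat_eq_iff)
qed

text \<open>Through each point of the exceptional curve off the member \<open>g\<close> passes one
  member \<open>f + k g\<close>. As \<open>f / g\<close> is not constant on the curve, all but
  finitely many points give a parameter outside \<open>K0\<close>.\<close>

lemma free_member:
  assumes p: "p \<in> B" "term_dic_at W p" and T: "finite T"
  shows "\<exists>k t. k \<notin> K0 \<and> t \<notin> T \<and> ev (f (Near p (Some t)) + bconst k * g (Near p (Some t))) (0, 0) = 0"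
proof -
  note s = surfB[OF p(1)]
  have ind: "indep (f p) (g p)" using dicritical_iff[OF s] p(2) by blast
  have o: "oge (m p) (f p)" "oge (m p) (g p)" using pm_oge[OF tree_nz(1,2)[OF s]] by (auto simp: m_def)
  let ?F = "rX (vt (Some 0) (m p) (f p))" and ?G = "rX (vt (Some 0) (m p) (g p))"
  have comb: "[:a:] * ?F + [:b:] * ?G \<noteq> 0" if "(a, b) \<noteq> (0, 0)" for a b
  proof
    assume "[:a:] * ?F + [:b:] * ?G = 0"
    then have "rX (vt (Some 0) (m p) (bconst a * f p + bconst b * g p)) = 0" unfolding vt_lin[OF o] by simp
    then have "exc_eq (Some 0) dvd vt (Some 0) (m p) (bconst a * f p + bconst b * g p)" by (simp add: bX_dvd_iff)
    then have "oge (Suc (m p)) (bconst a * f p + bconst b * g p)"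
      using exc_dvd_vt[OF oge_add[OF oge_bconst[OF o(1)] oge_bconst[OF o(2)]]] by blast
    then show False using ind that unfolding indep_def m_def by auto
  qed
  \<comment> \<open>Its roots are the points to be avoided: those on members with parameter in
    \<open>K0\<close>, those on the member \<open>g\<close>, and those in \<open>T\<close>.\<close>
  define R where "R = (\<Prod>k\<in>K0. ?F + [:k:] * ?G) * ?G * (\<Prod>t\<in>T. [:- t, 1:])"
  have G0: "?G \<noteq> 0" using comb[of 0 1] by (simp add: one_pCons[symmetric] flip: pCons_one)
  have Fk: "?F + [:k:] * ?G \<noteq> 0" for k using comb[of 1 k] by (simp flip: pCons_one)
  have "R \<noteq> 0" unfolding R_def using finK0 T G0 Fk by (simp add: prod_zero_iff)
  then have "finite {t. poly R t = 0}" by (rule poly_roots_finite)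
  then obtain t where t: "poly R t \<noteq> 0" using ex_new_if_finite[OF infinite_UNIV_char_0] by blast
  then have tG: "poly ?G t \<noteq> 0" and tK: "\<And>k. k \<in> K0 \<Longrightarrow> poly ?F t + k * poly ?G t \<noteq> 0" and tT: "t \<notin> T"
    unfolding R_def using finK0 T by (auto simp: poly_prod prod_zero_iff)
  define k where "k = - poly ?F t / poly ?G t"
  have k: "poly ?F t + k * poly ?G t = 0" using tG by (simp add: k_def)
  then have "k \<notin> K0" using tK by blast
  moreover have "ev (f (Near p (Some t)) + bconst k * g (Near p (Some t))) (0, 0) = 0"
    unfolding pen_Near using k o by (simp add: ev_vt_Some del: poly_rX)
  ultimately show ?thesis using tT by blast
qed

text \<open>A dicritical exceptional curve is transversal to the pencil at its points outside the
  configuration, so a member through such a point makes the proximity inequality strict.\<close>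

lemma proximity_strict:
  assumes p: "p \<in> B" "term_dic_at W p"
  shows "(\<Sum>q\<in>{q\<in>B. proximate q p}. m q) < m p"
proof -
  let ?T = "(\<lambda>t. Near p (Some t)) -` B"
  have inj: "inj (\<lambda>t. Near p (Some t))" by (rule injI) simp
  obtain k t where k: "k \<notin> K0" and t: "t \<notin> ?T"
    and z: "ev (f (Near p (Some t)) + bconst k * g (Near p (Some t))) (0, 0) = 0"
    using free_member[OF p finite_vimageI[OF finB inj]] by blast
  define q0 where "q0 = Near p (Some t)"
  have q0: "q0 \<notin> B" using t by (simp add: q0_def)
  \<comment> \<open>One more point is blown up. The chosen member and the exceptional curve still
    meet there, and this positive term makes the inequality strict.\<close>
  let ?H = "local_curve S (member k)" and ?B = "insert q0 B"
  have s: "on_surface S p" by (rule surfB[OF p(1)])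
  have conf': "configuration S ?B" using confB p(1) s by (auto simp: configuration_def q0_def)
  have Hq0: "?H q0 \<noteq> 0" using local_member_B(2)[OF k p(1)] by (simp add: q0_def strict_ne_0)
  have "?H q0 = f q0 + bconst k * g q0"
    using s configuration_inf_near[OF confB p(1)] by (intro local_member[OF k]) (auto simp: q0_def)
  then have Hm: "mult0 (?H q0) \<ge> 1" using mult0_eq_0_iff[OF Hq0] z by (simp add: q0_def)
  let ?e = "\<lambda>q. if q = p then -1 else int (mult0 (local_exc p q))"
  have eq0: "?e q0 = 1" using mult0_exc[of "Some t"] by (simp add: q0_def del: exc_eq.simps)
  have "(\<Sum>q\<in>?B. int (mult0 (?H q)) * ?e q) \<le> dot S d 0"
  proof (rule noether_sum(1)[where H = ?H and G = "local_exc p", OF conf' sec_member member_nz[OF chart0] sec_1])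
    show "finite (cz S (dehom S (member k)) (\<lambda>c. 1))" by (simp add: cz_def split_def)
    show "\<exists>k'. k' \<noteq> 0 \<and> trl u v 1 = bconst k' * local_exc p (Proper c u v)" for c u v
      by (intro exI[of _ 1]) simp
    show "?H q \<noteq> 0 \<and> local_exc p q \<noteq> 0" if "q \<in> ?B" for q
      using that Hq0 local_member_B(2)[OF k] local_exc_ne_0 by blast
    show "\<exists>j. (\<forall>d. local_exc p (Near q d) = exc_eq d ^ j * strict_curve d (local_exc p q)) \<and>
        int j = int (mult0 (local_exc p q)) - ?e q" for q
      using local_exc_Near[of p q] by blast
  qed (simp_all add: local_curve_Proper del: local_curve.simps(1))
  moreover have "(\<Sum>q\<in>?B. int (mult0 (?H q)) * ?e q) = int (mult0 (?H q0)) * ?e q0 + (\<Sum>q\<in>B. int (mult0 (?H q)) * ?e q)"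
    by (rule sum.insert[OF finB q0])
  moreover have "(\<Sum>q\<in>B. int (mult0 (?H q)) * ?e q) = (\<Sum>q\<in>B. int (m q) * ?e q)"
    by (rule sum.cong) (simp_all add: local_member_B(3)[OF k])
  ultimately have "int (\<Sum>q\<in>{q\<in>B. proximate q p}. m q) < int (m p)"
    using Hm unfolding exceptional_sum[OF p(1)] dot_0 eq0 by simp
  then show ?thesis by (simp only: of_nat_less_iff)
qed

lemma dicritical_point_exists: "B \<noteq> {} \<Longrightarrow> \<exists>p\<in>B. term_dic_at W p"
  using inf_near_refl by (fastforce simp: dicritical_config_def)

text \<open>At a dicritical point \<open>m\<close> is positive by the strict proximity inequality,
  so \<open>dot S d d\<close> is positive, which \<open>snd d = 0\<close> would contradict. A
  negative value is excluded by the Newton polygon of \<open>P\<close>.\<close>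

lemma degree_pos:
  assumes "B \<noteq> {}" shows "snd d > 0"
proof -
  obtain p where p: "p \<in> B" "term_dic_at W p" using dicritical_point_exists[OF assms] by blast
  have "m p > 0" using proximity_strict[OF p] by simp
  then have "0 < int (m p) * int (m p)" by simp
  also have "\<dots> \<le> (\<Sum>q\<in>B. int (m q) * int (m q))" using finB p(1) by (intro member_le_sum) auto
  finally have dd: "0 < dot S d d" unfolding self_intersection .
  obtain i j where "cf (dehom S P 0) i j \<noteq> 0" using P_nz[OF chart0] cf_ext[of "dehom S P 0" 0] by auto
  then have "snd d \<ge> 0" using sec_cap[OF sec_dehom[OF homP]] by (cases S) (fastforce simp: cap_def)+
  moreover have "snd d \<noteq> 0" using dd by (cases S) (auto simp: dot_def)
  ultimately show ?thesis by simp
qed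

end

section \<open>The affine family of classes and the quadratic function on it\<close>

section \<open>The classes \<open>T\<^sub>\<alpha>\<close>\<close>

definition rdot :: "surface \<Rightarrow> real \<Rightarrow> real \<Rightarrow> real \<Rightarrow> real \<Rightarrow> real" where
  "rdot S a b a' b' = (case S of P2 \<Rightarrow> b * b' | Hirz \<delta> \<Rightarrow> a * b' + b * a' + real \<delta> * (b * b'))"

lemma inter_divisor:
  "inter S BF (divisor S BF a b e) (divisor S BF a' b' e') = rdot S a b a' b' - (\<Sum>p\<in>BF. e p * e' p)"
  by (cases S) (simp_all add: inter_def divisor_def rdot_def)

lemma rdot_dot: "rdot S (of_int (fst d)) (of_int (snd d)) (of_int (fst d')) (of_int (snd d')) = of_int (dot S d d')"
  by (cases S) (simp_all add: rdot_def dot_def)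

lemma rdot_scale: "rdot S (c * a) (c * b) a' b' = c * rdot S a b a' b'"
  by (cases S) (simp_all add: rdot_def algebra_simps)

lemma divisor_cong: "(\<And>p. p \<in> BF \<Longrightarrow> e p = e' p) \<Longrightarrow> (S \<noteq> P2 \<Longrightarrow> a = a') \<Longrightarrow> divisor S BF a b e = divisor S BF a' b e'"
  by (auto simp: divisor_def fun_eq_iff split: gen.split)

lemma scaleR_divisor: "c *\<^sub>R divisor S BF a b e = divisor S BF (c * a) (c * b) (\<lambda>p. c * e p)"
  by (auto simp: divisor_def scaleR_fun_def fun_eq_iff split: gen.split)

lemma K_diff: "K_fol S W kd BF - K_Z S BF =
   divisor S BF (of_int (fst (kd - kzdeg S))) (of_int (snd (kd - kzdeg S))) (\<lambda>p. real (nu W p) + real (eps W p))"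
  by (cases S) (auto simp: K_fol_def K_Z_def divisor_def kzdeg_def fun_eq_iff split: gen.split)

lemma proximate_inf_near: "proximate s p \<Longrightarrow> inf_near p s \<and> s \<noteq> p"
  by (simp add: proximate_def)

text \<open>The recursion without case distinction: unless \<open>q\<close> lies strictly above
  \<open>p\<close>, it lies above no point proximate to \<open>p\<close>, and the sum is
  zero.\<close>

lemma lam_rec: "lam BF q p = (if p = q then 1 else 0) + (\<Sum>s\<in>{s\<in>BF. proximate s p}. lam BF q s)"
proof (cases "inf_near p q \<and> p \<noteq> q")
  case True
  then show ?thesis by (simp add: lam.simps[of BF q p])
next
  case False
  have "lam BF q s = 0" if "proximate s p" for s
  proof -
    have s: "inf_near p s" "s \<noteq> p" using proximate_inf_near[OF that] by auto
    have "\<not> inf_near s q"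
    proof
      assume "inf_near s q"
      moreover from this have "p = q" using False inf_near_trans[OF s(1)] by blast
      ultimately show False using s inf_near_size[of p s] inf_near_size[of s p] by auto
    qed
    then show ?thesis by (simp add: lam.simps[of BF q s])
  qed
  then show ?thesis using False by (auto simp: lam.simps[of BF q p])
qed

lemma lam_sum:
  assumes "finite BF" "p \<in> BF"
  shows "(\<Sum>q\<in>BF. lam BF q p * x q) = x p + (\<Sum>s\<in>{s\<in>BF. proximate s p}. \<Sum>q\<in>BF. lam BF q s * x q)"
proof -
  have "(\<Sum>q\<in>BF. lam BF q p * x q) =
      (\<Sum>q\<in>BF. (if p = q then x q else 0) + (\<Sum>s\<in>{s\<in>BF. proximate s p}. lam BF q s * x q))"
    by (subst lam_rec) (auto intro!: sum.cong simp: distrib_right sum_distrib_right)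
  also have "\<dots> = x p + (\<Sum>q\<in>BF. \<Sum>s\<in>{s\<in>BF. proximate s p}. lam BF q s * x q)"
    using assms by (simp add: sum.distrib)
  also have "(\<Sum>q\<in>BF. \<Sum>s\<in>{s\<in>BF. proximate s p}. lam BF q s * x q) =
      (\<Sum>s\<in>{s\<in>BF. proximate s p}. \<Sum>q\<in>BF. lam BF q s * x q)" by (rule sum.swap)
  finally show ?thesis .
qed

text \<open>The coefficients \<open>lam\<close> form the inverse of the proximity matrix; the
  recursion is solved from the last points down.\<close>

lemma lam_inverse:
  assumes fin: "finite BF" and y: "\<And>p. p \<in> BF \<Longrightarrow> y p = x p + (\<Sum>s\<in>{s\<in>BF. proximate s p}. y s)" and p: "p \<in> BF"
  shows "(\<Sum>q\<in>BF. lam BF q p * x q) = y p"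
  using p
proof (induction "card {q\<in>BF. inf_near p q}" arbitrary: p rule: less_induct)
  case (less p)
  have "(\<Sum>q\<in>BF. lam BF q s * x q) = y s" if s: "s \<in> {s\<in>BF. proximate s p}" for s
  proof (rule less.hyps)
    have ps: "inf_near p s" "s \<noteq> p" using proximate_inf_near s by auto
    have "{q\<in>BF. inf_near s q} \<subseteq> {q\<in>BF. inf_near p q}" using inf_near_trans[OF ps(1)] by blast
    moreover have "p \<notin> {q\<in>BF. inf_near s q}" using inf_near_size[of p s] inf_near_size[of s p] ps by auto
    moreover have "p \<in> {q\<in>BF. inf_near p q}" using less.prems by simp
    ultimately have "{q\<in>BF. inf_near s q} \<subset> {q\<in>BF. inf_near p q}" by blast
    then show "card {q\<in>BF. inf_near s q} < card {q\<in>BF. inf_near p q}" using fin by (intro psubset_card_mono) auto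
  qed (use s in blast)
  then show ?case unfolding lam_sum[OF fin less.prems] y[OF less.prems] by simp
qed

lemma split_solution:
  fixes \<phi> \<alpha> :: "nat \<Rightarrow> real"
  assumes "l \<le> D" "\<And>s. s \<in> {l+1..D} \<Longrightarrow> \<alpha> s = \<nu> s + (\<Sum>k=1..l. \<mu> k s * \<alpha> k)"
  shows "(\<Sum>j=1..D. \<phi> j * \<alpha> j) =
    (\<Sum>s=l+1..D. \<phi> s * \<nu> s) + (\<Sum>k=1..l. (\<phi> k + (\<Sum>s=l+1..D. \<phi> s * \<mu> k s)) * \<alpha> k)"
proof -
  have "{1..D} = {1..l} \<union> {l+1..D}" using assms(1) by auto
  then have "(\<Sum>j=1..D. \<phi> j * \<alpha> j) = (\<Sum>k=1..l. \<phi> k * \<alpha> k) + (\<Sum>s=l+1..D. \<phi> s * \<alpha> s)"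
    by (simp add: sum.union_disjoint)
  also have "(\<Sum>s=l+1..D. \<phi> s * \<alpha> s) = (\<Sum>s=l+1..D. \<phi> s * \<nu> s + (\<Sum>k=1..l. \<phi> s * \<mu> k s * \<alpha> k))"
    using assms(2) by (intro sum.cong refl) (simp add: distrib_left sum_distrib_left mult.assoc)
  also have "\<dots> = (\<Sum>s=l+1..D. \<phi> s * \<nu> s) + (\<Sum>s=l+1..D. \<Sum>k=1..l. \<phi> s * \<mu> k s * \<alpha> k)"
    by (rule sum.distrib)
  also have "(\<Sum>s=l+1..D. \<Sum>k=1..l. \<phi> s * \<mu> k s * \<alpha> k) = (\<Sum>k=1..l. \<Sum>s=l+1..D. \<phi> s * \<mu> k s * \<alpha> k)"
    by (rule sum.swap)
  finally show ?thesis by (simp add: distrib_right sum_distrib_right sum.distrib)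
qed

text \<open>The system \<open>crit\<close> says that the gradient of \<open>q\<close> vanishes at
  \<open>\<beta>\<close>, so the expansion around \<open>\<beta>\<close> has no linear term, and its
  quadratic term is minus the sum of squares.\<close>

lemma quadratic_at_critical_point:
  fixes \<Gamma> :: "'p \<Rightarrow> real" and \<Lambda> :: "'p \<Rightarrow> nat \<Rightarrow> real" and \<alpha> \<beta> H :: "nat \<Rightarrow> real"
  assumes crit: "\<And>j. j \<in> {1..l} \<Longrightarrow>
    (\<Sum>k=1..l. (\<Sum>p\<in>B. \<Lambda> p j * \<Lambda> p k) * \<beta> k) = H j - (\<Sum>p\<in>B. \<Gamma> p * \<Lambda> p j)"
  defines "q \<equiv> \<lambda>\<gamma>. 2 * (\<Sum>k=1..l. H k * \<gamma> k) - (\<Sum>p\<in>B. (\<Gamma> p + (\<Sum>k=1..l. \<Lambda> p k * \<gamma> k))\<^sup>2)"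
  shows "q \<beta> = q \<alpha> + (\<Sum>p\<in>B. (\<Sum>k=1..l. \<Lambda> p k * (\<alpha> k - \<beta> k))\<^sup>2)"
proof -
  define L where "L p \<gamma> = (\<Sum>k=1..l. \<Lambda> p k * \<gamma> k)" for p and \<gamma> :: "nat \<Rightarrow> real"
  have Ld: "(\<Sum>k=1..l. \<Lambda> p k * (\<alpha> k - \<beta> k)) = L p \<alpha> - L p \<beta>" for p
    by (simp add: L_def right_diff_distrib sum_subtractf)
  have "H j = (\<Sum>p\<in>B. \<Lambda> p j * (\<Gamma> p + L p \<beta>))" if j: "j \<in> {1..l}" for j
  proof -
    have "(\<Sum>k=1..l. (\<Sum>p\<in>B. \<Lambda> p j * \<Lambda> p k) * \<beta> k) = (\<Sum>k=1..l. \<Sum>p\<in>B. \<Lambda> p j * (\<Lambda> p k * \<beta> k))"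
      by (simp add: sum_distrib_right mult.assoc)
    also have "\<dots> = (\<Sum>p\<in>B. \<Sum>k=1..l. \<Lambda> p j * (\<Lambda> p k * \<beta> k))" by (rule sum.swap)
    finally have "(\<Sum>k=1..l. (\<Sum>p\<in>B. \<Lambda> p j * \<Lambda> p k) * \<beta> k) = (\<Sum>p\<in>B. \<Lambda> p j * L p \<beta>)"
      by (simp add: L_def sum_distrib_left)
    then show ?thesis using crit[OF j] by (simp add: distrib_left sum.distrib mult.commute)
  qed
  then have "(\<Sum>k=1..l. H k * (\<alpha> k - \<beta> k)) = (\<Sum>k=1..l. (\<Sum>p\<in>B. \<Lambda> p k * (\<Gamma> p + L p \<beta>)) * (\<alpha> k - \<beta> k))"
    by (intro sum.cong) auto
  also have "\<dots> = (\<Sum>k=1..l. \<Sum>p\<in>B. (\<Gamma> p + L p \<beta>) * (\<Lambda> p k * (\<alpha> k - \<beta> k)))"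
    unfolding sum_distrib_right by (intro sum.cong refl) (simp only: mult_ac)
  also have "\<dots> = (\<Sum>p\<in>B. (\<Gamma> p + L p \<beta>) * (L p \<alpha> - L p \<beta>))"
    unfolding Ld[symmetric] sum_distrib_left by (rule sum.swap)
  finally have H: "(\<Sum>k=1..l. H k * \<alpha> k) - (\<Sum>k=1..l. H k * \<beta> k) = (\<Sum>p\<in>B. (\<Gamma> p + L p \<beta>) * (L p \<alpha> - L p \<beta>))"
    by (simp add: right_diff_distrib sum_subtractf)
  have "(\<Sum>p\<in>B. (L p \<alpha> - L p \<beta>)\<^sup>2) = (\<Sum>p\<in>B. (\<Gamma> p + L p \<alpha>)\<^sup>2 - (\<Gamma> p + L p \<beta>)\<^sup>2 - 2 * ((\<Gamma> p + L p \<beta>) * (L p \<alpha> - L p \<beta>)))"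
    by (intro sum.cong refl) (simp add: power2_eq_square algebra_simps)
  also have "\<dots> = (\<Sum>p\<in>B. (\<Gamma> p + L p \<alpha>)\<^sup>2) - (\<Sum>p\<in>B. (\<Gamma> p + L p \<beta>)\<^sup>2) -
      2 * ((\<Sum>k=1..l. H k * \<alpha> k) - (\<Sum>k=1..l. H k * \<beta> k))"
    unfolding H by (simp add: sum_subtractf sum_distrib_left)
  finally show ?thesis unfolding q_def Ld L_def[symmetric] by simp
qed

lemma ell_le: "ell S W BF \<Sigma> \<le> card (dic_points W BF)"
  by (simp add: ell_def)

text \<open>Isolates the part that varies with \<open>\<alpha>\<close>. In the plane the coefficient
  of \<open>L\<close> is always \<open>1\<close> and \<open>Hco\<close> vanishes for positive index;
  on a Hirzebruch surface \<open>F\<close> and \<open>M\<close> contribute twice the coefficient of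
  \<open>F\<close>, and the square of \<open>M\<close> the constant \<open>\<delta>\<close>.\<close>

lemma T_div_square:
  "\<exists>c. \<forall>\<alpha>. inter S BF (T_div S W kd BF \<Sigma> ks \<mu> \<alpha>) (T_div S W kd BF \<Sigma> ks \<mu> \<alpha>) = c +
    (2 * (\<Sum>k=1..ell S W BF \<Sigma>. Hco S W kd BF \<Sigma> ks \<mu> k * \<alpha> k) -
      (\<Sum>p\<in>BF. (Lam S W BF \<Sigma> ks \<mu> p 0 + (\<Sum>k=1..ell S W BF \<Sigma>. Lam S W BF \<Sigma> ks \<mu> p k * \<alpha> k))\<^sup>2))"
proof (cases S)
  case P2
  have "Hco S W kd BF \<Sigma> ks \<mu> k = 0" if "k \<in> {1..ell S W BF \<Sigma>}" for k
    using that P2 by (auto simp: Hco_def hco_def)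
  then show ?thesis unfolding T_div_def Let_def inter_divisor
    using P2 by (intro exI[of _ 1]) (simp add: rdot_def power2_eq_square)
next
  case (Hirz \<delta>)
  then show ?thesis unfolding T_div_def Let_def inter_divisor
    by (intro exI[of _ "2 * Hco S W kd BF \<Sigma> ks \<mu> 0 + real \<delta>"]) (simp add: rdot_def power2_eq_square)
qed

lemma v_vec_T_div:
  assumes "solution_param S W kd BF \<Sigma> ks \<mu>" "v_system S W kd BF \<Sigma> ks \<alpha>"
  shows "v_vec S W kd BF ks \<alpha> = T_div S W kd BF \<Sigma> ks \<mu> \<alpha>"
proof -
  let ?l = "ell S W BF \<Sigma>" and ?D = "card (dic_points W BF)"
  have "\<alpha> s = \<mu> 0 s + (\<Sum>k=1..?l. \<mu> k s * \<alpha> k)" if "s \<in> {?l+1..?D}" for s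
    using assms that unfolding solution_param_def Let_def by blast
  then have split: "(\<Sum>j=1..?D. \<phi> j * \<alpha> j) = (\<Sum>s=?l+1..?D. \<phi> s * \<mu> 0 s) +
      (\<Sum>k=1..?l. (\<phi> k + (\<Sum>s=?l+1..?D. \<phi> s * \<mu> k s)) * \<alpha> k)" for \<phi>
    by (rule split_solution[OF ell_le])
  have "(\<Sum>j=1..?D. hco S W kd BF ks j * \<alpha> j) =
      Hco S W kd BF \<Sigma> ks \<mu> 0 - hco S W kd BF ks 0 + (\<Sum>k=1..?l. Hco S W kd BF \<Sigma> ks \<mu> k * \<alpha> k)"
    unfolding split[of "hco S W kd BF ks"] Hco_def by simp
  moreover have "(\<Sum>j=1..?D. lam BF (ks j) p * \<alpha> j) =
      Lam S W BF \<Sigma> ks \<mu> p 0 + (\<Sum>k=1..?l. Lam S W BF \<Sigma> ks \<mu> p k * \<alpha> k)" for p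
    unfolding split[of "\<lambda>j. lam BF (ks j) p"] Lam_def by (auto intro!: sum.cong)
  ultimately show ?thesis unfolding v_vec_def T_div_def Let_def by simp
qed

lemma sum_dic_points:
  assumes "finite BF" and bij: "bij_betw ks {1..card (dic_points W BF)} (dic_points W BF)"
    and x: "\<And>q. q \<in> BF \<Longrightarrow> q \<notin> dic_points W BF \<Longrightarrow> x q = (0 :: real)"
  shows "(\<Sum>j=1..card (dic_points W BF). lam BF (ks j) p * x (ks j)) = (\<Sum>q\<in>BF. lam BF q p * x q)"
proof -
  have "(\<Sum>j=1..card (dic_points W BF). lam BF (ks j) p * x (ks j)) = (\<Sum>q\<in>dic_points W BF. lam BF q p * x q)"
    by (rule sum.reindex_bij_betw[OF bij])
  also have "\<dots> = (\<Sum>q\<in>BF. lam BF q p * x q)"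
    using assms(1) x by (intro sum.mono_neutral_left) (auto simp: dic_points_def)
  finally show ?thesis .
qed

text \<open>Completed by the homogeneous part of the solution formula, the vector lives on all
  dicritical points and is annihilated by the coefficients \<open>lam\<close>, which are invertible
  by the proximity recursion. This makes the critical point unique.\<close>

lemma Lam_injective:
  assumes fin: "finite BF" and bij: "bij_betw ks {1..card (dic_points W BF)} (dic_points W BF)"
    and zero: "\<And>p. p \<in> BF \<Longrightarrow> (\<Sum>k=1..ell S W BF \<Sigma>. Lam S W BF \<Sigma> ks \<mu> p k * \<delta> k) = 0"
    and k: "k \<in> {1..ell S W BF \<Sigma>}"
  shows "\<delta> k = 0"
proof -
  let ?l = "ell S W BF \<Sigma>" and ?D = "card (dic_points W BF)"
  define \<delta>' where "\<delta>' s = (if s \<le> ?l then \<delta> s else (\<Sum>k=1..?l. \<mu> k s * \<delta> k))" for s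
  have "\<delta>' s = 0 + (\<Sum>k=1..?l. \<mu> k s * \<delta>' k)" if "s \<in> {?l+1..?D}" for s
    using that by (auto simp: \<delta>'_def intro!: sum.cong)
  then have split: "(\<Sum>j=1..?D. \<phi> j * \<delta>' j) = (\<Sum>s=?l+1..?D. \<phi> s * 0) +
      (\<Sum>k=1..?l. (\<phi> k + (\<Sum>s=?l+1..?D. \<phi> s * \<mu> k s)) * \<delta>' k)" for \<phi>
    by (rule split_solution[OF ell_le, where \<nu> = "\<lambda>_. 0"])
  define x where "x q = (if q \<in> dic_points W BF then \<delta>' (inv_into {1..?D} ks q) else 0)" for q
  have xk: "x (ks j) = \<delta>' j" if "j \<in> {1..?D}" for j
    using bij that by (auto simp: x_def bij_betw_def)
  have 0: "(\<Sum>q\<in>BF. lam BF q p * x q) = 0" if p: "p \<in> BF" for p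
  proof -
    have "(\<Sum>q\<in>BF. lam BF q p * x q) = (\<Sum>j=1..?D. lam BF (ks j) p * x (ks j))"
      by (rule sum_dic_points[OF fin bij, symmetric]) (simp add: x_def)
    also have "\<dots> = (\<Sum>j=1..?D. lam BF (ks j) p * \<delta>' j)" using xk by (intro sum.cong) auto
    also have "\<dots> = (\<Sum>k=1..?l. Lam S W BF \<Sigma> ks \<mu> p k * \<delta> k)"
      unfolding split[of "\<lambda>j. lam BF (ks j) p"] Lam_def by (auto simp: \<delta>'_def intro!: sum.cong)
    also have "\<dots> = 0" by (rule zero[OF p])
    finally show ?thesis .
  qed
  have kD: "k \<in> {1..?D}" using k ell_le[of S W BF \<Sigma>] by auto
  then have "ks k \<in> BF" using bij by (auto simp: bij_betw_def dic_points_def)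
  from lam_sum[OF fin this, of x] have "x (ks k) = 0" using 0 \<open>ks k \<in> BF\<close> by simp
  then show ?thesis using xk[OF kD] k by (simp add: \<delta>'_def)
qed

section \<open>The class of a first integral as a member of the family\<close>

context first_integral_pencil
begin

definition \<alpha>0 where "\<alpha>0 q = (real (m q) - (\<Sum>s\<in>{s\<in>B. proximate s q}. real (m s))) / real_of_int (snd d)"

lemma \<alpha>0_zero: "q \<in> B \<Longrightarrow> q \<notin> dic_points W B \<Longrightarrow> \<alpha>0 q = 0"
  using proximity_equality[of q] by (simp add: \<alpha>0_def dic_points_def flip: of_nat_sum)

lemma \<alpha>0_pos: assumes "q \<in> dic_points W B" shows "\<alpha>0 q > 0" "\<alpha>0 q \<in> \<rat>"
proof -
  have q: "q \<in> B" "term_dic_at W q" using assms by (auto simp: dic_points_def)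
  have "real (\<Sum>s\<in>{s\<in>B. proximate s q}. m s) < real (m q)" using proximity_strict[OF q] by (simp only: of_nat_less_iff)
  then show "\<alpha>0 q > 0" using degree_pos q(1) unfolding \<alpha>0_def by (intro divide_pos_pos) auto
  show "\<alpha>0 q \<in> \<rat>" by (simp add: \<alpha>0_def flip: of_nat_sum)
qed

lemma lam_\<alpha>0:
  assumes "p \<in> B" shows "(\<Sum>q\<in>B. lam B q p * \<alpha>0 q) = real (m p) / real_of_int (snd d)"
  by (rule lam_inverse[OF finB _ assms]) (simp add: \<alpha>0_def sum_divide_distrib diff_divide_distrib)

lemma T_F_eq: "T_F S B P Q = divisor S B (of_int (fst d) / of_int (snd d)) 1 (\<lambda>p. real (m p) / of_int (snd d))"
  if "B \<noteq> {}"
proof -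
  have "P \<noteq> 0" using fi by (simp add: first_integral_def)
  then have "hdeg S P = d" by (rule hdeg_eq[OF homP])
  then show ?thesis unfolding T_F_def D_F_def scaleR_divisor using degree_pos[OF that]
    by (auto intro!: divisor_cong simp: general_mult_eq)
qed

lemma T_F_inter:
  assumes "B \<noteq> {}"
  shows "inter S B (T_F S B P Q) (divisor S B (of_int (fst d')) (of_int (snd d')) e) =
    (of_int (dot S d d') - (\<Sum>p\<in>B. real (m p) * e p)) / of_int (snd d)"
proof -
  let ?b = "real_of_int (snd d)"
  have b: "?b > 0" using degree_pos[OF assms] by simp
  have "rdot S (of_int (fst d) / ?b) 1 (of_int (fst d')) (of_int (snd d')) = of_int (dot S d d') / ?b"
    using rdot_scale[of S "1 / ?b" "of_int (fst d)" ?b "of_int (fst d')" "of_int (snd d')"] b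
    by (simp add: rdot_dot)
  then show ?thesis unfolding T_F_eq[OF assms] inter_divisor
    by (simp add: diff_divide_distrib sum_divide_distrib)
qed

lemma T_F_square:
  assumes "B \<noteq> {}" shows "inter S B (T_F S B P Q) (T_F S B P Q) = 0"
proof -
  let ?b = "real_of_int (snd d)"
  have b: "?b > 0" using degree_pos[OF assms] by simp
  have "T_F S B P Q = (1 / ?b) *\<^sub>R divisor S B (of_int (fst d)) ?b (\<lambda>p. real (m p))"
    unfolding T_F_eq[OF assms] scaleR_divisor using b by simp
  moreover have "inter S B D (c *\<^sub>R D') = c * inter S B D D'" for c D D'
    by (cases S) (simp_all add: inter_def scaleR_fun_def sum_distrib_left right_diff_distrib mult_ac distrib_left)
  moreover have "real_of_int (dot S d d) = (\<Sum>p\<in>B. real (m p) * real (m p))"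
    using arg_cong[OF self_intersection, of real_of_int] by simp
  ultimately show ?thesis using T_F_inter[OF assms, of d "\<lambda>p. real (m p)"] by simp
qed

text \<open>Both follow by subtracting \<open>canonical_intersection\<close> from twice the
  self-intersection.\<close>

lemma T_F_canonical:
  assumes "B \<noteq> {}" and can: "canonical_degree S W kd"
  shows "real_of_int (dot S d (kd - kzdeg S)) = (\<Sum>p\<in>B. real (m p) * (real (nu W p) + real (eps W p)))"
    and "inter S B (T_F S B P Q) (K_fol S W kd B - K_Z S B) = 0"
proof -
  have "dot S d (d + d - kd + kzdeg S) = 2 * dot S d d - dot S d (kd - kzdeg S)"
    by (cases S) (simp_all add: dot_def algebra_simps)
  moreover have "(\<Sum>q\<in>B. int (m q) * (2 * int (m q) - (int (nu W q) + int (eps W q)))) =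
      2 * (\<Sum>q\<in>B. int (m q) * int (m q)) - (\<Sum>q\<in>B. int (m q) * (int (nu W q) + int (eps W q)))"
    unfolding sum_distrib_left sum_subtractf[symmetric] by (intro sum.cong) (auto simp: algebra_simps)
  ultimately have "dot S d (kd - kzdeg S) = (\<Sum>q\<in>B. int (m q) * (int (nu W q) + int (eps W q)))"
    using canonical_intersection[OF can] self_intersection by simp
  from arg_cong[OF this, of real_of_int]
  show *: "real_of_int (dot S d (kd - kzdeg S)) = (\<Sum>p\<in>B. real (m p) * (real (nu W p) + real (eps W p)))" by simp
  show "inter S B (T_F S B P Q) (K_fol S W kd B - K_Z S B) = 0"
    unfolding K_diff T_F_inter[OF assms(1)] * by simp
qed

text \<open>Secures the denominators in \<open>hco\<close>: in fiber degree \<open>-2\<close> the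
  foliation is the ruling, which has no ordinary and hence no dicritical point.\<close>

lemma fiber_degree:
  assumes "B \<noteq> {}" and can: "canonical_degree S W kd" and S: "S = Hirz \<delta>"
  shows "snd kd + 2 \<noteq> 0"
proof
  assume kd: "snd kd + 2 = 0"
  obtain p where p: "p \<in> B" "term_dic_at W p" using dicritical_point_exists[OF assms(1)] by blast
  have s: "on_surface S p" by (rule surfB[OF p(1)])
  have "ordinary_sing (local_form W p)"
    using terminal_dicritical_ordinary[OF local_form_ne_0[OF fol s]] p(2) by (simp add: term_dic_at_def)
  moreover have "\<not> ordinary_sing (local_form W p)"
    using ruling_not_ordinary[of \<delta> W kd p] fol can kd s S by simp
  ultimately show False by blast
qed

text \<open>The proximity relations account for the exceptional coefficients. On a Hirzebruch
  surface the coefficient of \<open>F\<close> is then determined by the vanishing product with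
  \<open>K_fol - K_Z\<close>; solving that equation is the origin of the constants
  \<open>hco\<close>.\<close>

lemma T_F_v_vec:
  assumes ne: "B \<noteq> {}" and can: "canonical_degree S W kd"
    and bij: "bij_betw ks {1..card (dic_points W B)} (dic_points W B)"
  shows "T_F S B P Q = v_vec S W kd B ks (\<lambda>j. \<alpha>0 (ks j))"
  unfolding T_F_eq[OF ne] v_vec_def Let_def
proof (rule divisor_cong)
  let ?b = "real_of_int (snd d)"
  have b: "?b > 0" using degree_pos[OF ne] by simp
  have e: "(\<Sum>j=1..card (dic_points W B). lam B (ks j) p * \<alpha>0 (ks j)) = real (m p) / ?b" if "p \<in> B" for p
  proof -
    have "(\<Sum>j=1..card (dic_points W B). lam B (ks j) p * \<alpha>0 (ks j)) = (\<Sum>q\<in>B. lam B q p * \<alpha>0 q)"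
      by (rule sum_dic_points[OF finB bij]) (rule \<alpha>0_zero)
    then show ?thesis using lam_\<alpha>0[OF that] by simp
  qed
  then show "real (m p) / ?b = (\<Sum>j=1..card (dic_points W B). lam B (ks j) p * \<alpha>0 (ks j))" if "p \<in> B" for p
    using that by simp
  assume "S \<noteq> P2"
  then obtain \<delta> where S: "S = Hirz \<delta>" by (cases S) auto
  let ?n = "\<lambda>p. real (nu W p) + real (eps W p)" and ?a = "real_of_int (fst d)"
    and ?k1 = "real_of_int (fst kd)" and ?k2 = "real_of_int (snd kd) + 2"
  have k2: "?k2 \<noteq> 0" using fiber_degree[OF ne can S] by linarith
  have "(\<Sum>j=1..card (dic_points W B). hco S W kd B ks j * \<alpha>0 (ks j)) =
      (\<Sum>j=1..card (dic_points W B). (\<Sum>p\<in>B. ?n p * (lam B (ks j) p * \<alpha>0 (ks j))) / ?k2)"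
  proof (intro sum.cong refl)
    fix j assume "j \<in> {1..card (dic_points W B)}"
    then have "hco S W kd B ks j = (\<Sum>p\<in>B. ?n p * lam B (ks j) p) / ?k2" using S by (simp add: hco_def)
    then show "hco S W kd B ks j * \<alpha>0 (ks j) = (\<Sum>p\<in>B. ?n p * (lam B (ks j) p * \<alpha>0 (ks j))) / ?k2"
      by (simp only: times_divide_eq_left sum_distrib_right mult.assoc)
  qed
  also have "\<dots> = (\<Sum>j=1..card (dic_points W B). \<Sum>p\<in>B. ?n p * (lam B (ks j) p * \<alpha>0 (ks j))) / ?k2"
    by (simp only: sum_divide_distrib)
  also have "(\<Sum>j=1..card (dic_points W B). \<Sum>p\<in>B. ?n p * (lam B (ks j) p * \<alpha>0 (ks j))) =
      (\<Sum>p\<in>B. \<Sum>j=1..card (dic_points W B). ?n p * (lam B (ks j) p * \<alpha>0 (ks j)))" by (rule sum.swap)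
  also have "\<dots> = (\<Sum>p\<in>B. ?n p * (real (m p) / ?b))"
    unfolding sum_distrib_left[symmetric] using e by (intro sum.cong) auto
  also have "\<dots> = real_of_int (dot S d (kd - kzdeg S)) / ?b"
    unfolding T_F_canonical(1)[OF ne can] sum_divide_distrib by (intro sum.cong) (auto simp: field_simps)
  also have "real_of_int (dot S d (kd - kzdeg S)) = ?a * ?k2 + ?b * (?k1 - real \<delta> + 2) + real \<delta> * (?b * ?k2)"
    using S by (simp add: dot_def kzdeg_def)
  finally have "(\<Sum>j=1..card (dic_points W B). hco S W kd B ks j * \<alpha>0 (ks j)) =
      (?a * ?k2 + ?b * (?k1 - real \<delta> + 2) + real \<delta> * (?b * ?k2)) / ?b / ?k2" .
  also have "\<dots> = ?a / ?b + (?k1 - real \<delta> + 2) / ?k2 + real \<delta>"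
  proof -
    have gen: "(x * z + y * s + t * (y * z)) / y / z = x / y + s / z + t" if "y \<noteq> 0" "z \<noteq> 0" for x y z s t :: real
      using that by (simp add: add_divide_distrib)
    have "?b \<noteq> 0" using b by simp
    then show ?thesis using k2 by (rule gen)
  qed
  finally have "(\<Sum>j=1..card (dic_points W B). hco S W kd B ks j * \<alpha>0 (ks j)) =
      ?a / ?b + (?k1 - real \<delta> + 2) / ?k2 + real \<delta>" .
  moreover have "hco S W kd B ks 0 = - ((?k1 - real \<delta> + 2) / ?k2) - real \<delta>"
    using S by (simp add: hco_def minus_divide_left)
  ultimately show "?a / ?b = hco S W kd B ks 0 + (\<Sum>j=1..card (dic_points W B). hco S W kd B ks j * \<alpha>0 (ks j))"
    by linarith
qed

lemma characteristic_solution: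
  assumes ne: "B \<noteq> {}" and can: "canonical_degree S W kd"
    and ind: "independent_solutions S W kd B \<Sigma>"
    and bij: "bij_betw ks {1..card (dic_points W B)} (dic_points W B)"
    and sol: "solution_param S W kd B \<Sigma> ks \<mu>" and crit: "alpha_system S W kd B \<Sigma> ks \<mu> \<alpha>F"
  defines "T \<equiv> T_div S W kd B \<Sigma> ks \<mu> \<alpha>F"
  shows "inter S B T T \<ge> 0"
    and "inter S B T T = 0 \<Longrightarrow> T_F S B P Q = T"
    and "inter S B T T = 0 \<Longrightarrow> k \<in> {1..ell S W B \<Sigma>} \<Longrightarrow> \<alpha>F k \<in> \<rat> \<and> \<alpha>F k > 0"
proof -
  let ?\<alpha> = "\<lambda>j. \<alpha>0 (ks j)" and ?l = "ell S W B \<Sigma>" and ?D = "card (dic_points W B)"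
  let ?L = "Lam S W B \<Sigma> ks \<mu>"
  note vv = T_F_v_vec[OF ne can bij]
  have "v_system S W kd B \<Sigma> ks ?\<alpha>"
    unfolding v_system_def vv[symmetric]
  proof (intro conjI ballI impI)
    fix C assume "C \<in> \<Sigma>"
    then have C: "integral_curve S C" "invariant_curve S W C" using ind by (auto simp: independent_solutions_def)
    from arg_cong[OF curve_intersection[OF C], of real_of_int]
    show "inter S B (T_F S B P Q) (strict_cls S B C) = 0"
      unfolding strict_cls_def T_F_inter[OF ne] by simp
  qed (rule T_F_canonical(2)[OF ne can])
  then have TF: "T_F S B P Q = T_div S W kd B \<Sigma> ks \<mu> ?\<alpha>" unfolding vv by (rule v_vec_T_div[OF sol])
  obtain c where sq: "\<And>\<alpha>. inter S B (T_div S W kd B \<Sigma> ks \<mu> \<alpha>) (T_div S W kd B \<Sigma> ks \<mu> \<alpha>) = c +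
    (2 * (\<Sum>k=1..?l. Hco S W kd B \<Sigma> ks \<mu> k * \<alpha> k) - (\<Sum>p\<in>B. (?L p 0 + (\<Sum>k=1..?l. ?L p k * \<alpha> k))\<^sup>2))"
    using T_div_square[of S B W kd \<Sigma> ks \<mu>] by blast
  have crit': "(\<Sum>k=1..?l. (\<Sum>p\<in>B. ?L p j * ?L p k) * \<alpha>F k) = Hco S W kd B \<Sigma> ks \<mu> j - (\<Sum>p\<in>B. ?L p 0 * ?L p j)"
    if "j \<in> {1..?l}" for j using crit that unfolding alpha_system_def Let_def by blast
  have "inter S B T T = inter S B (T_F S B P Q) (T_F S B P Q) + (\<Sum>p\<in>B. (\<Sum>k=1..?l. ?L p k * (?\<alpha> k - \<alpha>F k))\<^sup>2)"
    unfolding T_def TF sq using quadratic_at_critical_point[OF crit', of ?\<alpha>] by simp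
  then have TT: "inter S B T T = (\<Sum>p\<in>B. (\<Sum>k=1..?l. ?L p k * (?\<alpha> k - \<alpha>F k))\<^sup>2)"
    unfolding T_F_square[OF ne] by simp
  then show "inter S B T T \<ge> 0" by (simp add: sum_nonneg)
  have eq: "\<alpha>F k = ?\<alpha> k" if 0: "inter S B T T = 0" and k: "k \<in> {1..?l}" for k
  proof -
    have "(\<Sum>k=1..?l. ?L p k * (?\<alpha> k - \<alpha>F k)) = 0" if "p \<in> B" for p
      using 0 that finB unfolding TT by (simp add: sum_nonneg_eq_0_iff)
    from Lam_injective[where \<delta> = "\<lambda>k. ?\<alpha> k - \<alpha>F k", OF finB bij this k] show ?thesis by simp
  qed
  show "T_F S B P Q = T" if "inter S B T T = 0"
  proof -
    have "(\<Sum>k=1..?l. x k * ?\<alpha> k) = (\<Sum>k=1..?l. x k * \<alpha>F k)" for x using eq[OF that] by (intro sum.cong) auto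
    then show ?thesis unfolding TF T_def T_div_def Let_def by simp
  qed
  show "\<alpha>F k \<in> \<rat> \<and> \<alpha>F k > 0" if 0: "inter S B T T = 0" and k: "k \<in> {1..?l}"
  proof -
    have "k \<in> {1..?D}" using k ell_le[of S W B \<Sigma>] by auto
    then have "ks k \<in> dic_points W B" using bij by (auto simp: bij_betw_def)
    then show ?thesis using eq[OF 0 k] \<alpha>0_pos by simp
  qed
qed

end

lemma first_integral_pencil_exists:
  assumes "first_integral S W SF P Q" "foliation_on S W" "reduces S W SF"
  shows "\<exists>d h. first_integral_pencil S W SF P Q d h"
proof -
  have fin: "finite SF" using assms(3) by (simp add: reduces_def configuration_def)
  have "\<exists>d. homogeneous S d P \<and> homogeneous S d Q" using assms(1) unfolding first_integral_def by (elim conjE)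
  then obtain d where d: "homogeneous S d P" "homogeneous S d Q" by blast
  have "\<forall>c\<in>charts S. \<exists>h. fpen (dehom S P c) (dehom S Q c) (W c) h"
    using first_integral_fpen[OF assms(1) d assms(2) fin] by blast
  from bchoice[OF this] have "\<exists>h. \<forall>c\<in>charts S. fpen (dehom S P c) (dehom S Q c) (W c) (h c)" .
  then obtain h where h: "\<And>c. c \<in> charts S \<Longrightarrow> fpen (dehom S P c) (dehom S Q c) (W c) (h c)" by blast
  have "first_integral_pencil S W SF P Q d h" by (standard; fact assms d h)
  then show ?thesis by (intro exI)
qed

theorem theorem3p15:
  fixes S :: surface
    and A B :: bipoly
    and W :: "nat \<Rightarrow> form"
    and kd :: deg
    and SF BF :: "ipt set"
    and \<Sigma> :: "mpoly set"
    and ks :: "nat \<Rightarrow> ipt"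
    and \<mu> :: "nat \<Rightarrow> nat \<Rightarrow> real"
    and \<alpha>F :: "nat \<Rightarrow> real"
  assumes "coprime A B"
    and "extends_to S A B W"
    and "canonical_degree S W kd"
    and "minimal_reduction S W SF"
    and "BF = dicritical_config W SF"
    and "BF \<noteq> {}"
    and "independent_solutions S W kd BF \<Sigma>"
    and "restricted S W kd BF \<Sigma>"
    and "bij_betw ks {1..card (dic_points W BF)} (dic_points W BF)"
    and "solution_param S W kd BF \<Sigma> ks \<mu>"
    and "alpha_system S W kd BF \<Sigma> ks \<mu> \<alpha>F"
  shows "(let T = T_div S W kd BF \<Sigma> ks \<mu> \<alpha>F in
          (inter S BF T T < 0 \<longrightarrow> \<not> alg_integrable S W SF) \<and>
          (inter S BF T T = 0 \<and> alg_integrable S W SF \<longrightarrow>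
             (\<forall>P Q. primitive_first_integral S W SF P Q \<longrightarrow> T_F S BF P Q = T) \<and>
             (\<forall>k\<in>{1..ell S W BF \<Sigma>}. \<alpha>F k \<in> \<rat> \<and> \<alpha>F k > 0)))"
proof -
  let ?T = "T_div S W kd BF \<Sigma> ks \<mu> \<alpha>F"
  have fol: "foliation_on S W" using assms(2) by (simp add: extends_to_def)
  have red: "reduces S W SF" using assms(4) by (simp add: minimal_reduction_def)
  have main: "0 \<le> inter S BF ?T ?T \<and> (inter S BF ?T ?T = 0 \<longrightarrow> T_F S BF P Q = ?T \<and>
      (\<forall>k\<in>{1..ell S W BF \<Sigma>}. \<alpha>F k \<in> \<rat> \<and> \<alpha>F k > 0))" if fi: "first_integral S W SF P Q" for P Q
  proof -
    obtain d h where "first_integral_pencil S W SF P Q d h"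
      using first_integral_pencil_exists[OF fi fol red] by blast
    from first_integral_pencil.characteristic_solution[OF this, folded assms(5), OF assms(6,3,7,9-11)]
    show ?thesis by blast
  qed
  show ?thesis unfolding Let_def
  proof (intro conjI impI)
    show "\<not> alg_integrable S W SF" if "inter S BF ?T ?T < 0"
      using main that unfolding alg_integrable_def by force
    assume *: "inter S BF ?T ?T = 0 \<and> alg_integrable S W SF"
    then show "\<forall>k\<in>{1..ell S W BF \<Sigma>}. \<alpha>F k \<in> \<rat> \<and> \<alpha>F k > 0"
      using main unfolding alg_integrable_def by blast
    show "\<forall>P Q. primitive_first_integral S W SF P Q \<longrightarrow> T_F S BF P Q = ?T"
      using main * unfolding primitive_first_integral_def by blast
  qed
qed

end
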